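(* Let $1>r>\alpha>0$ and $t>13$. Then $$N(1+it,\alpha)\le\frac{C_{1,\alpha,r}}{\pi}\log|t|+C_{2,\alpha,r}\log\log|t|+C_{3,\alpha,r}+O^*\!\left(\frac{1}{\log(r/\alpha)}\left(\frac{5}{6(t-1)}+\frac{1}{(t-1)^2}+\frac{579}{8(t-1)^2\log(t-1)}\right)\right),$$ where $$C_{1,\alpha,r}=\frac{c_{1,r}}{\log(r/\alpha)},\qquad C_{2,\alpha,r}=\frac{c_{2,r}}{\pi\log(r/\alpha)}+\frac{1}{\log(r/\alpha)},$$ $$C_{3,\alpha,r}=\frac{c_{3,r}}{\pi\log(r/\alpha)}+\frac{c_{4,r}}{\log(r/\alpha)}+\frac{\log(29.388)}{\log(r/\alpha)}.$$
   Context: $N(s,\alpha)$ denotes the number of zeros $\rho$ of the Riemann zeta function $\zeta$ with $|\rho-s|\le\alpha$, counted with multiplicity, zeros on the boundary counting with $1/2$ of their multiplicity. $O^*(E)$ denotes a quantity of absolute value at most $E$ (so $X\le U+O^*(E)$ means $X\le U+E$). Coefficients. For integers $k\ge 0$ let $\sigma_k=1-\frac{k+3}{2^{k+3}-2}$, $\sigma_{-k}=\frac{k+3}{2^{k+3}-2}$, $v_k=\frac{1}{2^{k+3}-2}$, $v_{-k}=\sigma_k-\frac12+\frac1{2^{k+3}-2}$. Let $v_k'=1$ for all integers $k$, and $v_0''=\log(0.611)$, $v_k''=\log(1.546)$ for $k>0$, $v_k''=\log(1.546)+(\sigma_k-\frac12)\log\pi$ for $k<0$. For each integer $k$ let $m_k=\frac{v_k-v_{k+1}}{\sigma_k-\sigma_{k+1}}$,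 $b_k=v_k-m_k\sigma_k$, and define $m_k',b_k'$ (resp. $m_k'',b_k''$) by the same formulas with $v$ replaced by $v'$ (resp. $v''$). For $0<r<1$ let $K$ be the least integer $k$ with $r\ge 1-\sigma_k$, and for $k\ge K$ let $\theta_{k,r}=\arcsin((1-\sigma_k)/r)$. Define $$c_{1,r}=(m_{K-1}+b_{K-1})(\tfrac{\pi}{2}-\theta_{K,r})-m_{K-1}r\cos\theta_{K,r}+\sum_{k=K}^\infty\left[(m_k+b_k)(\theta_{k,r}-\theta_{k+1,r})+m_k r(\cos\theta_{k,r}-\cos\theta_{k+1,r})\right],$$ and define $c_{2,r}$ (resp. $c_{3,r}$) by the same formula with $(m_k,b_k)$ replaced everywhere by $(m_k',b_k')$ (resp. $(m_k'',b_k'')$). Let $c_{4,r}=\frac12\log(\zeta(1+r))-\frac r\pi\int_0^1\frac{\zeta'(1+ru)}{\zeta(1+ru)}\arcsin(u)\,du$. *)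

theory Defs
  imports "HOL-Complex_Analysis.Complex_Analysis"
begin

section \<open>The Riemann zeta function\<close>

text \<open>
  The value at the pole is irrelevant; it is fixed to be 0 only to make the description unique.
  Existence and uniqueness of the continuation are proved below (\<open>zeta_ex1\<close>).
\<close>

definition is_zeta :: "(complex \<Rightarrow> complex) \<Rightarrow> bool" where
  "is_zeta f \<longleftrightarrow> f holomorphic_on - {1} \<and>
     (\<forall>s. Re s > 1 \<longrightarrow> (\<lambda>n. 1 / of_nat (Suc n) powr s) sums f s) \<and> f 1 = 0"

definition zeta :: "complex \<Rightarrow> complex" where
  "zeta = (THE f. is_zeta f)"

lemma holomorphic_series:
  fixes f :: "nat \<Rightarrow> complex \<Rightarrow> complex"
  assumes S: "open S" and f: "\<And>n. f n holomorphic_on S"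
    and M: "\<And>x. x \<in> S \<Longrightarrow> \<exists>d h. 0 < d \<and> summable h \<and> (\<forall>n. \<forall>y\<in>ball x d \<inter> S. cmod (f n y) \<le> h n)"
  shows "(\<lambda>s. \<Sum>n. f n s) holomorphic_on S" and "\<And>s. s \<in> S \<Longrightarrow> summable (\<lambda>n. f n s)"
proof -
  have d: "\<And>n x. x \<in> S \<Longrightarrow> f n field_differentiable at x"
    using f S by (metis holomorphic_on_imp_differentiable_at)
  have M': "\<exists>d h. 0 < d \<and> summable h \<and> range h \<subseteq> \<real>\<^sub>\<ge>\<^sub>0 \<and>
      (\<forall>\<^sub>F n in sequentially. \<forall>y\<in>ball x d \<inter> S. cmod (f n y) \<le> cmod (h n))" if x: "x \<in> S" for x
  proof -
    from M[OF x] obtain d h where h: "0 < d" "summable h"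
      "\<And>n y. y \<in> ball x d \<inter> S \<Longrightarrow> cmod (f n y) \<le> h n" by blast
    have pos: "h n \<ge> 0" for n
      using h(3)[of x n] x h(1) norm_ge_zero[of "f n x"] by (meson IntI centre_in_ball order_trans)
    show ?thesis
    proof (intro exI conjI)
      show "summable (\<lambda>n. complex_of_real (h n))" using h(2) by (rule summable_of_real)
      show "range (\<lambda>n. complex_of_real (h n)) \<subseteq> \<real>\<^sub>\<ge>\<^sub>0" using pos by auto
      show "\<forall>\<^sub>F n in sequentially. \<forall>y\<in>ball x d \<inter> S. cmod (f n y) \<le> cmod (complex_of_real (h n))"
        using h(3) pos by (auto intro!: always_eventually)
    qed (rule h(1))
  qed
  obtain g where g: "\<forall>x\<in>S. (\<lambda>n. f n x) sums g x \<and> g field_differentiable at x"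
    using series_differentiable_comparison_complex[OF S d M'] by blast
  have "g holomorphic_on S"
    using g by (auto simp: holomorphic_on_def intro: field_differentiable_at_within)
  moreover have "(\<Sum>n. f n s) = g s" if "s \<in> S" for s
    using g that by (simp add: sums_iff)
  ultimately show "(\<lambda>s. \<Sum>n. f n s) holomorphic_on S"
    by (simp cong: holomorphic_cong)
  show "\<And>s. s \<in> S \<Longrightarrow> summable (\<lambda>n. f n s)" using g by (auto simp: sums_iff)
qed

lemma summable_shifted_powr:
  fixes a :: real
  assumes "a < -1"
  shows "summable (\<lambda>n. real (Suc n) powr a)"
  using assms summable_real_powr_iff[of a]
    summable_Suc_iff[of "\<lambda>n. real n powr a"] by simp

lemma norm_pochhammer_le:
  fixes z :: complex
  assumes "cmod z \<le> A"
  shows "cmod (pochhammer z n) \<le> pochhammer A n"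
proof (induction n)
  case (Suc n)
  have A: "A \<ge> 0" using assms norm_ge_zero order_trans by blast
  have "cmod (z + of_nat n) \<le> A + real n"
    using assms norm_triangle_ineq[of z "of_nat n"] by simp
  then show ?case
    using Suc A unfolding pochhammer_Suc norm_mult
    by (intro mult_mono) (auto intro: order_trans[OF norm_ge_zero])
qed auto

definition zeta_term :: "nat \<Rightarrow> complex \<Rightarrow> nat \<Rightarrow> complex" where
  "zeta_term j s n = pochhammer (s - 1) j / fact j * of_nat (n + 2) powr (1 - s - of_nat j)"

definition zeta_rem :: "nat \<Rightarrow> complex \<Rightarrow> nat \<Rightarrow> complex" where
  "zeta_rem J s n = of_nat (n + 1) powr (1 - s) - (\<Sum>j\<le>J. zeta_term j s n)"

lemma zeta_rem_bound:
  assumes A: "cmod (s - 1) \<le> A" and c: "Re s \<ge> c" "c + real J \<ge> 0"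
  shows "cmod (zeta_rem J s n) \<le> pochhammer A (Suc J) * real (Suc n) powr (- c - real J)"
proof -
  define f where "f i x = (-1) ^ i * pochhammer (s - 1) i * x powr (1 - s - of_nat i)"
    for i :: nat and x :: complex
  define S :: "complex set" where "S = of_real ` {real (n + 1)..real (n + 2)}"
  define B where "B = pochhammer A (Suc J) * real (Suc n) powr (- c - real J)"
  have P0: "pochhammer A (Suc J) \<ge> 0"
    using norm_pochhammer_le[OF A, of "Suc J"] norm_ge_zero order_trans by blast
  have S: "x \<in> S \<longleftrightarrow> (\<exists>y. x = of_real y \<and> real (n + 1) \<le> y \<and> y \<le> real (n + 2))" for x
    by (auto simp: S_def)
  have "convex S"
    unfolding S_def by (intro convex_linear_image) (auto intro: bounded_linear.linear[OF bounded_linear_of_real])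
  moreover have "(f i has_field_derivative f (Suc i) x) (at x within S)" if "x \<in> S" "i \<le> J" for i x
  proof -
    have "x \<notin> \<real>\<^sub>\<le>\<^sub>0" using that by (auto simp: S complex_nonpos_Reals_iff)
    then have "((\<lambda>x. (-1) ^ i * pochhammer (s - 1) i * x powr (1 - s - of_nat i)) has_field_derivative
        (-1) ^ i * pochhammer (s - 1) i * ((1 - s - of_nat i) * x powr (1 - s - of_nat i - 1)))
        (at x within S)"
      by (intro DERIV_cmult has_field_derivative_at_within[OF has_field_derivative_powr])
    moreover have "(-1) ^ i * pochhammer (s - 1) i * ((1 - s - of_nat i) * x powr (1 - s - of_nat i - 1))
        = f (Suc i) x"
      unfolding f_def pochhammer_Suc by (simp add: algebra_simps)
    ultimately show ?thesis unfolding f_def by simp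
  qed
  moreover have "cmod (f (Suc J) x) \<le> B" if "x \<in> S" for x
  proof -
    from that obtain y where y: "x = of_real y" "real (n + 1) \<le> y" by (auto simp: S)
    have "cmod (x powr (1 - s - of_nat (Suc J))) = y powr (- Re s - real J)"
      using y by (simp add: norm_powr_real_powr)
    also have "\<dots> \<le> y powr (- c - real J)"
      using c y by (intro powr_mono) auto
    also have "\<dots> \<le> real (Suc n) powr (- c - real J)"
      using c y by (intro powr_mono2') auto
    finally show ?thesis
      using mult_mono[OF norm_pochhammer_le[OF A, of "Suc J"] _ P0 norm_ge_zero]
      unfolding f_def B_def by (simp add: norm_mult norm_power del: of_nat_Suc pochhammer_Suc power_Suc)
  qed
  moreover have "of_nat (n + 2) \<in> S" "of_nat (n + 1) \<in> S"
    unfolding S by (rule exI[of _ "real (n + 2)"], simp, rule exI[of _ "real (n + 1)"], simp)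
  ultimately have "cmod (f 0 (of_nat (n + 1)) - (\<Sum>i\<le>J. f i (of_nat (n + 2)) *
       (of_nat (n + 1) - of_nat (n + 2)) ^ i / fact i))
     \<le> B * cmod (of_nat (n + 1) - of_nat (n + 2)) ^ Suc J / fact J"
    by (rule complex_Taylor)
  moreover have "f i (of_nat (n + 2)) * (of_nat (n + 1) - of_nat (n + 2)) ^ i / fact i
      = zeta_term i s n" for i
  proof -
    have "(of_nat (n + 1) - of_nat (n + 2) :: complex) = -1" by simp
    moreover have "(-1) ^ i * p * q * (-1) ^ i / F = p / F * q" for p q F :: complex
    proof -
      have "(-1) ^ i * p * q * (-1) ^ i = ((-1) ^ i * (-1) ^ i) * (p * q)" by (simp only: mult_ac)
      also have "(-1) ^ i * (-1) ^ i = (1 :: complex)" by simp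
      finally show ?thesis by simp
    qed
    ultimately show ?thesis unfolding f_def zeta_term_def by (simp only:)
  qed
  moreover have "f 0 (of_nat (n + 1)) = of_nat (n + 1) powr (1 - s)"
    by (simp add: f_def)
  moreover have "cmod (of_nat (n + 1) - of_nat (n + 2)) = 1" by simp
  ultimately have "cmod (zeta_rem J s n) \<le> B / fact J"
    unfolding zeta_rem_def by (simp only: power_one mult_1_right)
  also have "\<dots> \<le> B"
  proof -
    have "B \<ge> 0" using P0 unfolding B_def by (intro mult_nonneg_nonneg) auto
    then show ?thesis using frac_le[of B B 1 "fact J"] fact_ge_1[of J, where 'a = real] by simp
  qed
  finally show ?thesis unfolding B_def .
qed

lemma dirichlet_series:
  "(\<lambda>s. \<Sum>n. 1 / of_nat (Suc n) powr s) holomorphic_on {s. Re s > 1}" (is ?A)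
  "Re s > 1 \<Longrightarrow> summable (\<lambda>n. 1 / of_nat (Suc n) powr s)" (is "_ \<Longrightarrow> ?B")
proof -
  have op: "open {s. Re s > 1}" by (rule open_halfspace_Re_gt)
  have hol: "(\<lambda>s. 1 / of_nat (Suc n) powr s) holomorphic_on {s. Re s > 1}" for n
    by (intro holomorphic_intros) auto
  have M: "\<exists>d h. 0 < d \<and> summable h \<and> (\<forall>n. \<forall>y\<in>ball x d \<inter> {s. Re s > 1}.
     cmod (1 / of_nat (Suc n) powr y) \<le> h n)" if "x \<in> {s. Re s > 1}" for x
  proof (intro exI conjI allI ballI)
    define d where "d = (Re x - 1) / 2"
    show "0 < d" using that by (simp add: d_def)
    show "summable (\<lambda>n. real (Suc n) powr (- (1 + d)))"
      using \<open>0 < d\<close> by (intro summable_shifted_powr) auto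
    fix n y assume "y \<in> ball x d \<inter> {s. Re s > 1}"
    then have "\<bar>Re x - Re y\<bar> < d"
      using abs_Re_le_cmod[of "x - y"] by (auto simp: dist_norm)
    then have "Re y \<ge> 1 + d" unfolding d_def by (auto simp: abs_if field_simps split: if_splits)
    then have "real (Suc n) powr (- Re y) \<le> real (Suc n) powr (- (1 + d))"
      by (intro powr_mono) auto
    moreover have "cmod (1 / of_nat (Suc n) powr y) = real (Suc n) powr (- Re y)"
      using norm_powr_real_powr[of "of_nat (Suc n)" y]
      by (simp add: norm_divide powr_minus field_simps)
    ultimately show "cmod (1 / of_nat (Suc n) powr y) \<le> real (Suc n) powr (- (1 + d))" by simp
  qed
  show ?A by (rule holomorphic_series(1)[OF op hol M])
  show "Re s > 1 \<Longrightarrow> ?B" using holomorphic_series(2)[OF op hol M, of s] by simp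
qed

lemma zeta_rem_series:
  assumes "c + real J > 1"
  shows "(\<lambda>s. \<Sum>n. zeta_rem J s n) holomorphic_on {s. Re s > c}" (is ?A)
    and "\<And>s. Re s > c \<Longrightarrow> summable (zeta_rem J s)"
proof -
  have op: "open {s. Re s > c}" by (rule open_halfspace_Re_gt)
  have hol: "(\<lambda>s. zeta_rem J s n) holomorphic_on {s. Re s > c}" for n
    unfolding zeta_rem_def zeta_term_def pochhammer_prod
    by (intro holomorphic_intros) (auto simp: of_nat_Suc[symmetric] simp del: of_nat_Suc)
  have M: "\<exists>d h. 0 < d \<and> summable h \<and> (\<forall>n. \<forall>y\<in>ball x d \<inter> {s. Re s > c}.
     cmod (zeta_rem J y n) \<le> h n)" for x
  proof (intro exI conjI allI ballI)
    show "(0::real) < 1" by simp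
    show "summable (\<lambda>n. pochhammer (cmod (x - 1) + 1) (Suc J) * real (Suc n) powr (- c - real J))"
      using assms by (intro summable_mult summable_shifted_powr) auto
    fix n y assume y: "y \<in> ball x 1 \<inter> {s. Re s > c}"
    have "cmod (y - 1) \<le> cmod (x - 1) + cmod (y - x)"
      using norm_triangle_ineq[of "x - 1" "y - x"] by simp
    then show "cmod (zeta_rem J y n)
      \<le> pochhammer (cmod (x - 1) + 1) (Suc J) * real (Suc n) powr (- c - real J)"
      using y assms by (intro zeta_rem_bound) (auto simp: dist_norm norm_minus_commute)
  qed
  show ?A by (rule holomorphic_series(1)[OF op hol M])
  show "\<And>s. Re s > c \<Longrightarrow> summable (zeta_rem J s)" using holomorphic_series(2)[OF op hol M] by simp
qed

text \<open>
  Taylor expansion of \<open>(m - 1) powr (1 - s)\<close> at \<open>m\<close>, summed over \<open>m \<ge> 2\<close>, expresses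
  \<open>(s - 1) * zeta s\<close> through its values at \<open>s + 1, s + 2, \<dots>\<close> and a remainder series that
  converges in a larger half-plane.
\<close>

lemma zeta_recursion:
  assumes s: "Re s > 1" and J: "J \<ge> 1"
    and Z: "\<And>w. Re w > 1 \<Longrightarrow> (\<lambda>n. 1 / of_nat (Suc n) powr w) sums Z w"
  shows "(s - 1) * Z s = s - (\<Sum>j=2..J. pochhammer (s - 1) j / fact j * (Z (s + of_nat j - 1) - 1))
           - (\<Sum>n. zeta_rem J s n)"
proof -
  define u where "u n = (of_nat (n + 1) :: complex) powr (1 - s)" for n :: nat
  have "u \<longlonglongrightarrow> 0"
  proof (rule tendsto_norm_zero_cancel)
    have "norm (u n) = real (Suc n) powr (1 - Re s)" for n
      unfolding u_def using norm_powr_real_powr[of "of_nat (n + 1)" "1 - s"] by simp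
    moreover have "(\<lambda>n. real (Suc n) powr (1 - Re s)) \<longlonglongrightarrow> 0"
      using s by (intro tendsto_neg_powr filterlim_compose[OF filterlim_real_sequentially filterlim_Suc]) auto
    ultimately show "(\<lambda>n. norm (u n)) \<longlonglongrightarrow> 0" by simp
  qed
  then have tele: "(\<lambda>n. u n - u (Suc n)) sums 1"
    using telescope_sums'[of u 0] by (simp add: u_def)
  have tm: "(\<lambda>n. zeta_term j s n) sums (pochhammer (s - 1) j / fact j * (Z (s + of_nat j - 1) - 1))"
    if "j \<ge> 1" for j
  proof -
    have "Re (s + of_nat j - 1) > 1" using s that by simp
    from Z[OF this] have "(\<lambda>n. 1 / of_nat (Suc (Suc n)) powr (s + of_nat j - 1)) sums (Z (s + of_nat j - 1) - 1)"
      by (subst sums_Suc_iff) auto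
    moreover have "1 / of_nat (Suc (Suc n)) powr (s + of_nat j - 1)
        = (of_nat (n + 2) :: complex) powr (1 - s - of_nat j)" for n
      using powr_minus[of "of_nat (n + 2) :: complex" "s + of_nat j - 1"]
      by (simp add: field_simps inverse_eq_divide)
    ultimately show ?thesis unfolding zeta_term_def by (intro sums_mult) simp
  qed
  have "summable (zeta_rem J s)" using s J by (intro zeta_rem_series(2)[of 1]) auto
  then have "zeta_rem J s sums (\<Sum>n. zeta_rem J s n)" by (simp add: summable_sums)
  moreover have "(\<lambda>n. \<Sum>j=1..J. zeta_term j s n) sums
      (\<Sum>j=1..J. pochhammer (s - 1) j / fact j * (Z (s + of_nat j - 1) - 1))"
    by (intro sums_sum tm) auto
  ultimately have "(\<lambda>n. zeta_rem J s n + (\<Sum>j=1..J. zeta_term j s n)) sums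
      ((\<Sum>n. zeta_rem J s n) + (\<Sum>j=1..J. pochhammer (s - 1) j / fact j * (Z (s + of_nat j - 1) - 1)))"
    by (rule sums_add)
  moreover have "zeta_rem J s n + (\<Sum>j=1..J. zeta_term j s n) = u n - u (Suc n)" for n
    by (simp add: zeta_rem_def zeta_term_def u_def atMost_atLeast0 sum.atLeast_Suc_atMost add_ac)
  ultimately have "(\<Sum>n. zeta_rem J s n) + (\<Sum>j=1..J. pochhammer (s - 1) j / fact j * (Z (s + of_nat j - 1) - 1)) = 1"
    using tele sums_unique2 by simp
  moreover have "(\<Sum>j=1..J. pochhammer (s - 1) j / fact j * (Z (s + of_nat j - 1) - 1))
      = (s - 1) * (Z s - 1) + (\<Sum>j=2..J. pochhammer (s - 1) j / fact j * (Z (s + of_nat j - 1) - 1))"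
    using J by (subst sum.atLeast_Suc_atMost) (auto simp: numeral_2_eq_2)
  moreover have "(s - 1) * (Z s - 1) = (s - 1) * Z s - s + 1" by (simp add: algebra_simps)
  moreover have "z = s - C - R" if "R + A = 1" "A = B + C" "B = z - s + 1" for R A B C z :: complex
  proof -
    have "z = (R + A) - 1 + z - R - A + 1 - 1 + 1" by simp
    also have "\<dots> = s - C - R" unfolding that(1) unfolding that(2,3) by (simp add: algebra_simps)
    finally show ?thesis .
  qed
  ultimately show ?thesis by blast
qed

lemma zeta_halfplane:
  "\<exists>g. g holomorphic_on {s. Re s > 1 - real N} \<and>
     (\<forall>s. Re s > 1 \<longrightarrow> g s = (s - 1) * (\<Sum>n. 1 / of_nat (Suc n) powr s))"
proof (induction N)
  case 0
  show ?case
    by (rule exI[of _ "\<lambda>s. (s - 1) * (\<Sum>n. 1 / of_nat (Suc n) powr s)"])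
      (auto intro!: holomorphic_intros dirichlet_series(1) simp del: of_nat_Suc)
next
  case (Suc N)
  define Z :: "complex \<Rightarrow> complex" where "Z s = (\<Sum>n. 1 / of_nat (Suc n) powr s)" for s
  have Z: "(\<lambda>n. 1 / of_nat (Suc n) powr w) sums Z w" if "Re w > 1" for w
    unfolding Z_def using dirichlet_series(2)[OF that] by (rule summable_sums)
  from Suc obtain g where g: "g holomorphic_on {s. Re s > 1 - real N}"
    and gZ: "\<And>s. Re s > 1 \<Longrightarrow> g s = (s - 1) * Z s" unfolding Z_def by blast
  define J where "J = N + 2"
  define h where "h s = s - (\<Sum>j=2..J. pochhammer (s - 1) (j - 1) / fact j * g (s + of_nat j - 1)
      - pochhammer (s - 1) j / fact j) - (\<Sum>n. zeta_rem J s n)" for s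
  have "h holomorphic_on {s. Re s > 1 - real (Suc N)}"
  proof -
    have 1: "(\<lambda>s. g (s + of_nat j - 1)) holomorphic_on {s. Re s > 1 - real (Suc N)}" if "j \<ge> 2" for j
      by (rule holomorphic_on_compose_gen[OF _ g, unfolded o_def])
        (use that in \<open>auto intro!: holomorphic_intros\<close>)
    have 2: "(\<lambda>s. \<Sum>n. zeta_rem J s n) holomorphic_on {s. Re s > 1 - real (Suc N)}"
      by (rule zeta_rem_series) (simp add: J_def)
    show ?thesis unfolding h_def pochhammer_prod
      by (intro holomorphic_intros 1 2) auto
  qed
  moreover have "h s = (s - 1) * Z s" if s: "Re s > 1" for s
  proof -
    have "pochhammer (s - 1) (j - 1) / fact j * g (s + of_nat j - 1) - pochhammer (s - 1) j / fact j
        = pochhammer (s - 1) j / fact j * (Z (s + of_nat j - 1) - 1)" if j: "j \<in> {2..J}" for j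
    proof -
      obtain i where i: "j = Suc i" using j by (cases j) auto
      have "g (s + of_nat j - 1) = (s - 1 + of_nat i) * Z (s + of_nat j - 1)"
        using j s by (subst gZ) (auto simp: i)
      moreover have "p / F * (a * z) - p * a / F = p * a / F * (z - 1)" for p F a z :: complex
        by (simp add: right_diff_distrib mult.assoc)
      ultimately show ?thesis unfolding i pochhammer_Suc diff_Suc_1 by (simp only:)
    qed
    then show ?thesis unfolding h_def
      using zeta_recursion[of s J Z] s Z by (simp add: J_def)
  qed
  ultimately show ?case unfolding Z_def by blast
qed

lemma halfplane_identity:
  assumes f: "f holomorphic_on S" and g: "g holomorphic_on S" and S: "open S" "connected S"
    and sub: "{s. Re s > 1} \<subseteq> S" and eq: "\<And>s. Re s > 1 \<Longrightarrow> f s = g s" and s: "s \<in> S"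
  shows "f s = g s"
proof (rule analytic_continuation_open[of "{s. Re s > 1}" S f g])
  show "{s. Re s > 1} \<noteq> {}" by (auto intro: exI[of _ 2])
qed (use assms in \<open>auto simp: open_halfspace_Re_gt\<close>)

lemma zeta_ex1: "\<exists>!f. is_zeta f"
proof (rule ex_ex1I)
  define Z :: "complex \<Rightarrow> complex" where "Z s = (\<Sum>n. 1 / of_nat (Suc n) powr s)" for s
  define H where "H N = {s. Re s > 1 - real N}" for N
  obtain G where G: "\<And>N. G N holomorphic_on H N"
    and GZ: "\<And>N s. Re s > 1 \<Longrightarrow> G N s = (s - 1) * Z s"
    using zeta_halfplane unfolding Z_def H_def by metis
  have H: "open (H N)" "connected (H N)" "{s. Re s > 1} \<subseteq> H N" for N
    unfolding H_def
    by (rule open_halfspace_Re_gt, rule convex_connected[OF convex_halfspace_Re_gt], auto)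
  have mono: "H M \<subseteq> H N" if "M \<le> N" for M N using that by (auto simp: H_def)
  have GG: "G M s = G N s" if "M \<le> N" "s \<in> H M" for M N s
    by (rule halfplane_identity[OF G[of M] holomorphic_on_subset[OF G[of N] mono[OF that(1)]] H])
      (simp_all add: GZ that)
  have GG: "G M s = G N s" if "s \<in> H M" "s \<in> H N" for M N s
    using GG[of M N s] GG[of N M s] that by (metis nle_le)
  define g where "g s = G (SOME N. s \<in> H N) s" for s
  have ex: "\<exists>N. s \<in> H N" for s
    using reals_Archimedean2[of "1 - Re s"] by (auto simp: H_def algebra_simps)
  have gG: "g s = G N s" if "s \<in> H N" for s N
    unfolding g_def by (rule GG[OF someI_ex[OF ex[of s]] that])
  have "g holomorphic_on (\<Union>N. H N)"
  proof (rule holomorphic_on_UN_open)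
    show "g holomorphic_on H N" for N
      by (rule holomorphic_transform[OF G[of N]]) (simp add: gG)
  qed (rule H(1))
  moreover have "(\<Union>N. H N) = UNIV" using ex by blast
  ultimately have g: "g holomorphic_on UNIV" by simp
  have gZ: "g s = (s - 1) * Z s" if "Re s > 1" for s
    using gG[of s 0] GZ[of s 0] that by (simp add: H_def)
  define f where "f s = (if s = 1 then 0 else g s / (s - 1))" for s
  have "(\<lambda>s. g s / (s - 1)) holomorphic_on - {1}"
    by (intro holomorphic_intros holomorphic_on_subset[OF g]) auto
  then have "f holomorphic_on - {1}"
    by (rule holomorphic_transform) (auto simp: f_def)
  moreover have "(\<lambda>n. 1 / of_nat (Suc n) powr s) sums f s" if "Re s > 1" for s
  proof -
    have "s \<noteq> 1" using that by auto
    then have "f s = Z s" using gZ[OF that] by (simp add: f_def)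
    then show ?thesis unfolding Z_def using summable_sums[OF dirichlet_series(2)[OF that]] by simp
  qed
  ultimately show "\<exists>f. is_zeta f" unfolding is_zeta_def by (auto simp: f_def)
next
  fix f g assume f: "is_zeta f" and g: "is_zeta g"
  have "f s = g s" if "s \<noteq> 1" for s
  proof (rule halfplane_identity[of f "- {1}" g])
    show "f s = g s" if "Re s > 1" for s
      using f g that unfolding is_zeta_def by (meson sums_unique2)
    show "connected (- {1 :: complex})" by (rule connected_punctured_universe) simp
  qed (use f g that in \<open>auto simp: is_zeta_def\<close>)
  moreover have "f 1 = g 1" using f g by (simp add: is_zeta_def)
  ultimately show "f = g" by (metis ext)
qed

lemma is_zeta_zeta: "is_zeta zeta"
  unfolding zeta_def by (rule theI'[OF zeta_ex1])


section \<open>Counting zeros in a disc\<close>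

definition zeta_zero_count :: "complex \<Rightarrow> real \<Rightarrow> real" where
  "zeta_zero_count s \<alpha> =
     (\<Sum>\<rho> | \<rho> \<noteq> 1 \<and> zeta \<rho> = 0 \<and> dist \<rho> s \<le> \<alpha>.
        (if dist \<rho> s = \<alpha> then 1 / 2 else 1) * of_int (zorder zeta \<rho>))"


section \<open>Coefficients\<close>

definition sigma_k :: "int \<Rightarrow> real" where
  "sigma_k k = (if k \<ge> 0 then 1 - (real_of_int k + 3) / (2 ^ (nat k + 3) - 2)
          else (real_of_int (- k) + 3) / (2 ^ (nat (- k) + 3) - 2))"

definition v_k :: "int \<Rightarrow> real" where
  "v_k k = (if k \<ge> 0 then 1 / (2 ^ (nat k + 3) - 2)
          else sigma_k (- k) - 1 / 2 + 1 / (2 ^ (nat (- k) + 3) - 2))"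

definition v_k' :: "int \<Rightarrow> real" where
  "v_k' k = 1"

definition v_k'' :: "int \<Rightarrow> real" where
  "v_k'' k = (if k = 0 then ln 0.611
            else if k > 0 then ln 1.546
            else ln 1.546 + (sigma_k k - 1 / 2) * ln pi)"

text \<open>
  The formulas for \<open>\<sigma>\<^sub>k, \<sigma>\<^sub>-\<^sub>k, v\<^sub>k, v\<^sub>-\<^sub>k\<close> all apply to \<open>k \<ge> 0\<close> and thus overlap at
  \<open>k = 0\<close>, where they agree.
\<close>

lemma coefficients_at_zero:
  "sigma_k 0 = (0 + 3) / (2 ^ (0 + 3) - 2)"
  "v_k 0 = sigma_k 0 - 1 / 2 + 1 / (2 ^ (0 + 3) - 2)"
  by (simp_all add: sigma_k_def v_k_def)

definition slope :: "(int \<Rightarrow> real) \<Rightarrow> int \<Rightarrow> real" where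
  "slope w k = (w k - w (k + 1)) / (sigma_k k - sigma_k (k + 1))"

definition intercept :: "(int \<Rightarrow> real) \<Rightarrow> int \<Rightarrow> real" where
  "intercept w k = w k - slope w k * sigma_k k"

definition K_index :: "real \<Rightarrow> int" where
  "K_index r = (LEAST k. r \<ge> 1 - sigma_k k)"

definition theta_k :: "int \<Rightarrow> real \<Rightarrow> real" where
  "theta_k k r = arcsin ((1 - sigma_k k) / r)"

definition c_coeff :: "(int \<Rightarrow> real) \<Rightarrow> real \<Rightarrow> real" where
  "c_coeff w r =
     (let m = slope w; b = intercept w in
       (m (K_index r - 1) + b (K_index r - 1)) * (pi / 2 - theta_k (K_index r) r) - m (K_index r - 1) * r * cos (theta_k (K_index r) r)
       + (\<Sum>n. let k = K_index r + int n in
            (m k + b k) * (theta_k k r - theta_k (k + 1) r)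
            + m k * r * (cos (theta_k k r) - cos (theta_k (k + 1) r))))"

definition c1 :: "real \<Rightarrow> real" where "c1 = c_coeff v_k"
definition c2 :: "real \<Rightarrow> real" where "c2 = c_coeff v_k'"
definition c3 :: "real \<Rightarrow> real" where "c3 = c_coeff v_k''"

text \<open>
  On the real axis to the right of 1, \<open>zeta\<close> and \<open>deriv zeta\<close> are real, so taking real parts
  below only changes the type. The integrand is bounded on \<open>{0<..1}\<close>; its value at the
  endpoint 0 does not matter.
\<close>

definition c4 :: "real \<Rightarrow> real" where
  "c4 r = 1 / 2 * ln (Re (zeta (of_real (1 + r))))
     - r / pi * integral {0..1} (\<lambda>u.
         Re (deriv zeta (of_real (1 + r * u)) / zeta (of_real (1 + r * u))) * arcsin u)"

definition C1 :: "real \<Rightarrow> real \<Rightarrow> real" where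
  "C1 \<alpha> r = c1 r / ln (r / \<alpha>)"

definition C2 :: "real \<Rightarrow> real \<Rightarrow> real" where
  "C2 \<alpha> r = c2 r / (pi * ln (r / \<alpha>)) + 1 / ln (r / \<alpha>)"

definition C3 :: "real \<Rightarrow> real \<Rightarrow> real" where
  "C3 \<alpha> r = c3 r / (pi * ln (r / \<alpha>)) + c4 r / ln (r / \<alpha>) + ln 29.388 / ln (r / \<alpha>)"

end

theory Submission
  imports Defs "HOL-Number_Theory.Prime_Powers"
begin

text \<open>
  Jensen's formula on a circle centred at \<open>1 + \<delta> + it\<close> whose radius tends to \<open>r\<close> bounds the count
  by a mean of \<open>ln |zeta|\<close> over the circle minus \<open>ln |zeta(1 + \<delta> + it)|\<close>.  On the right half the Euler
  product gives \<open>c4\<close>; on the left half \<open>zeta\<close> is bounded on the lines \<open>Re s = sigma_k\<close> by van der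
  Corput's method (and by the functional equation for negative \<open>k\<close>), and convexity between the lines
  turns the mean into \<open>c1\<close>, \<open>c2\<close>, \<open>c3\<close>.  The term \<open>- ln |zeta(1 + \<delta> + it)|\<close> is of size
  \<open>ln (1 / \<delta>)\<close>, so \<open>\<delta>\<close> is taken proportional to \<open>\<alpha>\<close>; that this costs only one
  \<open>ln (ln t)\<close> follows from the inequality \<open>3 + 4 cos \<theta> + cos 2\<theta> >= 0\<close> combined with the
  differentiated Jensen formula, which bounds the number of zeros in a small disc.
\<close>

text \<open>As \<open>c2 r = pi / 2\<close>, the claim is
  \<open>n * ln (r / \<alpha>) <= c1 r / pi * L + 3/2 * ln L + const\<close> with
  \<open>L = ln t\<close>. Half a \<open>ln L\<close> pays for the factor \<open>ln t\<close> in the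
  bound for zeta, averaged over the left half circle, so the centre may cost only
  \<open>ln L\<close> and a constant. With \<open>\<delta> = \<alpha> / n\<close>, passing from
  \<open>\<alpha>\<close> to \<open>\<alpha> + \<delta>\<close> costs at most
  \<open>n * ln (1 + 1 / n) <= 1\<close>, and \<open>1 / \<delta> = n / \<alpha>\<close>; hence an
  explicit bound for \<open>n / \<alpha>\<close> by a multiple of \<open>L\<close> is required. For
  \<open>n\<close> equal to 1 or 2 a zero-free region bounds \<open>1 / \<alpha>\<close> instead.
  The obstacle is numerical. The bound proved here for zeta is
  \<open>1001/1000 * A * t powr v * ln t\<close> with \<open>A\<close> between 3.49 and 13.98, well
  above 1.546; the room for it is found in 29.388, of which 22.97 remains once \<open>c3\<close> is
  bounded below by \<open>ln 0.611 * pi / 2\<close>. All constants, from the derivative tests to the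
  logarithmic derivative, are tuned to that margin. Between two nodes the interpolation is carried
  out on dyadic blocks of the Dirichlet polynomial rather than on zeta itself.\<close>

section \<open>Exponential sums: Kusmin-Landau and van der Corput's difference method\<close>

definition ee :: "real => complex" where "ee x = cis (2 * pi * x)"

lemma norm_ee [simp]: "norm (ee x) = 1"
 by (simp add: ee_def)

lemma ee_add: "ee (x + y) = ee x * ee y"
 by (simp add: ee_def cis_mult algebra_simps)

lemma ee_diff: "ee (x - y) = ee x * cnj (ee y)"
 by (simp add: ee_def cis_cnj cis_mult algebra_simps)

lemma ee_of_int [simp]: "ee (of_int k) = 1"
 using cis_multiple_2pi[of "of_int k"] by (simp add: ee_def)

lemma ee_minus_of_int: "ee (x - of_int k) = ee x"
 by (simp add: ee_diff)

text \<open>The derivative of \<open>sin x - x * cos x\<close> is \<open>x * sin x >= 0\<close>.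
  This form of \<open>x <= tan x\<close> survives at \<open>pi / 2\<close>, as
  \<open>c4_integral\<close> requires.\<close>

lemma mult_cos_le_sin:
 fixes x :: real
 assumes "0 <= x" "x <= pi / 2"
 shows "x * cos x <= sin x"
proof -
 have "(%x. sin x - x * cos x) 0 <= (%x. sin x - x * cos x) x"
 proof (rule DERIV_nonneg_imp_nondecreasing[OF assms(1)])
  fix y :: real assume y: "0 <= y" "y <= x"
  have "((%x. sin x - x * cos x) has_real_derivative y * sin y) (at y)"
   by (auto intro!: derivative_eq_intros)
  moreover have "y * sin y >= 0" using y assms by (intro mult_nonneg_nonneg sin_ge_zero) auto
  ultimately show "\<exists>z. ((%x. sin x - x * cos x) has_real_derivative z) (at y) \<and> 0 <= z" by blast
 qed
 thus ?thesis by simp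
qed

text \<open>The quotient is \<open>cot (a / 2)\<close>; this is the shape in which the boundary
  terms of Kusmin-Landau arrive.\<close>

lemma cot_half_le:
 fixes a :: real
 assumes "0 < a" "a < pi"
 shows "(1 + cos a) / sin a <= 2 / a"
proof -
 define x where "x = a / 2"
 have x: "0 < x" "x < pi / 2" "a = 2 * x" using assms by (auto simp: x_def)
 have s: "sin x > 0" "cos x > 0" "sin a > 0" using x assms by (auto intro: sin_gt_zero cos_gt_zero)
 have "a * (1 + cos a) = 4 * cos x * (x * cos x)"
  by (simp add: x(3) cos_double_cos power2_eq_square)
 also have "... <= 4 * cos x * sin x"
  using s mult_cos_le_sin[of x] x by (intro mult_left_mono) auto
 also have "... = 2 * sin a" by (simp add: x(3) sin_double)
 finally show ?thesis using s assms by (simp add: field_simps)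
qed

text \<open>Summation by parts. Each \<open>E i\<close> is \<open>E i - E (Suc i)\<close> divided by
  \<open>1 - ee\<close> of the increment. The inverse of that divisor has real part 1/2 and half a
  cotangent as imaginary part, which is monotone because the increments are, so its total variation
  telescopes to the two ends.\<close>

lemma kusmin_landau_aux:
 fixes f :: "nat => real"
 assumes th: "0 < \<theta>" "\<theta> <= 1 / 2"
  and g: "\<And>i. i < m ==> \<theta> <= f (Suc i) - f i \<and> f (Suc i) - f i <= 1 - \<theta>"
  and mono: "\<And>i. Suc i < m ==> f (Suc i) - f i <= f (Suc (Suc i)) - f (Suc i)"
 shows "norm (\<Sum>i<Suc m. ee (f i)) <= 2 / (pi * \<theta>)"
proof (cases "m = 0")
 case True
 have "pi * \<theta> <= 2" using th pi_less_4 mult_mono[of pi 4 \<theta> "1/2"] by simp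
 thus ?thesis using True th by (simp add: field_simps)
next
 case False
 define E where "E i = ee (f i)" for i
 define \<alpha> where "\<alpha> i = pi * (f (Suc i) - f i)" for i
 \<comment> \<open>This is \<open>1 / (1 - ee (f (Suc i) - f i))\<close>, split into real and
   imaginary part.\<close>
 define c where "c i = Complex (1/2) (cot (\<alpha> i) / 2)" for i
 have a: "pi * \<theta> <= \<alpha> i" "\<alpha> i <= pi - pi * \<theta>" if "i < m" for i
  using mult_left_mono[of \<theta> "f (Suc i) - f i" pi] mult_left_mono[of "f (Suc i) - f i" "1 - \<theta>" pi] g[OF that]
  by (auto simp: \<alpha>_def algebra_simps)
 have a0: "0 < \<alpha> i" "\<alpha> i < pi" if "i < m" for i
  using a[OF that] th by (auto intro: less_le_trans[of 0 "pi * \<theta>"] le_less_trans[of _ "pi - pi * \<theta>"])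
 have s: "sin (\<alpha> i) > 0" if "i < m" for i using a0[OF that] by (intro sin_gt_zero) auto
 have step: "c i * (E i - E (Suc i)) = E i" if "i < m" for i
 proof -
  have "ee (f (Suc i)) = ee (f i) * ee (f (Suc i) - f i)"
   by (simp flip: ee_add)
  moreover have "ee (f (Suc i) - f i) = Complex (cos (2 * \<alpha> i)) (sin (2 * \<alpha> i))"
   by (simp add: ee_def cis.ctr \<alpha>_def mult.assoc)
  ultimately have "E i - E (Suc i) = E i * (1 - Complex (cos (2 * \<alpha> i)) (sin (2 * \<alpha> i)))"
   by (simp add: E_def algebra_simps)
  moreover have "c i * (1 - Complex (cos (2 * \<alpha> i)) (sin (2 * \<alpha> i))) = 1"
  proof -
   have n0: "sin (\<alpha> i) ~= 0" using s[OF that] by simp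
   have cs: "cot (\<alpha> i) * sin (\<alpha> i) = cos (\<alpha> i)" using n0 by (simp add: cot_def)
   have "1/2 * (1 - cos (2 * \<alpha> i)) + cot (\<alpha> i) / 2 * sin (2 * \<alpha> i)
     = (sin (\<alpha> i))\<^sup>2 + (cot (\<alpha> i) * sin (\<alpha> i)) * cos (\<alpha> i)"
    by (simp add: cos_double_sin sin_double)
   also have "... = 1" unfolding cs by (simp add: power2_eq_square flip: power2_eq_square)
   finally have 1: "1/2 * (1 - cos (2 * \<alpha> i)) + cot (\<alpha> i) / 2 * sin (2 * \<alpha> i) = 1" .
   have "cot (\<alpha> i) / 2 * (1 - cos (2 * \<alpha> i)) - 1/2 * sin (2 * \<alpha> i)
     = (cot (\<alpha> i) * sin (\<alpha> i)) * sin (\<alpha> i) - sin (\<alpha> i) * cos (\<alpha> i)"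
    by (simp add: cos_double_sin sin_double power2_eq_square)
   also have "... = 0" unfolding cs by simp
   finally have 2: "cot (\<alpha> i) / 2 * (1 - cos (2 * \<alpha> i)) - 1/2 * sin (2 * \<alpha> i) = 0" .
   show ?thesis unfolding c_def complex_eq_iff using 1 2 by (simp add: algebra_simps)
  qed
  ultimately show ?thesis by (metis mult.left_commute mult.right_neutral)
 qed
 have nc: "norm (c i) = 1 / (2 * sin (\<alpha> i))" "norm (1 - c i) = 1 / (2 * sin (\<alpha> i))" if "i < m" for i
 proof -
  have p: "sin (\<alpha> i) > 0" using s[OF that] .
  have "(1/2)\<^sup>2 + (cot (\<alpha> i) / 2)\<^sup>2 = ((sin (\<alpha> i))\<^sup>2 + (cos (\<alpha> i))\<^sup>2) / (2 * sin (\<alpha> i))\<^sup>2"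
   using p by (simp add: cot_def power_divide field_simps)
  hence e: "(1/2)\<^sup>2 + (cot (\<alpha> i) / 2)\<^sup>2 = (1 / (2 * sin (\<alpha> i)))\<^sup>2"
   by (simp add: power_divide)
  show "norm (c i) = 1 / (2 * sin (\<alpha> i))"
   unfolding c_def complex_norm e using p by simp
  have "1 - c i = Complex (1/2) (- (cot (\<alpha> i) / 2))" by (simp add: c_def complex_eq_iff)
  thus "norm (1 - c i) = 1 / (2 * sin (\<alpha> i))"
   using e p by (simp add: complex_norm power2_minus[of "cot (\<alpha> i) / 2", simplified])
 qed
 have cd: "norm (c (Suc i) - c i) = (cot (\<alpha> i) - cot (\<alpha> (Suc i))) / 2" if "Suc i < m" for i
 proof -
  have "\<alpha> i <= \<alpha> (Suc i)" using mono[OF that] by (simp add: \<alpha>_def)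
  moreover have si: "sin (\<alpha> i) > 0" "sin (\<alpha> (Suc i)) > 0" using s that by auto
  ultimately have "cot (\<alpha> (Suc i)) <= cot (\<alpha> i)"
  proof -
   have "0 <= sin (\<alpha> (Suc i) - \<alpha> i)"
    using \<open>\<alpha> i <= \<alpha> (Suc i)\<close> a0[of i] a0[of "Suc i"] that by (intro sin_ge_zero) auto
   thus ?thesis using si by (simp add: cot_def sin_diff field_simps)
  qed
  moreover have "c (Suc i) - c i = Complex 0 ((cot (\<alpha> (Suc i)) - cot (\<alpha> i)) / 2)"
   by (simp add: c_def complex_eq_iff field_simps)
  ultimately show ?thesis by (simp add: complex_norm)
 qed
 \<comment> \<open>The partial sum is kept together with the pending boundary term
   \<open>c j * E (Suc j)\<close>, so that each step adds only the variation of
   \<open>c\<close>.\<close>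
 have Q: "norm ((\<Sum>i<Suc j. E i) + c j * E (Suc j)) <= norm (c 0) + (cot (\<alpha> 0) - cot (\<alpha> j)) / 2"
  if "j < m" for j
  using that
 proof (induction j)
  case 0
  have "(\<Sum>i<Suc 0. E i) + c 0 * E (Suc 0) = c 0 * E 0"
   using step[of 0] 0 by (simp add: algebra_simps)
  thus ?case by (simp add: norm_mult E_def)
 next
  case (Suc j)
  have "(\<Sum>i<Suc (Suc j). E i) + c (Suc j) * E (Suc (Suc j))
    = ((\<Sum>i<Suc j. E i) + c j * E (Suc j)) + (c (Suc j) - c j) * E (Suc j)"
   using step[of "Suc j"] Suc.prems by (simp add: algebra_simps)
  hence "norm ((\<Sum>i<Suc (Suc j). E i) + c (Suc j) * E (Suc (Suc j)))
    <= norm ((\<Sum>i<Suc j. E i) + c j * E (Suc j)) + norm (c (Suc j) - c j)"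
   by (metis norm_triangle_ineq norm_mult norm_ee E_def mult.right_neutral)
  thus ?case using Suc.IH Suc.prems cd[of j] by (simp add: field_simps)
 qed
 obtain j where j: "m = Suc j" using False by (cases m) auto
 define X where "X = (\<Sum>i<Suc j. E i) + c j * E (Suc j)"
 have "(\<Sum>i<Suc m. E i) = X + (1 - c j) * E (Suc j)"
  by (simp add: j X_def algebra_simps)
 hence "norm (\<Sum>i<Suc m. E i) <= norm X + norm (1 - c j)"
  by (metis norm_triangle_ineq norm_mult norm_ee E_def mult.right_neutral)
 also have "norm X <= norm (c 0) + (cot (\<alpha> 0) - cot (\<alpha> j)) / 2"
  using Q[of j] j by (simp add: X_def)
 finally have "norm (\<Sum>i<Suc m. E i) <= norm (c 0) + (cot (\<alpha> 0) - cot (\<alpha> j)) / 2 + norm (1 - c j)"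
  by simp
 \<comment> \<open>Both ends combine to half-angle cotangents, at \<open>\<alpha> j\<close> after
   reflecting it to \<open>pi - \<alpha> j\<close>.\<close>
 also have "... = ((1 + cos (\<alpha> 0)) / sin (\<alpha> 0) + (1 + cos (pi - \<alpha> j)) / sin (pi - \<alpha> j)) / 2"
 proof -
  have "norm (c 0) = 1 / (2 * sin (\<alpha> 0))" "norm (1 - c j) = 1 / (2 * sin (\<alpha> j))"
   using nc(1)[of 0] nc(2)[of j] j by auto
  thus ?thesis using j s[of 0] s[of j]
   by (simp only: cot_def sin_pi_minus cos_pi_minus) (simp add: add_divide_distrib diff_divide_distrib)
 qed
 also have "... <= (2 / \<alpha> 0 + 2 / (pi - \<alpha> j)) / 2"
  using cot_half_le[of "\<alpha> 0"] cot_half_le[of "pi - \<alpha> j"] a0[of 0] a0[of j] j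
  by (intro divide_right_mono add_mono) auto
 also have "... <= (2 / (pi * \<theta>) + 2 / (pi * \<theta>)) / 2"
 proof -
  have pt: "0 < pi * \<theta>" using th by simp
  have "2 / x <= 2 / (pi * \<theta>)" if "pi * \<theta> <= x" for x
   using that pt by (intro frac_le) auto
  from this[of "\<alpha> 0"] this[of "pi - \<alpha> j"] a(1)[of 0] a(2)[of j] j show ?thesis by simp
 qed
 finally show ?thesis by (simp add: E_def)
qed

text \<open>Adding integers to \<open>f i\<close> leaves \<open>ee (f i)\<close> unchanged, so
  subtracting \<open>\<nu> * i\<close> moves the increments into the window of
  \<open>kusmin_landau_aux\<close>.\<close>

lemma kusmin_landau:
 fixes f :: "nat => real" and \<nu> :: int
 assumes th: "0 < \<theta>" "\<theta> <= 1 / 2" and ab: "a <= b"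
  and g: "\<And>i. a <= i ==> Suc i < b ==> of_int \<nu> + \<theta> <= f (Suc i) - f i \<and> f (Suc i) - f i <= of_int \<nu> + 1 - \<theta>"
  and mono: "\<And>i. a <= i ==> Suc (Suc i) < b ==> f (Suc i) - f i <= f (Suc (Suc i)) - f (Suc i)"
 shows "norm (\<Sum>i=a..<b. ee (f i)) <= 2 / (pi * \<theta>)"
proof (cases "a = b")
 case True thus ?thesis using th by simp
next
 case False
 then obtain m where m: "b = a + Suc m" using ab less_iff_Suc_add[of a b] by (metis le_neq_implies_less add_Suc_right)
 define F where "F i = f (a + i) - of_int (\<nu> * int i)" for i
 have "(\<Sum>i=a..<b. ee (f i)) = (\<Sum>i<Suc m. ee (f (a + i)))"
  unfolding m using sum.shift_bounds_nat_ivl[of "%i. ee (f i)" 0 a "Suc m"]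
  by (simp add: atLeast0LessThan add.commute)
 also have "... = (\<Sum>i<Suc m. ee (F i))"
  unfolding F_def ee_minus_of_int ..
 also have "norm ... <= 2 / (pi * \<theta>)"
 proof (rule kusmin_landau_aux[OF th])
  fix i assume i: "i < m"
  show "\<theta> <= F (Suc i) - F i \<and> F (Suc i) - F i <= 1 - \<theta>"
   using g[of "a + i"] i unfolding F_def m by (simp add: algebra_simps)
 next
  fix i assume i: "Suc i < m"
  show "F (Suc i) - F i <= F (Suc (Suc i)) - F (Suc i)"
   using mono[of "a + i"] i unfolding F_def m by (simp add: algebra_simps)
 qed
 finally show ?thesis .
qed

text \<open>Pairs are grouped by distance: the distance \<open>j > 0\<close> occurs
  \<open>2 * (q - j)\<close> times in the square.\<close>

lemma sum_abs_diff_square: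
 fixes c :: "nat => real"
 shows "(\<Sum>r<q. \<Sum>s<q. c (nat \<bar>int r - int s\<bar>)) = real q * c 0 + 2 * (\<Sum>j=1..<q. real (q - j) * c j)"
proof (induction q)
 case (Suc q)
 have col: "(\<Sum>s<q. c (nat \<bar>int q - int s\<bar>)) = (\<Sum>j=1..<Suc q. c j)"
  by (rule sum.reindex_bij_witness[of _ "%j. q - j" "%s. q - s"]) (auto simp: nat_diff_distrib' of_nat_diff)
 have col': "(\<Sum>s<q. c (nat \<bar>int s - int q\<bar>)) = (\<Sum>j=1..<Suc q. c j)"
  by (subst col[symmetric]) (simp add: abs_minus_commute)
 have "(\<Sum>r<Suc q. \<Sum>s<Suc q. c (nat \<bar>int r - int s\<bar>))
   = (\<Sum>r<q. \<Sum>s<q. c (nat \<bar>int r - int s\<bar>)) + (\<Sum>s<q. c (nat \<bar>int s - int q\<bar>))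
    + (\<Sum>s<q. c (nat \<bar>int q - int s\<bar>)) + c 0"
  by (simp add: sum.distrib)
 also have "... = real (Suc q) * c 0 + 2 * ((\<Sum>j=1..<q. real (q - j) * c j) + (\<Sum>j=1..<Suc q. c j))"
  unfolding col col' Suc.IH by (simp add: algebra_simps)
 also have "(\<Sum>j=1..<q. real (q - j) * c j) = (\<Sum>j=1..<Suc q. real (q - j) * c j)"
  by (cases "q >= 1") auto
 also have "... + (\<Sum>j=1..<Suc q. c j) = (\<Sum>j=1..<Suc q. real (Suc q - j) * c j)"
  by (subst sum.distrib[symmetric], rule sum.cong) (auto simp: Suc_diff_le algebra_simps)
 finally show ?case .
qed simp

text \<open>Cauchy--Schwarz applied to the \<open>q\<close>-fold overcounted sum.\<close>

lemma weyl_van_der_corput: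
 fixes z :: "nat => complex"
 assumes q: "q >= 1"
 shows "(real q * norm (\<Sum>i<n. z i))\<^sup>2
  <= real (n + q) * (real q * (\<Sum>i<n. (norm (z i))\<^sup>2)
    + 2 * (\<Sum>j=1..<q. real (q - j) * norm (\<Sum>i<n - j. z (i + j) * cnj (z i))))"
proof -
 \<comment> \<open>Extending \<open>z\<close> by zero to all integers lets \<open>M\<close> serve as
   one window for all \<open>q\<close> shifts, which removes the boundary cases.\<close>
 define Z where "Z k = (if 0 <= k \<and> k < int n then z (nat k) else 0)" for k :: int
 define M where "M = {0..<int (n + q)}"
 define c where "c j = norm (\<Sum>i<n - j. z (i + j) * cnj (z i))" for j
 have zz: "(\<Sum>m\<in>M. Z (m - int r) * cnj (Z (m - int s))) = (\<Sum>i<n - (s - r). z (i + (s - r)) * cnj (z i))"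
  if rs: "r <= s" "s < q" for r s
 proof -
  have "(\<Sum>m\<in>M. Z (m - int r) * cnj (Z (m - int s)))
    = (\<Sum>m\<in>{int s..<int n + int r}. Z (m - int r) * cnj (Z (m - int s)))"
   by (rule sum.mono_neutral_right) (use rs in \<open>auto simp: M_def Z_def\<close>)
  also have "... = (\<Sum>i<n - (s - r). z (i + (s - r)) * cnj (z i))"
   by (rule sum.reindex_bij_witness[of _ "%i. int i + int s" "%m. nat (m - int s)"])
    (use rs in \<open>auto simp: Z_def nat_diff_distrib' algebra_simps of_nat_diff intro!: arg_cong[where f = z] arg_cong2[where f = "(*)"]\<close>)
  finally show ?thesis .
 qed
 have zz': "norm (\<Sum>m\<in>M. Z (m - int r) * cnj (Z (m - int s))) = c (nat \<bar>int r - int s\<bar>)"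
  if "r < q" "s < q" for r s
 proof (cases "r <= s")
  case True
  thus ?thesis using zz[of r s] that by (simp add: c_def nat_diff_distrib' abs_minus_commute flip: of_nat_diff)
 next
  case False
  have "(\<Sum>m\<in>M. Z (m - int r) * cnj (Z (m - int s))) = cnj (\<Sum>m\<in>M. Z (m - int s) * cnj (Z (m - int r)))"
   by (simp add: mult.commute)
  thus ?thesis using zz[of s r] that False by (simp add: c_def flip: of_nat_diff del: cnj_sum)
 qed
 have row: "(\<Sum>m\<in>M. Z (m - int r)) = (\<Sum>i<n. z i)" if "r < q" for r
 proof -
  have "(\<Sum>m\<in>M. Z (m - int r)) = (\<Sum>m\<in>{int r..<int n + int r}. Z (m - int r))"
   by (rule sum.mono_neutral_right) (use that in \<open>auto simp: M_def Z_def\<close>)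
  also have "... = (\<Sum>i<n. z i)"
   by (rule sum.reindex_bij_witness[of _ "%i. int i + int r" "%m. nat (m - int r)"])
    (auto simp: Z_def)
  finally show ?thesis .
 qed
 have "real q * norm (\<Sum>i<n. z i) = norm (\<Sum>r<q. \<Sum>m\<in>M. Z (m - int r))"
  by (simp add: row norm_mult)
 also have "... = norm (\<Sum>m\<in>M. \<Sum>r<q. Z (m - int r))"
  by (subst sum.swap) simp
 also have "... <= (\<Sum>m\<in>M. norm (\<Sum>r<q. Z (m - int r)))" by (rule norm_sum)
 finally have "(real q * norm (\<Sum>i<n. z i))\<^sup>2 <= (\<Sum>m\<in>M. norm (\<Sum>r<q. Z (m - int r)))\<^sup>2"
  by (intro power_mono) auto
 also have "... <= real (card M) * (\<Sum>m\<in>M. (norm (\<Sum>r<q. Z (m - int r)))\<^sup>2)"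
  using sum_squared_le_sum_of_squares[of "%m. norm (\<Sum>r<q. Z (m - int r))" M]
  by (simp add: mult.commute M_def)
 also have "card M = n + q" by (simp add: M_def)
 also have "(\<Sum>m\<in>M. (norm (\<Sum>r<q. Z (m - int r)))\<^sup>2)
   = Re (\<Sum>m\<in>M. \<Sum>r<q. \<Sum>s<q. Z (m - int r) * cnj (Z (m - int s)))"
 proof -
  have "(norm X)\<^sup>2 = Re (X * cnj X)" for X :: complex
   by (simp add: complex_norm_square[symmetric] flip: of_real_power)
  thus ?thesis by (simp only: cnj_sum sum_product Re_sum)
 qed
 also have "(\<Sum>m\<in>M. \<Sum>r<q. \<Sum>s<q. Z (m - int r) * cnj (Z (m - int s)))
   = (\<Sum>r<q. \<Sum>s<q. \<Sum>m\<in>M. Z (m - int r) * cnj (Z (m - int s)))"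
  by (subst sum.swap, rule sum.cong[OF refl], subst sum.swap, rule refl)
 also have "Re ... <= norm ..." by (rule complex_Re_le_cmod)
 also have "... <= (\<Sum>r<q. \<Sum>s<q. norm (\<Sum>m\<in>M. Z (m - int r) * cnj (Z (m - int s))))"
  by (rule order_trans[OF norm_sum], rule sum_mono, rule norm_sum)
 also have "... = (\<Sum>r<q. \<Sum>s<q. c (nat \<bar>int r - int s\<bar>))"
  by (intro sum.cong refl zz') auto
 also have "... = real q * c 0 + 2 * (\<Sum>j=1..<q. real (q - j) * c j)"
  by (rule sum_abs_diff_square)
 also have "c 0 = (\<Sum>i<n. (norm (z i))\<^sup>2)"
 proof -
  have "(\<Sum>i<n. z i * cnj (z i)) = of_real (\<Sum>i<n. (norm (z i))\<^sup>2)"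
   by (simp add: complex_norm_square[symmetric])
  hence "norm (\<Sum>i<n. z i * cnj (z i)) = \<bar>\<Sum>i<n. (norm (z i))\<^sup>2\<bar>"
   by (simp only: norm_of_real)
  thus ?thesis unfolding c_def by (simp add: sum_nonneg)
 qed
 finally show ?thesis unfolding c_def by (simp add: mult_left_mono)
qed

text \<open>Intervals are what \<open>kusmin_landau\<close> accepts;
  \<open>second_difference_test\<close> takes from here its two level sets for each integer.\<close>

lemma level_set_interval:
 fixes g :: "nat => real"
 assumes mono: "\<And>i j. i <= j ==> j < n ==> g i <= g j"
 obtains a b where "a <= b" "{i. i < n \<and> x <= g i \<and> g i < y} = {a..<b}"
proof -
 let ?A = "{i. i < n \<and> x <= g i \<and> g i < y}"
 show thesis
 proof (cases "?A = {}")
  case True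
  thus ?thesis using that[of 0 0] by auto
 next
  case False
  have fin: "finite ?A" by auto
  have mem: "Min ?A \<in> ?A" "Max ?A \<in> ?A"
   using Min_in[OF fin False] Max_in[OF fin False] by blast+
  have "?A = {Min ?A..<Suc (Max ?A)}"
  proof (intro set_eqI iffI)
   fix i assume "i \<in> ?A"
   thus "i \<in> {Min ?A..<Suc (Max ?A)}"
    using Min_le[OF fin] Max_ge[OF fin] by (auto simp: less_Suc_eq_le)
  next
   fix i assume i: "i \<in> {Min ?A..<Suc (Max ?A)}"
   hence "Min ?A <= i" "i <= Max ?A" by auto
   moreover have "Max ?A < n" "x <= g (Min ?A)" "g (Max ?A) < y" using mem by auto
   ultimately show "i \<in> ?A"
    using mono[of "Min ?A" i] mono[of i "Max ?A"] by auto
  qed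
  moreover have "Min ?A <= Suc (Max ?A)" using Min_le[OF fin mem(2)] by simp
  ultimately show ?thesis using that by blast
 qed
qed

text \<open>The increments \<open>g\<close> grow by at least \<open>lm\<close> per step. For each
  integer \<open>\<nu>\<close> the indices with \<open>g\<close> within \<open>\<theta>\<close> of
  \<open>\<nu>\<close> number at most \<open>2 * \<theta> / lm + 1\<close> and are counted
  trivially, while those from there up to the next such window fall under Kusmin-Landau. A total
  growth \<open>G\<close> of the increments meets at most \<open>G + 2\<close> integers.\<close>

lemma second_difference_test:
 fixes f :: "nat => real"
 assumes lam: "lm > 0" and th: "0 < \<theta>" "\<theta> <= 1 / 2" and n: "n >= 1"
  and step: "\<And>i. Suc (Suc i) <= n ==> lm <= (f (Suc (Suc i)) - f (Suc i)) - (f (Suc i) - f i)"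
  and G: "(f n - f (n - 1)) - (f 1 - f 0) <= G"
 shows "norm (\<Sum>i<n. ee (f i)) <= (G + 2) * (2 * \<theta> / lm + 1 + 2 / (pi * \<theta>))"
proof -
 define g where "g i = f (Suc i) - f i" for i
 define P where "P = 2 * \<theta> / lm + 1 + 2 / (pi * \<theta>)"
 have P: "P >= 0" unfolding P_def using lam th by simp
 have sep: "lm * real (j - i) <= g j - g i" if "i <= j" "j < n" for i j
  using that
 proof (induction j rule: dec_induct)
  case (step j)
  thus ?case using assms(5)[of j] by (simp add: g_def Suc_diff_le algebra_simps)
 qed simp
 have mono: "g i <= g j" if "i <= j" "j < n" for i j
 proof -
  have "0 <= lm * real (j - i)" using lam by simp
  thus ?thesis using sep[OF that] by linarith
 qed
 \<comment> \<open>Shifting by \<open>\<theta>\<close> before taking the floor makes a class begin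
   at the left end of the window around \<open>\<nu>\<close>.\<close>
 define u where "u i = \<lfloor>g i + \<theta>\<rfloor>" for i
 have grp: "norm (\<Sum>i | i \<in> {..<n} \<and> u i = \<nu>. ee (f i)) <= P" for \<nu>
 proof -
  obtain a b where ab: "a <= b" "{i. i < n \<and> of_int \<nu> - \<theta> <= g i \<and> g i < of_int \<nu> + \<theta>} = {a..<b}"
   using level_set_interval[of n g "of_int \<nu> - \<theta>" "of_int \<nu> + \<theta>"] mono by blast
  obtain c d where cd: "c <= d" "{i. i < n \<and> of_int \<nu> + \<theta> <= g i \<and> g i < of_int \<nu> + 1 - \<theta>} = {c..<d}"
   using level_set_interval[of n g "of_int \<nu> + \<theta>" "of_int \<nu> + 1 - \<theta>"] mono by blast
  have "{i. i \<in> {..<n} \<and> u i = \<nu>} = {a..<b} \<union> {c..<d}"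
   unfolding ab(2)[symmetric] cd(2)[symmetric] u_def using th by (auto simp: floor_eq_iff)
  moreover have "{a..<b} \<inter> {c..<d} = {}"
   unfolding ab(2)[symmetric] cd(2)[symmetric] by auto
  ultimately have split: "(\<Sum>i | i \<in> {..<n} \<and> u i = \<nu>. ee (f i)) = (\<Sum>i=a..<b. ee (f i)) + (\<Sum>i=c..<d. ee (f i))"
   by (simp add: sum.union_disjoint)
  have "norm (\<Sum>i=a..<b. ee (f i)) <= 2 * \<theta> / lm + 1"
  proof (cases "a = b")
   case True
   thus ?thesis using lam th by simp
  next
   case False
   hence "a \<in> {a..<b}" "b - 1 \<in> {a..<b}" using ab(1) by auto
   hence m: "of_int \<nu> - \<theta> <= g a" "g (b - 1) < of_int \<nu> + \<theta>" "b - 1 < n"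
    unfolding ab(2)[symmetric] by auto
   have "lm * real (b - 1 - a) <= 2 * \<theta>"
    using sep[of a "b - 1"] m False ab(1) by linarith
   hence "real (b - 1 - a) <= 2 * \<theta> / lm" using lam by (simp add: field_simps)
   moreover have "real (b - a) = real (b - 1 - a) + 1" using False ab(1) by (simp add: of_nat_diff)
   moreover have "norm (\<Sum>i=a..<b. ee (f i)) <= real (b - a)"
    using norm_sum[of "%i. ee (f i)" "{a..<b}"] by simp
   ultimately show ?thesis by linarith
  qed
  moreover have "norm (\<Sum>i=c..<d. ee (f i)) <= 2 / (pi * \<theta>)"
  proof (rule kusmin_landau[OF th cd(1), where \<nu> = \<nu>])
   fix i assume "c <= i" "Suc i < d"
   hence "i \<in> {c..<d}" by auto
   thus "of_int \<nu> + \<theta> <= f (Suc i) - f i \<and> f (Suc i) - f i <= of_int \<nu> + 1 - \<theta>"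
    unfolding cd(2)[symmetric] g_def by auto
  next
   fix i assume "c <= i" "Suc (Suc i) < d"
   hence "Suc i \<in> {c..<d}" by auto
   hence "Suc i < n" unfolding cd(2)[symmetric] by auto
   thus "f (Suc i) - f i <= f (Suc (Suc i)) - f (Suc i)"
    using mono[of i "Suc i"] by (simp add: g_def)
  qed
  ultimately show ?thesis unfolding P_def split
   using norm_triangle_ineq[of "\<Sum>i=a..<b. ee (f i)" "\<Sum>i=c..<d. ee (f i)"] by linarith
 qed
 have "(\<Sum>i<n. ee (f i)) = (\<Sum>\<nu>\<in>u ` {..<n}. \<Sum>i | i \<in> {..<n} \<and> u i = \<nu>. ee (f i))"
  by (rule sum.image_gen) simp
 also have "norm ... <= (\<Sum>\<nu>\<in>u ` {..<n}. P)"
  by (rule order_trans[OF norm_sum]) (intro sum_mono grp)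
 also have "... = real (card (u ` {..<n})) * P" by simp
 also have "... <= (G + 2) * P"
 proof (rule mult_right_mono[OF _ P])
  have "u ` {..<n} \<subseteq> {u 0..u (n - 1)}"
   unfolding u_def using mono n by (auto intro!: floor_mono)
  hence "card (u ` {..<n}) <= card {u 0..u (n - 1)}" by (intro card_mono) auto
  hence c: "real (card (u ` {..<n})) <= real (nat (u (n - 1) - u 0 + 1))" by simp
  have "u 0 <= u (n - 1)" unfolding u_def using mono[of 0 "n - 1"] n by (intro floor_mono) auto
  hence "real (nat (u (n - 1) - u 0 + 1)) = of_int (u (n - 1)) - of_int (u 0) + 1" by simp
  also have "... <= (g (n - 1) + \<theta>) - (g 0 + \<theta> - 1) + 1"
   unfolding u_def by linarith
  also have "... <= G + 2" using G n by (simp add: g_def)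
  finally show "real (card (u ` {..<n})) <= G + 2" using c by linarith
 qed
 finally show ?thesis unfolding P_def .
qed

primrec fwd :: "nat => (nat => real) => nat => real" where
 "fwd 0 f i = f i"
| "fwd (Suc k) f i = fwd k f (Suc i) - fwd k f i"

text \<open>Together with \<open>fwd_telescope\<close> this drives the induction on
  \<open>k\<close>: the \<open>k\<close>-th differences of the phase \<open>f (i + j) - f i\<close>
  are sums of \<open>j\<close> differences of order \<open>k + 1\<close>, so the range
  \<open>[lm, h * lm]\<close> becomes \<open>[j * lm, h * (j * lm)]\<close> with the same
  \<open>h\<close>.\<close>

lemma fwd_shift_diff: "fwd k (%i. f (i + j) - f i) i = fwd k f (i + j) - fwd k f i"
 by (induction k arbitrary: i) auto

lemma fwd_telescope: "fwd k f (i + j) - fwd k f i = (\<Sum>l<j. fwd (Suc k) f (i + l))"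
 by (induction j) auto

text \<open>
  \<open>vdc k h A B\<close> is the \<open>k\<close>-th derivative test of van der Corput with constants \<open>A\<close>, \<open>B\<close>, for
  functions whose \<open>k\<close>-th differences (instead of derivatives) lie in \<open>[lm, h lm]\<close>.
\<close>

definition vdc :: "nat => real => real => real => bool" where
 "vdc k h A B \<longleftrightarrow> (\<forall>f n lm. 0 < lm \<longrightarrow> (\<forall>i. i + k <= n \<longrightarrow> lm <= fwd k f i \<and> fwd k f i <= h * lm) \<longrightarrow>
   norm (\<Sum>i<n. ee (f i)) <= A * real n * lm powr (1 / (2 ^ k - 2))
    + B * real n powr (1 - 4 / 2 ^ k) * lm powr (- 1 / (2 ^ k - 2)))"

lemma norm_sum_ee_le: "norm (\<Sum>i<n. ee (f i)) <= real n"
 using norm_sum[of "%i. ee (f i)" "{..<n}"] by simp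

lemma sqrt_pi_bounds: "(17724/10000) <= sqrt pi" "sqrt pi <= (17725/10000)"
proof -
 have "((17724/10000)::real)\<^sup>2 <= pi" "pi <= ((17725/10000)::real)\<^sup>2"
  using pi_approx by (auto simp: power2_eq_square)
 from real_le_rsqrt[OF this(1)] show "(17724/10000) <= sqrt pi" .
 from real_le_lsqrt[OF _ \<open>pi <= (17725/10000)\<^sup>2\<close>] show "sqrt pi <= (17725/10000)" by simp
qed

text \<open>The best \<open>\<theta>\<close> in \<open>second_difference_test\<close> gives
  \<open>c / s\<close> with \<open>c = 4 / sqrt pi\<close>. The excess of 2.32 over \<open>c\<close>
  and of 4.63 over \<open>2 * c\<close> pays for the lower order terms, which are small because
  \<open>h >= 8\<close>; when \<open>c * h * s >= 1\<close> the trivial bound is enough.\<close>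

lemma vdc_2:
 assumes h: "h >= 8"
 shows "vdc 2 h ((232/100) * h) (463/100)"
 unfolding vdc_def
proof (intro allI impI)
 fix f :: "nat => real" and n :: nat and lm :: real
 assume lam: "0 < lm" and D: "\<forall>i. i + 2 <= n \<longrightarrow> lm <= fwd 2 f i \<and> fwd 2 f i <= h * lm"
 define c where "c = 4 / sqrt pi"
 define s where "s = sqrt lm"
 have s: "s > 0" "s * s = lm" using lam by (auto simp: s_def)
 have c: "c <= (22569/10000)" "(22566/10000) <= c" using sqrt_pi_bounds by (auto simp: c_def field_simps)
 have pw: "lm powr (1 / (2 ^ 2 - 2)) = s" "lm powr (- 1 / (2 ^ 2 - 2)) = 1 / s"
 proof -
  have e: "1 / (2 ^ 2 - 2) = (1/2 :: real)" "- 1 / (2 ^ 2 - 2) = - (1/2 :: real)" by simp_all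
  show "lm powr (1 / (2 ^ 2 - 2)) = s" unfolding e s_def using lam by (simp add: powr_half_sqrt)
  show "lm powr (- 1 / (2 ^ 2 - 2)) = 1 / s" unfolding e s_def powr_minus using lam
   by (simp add: powr_half_sqrt inverse_eq_divide)
 qed
 have goal: "norm (\<Sum>i<n. ee (f i)) <= (232/100) * h * real n * s + (463/100) / s" if n: "n >= 1"
 proof (cases "c * h * s >= 1")
  case True
  have "c * (h * s) <= (232/100) * (h * s)" using c(1) h s(1) by (intro mult_right_mono) auto
  hence "1 <= (232/100) * h * s" using True by (simp add: mult.assoc)
  hence "real n <= (232/100) * h * real n * s"
   using mult_left_mono[of 1 "(232/100) * h * s" "real n"] by (simp add: mult_ac)
  moreover have "(463/100) / s >= 0" using s by simp
  ultimately show ?thesis using norm_sum_ee_le[of f n] by linarith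
 next
  case False
  \<comment> \<open>This value makes \<open>2 * \<theta> / lm\<close> and
    \<open>2 / (pi * \<theta>)\<close> equal.\<close>
  define \<theta> where "\<theta> = s / sqrt pi"
  have hs: "h * s <= 1 / c" using False c by (simp add: field_simps)
  have "8 * s <= h * s" using h s by simp
  hence "8 * s <= 1 / c" using hs by linarith
  hence s8: "8 * c * s <= 1" using c by (simp add: field_simps)
  have "s <= (56/1000)"
  proof -
   have "8 * (22566/10000) * s <= 8 * c * s" using c s by (intro mult_right_mono) auto
   thus ?thesis using s8 by linarith
  qed
  hence th: "0 < \<theta>" "\<theta> <= 1 / 2" unfolding \<theta>_def using s sqrt_pi_bounds
   by (auto simp: field_simps)
  have step: "lm <= (f (Suc (Suc i)) - f (Suc i)) - (f (Suc i) - f i)"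
   "(f (Suc (Suc i)) - f (Suc i)) - (f (Suc i) - f i) <= h * lm" if "Suc (Suc i) <= n" for i
   using D[rule_format, of i] that by (auto simp: numeral_2_eq_2)
  have tele: "(f (Suc m) - f m) - (f 1 - f 0) <= h * lm * real m" if "Suc m <= n" for m
   using that
  proof (induction m)
   case (Suc m)
   thus ?case using step(2)[of m] by (simp add: algebra_simps)
  qed simp
  have G: "(f n - f (n - 1)) - (f 1 - f 0) <= h * lm * real n"
  proof -
   have "h * lm * real (n - 1) <= h * lm * real n" using h lam by (intro mult_left_mono) auto
   thus ?thesis using tele[of "n - 1"] n by simp
  qed
  have "norm (\<Sum>i<n. ee (f i)) <= (h * lm * real n + 2) * (2 * \<theta> / lm + 1 + 2 / (pi * \<theta>))"
   by (rule second_difference_test[OF lam th n step(1) G])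
  also have "2 * \<theta> / lm + 1 + 2 / (pi * \<theta>) = c / s + 1"
  proof -
   have p: "sqrt pi * sqrt pi = pi" "sqrt pi > 0" by auto
   have "2 * \<theta> / lm = 2 / (s * sqrt pi)" unfolding \<theta>_def unfolding s(2)[symmetric] using s(1) p(2) by (simp add: field_simps)
   moreover have "2 / (pi * \<theta>) = 2 / (s * sqrt pi)"
    unfolding \<theta>_def using s p by (simp add: field_simps)
   ultimately show ?thesis unfolding c_def using s p by (simp add: field_simps)
  qed
  also have "(h * lm * real n + 2) * (c / s + 1) = (c * h + h * s) * (real n * s) + (2 * c + 2 * s) * (1 / s)"
   unfolding s(2)[symmetric] using s(1) by (simp add: field_simps)
  also have "... <= (232/100) * h * (real n * s) + (463/100) * (1 / s)"
  proof (intro add_mono mult_right_mono)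
   have "1 / c <= 1 / 2" using c by (intro divide_left_mono) auto
   moreover have "c * h <= (22569/10000) * h" using c h by (intro mult_right_mono) auto
   ultimately show "c * h + h * s <= (232/100) * h" using hs h by linarith
   show "2 * c + 2 * s <= (463/100)" using c s8 \<open>s <= (56/1000)\<close> by linarith
  qed (use s in auto)
  finally show ?thesis by (simp only: mult.assoc times_divide_eq_right mult_1_right)
 qed
 show "norm (\<Sum>i<n. ee (f i)) <= (232/100) * h * real n * lm powr (1 / (2 ^ 2 - 2))
    + (463/100) * real n powr (1 - 4 / 2 ^ 2) * lm powr (- 1 / (2 ^ 2 - 2))"
 proof (cases "n = 0")
  case False
  have "real n powr (1 - 4 / 2 ^ 2) = 1" using False by simp
  thus ?thesis using goal False unfolding pw by (simp only: mult_1_right times_divide_eq_right)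
 qed simp
qed

text \<open>Weighted AM-GM, read off from the convexity of \<open>exp\<close> between
  \<open>0\<close> and \<open>ln y\<close>.\<close>

lemma powr_le_affine:
 fixes y p :: real
 assumes "0 <= y" "0 <= p" "p <= 1"
 shows "y powr p <= 1 + p * (y - 1)"
proof (cases "y = 0")
 case True
 thus ?thesis using assms by simp
next
 case False
 hence y: "y > 0" using assms by simp
 have "exp ((1 - p) *\<^sub>R 0 + p *\<^sub>R ln y) <= (1 - p) * exp 0 + p * exp (ln y)"
  using assms by (intro convex_onD[OF exp_convex]) auto
 thus ?thesis using y by (simp add: powr_def algebra_simps)
qed

lemma affine_le_powr:
 fixes y p :: real
 assumes "0 <= y" "p >= 1"
 shows "1 + p * (y - 1) <= y powr p"
proof -
 have "(y powr p) powr (1 / p) <= 1 + 1 / p * (y powr p - 1)"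
  using assms by (intro powr_le_affine) auto
 moreover have "(y powr p) powr (1 / p) = y" using assms by (simp add: powr_powr)
 ultimately have "y - 1 <= (y powr p - 1) / p" by simp
 hence "p * (y - 1) <= y powr p - 1" using assms by (simp add: field_simps)
 thus ?thesis by simp
qed

lemma sum_triangle: "(\<Sum>j=1..<q. real (q - j)) = real q * (real q - 1) / 2"
proof -
 have "(\<Sum>j=1..<q. real (q - j)) = (\<Sum>j=1..<q. real j)"
  by (rule sum.reindex_bij_witness[of _ "%j. q - j" "%j. q - j"]) auto
 also have "... = real q * (real q - 1) / 2"
  by (induction q) (auto simp: field_simps)
 finally show ?thesis .
qed

lemma sum_tetrahedral: "(\<Sum>j=1..<q. real (q - j) * real j) = (real q - 1) * real q * (real q + 1) / 6"
proof (induction q)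
 case (Suc q)
 have "(\<Sum>j=1..<Suc q. real (Suc q - j) * real j) = (\<Sum>j=1..<Suc q. real (q - j) * real j) + (\<Sum>j=1..<Suc q. real j)"
  by (subst sum.distrib[symmetric], rule sum.cong) (auto simp: Suc_diff_le algebra_simps)
 also have "(\<Sum>j=1..<Suc q. real (q - j) * real j) = (\<Sum>j=1..<q. real (q - j) * real j)"
  by (cases "q >= 1") auto
 also have "(\<Sum>j=1..<Suc q. real j) = real q * (real q + 1) / 2"
  by (induction q) (auto simp: field_simps)
 finally show ?case unfolding Suc.IH by (simp add: field_simps)
qed simp

text \<open>With weights \<open>q - j\<close> the mean of \<open>j\<close> is about
  \<open>q / 3\<close>. Concavity replaces \<open>j powr \<kappa>\<close> by its tangent at
  \<open>q / 3\<close>, and the weighted sum that remains is polynomial.\<close>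

lemma weighted_powr_sum:
 assumes k: "0 < \<kappa>" "\<kappa> <= 1" and q: "q >= 1"
 shows "(\<Sum>j=1..<q. real (q - j) * real j powr \<kappa>) <= (real q)\<^sup>2 / 2 * (real q / 3) powr \<kappa>"
proof -
 have "(\<Sum>j=1..<q. real (q - j) * real j powr \<kappa>)
   <= (\<Sum>j=1..<q. real (q - j) * ((real q / 3) powr \<kappa> * (1 + \<kappa> * (3 * real j / real q - 1))))"
 proof (intro sum_mono mult_left_mono)
  fix j assume "j \<in> {1..<q}"
  have "real j powr \<kappa> = (real q / 3) powr \<kappa> * (3 * real j / real q) powr \<kappa>"
   using q by (subst powr_mult[symmetric]) auto
  also have "... <= (real q / 3) powr \<kappa> * (1 + \<kappa> * (3 * real j / real q - 1))"
   using k by (intro mult_left_mono powr_le_affine) auto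
  finally show "real j powr \<kappa> <= (real q / 3) powr \<kappa> * (1 + \<kappa> * (3 * real j / real q - 1))" .
 qed auto
 also have "... = (real q / 3) powr \<kappa> * ((1 - \<kappa>) * (\<Sum>j=1..<q. real (q - j))
    + 3 * \<kappa> / real q * (\<Sum>j=1..<q. real (q - j) * real j))"
  unfolding sum_distrib_left sum.distrib[symmetric]
  by (intro sum.cong refl) (use q in \<open>auto simp: field_simps\<close>)
 also have "... <= (real q / 3) powr \<kappa> * ((real q)\<^sup>2 / 2)"
 proof (rule mult_left_mono)
  have "(1 - \<kappa>) * (\<Sum>j=1..<q. real (q - j)) + 3 * \<kappa> / real q * (\<Sum>j=1..<q. real (q - j) * real j)
    = (real q - 1) * (real q + \<kappa>) / 2"
   unfolding sum_triangle sum_tetrahedral using q by (simp add: field_simps)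
  also have "... <= (real q)\<^sup>2 / 2"
  proof -
   have "(real q - 1) * (real q + \<kappa>) <= (real q - 1) * (real q + 1)"
    using k q by (intro mult_left_mono) auto
   thus ?thesis by (simp add: power2_eq_square algebra_simps)
  qed
  finally show "(1 - \<kappa>) * (\<Sum>j=1..<q. real (q - j)) + 3 * \<kappa> / real q * (\<Sum>j=1..<q. real (q - j) * real j)
   <= (real q)\<^sup>2 / 2" .
 qed auto
 finally show ?thesis by (simp add: mult.commute)
qed

lemma sum_powr_neg_le:
 assumes k: "0 < \<kappa>" "\<kappa> < 1"
 shows "(\<Sum>j=1..<Suc q. real j powr (- \<kappa>)) <= real q powr (1 - \<kappa>) / (1 - \<kappa>)"
proof (induction q)
 case (Suc q)
 define Q where "Q = real (Suc q)"
 have Q: "Q >= 1" by (simp add: Q_def)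
 have "real q powr (1 - \<kappa>) = Q powr (1 - \<kappa>) * (real q / Q) powr (1 - \<kappa>)"
  using Q by (subst powr_mult[symmetric]) auto
 also have "... <= Q powr (1 - \<kappa>) * (1 + (1 - \<kappa>) * (real q / Q - 1))"
  using k Q by (intro mult_left_mono powr_le_affine) auto
 also have "real q / Q - 1 = - 1 / Q" using Q by (simp add: Q_def field_simps)
 also have "Q powr (1 - \<kappa>) * (1 + (1 - \<kappa>) * (- 1 / Q)) = Q powr (1 - \<kappa>) - (1 - \<kappa>) * Q powr (- \<kappa>)"
  using Q by (simp add: powr_diff powr_minus field_simps)
 finally have "real q powr (1 - \<kappa>) / (1 - \<kappa>) <= Q powr (1 - \<kappa>) / (1 - \<kappa>) - Q powr (- \<kappa>)"
  using k divide_right_mono[of "real q powr (1 - \<kappa>)" "Q powr (1 - \<kappa>) - (1 - \<kappa>) * Q powr (- \<kappa>)" "1 - \<kappa>"]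
  by (simp add: diff_divide_distrib)
 thus ?case using Suc.IH by (simp add: Q_def)
qed simp

text \<open>Discrete form of the integral of \<open>(q - x) * x powr (- \<kappa>)\<close> over
  \<open>[0, q]\<close>, whose value is the right side; passing from \<open>q\<close> to
  \<open>q + 1\<close> adds the plain sum of \<open>sum_powr_neg_le\<close>.\<close>

lemma weighted_powr_neg_sum:
 assumes k: "0 < \<kappa>" "\<kappa> < 1"
 shows "(\<Sum>j=1..<q. real (q - j) * real j powr (- \<kappa>)) <= real q powr (2 - \<kappa>) / ((1 - \<kappa>) * (2 - \<kappa>))"
proof (induction q)
 case (Suc q)
 have "(\<Sum>j=1..<Suc q. real (Suc q - j) * real j powr (- \<kappa>))
   = (\<Sum>j=1..<Suc q. real (q - j) * real j powr (- \<kappa>)) + (\<Sum>j=1..<Suc q. real j powr (- \<kappa>))"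
  by (subst sum.distrib[symmetric], rule sum.cong) (auto simp: Suc_diff_le algebra_simps)
 also have "(\<Sum>j=1..<Suc q. real (q - j) * real j powr (- \<kappa>)) = (\<Sum>j=1..<q. real (q - j) * real j powr (- \<kappa>))"
  by (cases "q >= 1") auto
 also have "... + (\<Sum>j=1..<Suc q. real j powr (- \<kappa>))
   <= real q powr (2 - \<kappa>) / ((1 - \<kappa>) * (2 - \<kappa>)) + real q powr (1 - \<kappa>) / (1 - \<kappa>)"
  using Suc.IH sum_powr_neg_le[OF k, of q] by linarith
 also have "... = (real q powr (2 - \<kappa>) + (2 - \<kappa>) * real q powr (1 - \<kappa>)) / ((1 - \<kappa>) * (2 - \<kappa>))"
  using k by (simp add: add_divide_distrib)
 also have "... <= real (Suc q) powr (2 - \<kappa>) / ((1 - \<kappa>) * (2 - \<kappa>))"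
 proof (intro divide_right_mono)
  show "real q powr (2 - \<kappa>) + (2 - \<kappa>) * real q powr (1 - \<kappa>) <= real (Suc q) powr (2 - \<kappa>)"
  proof (cases "q = 0")
   case False
   have "real q powr (2 - \<kappa>) + (2 - \<kappa>) * real q powr (1 - \<kappa>)
     = real q powr (2 - \<kappa>) * (1 + (2 - \<kappa>) * (real (Suc q) / real q - 1))"
   proof -
    have "real q powr (2 - \<kappa>) = real q powr (1 - \<kappa>) * real q"
     using False powr_add[of "real q" "1 - \<kappa>" 1] by simp
    thus ?thesis using False by (simp add: field_simps)
   qed
   also have "... <= real q powr (2 - \<kappa>) * (real (Suc q) / real q) powr (2 - \<kappa>)"
    using k False by (intro mult_left_mono affine_le_powr) auto
   also have "... = real (Suc q) powr (2 - \<kappa>)"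
    using False by (subst powr_mult[symmetric]) auto
   finally show ?thesis .
  qed auto
 qed (use k in auto)
 finally show ?case .
qed simp

text \<open>Weyl's inequality with \<open>q\<close> about \<open>lm powr (- 2 * \<mu>)\<close>,
  where \<open>\<mu>\<close> is the exponent of order \<open>Suc k\<close>: the diagonal term and
  the \<open>A\<close> term both become \<open>lm powr (2 * \<mu>)\<close>, the \<open>B\<close>
  term \<open>lm powr (- 2 * \<mu>)\<close>. The factor 9/8 bounds \<open>(n + q) / n\<close> for
  \<open>q <= n / 8\<close>; the factor 2/3 comes from \<open>q <= 2 * x\<close> in
  \<open>q / 3\<close>.\<close>

lemma vdc_step:
 assumes v: "vdc k h A B" and k: "k >= 2" and AB: "A >= 0" "B >= 0" "h >= 1"
  and \<kappa>: "\<kappa> = 1 / (2 ^ k - 2)"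
  and A': "A' >= 1" "9 / 8 * (1 + (2 / 3) powr \<kappa> * A) <= A'\<^sup>2"
  and B': "B' >= 4" "9 / 8 * (2 / ((1 - \<kappa>) * (2 - \<kappa>))) * B <= B'\<^sup>2"
 shows "vdc (Suc k) h A' B'"
 unfolding vdc_def
proof (intro allI impI)
 fix f :: "nat => real" and n :: nat and lm :: real
 assume lm: "0 < lm" and D: "\<forall>i. i + Suc k <= n \<longrightarrow> lm <= fwd (Suc k) f i \<and> fwd (Suc k) f i <= h * lm"
 define D where "D = (2::real) ^ k"
 define e where "e = 1 - 4 / D"
 define \<mu> where "\<mu> = 1 / (2 * D - 2)"
 have "(2::real) ^ 2 <= D" unfolding D_def using k by (intro power_increasing) auto
 hence D4: "D >= 4" by simp
 have kap: "\<kappa> = 1 / (D - 2)" using \<kappa> by (simp add: D_def)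
 have kk: "0 < \<kappa>" "\<kappa> <= 1 / 2" unfolding kap using D4 by (auto simp: field_simps)
 have mu0: "0 < \<mu>" "\<mu> <= 1 / 6" unfolding \<mu>_def using D4 by (auto simp: field_simps)
 \<comment> \<open>The relation \<open>\<kappa> * (1 - 2 * \<mu>) = 2 * \<mu>\<close> is what lets
   one choice of \<open>q\<close> balance all terms.\<close>
 have "2 * \<mu> = 1 / (D - 1)" unfolding \<mu>_def using D4 by (simp add: field_simps)
 moreover have "1 / (D - 2) * (1 - 1 / (D - 1)) = 1 / (D - 1)" using D4 by (simp add: divide_simps)
 ultimately have mu: "0 < \<mu>" "\<kappa> * (1 - 2 * \<mu>) = 2 * \<mu>" "\<mu> <= 1 / 6"
  unfolding kap using mu0 by simp_all
 have e: "0 <= e" "1 - 2 / D = (1 + e) / 2" unfolding e_def using D4 by (auto simp: field_simps)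
 define S where "S = norm (\<Sum>i<n. ee (f i))"
 define a where "a = real n * lm powr \<mu>"
 define b where "b = real n powr ((1 + e) / 2) * lm powr (- \<mu>)"
 have ab: "a >= 0" "b >= 0" by (auto simp: a_def b_def)
 have Sn: "S <= real n" unfolding S_def by (rule norm_sum_ee_le)
 have "S <= A' * a + B' * b"
 \<comment> \<open>For \<open>lm > 1\<close> the first term alone exceeds the trivial bound
   \<open>n\<close>.\<close>
 proof (cases "lm > 1 \<or> n = 0")
  case True
  show ?thesis
  proof (cases "n = 0")
   case False
   hence "lm powr \<mu> >= 1" using True mu by (intro ge_one_powr_ge_zero) auto
   hence "real n * 1 <= a" unfolding a_def by (intro mult_left_mono) auto
   also have "a <= A' * a" using A' ab mult_right_mono[of 1 A' a] by simp
   moreover have "0 <= B' * b" using ab B' by simp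
   ultimately show ?thesis using Sn by linarith
  next
   case n0: True
   have "0 <= A' * a" "0 <= B' * b" using ab A' B' by auto
   thus ?thesis using Sn n0 by simp
  qed
 next
  case False
  hence lm1: "lm <= 1" and n: "n >= 1" by auto
  define x where "x = lm powr (- 2 * \<mu>)"
  define q where "q = nat \<lceil>x\<rceil>"
  have x1: "x >= 1"
  proof -
   have "lm powr 0 <= lm powr (- 2 * \<mu>)" using lm lm1 mu by (intro powr_mono') auto
   thus ?thesis using lm by (simp add: x_def)
  qed
  have q: "x <= real q" "real q <= 2 * x" "q >= 1" unfolding q_def using x1 by linarith+
  show ?thesis
  proof (cases "8 * q <= n")
   \<comment> \<open>Here \<open>n < 8 * q <= 16 * x\<close>, and the trivial bound \<open>n\<close>
     is at most \<open>4 * b\<close>; this is the origin of \<open>B' >= 4\<close>.\<close>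
   case False
   hence nx: "real n <= 16 * x" using q by linarith
   have "real n = real n powr ((1 + e) / 2) * real n powr (1 - (1 + e) / 2)"
    using n by (simp flip: powr_add)
   also have "... <= real n powr ((1 + e) / 2) * (16 * x) powr (1 - (1 + e) / 2)"
   proof (intro mult_left_mono powr_mono2)
    show "0 <= 1 - (1 + e) / 2" using e(2) D4 by (simp add: e_def)
   qed (use nx in auto)
   finally have nle: "real n <= real n powr ((1 + e) / 2) * (16 * x) powr (1 - (1 + e) / 2)" .
   have "(16 * x) powr (1 - (1 + e) / 2) <= 4 * lm powr (- \<mu>)"
   proof -
    have p: "1 - (1 + e) / 2 = 2 / D" using e(2) by linarith
    have "(16 * x) powr (2 / D) <= (16 * x) powr (1 / 2)"
     using x1 D4 by (intro powr_mono) (auto simp: field_simps)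
    also have "... = 4 * lm powr (- \<mu>)"
     using x1 lm by (simp add: powr_mult x_def powr_powr)
    finally show ?thesis unfolding p .
   qed
   hence "real n powr ((1 + e) / 2) * (16 * x) powr (1 - (1 + e) / 2)
     <= real n powr ((1 + e) / 2) * (4 * lm powr (- \<mu>))"
    by (intro mult_left_mono) auto
   with nle have "real n <= real n powr ((1 + e) / 2) * (4 * lm powr (- \<mu>))" by linarith
   hence "real n <= 4 * b" unfolding b_def by (simp only: mult_ac)
   also have "4 * b <= B' * b" using B' ab by (intro mult_right_mono) auto
   moreover have "0 <= A' * a" using ab A' by simp
   ultimately show ?thesis using Sn by linarith
  next
   case True
   hence qn: "real q <= real n / 8" by linarith
   define Sj where "Sj j = norm (\<Sum>i<n - j. ee (f (i + j)) * cnj (ee (f i)))" for j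
   have Sj: "Sj j <= A * real n * lm powr \<kappa> * real j powr \<kappa> + B * real n powr e * lm powr (- \<kappa>) * real j powr (- \<kappa>)"
    if j: "j \<in> {1..<q}" for j
   proof -
    have jp: "real j * lm > 0" using j lm by simp
    have dd: "real j * lm <= fwd k (%i. f (i + j) - f i) i \<and> fwd k (%i. f (i + j) - f i) i <= h * (real j * lm)"
     if i: "i + k <= n - j" for i
    proof -
     have b: "lm <= fwd (Suc k) f (i + l) \<and> fwd (Suc k) f (i + l) <= h * lm" if "l < j" for l
     proof (rule D[rule_format])
      show "i + l + Suc k <= n" using that i k by arith
     qed
     have eq: "fwd k (%i. f (i + j) - f i) i = (\<Sum>l<j. fwd (Suc k) f (i + l))"
      by (simp only: fwd_shift_diff fwd_telescope)
     have "(\<Sum>l<j. lm) <= (\<Sum>l<j. fwd (Suc k) f (i + l))" using b by (intro sum_mono) auto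
     moreover have "(\<Sum>l<j. fwd (Suc k) f (i + l)) <= (\<Sum>l<j. h * lm)" using b by (intro sum_mono) auto
     ultimately show ?thesis unfolding eq by (simp add: mult_ac)
    qed
    have "Sj j = norm (\<Sum>i<n - j. ee (f (i + j) - f i))" unfolding Sj_def ee_diff ..
    also have "... <= A * real (n - j) * (real j * lm) powr \<kappa> + B * real (n - j) powr e * (real j * lm) powr (- \<kappa>)"
     using v[unfolded vdc_def, rule_format, OF jp, of "n - j" "%i. f (i + j) - f i"] dd
     by (simp add: kap e_def D_def)
    also have "... <= A * real n * (real j * lm) powr \<kappa> + B * real n powr e * (real j * lm) powr (- \<kappa>)"
     using AB e by (intro add_mono mult_right_mono mult_left_mono powr_mono2) auto
    also have "... = A * real n * lm powr \<kappa> * real j powr \<kappa> + B * real n powr e * lm powr (- \<kappa>) * real j powr (- \<kappa>)"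
     using lm by (simp add: powr_mult mult_ac)
    finally show ?thesis .
   qed
   define \<beta> where "\<beta> = 2 / ((1 - \<kappa>) * (2 - \<kappa>))"
   have "(\<Sum>j=1..<q. real (q - j) * Sj j)
    <= (\<Sum>j=1..<q. real (q - j) * (A * real n * lm powr \<kappa> * real j powr \<kappa> + B * real n powr e * lm powr (- \<kappa>) * real j powr (- \<kappa>)))"
    by (intro sum_mono mult_left_mono Sj) auto
   also have "... = A * real n * lm powr \<kappa> * (\<Sum>j=1..<q. real (q - j) * real j powr \<kappa>)
      + B * real n powr e * lm powr (- \<kappa>) * (\<Sum>j=1..<q. real (q - j) * real j powr (- \<kappa>))"
    unfolding sum_distrib_left sum.distrib[symmetric] by (intro sum.cong refl) (simp add: algebra_simps)
   also have "... <= A * real n * lm powr \<kappa> * ((real q)\<^sup>2 / 2 * (real q / 3) powr \<kappa>)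
      + B * real n powr e * lm powr (- \<kappa>) * (real q powr (2 - \<kappa>) / ((1 - \<kappa>) * (2 - \<kappa>)))"
    using kk q AB by (intro add_mono mult_left_mono weighted_powr_sum weighted_powr_neg_sum) auto
   also have "... = (real q)\<^sup>2 / 2 * (A * real n * (lm * real q / 3) powr \<kappa> + \<beta> * B * real n powr e * (lm * real q) powr (- \<kappa>))"
   proof -
    have "real q powr (2 - \<kappa>) = (real q)\<^sup>2 * real q powr (- \<kappa>)"
     using q powr_add[of "real q" 2 "- \<kappa>"] by simp
    moreover have "(lm * real q / 3) powr \<kappa> = lm powr \<kappa> * (real q / 3) powr \<kappa>"
     "(lm * real q) powr (- \<kappa>) = lm powr (- \<kappa>) * real q powr (- \<kappa>)"
     using lm powr_mult[of lm "real q / 3" \<kappa>] powr_mult[of lm "real q" "- \<kappa>"] by auto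
    ultimately show ?thesis unfolding \<beta>_def by (simp add: algebra_simps)
   qed
   finally have sumS: "2 * (\<Sum>j=1..<q. real (q - j) * Sj j)
    <= (real q)\<^sup>2 * (A * real n * (lm * real q / 3) powr \<kappa> + \<beta> * B * real n powr e * (lm * real q) powr (- \<kappa>))"
    by simp
   have xl: "x * lm = lm powr (1 - 2 * \<mu>)"
    using lm powr_add[of lm "- 2 * \<mu>" 1] by (simp add: x_def)
   have t1: "(lm * real q / 3) powr \<kappa> <= (2 / 3) powr \<kappa> * lm powr (2 * \<mu>)"
   proof -
    have "lm * real q / 3 <= 2 / 3 * (x * lm)" using q(2) lm mult_left_mono[of "real q" "2 * x" lm] by simp
    hence "(lm * real q / 3) powr \<kappa> <= (2 / 3 * (x * lm)) powr \<kappa>" using lm kk by (intro powr_mono2) auto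
    also have "... = (2 / 3) powr \<kappa> * (lm powr (1 - 2 * \<mu>)) powr \<kappa>"
     unfolding xl by (rule powr_mult)
    also have "(lm powr (1 - 2 * \<mu>)) powr \<kappa> = lm powr (2 * \<mu>)"
     using mu by (simp add: powr_powr mult.commute)
    finally show ?thesis .
   qed
   have t2: "(lm * real q) powr (- \<kappa>) <= lm powr (- 2 * \<mu>)"
   proof -
    have "(lm * real q) powr (- \<kappa>) <= (x * lm) powr (- \<kappa>)"
     using q(1) lm x1 kk mult_left_mono[of x "real q" lm] by (intro powr_mono2') (auto simp: mult_ac)
    also have "... = lm powr (- 2 * \<mu>)"
    proof -
     have "(1 - 2 * \<mu>) * (- \<kappa>) = - (\<kappa> * (1 - 2 * \<mu>))" by simp
     also have "... = - 2 * \<mu>" unfolding mu(2) by simp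
     finally show ?thesis unfolding xl powr_powr by simp
    qed
    finally show ?thesis .
   qed
   have t0: "1 / real q <= lm powr (2 * \<mu>)"
   proof -
    have "1 / real q <= 1 / x" using q x1 by (intro divide_left_mono) auto
    also have "... = lm powr (2 * \<mu>)" unfolding x_def using lm powr_minus_divide[of lm "2 * \<mu>"] by simp
    finally show ?thesis .
   qed
   have \<beta>: "\<beta> >= 0" unfolding \<beta>_def using kk by simp
   have "(real q * S)\<^sup>2 <= real (n + q) * (real q * real n + 2 * (\<Sum>j=1..<q. real (q - j) * Sj j))"
    using weyl_van_der_corput[OF q(3), of "%i. ee (f i)" n] unfolding S_def Sj_def by simp
   also have "... <= (9 / 8 * real n) * (real q * real n + (real q)\<^sup>2 * (A * real n * (lm * real q / 3) powr \<kappa> + \<beta> * B * real n powr e * (lm * real q) powr (- \<kappa>)))"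
   proof (rule mult_mono)
    show "real (n + q) <= 9 / 8 * real n" using qn by simp
    show "real q * real n + 2 * (\<Sum>j=1..<q. real (q - j) * Sj j) <= real q * real n + (real q)\<^sup>2 * (A * real n * (lm * real q / 3) powr \<kappa> + \<beta> * B * real n powr e * (lm * real q) powr (- \<kappa>))"
     using sumS by (rule add_left_mono)
    show "0 <= real q * real n + 2 * (\<Sum>j=1..<q. real (q - j) * Sj j)"
     unfolding Sj_def by (intro add_nonneg_nonneg mult_nonneg_nonneg sum_nonneg) auto
   qed auto
   also have "... = (real q)\<^sup>2 * (9 / 8 * real n * (real n * (1 / real q) + A * real n * (lm * real q / 3) powr \<kappa> + \<beta> * B * real n powr e * (lm * real q) powr (- \<kappa>)))"
    using q(3) by (simp add: field_simps power2_eq_square)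
   finally have "(real q)\<^sup>2 * S\<^sup>2 <= (real q)\<^sup>2 * (9 / 8 * real n * (real n * (1 / real q) + A * real n * (lm * real q / 3) powr \<kappa> + \<beta> * B * real n powr e * (lm * real q) powr (- \<kappa>)))"
    by (simp add: power_mult_distrib)
   hence "S\<^sup>2 <= 9 / 8 * real n * (real n * (1 / real q) + A * real n * (lm * real q / 3) powr \<kappa> + \<beta> * B * real n powr e * (lm * real q) powr (- \<kappa>))"
    using q(3) by (subst (asm) mult_le_cancel_left_pos) auto
   also have "... <= 9 / 8 * real n * (real n * lm powr (2 * \<mu>) + A * real n * ((2 / 3) powr \<kappa> * lm powr (2 * \<mu>)) + \<beta> * B * real n powr e * lm powr (- 2 * \<mu>))"
    using t0 t1 t2 AB \<beta> by (intro mult_left_mono add_mono) (auto intro!: mult_nonneg_nonneg)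
   also have "... = (9 / 8 * (1 + (2 / 3) powr \<kappa> * A)) * a\<^sup>2 + (9 / 8 * \<beta> * B) * b\<^sup>2"
   proof -
    have "(lm powr \<mu>)\<^sup>2 = lm powr (2 * \<mu>)" "(lm powr (- \<mu>))\<^sup>2 = lm powr (- 2 * \<mu>)"
     using lm by (simp_all add: power2_eq_square flip: powr_add)
    moreover have "(real n powr ((1 + e) / 2))\<^sup>2 = real n * real n powr e"
     using n powr_add[of "real n" 1 e] by (simp add: power2_eq_square flip: powr_add)
    ultimately show ?thesis unfolding a_def b_def power_mult_distrib
     by (simp add: algebra_simps power2_eq_square[of "real n"])
   qed
   also have "... <= A'\<^sup>2 * a\<^sup>2 + B'\<^sup>2 * b\<^sup>2"
    using A' B' unfolding \<beta>_def by (intro add_mono mult_right_mono) auto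
   also have "... <= (A' * a + B' * b)\<^sup>2"
    using A' B' ab by (simp add: power2_sum power_mult_distrib)
   finally show ?thesis
    by (rule power2_le_imp_le) (use A' B' ab in auto)
  qed
 qed
 hence main: "S <= A' * a + B' * b" .
 have eq: "(2::real) ^ Suc k - 2 = 2 * D - 2" "1 - 4 / (2::real) ^ Suc k = (1 + e) / 2"
  using e by (simp_all add: D_def)
 show "norm (\<Sum>i<n. ee (f i)) <= A' * real n * lm powr (1 / (2 ^ Suc k - 2))
    + B' * real n powr (1 - 4 / 2 ^ Suc k) * lm powr (- 1 / (2 ^ Suc k - 2))"
  unfolding eq using main by (simp only: S_def a_def b_def \<mu>_def mult.assoc minus_divide_left)
qed

text \<open>One step from \<open>vdc_2\<close>, at \<open>\<kappa> = 1 / 2\<close>. The sharper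
  1.508 is kept because order 3 decides the constant in \<open>block_bound\<close>.\<close>

lemma vdc_3:
 assumes h: "h >= 8"
 shows "vdc 3 h ((1508/1000) * h powr (1 / 2)) 4"
proof -
 have "vdc (Suc 2) h ((1508/1000) * h powr (1 / 2)) 4"
 proof (rule vdc_step[OF vdc_2[OF h], of "1/2"])
  have h0: "h powr (1 / 2) = sqrt h" using h by (simp add: powr_half_sqrt)
  have "1 <= sqrt h" using h by simp
  thus "1 <= (1508/1000) * h powr (1 / 2)" unfolding h0 by linarith
  have "sqrt (2 / 3) <= (8165/10000)" by (rule real_le_lsqrt) (auto simp: power2_eq_square)
  hence "sqrt (2 / 3) * h <= (8165/10000) * h" using h by (intro mult_right_mono) auto
  moreover have "9 / 8 * (1 + sqrt (2 / 3) * ((232/100) * h)) = 9 / 8 + 261 / 100 * (sqrt (2 / 3) * h)"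
   by (simp add: algebra_simps)
  ultimately have "9 / 8 * (1 + sqrt (2 / 3) * ((232/100) * h)) <= (2274064/1000000) * h"
   using h by linarith
  hence "9 / 8 * (1 + sqrt (2 / 3) * ((232/100) * h)) <= (1508/1000)\<^sup>2 * h"
   by (simp add: power2_eq_square)
  thus "9 / 8 * (1 + (2 / 3) powr (1 / 2) * ((232/100) * h)) <= ((1508/1000) * h powr (1 / 2))\<^sup>2"
   unfolding h0 power_mult_distrib using h by (simp add: powr_half_sqrt)
 qed (use h in \<open>auto simp: power2_eq_square\<close>)
 thus ?thesis by (simp add: numeral_3_eq_3 numeral_2_eq_2)
qed

text \<open>The constants 1.8 and 4 reproduce themselves under \<open>vdc_step\<close>. The step
  takes a square root of \<open>A\<close>, which is why the exponent of \<open>h\<close> halves from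
  one order to the next.\<close>

lemma vdc_ge_3:
 assumes h: "h >= 8" and k: "k >= 3"
 shows "vdc k h ((18/10) * h powr (4 / 2 ^ k)) 4"
 using k
proof (induction k rule: nat_induct_at_least)
 case base
 have "vdc 3 h A 4 ==> A <= A' ==> vdc 3 h A' 4" for A A'
  unfolding vdc_def by (meson add_mono mult_right_mono of_nat_0_le_iff order_refl order_trans powr_ge_zero)
 from this[OF vdc_3[OF h], of "(18/10) * h powr (1 / 2)"] show ?case by simp
next
 case (Suc k)
 define p where "p = h powr (4 / 2 ^ Suc k)"
 have p2: "h powr (4 / 2 ^ k) = p\<^sup>2"
  unfolding p_def power2_eq_square powr_add[symmetric] by simp
 have p1: "p >= 1" unfolding p_def using h by (intro ge_one_powr_ge_zero) auto
 define \<kappa> where "\<kappa> = 1 / ((2::real) ^ k - 2)"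
 have "(2::real) ^ 3 <= 2 ^ k" using Suc by (intro power_increasing) auto
 hence \<kappa>: "0 < \<kappa>" "\<kappa> <= 1 / 6" unfolding \<kappa>_def by (auto simp: field_simps)
 show ?case
 proof (rule vdc_step[OF Suc.IH _ _ _ _ \<kappa>_def])
  show "1 <= (18/10) * h powr (4 / 2 ^ Suc k)" using p1 by (simp add: p_def)
  have "(2 / 3) powr \<kappa> <= (1::real)" using \<kappa> by (intro powr_le1) auto
  hence "(2 / 3) powr \<kappa> * ((18/10) * p\<^sup>2) <= 1 * ((18/10) * p\<^sup>2)" by (intro mult_right_mono) auto
  moreover have "1 <= p\<^sup>2" using p1 by (simp add: one_le_power)
  ultimately show "9 / 8 * (1 + (2 / 3) powr \<kappa> * ((18/10) * h powr (4 / 2 ^ k))) <= ((18/10) * h powr (4 / 2 ^ Suc k))\<^sup>2"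
   unfolding p2 p_def[symmetric] power_mult_distrib by (simp add: power2_eq_square)
  have "1 <= (1 - \<kappa>) * (2 - \<kappa>)"
   using mult_mono[of "5/6" "1 - \<kappa>" "11/6" "2 - \<kappa>"] \<kappa> by simp
  hence "2 / ((1 - \<kappa>) * (2 - \<kappa>)) <= 2 / 1" by (intro divide_left_mono) auto
  thus "9 / 8 * (2 / ((1 - \<kappa>) * (2 - \<kappa>))) * 4 <= (4::real)\<^sup>2" by simp
 qed (use Suc h in auto)
qed

section \<open>Euler-Maclaurin summation for zeta\<close>

lemma zeta_holomorphic: "zeta holomorphic_on - {1}"
 using is_zeta_zeta by (simp add: is_zeta_def)

lemma zeta_sums: "Re s > 1 ==> (%n. 1 / of_nat (Suc n) powr s) sums zeta s"
 using is_zeta_zeta by (simp add: is_zeta_def)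

text \<open>The error of the trapezoidal rule for \<open>x powr (- s)\<close> on
  \<open>[n, n + 1]\<close>.\<close>

definition trapezoid :: "complex => nat => complex" where
 "trapezoid s n = (of_nat n powr (- s) + of_nat (Suc n) powr (- s)) / 2
   - (of_nat (Suc n) powr (1 - s) - of_nat n powr (1 - s)) / (1 - s)"

lemma of_real_powr_derivative:
 assumes "x > 0"
 shows "((%x. complex_of_real x powr s) has_vector_derivative s * of_real x powr (s - 1)) (at x within S)"
proof -
 have "((%z. z powr s) has_field_derivative s * of_real x powr (s - 1)) (at (complex_of_real x))"
  using assms by (intro has_field_derivative_powr) (auto simp: complex_nonpos_Reals_iff)
 thus ?thesis by (rule has_vector_derivative_real_field)
qed

lemma norm_of_real_powr: "x > 0 ==> norm (complex_of_real x powr s) = x powr Re s"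
 by (simp add: norm_powr_real_powr)

text \<open>Integration by parts against the Peano kernel \<open>x - (n + 1/2)\<close>, which takes
  the values -1/2 and 1/2 at the ends.\<close>

lemma trapezoid_integral:
 assumes s: "s ~= 1" and n: "n >= 1"
 shows "((%x. - (s * of_real (x - (real n + 1 / 2)) * of_real x powr (- s - 1))) has_integral trapezoid s n) {real n..real (Suc n)}"
proof -
 define m where "m = real n + 1 / 2"
 have 1: "((%x. of_real x powr (- s) - s * of_real (x - m) * of_real x powr (- s - 1)) has_integral
   (of_real (1/2) * of_real (real (Suc n)) powr (- s) - of_real (- 1/2) * of_real (real n) powr (- s))) {real n..real (Suc n)}"
 proof -
  have "((%x. of_real (x - m) * (- s * of_real x powr (- s - 1)) + 1 * of_real x powr (- s)) has_integral
    of_real (real (Suc n) - m) * of_real (real (Suc n)) powr (- s) - of_real (real n - m) * of_real (real n) powr (- s)) {real n..real (Suc n)}"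
  proof (rule fundamental_theorem_of_calculus)
   fix x assume "x \<in> {real n..real (Suc n)}"
   hence x: "x > 0" using n by simp
   have "((%x. complex_of_real (x - m)) has_vector_derivative 1) (at x within {real n..real (Suc n)})"
    by (auto intro!: derivative_eq_intros)
   from has_vector_derivative_mult[OF this of_real_powr_derivative[OF x, of "- s"]]
   show "((%x. of_real (x - m) * of_real x powr (- s)) has_vector_derivative
     of_real (x - m) * (- s * of_real x powr (- s - 1)) + 1 * of_real x powr (- s)) (at x within {real n..real (Suc n)})" .
  qed simp
  moreover have "real (Suc n) - m = 1/2" "real n - m = -1/2" by (auto simp: m_def)
  moreover have "(%x. of_real (x - m) * (- s * of_real x powr (- s - 1)) + 1 * of_real x powr (- s))
    = (%x. of_real x powr (- s) - s * of_real (x - m) * of_real x powr (- s - 1))"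
   by (auto simp: algebra_simps)
  ultimately show ?thesis by (simp only:)
 qed
 have 2: "((%x. of_real x powr (- s)) has_integral
   (of_real (real (Suc n)) powr (1 - s) - of_real (real n) powr (1 - s)) / (1 - s)) {real n..real (Suc n)}"
 proof -
  have "((%x. of_real x powr (- s)) has_integral
    of_real (real (Suc n)) powr (1 - s) / (1 - s) - of_real (real n) powr (1 - s) / (1 - s)) {real n..real (Suc n)}"
  proof (rule fundamental_theorem_of_calculus)
   fix x assume "x \<in> {real n..real (Suc n)}"
   hence x: "x > 0" using n by simp
   show "((%x. of_real x powr (1 - s) / (1 - s)) has_vector_derivative of_real x powr (- s)) (at x within {real n..real (Suc n)})"
    using has_vector_derivative_divide[OF of_real_powr_derivative[OF x, of "1 - s"], of "1 - s"] s
    by simp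
  qed simp
  thus ?thesis by (simp add: diff_divide_distrib)
 qed
 have "((%x. (of_real x powr (- s) - s * of_real (x - m) * of_real x powr (- s - 1)) - of_real x powr (- s)) has_integral
   (of_real (1/2) * of_real (real (Suc n)) powr (- s) - of_real (- 1/2) * of_real (real n) powr (- s))
    - (of_real (real (Suc n)) powr (1 - s) - of_real (real n) powr (1 - s)) / (1 - s)) {real n..real (Suc n)}"
  by (rule has_integral_diff[OF 1 2])
 moreover have "(of_real (1/2) * of_real (real (Suc n)) powr (- s) - of_real (- 1/2) * of_real (real n) powr (- s))
    - (of_real (real (Suc n)) powr (1 - s) - of_real (real n) powr (1 - s)) / (1 - s) = trapezoid s n"
  unfolding trapezoid_def by (simp add: add_divide_distrib add.commute)
 moreover have "(%x. (of_real x powr (- s) - s * of_real (x - m) * of_real x powr (- s - 1)) - of_real x powr (- s))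
   = (%x. - (s * of_real (x - m) * of_real x powr (- s - 1)))" by simp
 ultimately have "((%x. - (s * of_real (x - m) * of_real x powr (- s - 1))) has_integral trapezoid s n) {real n..real (Suc n)}"
  by (simp only:)
 thus ?thesis by (simp only: m_def)
qed

text \<open>The kernel has modulus at most 1/2. The bound is left as a difference so that its sum
  over \<open>n\<close> telescopes.\<close>

lemma trapezoid_bound:
 assumes s: "Re s > 0" "s ~= 1" and n: "n >= 1"
 shows "norm (trapezoid s n) <= norm s / (2 * Re s) * (real n powr (- Re s) - real (Suc n) powr (- Re s))"
proof -
 define m where "m = real n + 1 / 2"
 note 3 = trapezoid_integral[OF s(2) n, folded m_def]
 have 4: "((%x. norm s / 2 * x powr (- Re s - 1)) has_integral
   norm s / (2 * Re s) * (real n powr (- Re s) - real (Suc n) powr (- Re s))) {real n..real (Suc n)}"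
 proof -
  have "((%x. norm s / 2 * x powr (- Re s - 1)) has_integral
   (- norm s / (2 * Re s) * real (Suc n) powr (- Re s)) - (- norm s / (2 * Re s) * real n powr (- Re s))) {real n..real (Suc n)}"
  proof (rule fundamental_theorem_of_calculus)
   fix x assume "x \<in> {real n..real (Suc n)}"
   hence x: "x > 0" using n by simp
   have "((%x. - norm s / (2 * Re s) * x powr (- Re s)) has_real_derivative - norm s / (2 * Re s) * (- Re s * x powr (- Re s - 1))) (at x within {real n..real (Suc n)})"
    using x by (auto intro!: derivative_eq_intros)
   thus "((%x. - norm s / (2 * Re s) * x powr (- Re s)) has_vector_derivative norm s / 2 * x powr (- Re s - 1)) (at x within {real n..real (Suc n)})"
    unfolding has_real_derivative_iff_has_vector_derivative using s by (simp add: field_simps)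
  qed simp
  thus ?thesis by (simp add: algebra_simps)
 qed
 have "norm (integral {real n..real (Suc n)} (%x. - (s * of_real (x - m) * of_real x powr (- s - 1))))
   <= integral {real n..real (Suc n)} (%x. norm s / 2 * x powr (- Re s - 1))"
 proof (rule integral_norm_bound_integral)
  fix x assume "x \<in> {real n..real (Suc n)}"
  hence "real n <= x" "x <= real n + 1" by auto
  hence x: "x > 0" "\<bar>x - m\<bar> <= 1 / 2" using n unfolding m_def by linarith+
  have "norm (- (s * of_real (x - m) * of_real x powr (- s - 1))) = norm s * \<bar>x - m\<bar> * x powr (- Re s - 1)"
   using norm_of_real_powr[OF x(1), of "- s - 1"] by (simp only: norm_minus_cancel norm_mult norm_of_real) simp
  also have "... <= norm s * (1 / 2) * x powr (- Re s - 1)"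
   using x by (intro mult_right_mono mult_left_mono) auto
  finally show "norm (- (s * of_real (x - m) * of_real x powr (- s - 1))) <= norm s / 2 * x powr (- Re s - 1)" by simp
 qed (use 3 4 in \<open>auto simp: integrable_on_def\<close>)
 thus ?thesis unfolding integral_unique[OF 3] integral_unique[OF 4] .
qed

text \<open>A second integration by parts, with the kernel \<open>q\<close>, gains a power of
  \<open>n\<close>. It makes the series of errors converge for \<open>Re s > -1\<close> and so
  reaches the strip where the functional equation is proved.\<close>

lemma trapezoid_bound_second_order:
 assumes s: "Re s > -1" "s ~= 1" and n: "n >= 1"
 shows "norm (trapezoid s n) <= norm s * norm (s + 1) / 8 * real n powr (- Re s - 2)"
proof -
 define m where "m = real n + 1 / 2"
 define q where "q x = (x - real n) * (real (Suc n) - x)" for x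
 note 3 = trapezoid_integral[OF s(2) n, folded m_def]
 have 1: "((%x. of_real (q x) * ((- s - 1) * of_real x powr (- s - 2)) + of_real (2 * m - 2 * x) * of_real x powr (- s - 1)) has_integral
   of_real (q (real (Suc n))) * of_real (real (Suc n)) powr (- s - 1) - of_real (q (real n)) * of_real (real n) powr (- s - 1)) {real n..real (Suc n)}"
 proof (rule fundamental_theorem_of_calculus)
  fix x assume "x \<in> {real n..real (Suc n)}"
  hence x: "x > 0" using n by simp
  have "(q has_real_derivative 2 * m - 2 * x) (at x within {real n..real (Suc n)})"
   unfolding q_def m_def by (auto intro!: derivative_eq_intros simp: algebra_simps)
  hence "((%x. complex_of_real (q x)) has_vector_derivative of_real (2 * m - 2 * x)) (at x within {real n..real (Suc n)})"
   by (rule has_vector_derivative_of_real)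
  moreover have "- s - 1 - 1 = - s - 2" by simp
  ultimately show "((%x. of_real (q x) * of_real x powr (- s - 1)) has_vector_derivative
    of_real (q x) * ((- s - 1) * of_real x powr (- s - 2)) + of_real (2 * m - 2 * x) * of_real x powr (- s - 1)) (at x within {real n..real (Suc n)})"
   using has_vector_derivative_mult[OF _ of_real_powr_derivative[OF x, of "- s - 1" "{real n..real (Suc n)}"], of "%x. of_real (q x)" "of_real (2 * m - 2 * x)"]
   by (simp only:)
 qed simp
 have "((%x. s / 2 * (of_real (q x) * ((- s - 1) * of_real x powr (- s - 2)) + of_real (2 * m - 2 * x) * of_real x powr (- s - 1))) has_integral s / 2 * 0) {real n..real (Suc n)}"
  using 1 by (intro has_integral_mult_right) (simp add: q_def)
 from has_integral_diff[OF 3 this]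
 have 4: "((%x. s * (s + 1) / 2 * (of_real (q x) * of_real x powr (- s - 2))) has_integral trapezoid s n) {real n..real (Suc n)}"
  by (simp add: algebra_simps add_divide_distrib)
 have "norm (integral {real n..real (Suc n)} (%x. s * (s + 1) / 2 * (of_real (q x) * of_real x powr (- s - 2))))
   <= integral {real n..real (Suc n)} (%x. norm s * norm (s + 1) / 8 * real n powr (- Re s - 2))"
 proof (rule integral_norm_bound_integral)
  fix x assume "x \<in> {real n..real (Suc n)}"
  hence x: "real n <= x" "x <= real n + 1" "x > 0" using n by auto
  have "q x = 1 / 4 - (x - m)\<^sup>2" by (simp add: q_def m_def power2_eq_square algebra_simps)
  hence "q x <= 1 / 4" by simp
  moreover have "0 <= q x" using x unfolding q_def by (intro mult_nonneg_nonneg) auto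
  ultimately have q: "\<bar>q x\<bar> <= 1 / 4" by simp
  have "norm (s * (s + 1) / 2 * (of_real (q x) * of_real x powr (- s - 2))) = norm s * norm (s + 1) / 2 * (\<bar>q x\<bar> * x powr (- Re s - 2))"
   using norm_of_real_powr[OF x(3), of "- s - 2"] by (simp only: norm_mult norm_divide norm_of_real) simp
  also have "... <= norm s * norm (s + 1) / 2 * (1 / 4 * real n powr (- Re s - 2))"
   using q x s n by (intro mult_left_mono mult_mono powr_mono2') auto
  finally show "norm (s * (s + 1) / 2 * (of_real (q x) * of_real x powr (- s - 2))) <= norm s * norm (s + 1) / 8 * real n powr (- Re s - 2)" by simp
 qed (use 4 in \<open>auto simp: integrable_on_def\<close>)
 thus ?thesis unfolding integral_unique[OF 4] by simp
qed

lemma trapezoid_partial_sum: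
 assumes "s ~= 1" "M <= N"
 shows "(\<Sum>n=M..<N. trapezoid s n) = (\<Sum>n=M..<N. of_nat n powr (- s)) + (of_nat N powr (- s) - of_nat M powr (- s)) / 2
   - (of_nat N powr (1 - s) - of_nat M powr (1 - s)) / (1 - s)"
 using assms(2)
proof (induction N rule: dec_induct)
 case (step N)
 have "(\<Sum>n=M..<Suc N. trapezoid s n) = (\<Sum>n=M..<N. trapezoid s n) + trapezoid s N"
  "(\<Sum>n=M..<Suc N. of_nat n powr (- s)) = (\<Sum>n=M..<N. of_nat n powr (- s)) + of_nat N powr (- s)"
  using step.hyps by (simp_all del: of_nat_Suc)
 thus ?case unfolding step.IH unfolding trapezoid_def
  by (simp add: add_divide_distrib diff_divide_distrib del: of_nat_Suc)
qed simp

lemma trapezoid_summable: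
 assumes s: "Re s > 0" "s ~= 1" and M: "M >= 1"
 shows "summable (%n. trapezoid s (n + M))"
  and "norm (\<Sum>n. trapezoid s (n + M)) <= norm s / (2 * Re s) * real M powr (- Re s)"
proof -
 define a where "a n = norm s / (2 * Re s) * (real (n + M) powr (- Re s))" for n
 have "(%n. real (n + M) powr (- Re s)) \<longlonglongrightarrow> 0"
  using s by (intro tendsto_neg_powr filterlim_compose[OF filterlim_real_sequentially filterlim_add_const_nat_at_top]) auto
 hence "a \<longlonglongrightarrow> norm s / (2 * Re s) * 0" unfolding a_def by (intro tendsto_mult tendsto_const)
 hence sums: "(%n. a n - a (Suc n)) sums (a 0)"
  using telescope_sums'[of a 0] by simp
 have le: "norm (trapezoid s (n + M)) <= a n - a (Suc n)" for n
  using trapezoid_bound[OF s, of "n + M"] M by (simp add: a_def right_diff_distrib)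
 show sm: "summable (%n. trapezoid s (n + M))"
  by (rule summable_comparison_test'[OF sums_summable[OF sums]]) (use le in auto)
 have "norm (\<Sum>n. trapezoid s (n + M)) <= (\<Sum>n. a n - a (Suc n))"
  by (rule norm_suminf_le[OF le sums_summable[OF sums]])
 also have "... = a 0" using sums by (rule sums_unique[symmetric])
 finally show "norm (\<Sum>n. trapezoid s (n + M)) <= norm s / (2 * Re s) * real M powr (- Re s)" by (simp add: a_def)
qed

text \<open>For \<open>Re s > 1\<close> the partial sums of the errors telescope to a partial sum of
  zeta. Both sides are holomorphic for \<open>Re s > -1\<close> off the pole, and
  \<open>halfplane_identity\<close> extends the equality.\<close>

lemma zeta_trapezoid_1:
 assumes s: "Re s > -1" "s ~= 1"
 shows "zeta s = 1 / (s - 1) + 1 / 2 + (\<Sum>n. trapezoid s (n + 1))"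
proof -
 define S where "S = {s. Re s > -1} - {1::complex}"
 have opS: "open S" unfolding S_def by (intro open_Diff open_halfspace_Re_gt) auto
 have "(%s. \<Sum>n. trapezoid s (n + 1)) holomorphic_on S"
 proof (rule holomorphic_series(1)[OF opS])
  fix n
  show "(%s. trapezoid s (n + 1)) holomorphic_on S"
   unfolding trapezoid_def S_def by (intro holomorphic_intros) (auto simp flip: of_nat_Suc simp del: of_nat_Suc)
 next
  fix x assume x: "x \<in> S"
  define d where "d = (Re x + 1) / 2"
  define A where "A = (norm x + d) * (norm x + d + 1) / 8"
  have d: "d > 0" using x by (auto simp: d_def S_def)
  have bd: "norm (trapezoid y (n + 1)) <= A * real (Suc n) powr (- 1 - d)" if y: "y \<in> ball x d \<inter> S" for n y
  proof -
   have ry: "Re y + 1 >= d" using y abs_Re_le_cmod[of "x - y"] d unfolding d_def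
    by (auto simp: dist_norm abs_if field_simps split: if_splits)
   have ny: "norm y <= norm x + d" using y norm_triangle_ineq[of x "y - x"] by (auto simp: dist_norm norm_minus_commute)
   hence ny1: "norm (y + 1) <= norm x + d + 1" using norm_triangle_ineq[of y 1] by simp
   have y1: "Re y > -1" "y ~= 1" using y by (auto simp: S_def)
   have "norm (trapezoid y (n + 1)) <= norm y * norm (y + 1) / 8 * real (Suc n) powr (- Re y - 2)"
    using trapezoid_bound_second_order[OF y1, of "Suc n"] by simp
   also have "... <= A * real (Suc n) powr (- 1 - d)"
    unfolding A_def using ny ny1 ry d by (intro mult_mono divide_right_mono powr_mono) auto
   finally show ?thesis .
  qed
  have "summable (%n. A * real (Suc n) powr (- 1 - d))"
   using d by (intro summable_mult summable_shifted_powr) auto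
  thus "\<exists>d h. 0 < d \<and> summable h \<and> (\<forall>n. \<forall>y\<in>ball x d \<inter> S. norm (trapezoid y (n + 1)) <= h n)"
   using bd d by blast
 qed
 hence hol: "(%s. 1 / (s - 1) + 1 / 2 + (\<Sum>n. trapezoid s (n + 1))) holomorphic_on S"
  by (intro holomorphic_intros) (auto simp: S_def)
 have eq: "zeta z = 1 / (z - 1) + 1 / 2 + (\<Sum>n. trapezoid z (n + 1))" if z: "Re z > 1" for z
 proof -
  have z1: "z ~= 1" "Re z > -1" using z by auto
  have "(%N. \<Sum>n<N. 1 / of_nat (Suc n) powr z) \<longlonglongrightarrow> zeta z"
   using zeta_sums[OF z] by (simp add: sums_def)
  moreover have "(\<Sum>n<N. 1 / of_nat (Suc n) powr z) = (\<Sum>n=1..<N+1. of_nat n powr (- z))" for N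
   by (rule sum.reindex_bij_witness[of _ "%n. n - 1" Suc]) (auto simp: powr_minus inverse_eq_divide)
  ultimately have L1: "(%N. \<Sum>n=1..<N+1. of_nat n powr (- z)) \<longlonglongrightarrow> zeta z" by simp
  have pz: "(%N. of_nat (N + 1) powr w) \<longlonglongrightarrow> (0::complex)" if "Re w < 0" for w
  proof (rule tendsto_norm_zero_cancel)
   have "(%N. real (N + 1) powr (Re w)) \<longlonglongrightarrow> 0"
    using that by (intro tendsto_neg_powr filterlim_compose[OF filterlim_real_sequentially filterlim_add_const_nat_at_top]) auto
   moreover have "norm (of_nat (N + 1) powr w :: complex) = real (N + 1) powr Re w" for N
    using norm_of_real_powr[of "real (N + 1)" w] by simp
   ultimately show "(%N. norm (of_nat (N + 1) powr w :: complex)) \<longlonglongrightarrow> 0" by simp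
  qed
  have "(%N. (\<Sum>n=1..<N+1. of_nat n powr (- z)) + (of_nat (N + 1) powr (- z) - of_nat 1 powr (- z)) / 2
   - (of_nat (N + 1) powr (1 - z) - of_nat 1 powr (1 - z)) / (1 - z)) \<longlonglongrightarrow> zeta z + (0 - of_nat 1 powr (- z)) / 2 - (0 - of_nat 1 powr (1 - z)) / (1 - z)"
   using z z1 by (intro tendsto_intros L1 pz) auto
  also have "(%N. (\<Sum>n=1..<N+1. of_nat n powr (- z)) + (of_nat (N + 1) powr (- z) - of_nat 1 powr (- z)) / 2
   - (of_nat (N + 1) powr (1 - z) - of_nat 1 powr (1 - z)) / (1 - z)) = (%N. \<Sum>n<N. trapezoid z (n + 1))"
  proof
   fix N
   have "(\<Sum>n<N. trapezoid z (n + 1)) = (\<Sum>n=1..<N+1. trapezoid z n)"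
    by (rule sum.reindex_bij_witness[of _ "%n. n - 1" Suc]) auto
   thus "(\<Sum>n=1..<N+1. of_nat n powr (- z)) + (of_nat (N + 1) powr (- z) - of_nat 1 powr (- z)) / 2
   - (of_nat (N + 1) powr (1 - z) - of_nat 1 powr (1 - z)) / (1 - z) = (\<Sum>n<N. trapezoid z (n + 1))"
    using trapezoid_partial_sum[OF z1(1), of 1 "N + 1"] by simp
  qed
  finally have "(%n. trapezoid z (n + 1)) sums (zeta z - 1 / 2 + 1 / (1 - z))"
   unfolding sums_def by simp
  hence "(\<Sum>n. trapezoid z (n + 1)) = zeta z - 1 / 2 + 1 / (1 - z)" by (rule sums_unique[symmetric])
  moreover have "1 / (z - 1) = - (1 / (1 - z))" using minus_divide_right[of 1 "z - 1"] by (simp only: minus_diff_eq) (metis minus_minus)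
  ultimately show ?thesis by simp
 qed
 show ?thesis
 proof (rule halfplane_identity[of zeta S])
  show "zeta holomorphic_on S" by (rule holomorphic_on_subset[OF zeta_holomorphic]) (auto simp: S_def)
  show "connected S" unfolding S_def
   by (intro connected_open_delete open_halfspace_Re_gt convex_connected convex_halfspace_Re_gt) simp
  show "s \<in> S" using s by (simp add: S_def)
 qed (use hol opS eq in \<open>auto simp: S_def\<close>)
qed

text \<open>On the real axis these are the values of the truncated Mellin transforms in
  \<open>mellin_bose_truncated\<close>, up to the factor \<open>Gamma s\<close>.\<close>

lemma zeta_limit:
 assumes s: "Re s > -1" "s ~= 1"
 shows "(%N. (\<Sum>n=1..<N+1. of_nat n powr (- s)) + of_nat (N + 1) powr (- s) / 2 - of_nat (N + 1) powr (1 - s) / (1 - s)) \<longlonglongrightarrow> zeta s"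
proof -
 have "summable (%n. trapezoid s (n + 1))"
 proof (rule summable_comparison_test')
  show "summable (%n. norm s * norm (s + 1) / 8 * real (Suc n) powr (- Re s - 2))"
   using s by (intro summable_mult summable_shifted_powr) auto
  show "norm (trapezoid s (n + 1)) <= norm s * norm (s + 1) / 8 * real (Suc n) powr (- Re s - 2)" for n
   using trapezoid_bound_second_order[OF s, of "Suc n"] by simp
 qed
 hence "(%N. \<Sum>n<N. trapezoid s (n + 1)) \<longlonglongrightarrow> (\<Sum>n. trapezoid s (n + 1))"
  using summable_LIMSEQ by blast
 hence "(%N. 1 / (s - 1) + 1 / 2 + (\<Sum>n<N. trapezoid s (n + 1))) \<longlonglongrightarrow> zeta s"
  unfolding zeta_trapezoid_1[OF s] by (intro tendsto_intros)
 moreover have "1 / (s - 1) + 1 / 2 + (\<Sum>n<N. trapezoid s (n + 1))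
   = (\<Sum>n=1..<N+1. of_nat n powr (- s)) + of_nat (N + 1) powr (- s) / 2 - of_nat (N + 1) powr (1 - s) / (1 - s)" for N
 proof -
  have "(\<Sum>n<N. trapezoid s (n + 1)) = (\<Sum>n=1..<N+1. trapezoid s n)"
   by (rule sum.reindex_bij_witness[of _ "%n. n - 1" Suc]) auto
  moreover have "1 / (s - 1) = - (1 / (1 - s))" using minus_divide_right[of 1 "s - 1"] by (simp only: minus_diff_eq) (metis minus_minus)
  ultimately show ?thesis using trapezoid_partial_sum[OF s(2), of 1 "N + 1"]
   by (simp add: diff_divide_distrib)
 qed
 ultimately show ?thesis by simp
qed

text \<open>The tail from \<open>X\<close> on of the series in \<open>zeta_trapezoid_1\<close>,
  bounded by telescoping. The cutoff \<open>X\<close> stays free: it is taken near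
  \<open>\<tau> powr (5/3)\<close> for large heights and near \<open>\<tau>\<close>
  otherwise.\<close>

theorem zeta_approx:
 assumes s: "Re s > 0" "s ~= 1" and X: "X >= 1"
 shows "norm (zeta s - ((\<Sum>n=1..X. of_nat n powr (- s)) + of_nat X powr (1 - s) / (s - 1) - of_nat X powr (- s) / 2))
   <= norm s / (2 * Re s) * real X powr (- Re s)"
proof -
 have "(\<Sum>n. trapezoid s (n + 1)) = (\<Sum>n. trapezoid s (n + (X - 1) + 1)) + (\<Sum>n<X - 1. trapezoid s (n + 1))"
  by (rule suminf_split_initial_segment) (use trapezoid_summable(1)[OF s, of 1] in auto)
 moreover have "(%n. trapezoid s (n + (X - 1) + 1)) = (%n. trapezoid s (n + X))" using X by auto
 moreover have "(\<Sum>n<X - 1. trapezoid s (n + 1)) = (\<Sum>n=1..<X. trapezoid s n)"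
  by (rule sum.reindex_bij_witness[of _ "%n. n - 1" Suc]) auto
 ultimately have e: "zeta s = 1 / (s - 1) + 1 / 2 + ((\<Sum>n. trapezoid s (n + X)) + (\<Sum>n=1..<X. trapezoid s n))"
  using zeta_trapezoid_1[OF _ s(2)] s by simp
 have "(\<Sum>n=1..X. of_nat n powr (- s)) = (\<Sum>n=1..<X. of_nat n powr (- s)) + of_nat X powr (- s)"
  using X by (cases X) (auto simp: atLeastLessThanSuc_atLeastAtMost)
 moreover have "y / (1 - s) = - (y / (s - 1))" for y
  using minus_divide_right[of y "s - 1"] by simp
 ultimately have "zeta s - ((\<Sum>n=1..X. of_nat n powr (- s)) + of_nat X powr (1 - s) / (s - 1) - of_nat X powr (- s) / 2)
   = (\<Sum>n. trapezoid s (n + X))"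
  unfolding e trapezoid_partial_sum[OF s(2) X] by (simp add: diff_divide_distrib)
 thus ?thesis using trapezoid_summable(2)[OF s X] by simp
qed

section \<open>Dirichlet series, the logarithmic derivative and lower bounds to the right of
  1\<close>

lemma norm_nat_powr: "norm (of_nat n powr s :: complex) = real n powr Re s"
 using norm_of_real_powr[of "real n" s] by (cases "n = 0") auto

lemma nat_powr_of_real: "of_nat n powr of_real x = complex_of_real (real n powr x)"
 using powr_of_real[of "real n" x] by simp

lemma summable_nat_powr: "\<sigma> > 1 ==> summable (%n. real n powr (- \<sigma>))"
 by (simp add: summable_real_powr_iff)

text \<open>Half of the excess \<open>\<sigma> - 1\<close> is spent on
  \<open>ln n <= n powr d / d\<close>.\<close>

lemma summable_ln_nat_powr:
 assumes "\<sigma> > 1"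
 shows "summable (%n. ln (real n) * real n powr (- \<sigma>))"
proof (rule summable_comparison_test')
 define d where "d = (\<sigma> - 1) / 2"
 have d: "d > 0" using assms by (simp add: d_def)
 show "summable (%n. 1 / d * real n powr (- (1 + d)))"
  using d by (intro summable_mult summable_nat_powr) auto
 fix n :: nat assume "n >= 1"
 hence n: "real n >= 1" by simp
 have "ln (real n powr d) <= real n powr d - 1" using n by (intro ln_le_minus_one) auto
 hence "ln (real n) <= real n powr d / d" using d n by (simp add: ln_powr field_simps)
 hence "ln (real n) * real n powr (- \<sigma>) <= real n powr d / d * real n powr (- \<sigma>)"
  by (intro mult_right_mono) auto
 also have "... = 1 / d * real n powr (- (1 + d))"
 proof -
  have "d + - \<sigma> = - (1 + d)" by (simp add: d_def field_simps)
  thus ?thesis by (simp only: times_divide_eq_left mult_1_left powr_add[symmetric])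
 qed
 finally show "norm (ln (real n) * real n powr (- \<sigma>)) <= 1 / d * real n powr (- (1 + d))"
  using n by simp
qed

lemma zeta_sums': "Re s > 1 ==> (%n. of_nat n powr (- s)) sums zeta s"
proof -
 assume s: "Re s > 1"
 have "(%n. of_nat (Suc n) powr (- s)) sums zeta s"
  using zeta_sums[OF s] by (simp add: powr_minus inverse_eq_divide)
 thus ?thesis by (subst (asm) sums_Suc_iff) simp
qed

text \<open>
  \<open>ch\<close> will be the constant 1 or the indicator of the odd numbers; the latter removes the
  Euler factor at 2, which improves the lower bound for \<open>zeta\<close> by the factor \<open>1 - 4 powr (- \<sigma>)\<close>.
\<close>

locale indicator_character =
 fixes ch :: "nat => real"
 assumes chi_mult: "ch (m * n) = ch m * ch n" and chi_01: "ch n = 0 \<or> ch n = 1" and chi_1: "ch 1 = 1"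
begin

definition dser :: "complex => complex" where
 "dser s = (\<Sum>n. of_real (ch n) * of_nat n powr (- s))"

definition vser :: "complex => complex" where
 "vser s = (\<Sum>n. of_real (ch n * mangoldt n) * of_nat n powr (- s))"

lemma chi_le: "0 <= ch n" "ch n <= 1" using chi_01[of n] by auto

lemma norm_summable_dser: "Re s > 1 ==> summable (%n. norm (of_real (ch n) * of_nat n powr (- s) :: complex))"
 by (rule summable_comparison_test'[OF summable_nat_powr[of "Re s"]])
  (use chi_le in \<open>auto simp: norm_mult norm_nat_powr intro!: mult_left_le_one_le\<close>)

lemma norm_summable_vser: "Re s > 1 ==> summable (%n. norm (of_real (ch n * mangoldt n) * of_nat n powr (- s) :: complex))"
proof (rule summable_comparison_test'[OF summable_ln_nat_powr[of "Re s"]])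
 fix n :: nat assume "n >= 1"
 hence "mangoldt n <= ln (real n)" using mangoldt_le[of n] by simp
 hence "ch n * mangoldt n <= 1 * ln (real n)"
  using chi_le[of n] by (intro mult_mono) (auto simp: mangoldt_nonneg)
 thus "norm (norm (of_real (ch n * mangoldt n) * of_nat n powr (- s) :: complex)) <= ln (real n) * real n powr - Re s"
  using chi_le[of n] by (auto simp: norm_mult norm_nat_powr abs_mult mangoldt_nonneg intro!: mult_right_mono)
qed auto

text \<open>The sum of \<open>mangoldt\<close> over the divisors of \<open>n\<close> is
  \<open>ln n\<close>, and \<open>ch\<close> is multiplicative: the absolutely convergent double sum
  is regrouped by the product of its indices.\<close>

lemma convolution:
 assumes s: "Re s > 1"
 shows "(%n. of_real (ch n * ln (real n)) * of_nat n powr (- s)) sums (vser s * dser s)"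
proof -
 define f where "f n = of_real (ch n * mangoldt n) * of_nat n powr (- s)" for n :: nat
 define g where "g n = of_real (ch n) * of_nat n powr (- s)" for n :: nat
 have f0: "f 0 = 0" and g0: "g 0 = 0" by (simp_all add: f_def g_def)
 have sf: "summable (%n. norm (f n))" and sg: "summable (%n. norm (g n))"
  unfolding f_def g_def using norm_summable_vser[OF s] norm_summable_dser[OF s] by auto
 have hf: "(f has_sum vser s) UNIV" unfolding vser_def f_def[symmetric]
  by (rule norm_summable_imp_has_sum[OF sf summable_sums[OF summable_norm_cancel[OF sf]]])
 have hg: "(g has_sum dser s) UNIV" unfolding dser_def g_def[symmetric]
  by (rule norm_summable_imp_has_sum[OF sg summable_sums[OF summable_norm_cancel[OF sg]]])
 \<comment> \<open>The index 0 is removed because regrouping by \<open>(d, n div d)\<close> is a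
   bijection only for positive indices; the terms at 0 vanish.\<close>
 define A where "A = {1::nat..}"
 have hfA: "(f has_sum vser s) A"
  by (rule has_sum_cong_neutral[THEN iffD1, OF _ _ _ hf]) (auto simp: A_def f0 not_le)
 have hgA: "(g has_sum dser s) A"
  by (rule has_sum_cong_neutral[THEN iffD1, OF _ _ _ hg]) (auto simp: A_def g0 not_le)
 have absf: "(%n. norm (f n)) summable_on A" and absg: "(%n. norm (g n)) summable_on A"
 proof -
  have "(%n. norm (f n)) summable_on UNIV" "(%n. norm (g n)) summable_on UNIV"
   using sf sg by (auto intro!: norm_summable_imp_summable_on)
  thus "(%n. norm (f n)) summable_on A" "(%n. norm (g n)) summable_on A" by (auto intro: summable_on_subset_banach)
 qed
 have "(%x. norm ((%(a, b). f a * g b) x)) summable_on A \<times> A"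
  unfolding Infinite_Sum.abs_summable_on_Sigma_iff
 proof (intro conjI ballI)
  fix a show "(%b. norm (case (a, b) of (a, b) => f a * g b)) summable_on A"
   using absg by (simp add: norm_mult summable_on_cmult_right)
 next
  have "infsum (%b. norm (case (a, b) of (a, b) => f a * g b)) A = norm (f a) * infsum (%b. norm (g b)) A" for a
   by (simp add: norm_mult infsum_cmult_right')
  thus "(%a. norm (infsum (%b. norm (case (a, b) of (a, b) => f a * g b)) A)) summable_on A"
   using absf by (simp add: abs_mult summable_on_cmult_left)
 qed
 hence "(%(a, b). f a * g b) summable_on A \<times> A" by (rule abs_summable_summable)
 hence "((%(a, b). f a * g b) has_sum (vser s * dser s)) (A \<times> A)"
  by (intro has_sum_SigmaI[where g = "%a. f a * dser s"])
    (auto intro!: has_sum_cmult_right has_sum_cmult_left hgA hfA)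
 also have "?this \<longleftrightarrow> ((%(n, d). f d * g (n div d)) has_sum (vser s * dser s)) (SIGMA n:A. {d. d dvd n})"
  by (rule has_sum_reindex_bij_witness[where i = "%(n, d). (d, n div d)" and j = "%(a, b). (a * b, a)"])
   (auto simp: A_def Suc_le_eq)
 finally have "((%(n, d). f d * g (n div d)) has_sum (vser s * dser s)) (SIGMA n:A. {d. d dvd n})" .
 hence "((%n. \<Sum>d | d dvd n. f d * g (n div d)) has_sum (vser s * dser s)) A"
  by (rule has_sum_SigmaD) (auto simp: A_def intro!: has_sum_finite)
 also have "?this \<longleftrightarrow> ((%n. of_real (ch n * ln (real n)) * of_nat n powr (- s)) has_sum (vser s * dser s)) A"
 proof (rule has_sum_cong)
  fix n assume n: "n \<in> A"
  have "(\<Sum>d | d dvd n. f d * g (n div d)) = (\<Sum>d | d dvd n. mangoldt d * (of_real (ch n) * of_nat n powr (- s)))"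
  proof (rule sum.cong[OF refl])
   fix d assume "d \<in> {d. d dvd n}"
   then obtain e where e: "n = d * e" by auto
   hence de: "d > 0" "n div d = e" using n by (auto simp: A_def)
   have "(of_nat n :: complex) powr (- s) = of_nat d powr (- s) * of_nat e powr (- s)"
    unfolding e of_nat_mult by (rule powr_times_real) auto
   thus "f d * g (n div d) = mangoldt d * (of_real (ch n) * of_nat n powr (- s))"
    unfolding f_def g_def de(2) by (simp add: e chi_mult)
  qed
  also have "... = of_real (ln (real n)) * (of_real (ch n) * of_nat n powr (- s))"
   unfolding sum_distrib_right[symmetric] using n by (subst mangoldt_sum) (auto simp: A_def)
  finally show "(\<Sum>d | d dvd n. f d * g (n div d)) = of_real (ch n * ln (real n)) * of_nat n powr (- s)"
   by simp
 qed
 finally have "((%n. of_real (ch n * ln (real n)) * of_nat n powr (- s)) has_sum (vser s * dser s)) UNIV"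
  by (rule has_sum_cong_neutral[THEN iffD1, rotated -1]) (auto simp: A_def not_le)
 thus ?thesis by (rule has_sum_imp_sums)
qed

text \<open>Termwise differentiation produces the series with weights \<open>- ln n\<close>, which
  \<open>convolution\<close> factors. Thus \<open>vser\<close> acts as minus the logarithmic
  derivative of \<open>dser\<close>.\<close>

lemma dser_derivative:
 assumes s: "Re s > 1"
 shows "(dser has_field_derivative - (vser s * dser s)) (at s)"
proof -
 define S where "S = {s. Re s > (1::real)}"
 have opS: "open S" unfolding S_def by (rule open_halfspace_Re_gt)
 have d: "((%s. of_real (ch n) * of_nat n powr (- s)) has_field_derivative
   - (of_real (ch n * ln (real n)) * of_nat n powr (- x))) (at x)" for n :: nat and x :: complex
 proof (cases "n = 0")
  case False
  hence "((%z. of_nat n powr z) has_field_derivative Ln (of_nat n) * of_nat n powr (- x)) (at (- x))"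
   by (intro has_field_derivative_powr_right) auto
  hence "((%s. of_nat n powr (- s)) has_field_derivative Ln (of_nat n) * of_nat n powr (- x) * (- 1)) (at x)"
   by (rule DERIV_chain2) (auto intro!: derivative_eq_intros)
  from DERIV_cmult[OF this, of "of_real (ch n)"] False show ?thesis by (simp add: Ln_of_nat mult.assoc)
 qed simp
 have M: "\<exists>d h. 0 < d \<and> summable h \<and> range h \<subseteq> \<real>\<^sub>\<ge>\<^sub>0 \<and>
   (\<forall>\<^sub>F n in sequentially. \<forall>y\<in>ball x d \<inter> S. cmod (of_real (ch n) * of_nat n powr (- y) :: complex) <= cmod (h n))" if x: "x \<in> S" for x
 proof (intro exI conjI)
  define d where "d = (Re x - 1) / 2"
  show d: "d > 0" using x by (simp add: d_def S_def)
  show "summable (%n. complex_of_real (real n powr (- (1 + d))))"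
   using d by (intro summable_of_real summable_nat_powr) auto
  show "range (%n. complex_of_real (real n powr (- (1 + d)))) \<subseteq> \<real>\<^sub>\<ge>\<^sub>0" by auto
  show "\<forall>\<^sub>F n in sequentially. \<forall>y\<in>ball x d \<inter> S. cmod (of_real (ch n) * of_nat n powr (- y) :: complex) <= cmod (complex_of_real (real n powr (- (1 + d))))"
  proof (intro eventually_sequentiallyI[of 1] ballI)
   fix n :: nat and y assume n: "n >= 1" and y: "y \<in> ball x d \<inter> S"
   have "Re y >= 1 + d" using y abs_Re_le_cmod[of "x - y"] unfolding d_def
    by (auto simp: dist_norm abs_if field_simps split: if_splits)
   hence "ch n * real n powr (- Re y) <= 1 * real n powr (- (1 + d))"
    using n chi_le[of n] by (intro mult_mono powr_mono) auto
   thus "cmod (of_real (ch n) * of_nat n powr (- y) :: complex) <= cmod (complex_of_real (real n powr (- (1 + d))))"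
    using chi_le[of n] by (simp add: norm_mult norm_nat_powr)
  qed
 qed
 obtain g g' where g: "\<forall>x\<in>S. (%n. of_real (ch n) * of_nat n powr (- x)) sums g x \<and>
   (%n. - (of_real (ch n * ln (real n)) * of_nat n powr (- x))) sums g' x \<and> (g has_field_derivative g' x) (at x)"
  using series_and_derivative_comparison_complex[OF opS d M] by blast
 have sS: "s \<in> S" using s by (simp add: S_def)
 have "(%n. - (of_real (ch n * ln (real n)) * of_nat n powr (- s))) sums (- (vser s * dser s))"
  by (rule sums_minus[OF convolution[OF s]])
 hence "g' s = - (vser s * dser s)" using g sS sums_unique2 by blast
 moreover have "g x = dser x" if "x \<in> S" for x
  using g that unfolding dser_def by (auto simp: sums_iff)
 ultimately show ?thesis using g sS opS
  by (metis has_field_derivative_transform_within_open)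
qed

lemma vser_sums: "Re s > 1 ==> (%n. of_real (ch n * mangoldt n) * of_nat n powr (- s)) sums vser s"
 unfolding vser_def by (rule summable_sums[OF summable_norm_cancel[OF norm_summable_vser]])

lemma Re_nat_powr: "Re (of_nat n powr (- s)) = real n powr (- Re s) * cos (Im s * ln (real n))"
proof (cases "n = 0")
 case False
 hence "of_nat n powr (- s) = exp (- s * of_real (ln (real n)))"
  by (simp add: powr_def Ln_of_nat)
 thus ?thesis using False by (simp add: Re_exp powr_def mult.commute)
qed simp

lemma Re_vser_sums:
 "Re s > 1 ==> (%n. ch n * mangoldt n * real n powr (- Re s) * cos (Im s * ln (real n))) sums Re (vser s)"
 using sums_Re[OF vser_sums] by (simp add: Re_nat_powr mult.assoc)

text \<open>The coefficients \<open>ch n * mangoldt n\<close> are nonnegative, so a nonnegative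
  cosine polynomial in \<open>t * ln n\<close> stays nonnegative after summation. It is applied with
  the coefficients \<open>(3, 4, 1)\<close>, \<open>(1, 1, 0)\<close> and
  \<open>(1, 0, 0)\<close>.\<close>

lemma Re_vser_nonneg_combination:
 assumes "\<sigma> > 1" and "\<And>x. 0 <= a + b * cos x + c * cos (2 * x)"
 shows "0 <= a * Re (vser (of_real \<sigma>)) + b * Re (vser (Complex \<sigma> t)) + c * Re (vser (Complex \<sigma> (2 * t)))"
proof -
 let ?w = "%n. ch n * mangoldt n * real n powr (- \<sigma>)"
 have S: "(%n. a * (?w n * cos (0 * ln (real n))) + b * (?w n * cos (t * ln (real n))) + c * (?w n * cos (2 * t * ln (real n))))
   sums (a * Re (vser (of_real \<sigma>)) + b * Re (vser (Complex \<sigma> t)) + c * Re (vser (Complex \<sigma> (2 * t))))"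
  using Re_vser_sums[of "of_real \<sigma>"] Re_vser_sums[of "Complex \<sigma> t"] Re_vser_sums[of "Complex \<sigma> (2 * t)"] assms(1)
  by (intro sums_add sums_mult) auto
 have "0 <= a * (?w n * cos (0 * ln (real n))) + b * (?w n * cos (t * ln (real n))) + c * (?w n * cos (2 * t * ln (real n)))" for n
 proof -
  have "0 <= ?w n * (a + b * cos (t * ln (real n)) + c * cos (2 * (t * ln (real n))))"
   using chi_le[of n] by (intro mult_nonneg_nonneg assms(2)) (auto simp: mangoldt_nonneg)
  thus ?thesis by (simp add: algebra_simps)
 qed
 thus ?thesis by (rule sums_le[OF _ sums_zero S])
qed

end

interpretation one: indicator_character "%_. 1"
 by unfold_locales auto

interpretation odd: indicator_character "%n. of_bool (odd n)"
 by unfold_locales auto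

lemma zeta_eq_dser: "Re s > 1 ==> zeta s = one.dser s"
 using zeta_sums'[of s] unfolding one.dser_def by (simp add: sums_iff)

lemma zeta_log_deriv:
 assumes "Re s > 1"
 shows "deriv zeta s = - (one.vser s * zeta s)"
proof -
 have "(zeta has_field_derivative - (one.vser s * one.dser s)) (at s)"
  by (rule has_field_derivative_transform_within_open[OF one.dser_derivative[OF assms] open_halfspace_Re_gt[of 1]])
   (use assms zeta_eq_dser in auto)
 thus ?thesis using zeta_eq_dser[OF assms] by (simp add: DERIV_imp_deriv)
qed

text \<open>Zeta on the real half line beyond 1, kept real so that logarithms and comparisons avoid
  casts.\<close>

definition zr :: "real => real" where "zr \<sigma> = (\<Sum>n. real n powr (- \<sigma>))"

lemma zr_sums: "\<sigma> > 1 ==> (%n. real n powr (- \<sigma>)) sums zr \<sigma>"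
 unfolding zr_def by (rule summable_sums[OF summable_nat_powr])

lemma zeta_of_real: "\<sigma> > 1 ==> zeta (of_real \<sigma>) = of_real (zr \<sigma>)"
proof -
 assume "\<sigma> > 1"
 hence "(%n. of_nat n powr (- of_real \<sigma>)) sums zeta (of_real \<sigma>)" by (intro zeta_sums') auto
 moreover have "(of_nat n :: complex) powr (- of_real \<sigma>) = of_real (real n powr (- \<sigma>))" for n
  using nat_powr_of_real[of n "- \<sigma>"] by simp
 ultimately have "(%n. complex_of_real (real n powr (- \<sigma>))) sums zeta (of_real \<sigma>)" by simp
 thus ?thesis using sums_of_real[OF zr_sums[OF \<open>\<sigma> > 1\<close>]] sums_unique2 by blast
qed

lemma norm_zeta_le: "Re s > 1 ==> norm (zeta s) <= zr (Re s)"
 using norm_sums_le[OF zeta_sums' zr_sums, of s "Re s"] by (simp add: norm_nat_powr)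

lemma zr_decreasing: "1 < \<sigma> ==> \<sigma> <= \<tau> ==> zr \<tau> <= zr \<sigma>"
proof (rule sums_le[OF _ zr_sums zr_sums])
 fix n :: nat assume "1 < \<sigma>" "\<sigma> <= \<tau>"
 thus "real n powr - \<tau> <= real n powr - \<sigma>" by (cases "n = 0") (auto intro: powr_mono)
qed auto

text \<open>The integral test one step at a time: mean value theorem for
  \<open>x powr (1 - \<sigma>)\<close> on \<open>[n, n + 1]\<close>.\<close>

lemma powr_tail_step:
 assumes "\<sigma> > 1" "n >= 1"
 shows "real (Suc n) powr (- \<sigma>) <= (real n powr (1 - \<sigma>) - real (Suc n) powr (1 - \<sigma>)) / (\<sigma> - 1)"
  and "(real n powr (1 - \<sigma>) - real (Suc n) powr (1 - \<sigma>)) / (\<sigma> - 1) <= real n powr (- \<sigma>)"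
proof -
 have "\<exists>\<xi>>real n. \<xi> < real (Suc n) \<and> real (Suc n) powr (1 - \<sigma>) - real n powr (1 - \<sigma>) = (real (Suc n) - real n) * ((1 - \<sigma>) * \<xi> powr (1 - \<sigma> - 1))"
 proof (rule MVT2)
  fix x assume "real n <= x"
  thus "((%x. x powr (1 - \<sigma>)) has_real_derivative (1 - \<sigma>) * x powr (1 - \<sigma> - 1)) (at x)"
   using assms by (auto intro!: derivative_eq_intros)
 qed simp
 then obtain \<xi> where \<xi>: "real n < \<xi>" "\<xi> < real (Suc n)" "real (Suc n) powr (1 - \<sigma>) - real n powr (1 - \<sigma>) = (1 - \<sigma>) * \<xi> powr (- \<sigma>)"
  by auto
 hence e: "(real n powr (1 - \<sigma>) - real (Suc n) powr (1 - \<sigma>)) / (\<sigma> - 1) = \<xi> powr (- \<sigma>)"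
  using assms by (simp add: field_simps)
 show "real (Suc n) powr (- \<sigma>) <= (real n powr (1 - \<sigma>) - real (Suc n) powr (1 - \<sigma>)) / (\<sigma> - 1)"
  unfolding e using \<xi> assms by (intro powr_mono2') auto
 show "(real n powr (1 - \<sigma>) - real (Suc n) powr (1 - \<sigma>)) / (\<sigma> - 1) <= real n powr (- \<sigma>)"
  unfolding e using \<xi> assms by (intro powr_mono2') auto
qed

lemma zr_partial:
 assumes "\<sigma> > 1" "N >= 1"
 shows "(\<Sum>n<Suc N. real n powr (- \<sigma>)) <= 1 + (1 - real N powr (1 - \<sigma>)) / (\<sigma> - 1)"
  and "(1 - real N powr (1 - \<sigma>)) / (\<sigma> - 1) <= (\<Sum>n<N. real n powr (- \<sigma>))"
proof -
 show "(\<Sum>n<Suc N. real n powr (- \<sigma>)) <= 1 + (1 - real N powr (1 - \<sigma>)) / (\<sigma> - 1)"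
  using assms(2)
 proof (induction N rule: nat_induct_at_least)
  case (Suc N)
  thus ?case using powr_tail_step(1)[OF assms(1), of N]
   by (simp add: diff_divide_distrib add_divide_distrib del: of_nat_Suc)
 qed simp
 show "(1 - real N powr (1 - \<sigma>)) / (\<sigma> - 1) <= (\<Sum>n<N. real n powr (- \<sigma>))"
  using assms(2)
 proof (induction N rule: nat_induct_at_least)
  case (Suc N)
  thus ?case using powr_tail_step(2)[OF assms(1), of N]
   by (simp add: diff_divide_distrib add_divide_distrib del: of_nat_Suc)
 qed simp
qed

lemma zr_bounds:
 assumes "\<sigma> > 1"
 shows "zr \<sigma> <= 1 + 1 / (\<sigma> - 1)" "1 / (\<sigma> - 1) <= zr \<sigma>" "1 <= zr \<sigma>"
proof -
 have lim: "(%N. real N powr (1 - \<sigma>)) \<longlonglongrightarrow> 0"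
  using assms by (intro tendsto_neg_powr filterlim_real_sequentially) auto
 have L: "(%N. \<Sum>n<N. real n powr (- \<sigma>)) \<longlonglongrightarrow> zr \<sigma>" using zr_sums[OF assms] by (simp add: sums_def)
 have "(%N. 1 + (1 - real N powr (1 - \<sigma>)) / (\<sigma> - 1)) \<longlonglongrightarrow> 1 + (1 - 0) / (\<sigma> - 1)"
  using assms by (intro tendsto_intros lim) auto
 thus "zr \<sigma> <= 1 + 1 / (\<sigma> - 1)"
  using LIMSEQ_le[OF LIMSEQ_Suc[OF L]] zr_partial(1)[OF assms] by force
 have "(%N. (1 - real N powr (1 - \<sigma>)) / (\<sigma> - 1)) \<longlonglongrightarrow> (1 - 0) / (\<sigma> - 1)"
  using assms by (intro tendsto_intros lim) auto
 thus "1 / (\<sigma> - 1) <= zr \<sigma>"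
  using LIMSEQ_le[OF _ L] zr_partial(2)[OF assms] by force
 have "(\<Sum>n<2. real n powr (- \<sigma>)) <= zr \<sigma>"
  unfolding zr_def by (rule sum_le_suminf[OF summable_nat_powr[OF assms]]) auto
 thus "1 <= zr \<sigma>" by (simp add: numeral_2_eq_2)
qed

text \<open>Equivalent to \<open>- zeta' <= zeta / (\<sigma> - 1)\<close>. Summation by parts sets
  the increments of \<open>ln n\<close>, at most \<open>1 / n\<close>, against the tails, at most
  \<open>n powr (1 - \<sigma>) / (\<sigma> - 1)\<close>; their product is
  \<open>n powr (- \<sigma>) / (\<sigma> - 1)\<close>.\<close>

lemma vser_real_le:
 assumes "\<sigma> > 1"
 shows "Re (one.vser (of_real \<sigma>)) <= 1 / (\<sigma> - 1)"
proof -
 let ?S = "%N. \<Sum>n<Suc N. ln (real n) * real n powr (- \<sigma>)"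
 \<comment> \<open>The second summand on the left weighs the bound for the tail not yet summed by
   the current logarithm; carrying it makes the induction close.\<close>
 have part: "?S N + ln (real N) * (real N powr (1 - \<sigma>) / (\<sigma> - 1)) <= (\<Sum>n<N. real n powr (- \<sigma>)) / (\<sigma> - 1)" if "N >= 1" for N
  using that
 proof (induction N rule: nat_induct_at_least)
  case (Suc N)
  define \<tau> where "\<tau> n = real n powr (1 - \<sigma>) / (\<sigma> - 1)" for n
  have t: "real (Suc N) powr (- \<sigma>) + \<tau> (Suc N) <= \<tau> N"
   using powr_tail_step(1)[OF assms Suc.hyps] by (simp add: \<tau>_def diff_divide_distrib)
  have "ln (real (Suc N)) - ln (real N) <= 1 / real N"
  proof -
   have "ln (real (Suc N)) - ln (real N) = ln (1 + 1 / real N)"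
   proof -
    have "1 + 1 / real N = real (Suc N) / real N" using Suc.hyps by (simp add: field_simps)
    thus ?thesis using Suc.hyps by (simp add: ln_div)
   qed
   also have "... <= 1 / real N" by (rule ln_add_one_self_le_self) simp
   finally show ?thesis .
  qed
  hence "(ln (real (Suc N)) - ln (real N)) * \<tau> N <= 1 / real N * \<tau> N"
   using assms by (intro mult_right_mono) (auto simp: \<tau>_def)
  also have "1 / real N * \<tau> N = real N powr (- \<sigma>) / (\<sigma> - 1)"
  proof -
   have "real N powr (1 - \<sigma>) = real N * real N powr (- \<sigma>)" using Suc.hyps powr_add[of "real N" 1 "- \<sigma>"] by simp
   thus ?thesis using Suc.hyps by (simp add: \<tau>_def)
  qed
  finally have l: "ln (real (Suc N)) * \<tau> N <= ln (real N) * \<tau> N + real N powr (- \<sigma>) / (\<sigma> - 1)"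
   by (simp add: left_diff_distrib)
  have "ln (real (Suc N)) * (real (Suc N) powr (- \<sigma>) + \<tau> (Suc N)) <= ln (real (Suc N)) * \<tau> N"
   using t by (intro mult_left_mono) auto
  hence "ln (real (Suc N)) * real (Suc N) powr (- \<sigma>) + ln (real (Suc N)) * \<tau> (Suc N) <= ln (real N) * \<tau> N + real N powr (- \<sigma>) / (\<sigma> - 1)"
   using l by (simp only: distrib_left)
  thus ?case using Suc.IH unfolding \<tau>_def[symmetric]
   by (simp add: add_divide_distrib del: of_nat_Suc)
 qed simp
 have ls: "(%n. ln (real n) * real n powr (- \<sigma>)) sums (Re (one.vser (of_real \<sigma>)) * zr \<sigma>)"
 proof -
  have "(%n. Re (of_real (1 * ln (real n)) * of_nat n powr (- of_real \<sigma>))) sums Re (one.vser (of_real \<sigma>) * one.dser (of_real \<sigma>))"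
   using assms by (intro sums_Re one.convolution) auto
  moreover have "one.dser (of_real \<sigma>) = of_real (zr \<sigma>)" using zeta_eq_dser[of "of_real \<sigma>"] zeta_of_real assms by simp
  moreover have "Re (of_real (1 * ln (real n)) * of_nat n powr (- of_real \<sigma>)) = ln (real n) * real n powr (- \<sigma>)" for n
  proof -
   have "(of_nat n :: complex) powr (- of_real \<sigma>) = of_real (real n powr (- \<sigma>))"
    using nat_powr_of_real[of n "- \<sigma>"] by simp
   thus ?thesis by (simp only: mult_1_left of_real_mult[symmetric] Re_complex_of_real)
  qed
  moreover have "Re (one.vser (of_real \<sigma>) * of_real (zr \<sigma>)) = Re (one.vser (of_real \<sigma>)) * zr \<sigma>" by simp
  ultimately show ?thesis by (simp only:)
 qed
 hence "(%N. ?S N) \<longlonglongrightarrow> Re (one.vser (of_real \<sigma>)) * zr \<sigma>" unfolding sums_def by (rule LIMSEQ_Suc)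
 moreover have "(%N. (\<Sum>n<N. real n powr (- \<sigma>)) / (\<sigma> - 1)) \<longlonglongrightarrow> zr \<sigma> / (\<sigma> - 1)"
  using zr_sums[OF assms] assms unfolding sums_def by (intro tendsto_divide tendsto_const) auto
 moreover have "?S N <= (\<Sum>n<N. real n powr (- \<sigma>)) / (\<sigma> - 1)" if "N >= 1" for N
 proof -
  have "0 <= ln (real N) * (real N powr (1 - \<sigma>) / (\<sigma> - 1))" using that assms by simp
  thus ?thesis using part[OF that] by linarith
 qed
 ultimately have "Re (one.vser (of_real \<sigma>)) * zr \<sigma> <= zr \<sigma> / (\<sigma> - 1)"
  by (intro LIMSEQ_le) auto
 hence "Re (one.vser (of_real \<sigma>)) * zr \<sigma> <= 1 / (\<sigma> - 1) * zr \<sigma>" by simp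
 moreover have "zr \<sigma> > 0" using zr_bounds(3)[OF assms] by simp
 ultimately show ?thesis by (simp only: mult_le_cancel_right_pos)
qed

text \<open>The cosine polynomial is \<open>2 * (1 + cos x) ^ 2\<close>. In differentiated form it
  sets the pole's \<open>3 / (\<sigma> - 1)\<close> against the zeros near \<open>1 + it\<close>,
  each of which counts four times.\<close>

theorem three_four_one:
 assumes "\<sigma> > 1" and nz: "zeta (Complex \<sigma> t) ~= 0" "zeta (Complex \<sigma> (2 * t)) ~= 0"
 shows "4 * Re (deriv zeta (Complex \<sigma> t) / zeta (Complex \<sigma> t)) + Re (deriv zeta (Complex \<sigma> (2 * t)) / zeta (Complex \<sigma> (2 * t))) <= 3 / (\<sigma> - 1)"
proof -
 have "0 <= 3 * Re (one.vser (of_real \<sigma>)) + 4 * Re (one.vser (Complex \<sigma> t)) + 1 * Re (one.vser (Complex \<sigma> (2 * t)))"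
 proof (rule one.Re_vser_nonneg_combination[OF assms(1)])
  fix x :: real
  have "3 + 4 * cos x + 1 * cos (2 * x) = 2 * (1 + cos x)\<^sup>2"
   unfolding cos_double_cos by (simp add: power2_eq_square algebra_simps)
  thus "0 <= 3 + 4 * cos x + 1 * cos (2 * x)" by simp
 qed
 moreover have "deriv zeta (Complex \<sigma> u) / zeta (Complex \<sigma> u) = - one.vser (Complex \<sigma> u)" if "zeta (Complex \<sigma> u) ~= 0" for u
  using zeta_log_deriv[of "Complex \<sigma> u"] that assms by simp
 ultimately show ?thesis using nz vser_real_le[OF assms(1)] by simp
qed

lemma odd_dser_eq:
 assumes s: "Re s > 1"
 shows "odd.dser s = (1 - 2 powr (- s)) * zeta s"
proof -
 define f where "f n = (if even n then of_nat n powr (- s) else (0::complex))" for n :: nat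
 have "f (2 * m) = 2 powr (- s) * of_nat m powr (- s)" for m
 proof -
  have "(of_nat (2 * m) :: complex) powr (- s) = of_nat 2 powr (- s) * of_nat m powr (- s)"
   unfolding of_nat_mult by (rule powr_times_real) auto
  thus ?thesis by (simp add: f_def)
 qed
 hence "(%m. f (2 * m)) sums (2 powr (- s) * zeta s)"
  using sums_mult[OF zeta_sums'[OF s], of "2 powr (- s)"] by simp
 moreover have "(%m. f (2 * m)) sums c \<longleftrightarrow> f sums c" for c
  by (rule sums_mono_reindex) (auto simp: strict_mono_def f_def elim: evenE)
 ultimately have "f sums (2 powr (- s) * zeta s)" by (simp only:)
 hence "(%n. if even n then of_nat n powr (- s) else 0) sums (2 powr (- s) * zeta s)"
  unfolding f_def[abs_def] .
 from sums_diff[OF zeta_sums'[OF s] this]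
 have "(%n. of_nat n powr (- s) - (if even n then of_nat n powr (- s) else 0)) sums (zeta s - 2 powr (- s) * zeta s)" .
 moreover have "of_nat n powr (- s) - (if even n then of_nat n powr (- s) else 0) = of_real (of_bool (odd n)) * of_nat n powr (- s)" for n
  by simp
 ultimately show ?thesis unfolding odd.dser_def by (simp add: sums_iff algebra_simps)
qed

lemma odd_dser_near_1:
 assumes s: "Re s > 1"
 shows "norm (odd.dser s - 1) <= 1 / (Re s - 1)"
proof -
 have "(%n. of_real (of_bool (odd n)) * of_nat n powr (- s)) sums odd.dser s"
  unfolding odd.dser_def by (rule summable_sums[OF summable_norm_cancel[OF odd.norm_summable_dser[OF s]]])
 from sums_diff[OF this sums_single[of 1 "%_. 1"]]
 have 1: "(%n. of_real (of_bool (odd n)) * of_nat n powr (- s) - (if n = 1 then 1 else 0)) sums (odd.dser s - 1)" .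
 from sums_diff[OF zr_sums[OF s] sums_single[of 1 "%_. 1"]]
 have 2: "(%n. real n powr (- Re s) - (if n = 1 then 1 else 0)) sums (zr (Re s) - 1)" .
 have "norm (odd.dser s - 1) <= zr (Re s) - 1"
  by (rule norm_sums_le[OF 1 2]) (auto simp: norm_nat_powr norm_mult)
 thus ?thesis using zr_bounds(1)[OF s] by linarith
qed

text \<open>As \<open>\<sigma>\<close> grows the product tends to 1, and it never increases: by
  \<open>1 + cos x >= 0\<close> the real parts of \<open>odd.vser\<close> at
  \<open>\<sigma> + it\<close> and at \<open>\<sigma>\<close> have a nonnegative sum.\<close>

lemma odd_dser_product_ge:
 assumes "\<sigma> > 1"
 shows "1 <= norm (odd.dser (Complex \<sigma> t)) * norm (odd.dser (of_real \<sigma>))"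
proof -
 define n where "n t x = (norm (odd.dser (Complex x t)))\<^sup>2" for t x
 have dn: "(n t has_real_derivative - 2 * Re (odd.vser (Complex x t)) * n t x) (at x)" if x: "x > 1" for t x
 proof -
  define D where "D = - (odd.vser (Complex x t) * odd.dser (Complex x t))"
  have C: "Complex y t = of_real y + \<i> * of_real t" for y by (simp add: complex_eq_iff)
  have "(odd.dser has_field_derivative D) (at (of_real x + \<i> * of_real t))"
   using odd.dser_derivative[of "Complex x t"] x unfolding D_def C by simp
  hence "((%z. odd.dser (z + \<i> * of_real t)) has_field_derivative D) (at (of_real x))"
   by (simp add: DERIV_shift)
  hence v: "((%x. odd.dser (Complex x t)) has_vector_derivative D) (at x)"
   unfolding C by (rule has_vector_derivative_real_field)
  have re: "((%x. Re (odd.dser (Complex x t))) has_real_derivative Re D) (at x)"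
   and im: "((%x. Im (odd.dser (Complex x t))) has_real_derivative Im D) (at x)"
   unfolding has_real_derivative_iff_has_vector_derivative
   by (rule bounded_linear.has_vector_derivative[OF bounded_linear_Re v])
     (rule bounded_linear.has_vector_derivative[OF bounded_linear_Im v])
  define w where "w = odd.dser (Complex x t)"
  have "((%x. Re (odd.dser (Complex x t)) ^ 2 + Im (odd.dser (Complex x t)) ^ 2) has_real_derivative
    2 * (Re w * Re D + Im w * Im D)) (at x)"
   using DERIV_add[OF DERIV_power[OF re, of 2] DERIV_power[OF im, of 2]] by (simp add: w_def algebra_simps)
  moreover have "2 * (Re w * Re D + Im w * Im D) = - 2 * Re (odd.vser (Complex x t)) * n t x"
   unfolding n_def cmod_power2 w_def[symmetric] D_def by (simp add: algebra_simps power2_eq_square)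
  ultimately show ?thesis unfolding n_def cmod_power2 by simp
 qed
 define \<psi> where "\<psi> x = n t x * n 0 x" for x
 have n0: "n t x >= 0" for t x by (simp add: n_def)
 have "\<psi> y <= \<psi> \<sigma>" if "y >= \<sigma>" for y
 proof (rule DERIV_nonpos_imp_nonincreasing[OF that])
  fix x assume "\<sigma> <= x" "x <= y"
  hence x: "x > 1" using assms by simp
  have "(\<psi> has_real_derivative (- 2 * Re (odd.vser (Complex x t)) * n t x) * n 0 x + (- 2 * Re (odd.vser (Complex x 0)) * n 0 x) * n t x) (at x)"
   unfolding \<psi>_def by (rule DERIV_mult[OF dn[OF x] dn[OF x]])
  moreover have "(- 2 * Re (odd.vser (Complex x t)) * n t x) * n 0 x + (- 2 * Re (odd.vser (Complex x 0)) * n 0 x) * n t x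
    = - 2 * (n t x * n 0 x) * (1 * Re (odd.vser (of_real x)) + 1 * Re (odd.vser (Complex x t)) + 0 * Re (odd.vser (Complex x (2 * t))))"
   by (simp add: algebra_simps complex_of_real_def)
  moreover have "0 <= 1 * Re (odd.vser (of_real x)) + 1 * Re (odd.vser (Complex x t)) + 0 * Re (odd.vser (Complex x (2 * t)))"
  proof (rule odd.Re_vser_nonneg_combination[OF x])
   fix y :: real show "0 <= 1 + 1 * cos y + 0 * cos (2 * y)" using cos_ge_minus_one[of y] by linarith
  qed
  ultimately have "(\<psi> has_real_derivative - 2 * (n t x * n 0 x) * (1 * Re (odd.vser (of_real x)) + 1 * Re (odd.vser (Complex x t)) + 0 * Re (odd.vser (Complex x (2 * t))))) (at x) \<and>
    0 <= 1 * Re (odd.vser (of_real x)) + 1 * Re (odd.vser (Complex x t)) + 0 * Re (odd.vser (Complex x (2 * t)))"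
   by (simp only:)
  moreover have "- 2 * (n t x * n 0 x) * Q <= 0" if "Q >= 0" for Q
   using that n0 by (intro mult_nonpos_nonneg) auto
  ultimately show "\<exists>D. (\<psi> has_real_derivative D) (at x) \<and> D <= 0"
   by blast
 qed
 \<comment> \<open>\<open>\<psi>\<close> is a product of two squared norms, hence the fourth
   power.\<close>
 moreover have "(1 - 1 / (y - 1)) ^ 4 <= \<psi> y" if "y >= 2" for y
 proof -
  have "1 - 1 / (y - 1) <= norm (odd.dser (Complex y t))" for t
   using odd_dser_near_1[of "Complex y t"] that norm_triangle_ineq2[of 1 "1 - odd.dser (Complex y t)"]
   by (simp add: norm_minus_commute)
  moreover have "0 <= 1 - 1 / (y - 1)" using that by simp
  ultimately have "(1 - 1 / (y - 1)) ^ 2 <= n t y" for t unfolding n_def by (intro power_mono)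
  hence "(1 - 1 / (y - 1)) ^ 2 * (1 - 1 / (y - 1)) ^ 2 <= n t y * n 0 y"
   by (intro mult_mono n0) auto
  thus ?thesis unfolding \<psi>_def by (simp flip: power_add)
 qed
 ultimately have ev: "(1 - 1 / (real k + 1)) ^ 4 <= \<psi> \<sigma>" if "real k >= \<sigma>" for k
 proof -
  have "(1 - 1 / ((real k + 2) - 1)) ^ 4 <= \<psi> (real k + 2)"
   using \<open>\<And>y. 2 <= y ==> (1 - 1 / (y - 1)) ^ 4 <= \<psi> y\<close>[of "real k + 2"] by simp
  also have "... <= \<psi> \<sigma>" using \<open>\<And>y. \<sigma> <= y ==> \<psi> y <= \<psi> \<sigma>\<close>[of "real k + 2"] that by simp
  finally show ?thesis by (simp add: algebra_simps)
 qed
 have "(%k. inverse (real (Suc k))) \<longlonglongrightarrow> 0" by (rule LIMSEQ_inverse_real_of_nat)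
 hence "(%k. (1 - 1 / (real k + 1)) ^ 4) \<longlonglongrightarrow> (1 - 0) ^ 4"
  by (intro tendsto_intros) (simp add: inverse_eq_divide add.commute)
 hence "(1 - 0) ^ 4 <= \<psi> \<sigma>"
  by (rule tendsto_upperbound)
    (auto intro!: eventually_sequentiallyI[of "nat \<lceil>\<sigma>\<rceil>"] ev simp: nat_le_iff ceiling_le_iff)
 hence "1 <= (norm (odd.dser (Complex \<sigma> t)) * norm (odd.dser (of_real \<sigma>)))\<^sup>2"
  by (simp add: \<psi>_def n_def power_mult_distrib complex_of_real_def)
 hence "1\<^sup>2 <= (norm (odd.dser (Complex \<sigma> t)) * norm (odd.dser (of_real \<sigma>)))\<^sup>2" by simp
 thus ?thesis by (rule power2_le_imp_le) simp
qed

text \<open>Against \<open>1 / zr\<close> this gains the factor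
  \<open>1 - 4 powr (- \<sigma>)\<close>, about 3/4 near \<open>\<sigma> = 1\<close>: the Euler
  factor at 2 contributes at most \<open>1 + 2 powr (- \<sigma>)\<close> at \<open>s\<close> and
  \<open>1 - 2 powr (- \<sigma>)\<close> at \<open>Re s\<close>.\<close>

theorem zeta_lower_bound:
 assumes s: "Re s > 1"
 shows "1 <= norm (zeta s) * ((1 - 4 powr (- Re s)) * zr (Re s))"
proof -
 have "Complex (Re s) (Im s) = s" by simp
 with odd_dser_product_ge[OF s, of "Im s"]
 have "1 <= norm (odd.dser s) * norm (odd.dser (of_real (Re s)))" by simp
 also have "... = (norm (1 - 2 powr (- s)) * norm (zeta s)) * (norm (1 - 2 powr (- of_real (Re s)) :: complex) * norm (zeta (of_real (Re s))))"
  using s by (simp add: odd_dser_eq norm_mult)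
 also have "zeta (of_real (Re s)) = of_real (zr (Re s))" using s by (rule zeta_of_real)
 also have "norm (complex_of_real (zr (Re s))) = zr (Re s)" using zr_bounds(3)[OF s] by simp
 also have "norm (1 - 2 powr (- of_real (Re s)) :: complex) = 1 - 2 powr (- Re s)"
 proof -
  have "(2::complex) powr (- of_real (Re s)) = of_real (2 powr (- Re s))"
   using powr_of_real[of 2 "- Re s"] by simp
  moreover have "2 powr (- Re s) <= 2 powr 0" using s by (intro powr_mono) auto
  moreover have "(1::complex) - of_real (2 powr (- Re s)) = of_real (1 - 2 powr (- Re s))" by simp
  ultimately show ?thesis by (simp only: norm_of_real) simp
 qed
 finally have 1: "1 <= norm (1 - 2 powr (- s)) * norm (zeta s) * ((1 - 2 powr (- Re s)) * zr (Re s))" .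
 have "norm (1 - 2 powr (- s)) <= 1 + 2 powr (- Re s)"
  using norm_triangle_ineq4[of 1 "2 powr (- s)"] norm_nat_powr[of 2 "- s"] by simp
 moreover have "2 powr (- Re s) <= 2 powr 0" using s by (intro powr_mono) auto
 ultimately have "norm (1 - 2 powr (- s)) * norm (zeta s) * ((1 - 2 powr (- Re s)) * zr (Re s))
   <= (1 + 2 powr (- Re s)) * norm (zeta s) * ((1 - 2 powr (- Re s)) * zr (Re s))"
  using zr_bounds(3)[OF s] by (intro mult_right_mono mult_nonneg_nonneg) auto
 also have "... = norm (zeta s) * ((1 - 4 powr (- Re s)) * zr (Re s))"
 proof -
  have "(4::real) powr (- Re s) = 2 powr (- Re s) * 2 powr (- Re s)"
   using powr_mult[of 2 2 "- Re s"] by simp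
  thus ?thesis by (simp add: algebra_simps)
 qed
 finally show ?thesis using 1 by linarith
qed

corollary zeta_nonzero: "Re s > 1 ==> zeta s ~= 0"
 using zeta_lower_bound[of s] by auto

section \<open>The functional equation\<close>

text \<open>Differentiate the reflection formula for \<open>Gamma z * Gamma (1 - z)\<close> and
  divide by it.\<close>

lemma Digamma_reflection_diff:
 fixes z :: complex
 assumes z: "z \<notin> \<int>"
 shows "Digamma (1 - z) - Digamma z = of_real pi * cos (of_real pi * z) / sin (of_real pi * z)"
proof -
 have z1: "z \<notin> \<int>\<^sub>\<le>\<^sub>0" "1 - z \<notin> \<int>\<^sub>\<le>\<^sub>0"
  using z by (auto dest: nonpos_Ints_Int)
 have sn: "sin (of_real pi * z) ~= 0"
  using z1 Gamma_reflection_complex[of z] Gamma_eq_zero_iff[of z] Gamma_eq_zero_iff[of "1 - z"]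
  by (metis divide_eq_0_iff mult_eq_0_iff)
 define F where "F = Gamma z * Gamma (1 - z)"
 have F0: "F ~= 0" using z1 by (simp add: F_def Gamma_eq_zero_iff)
 have "((%z. Gamma z * Gamma (1 - z)) has_field_derivative
   Gamma z * Digamma z * Gamma (1 - z) + (Gamma (1 - z) * Digamma (1 - z) * (- 1)) * Gamma z) (at z)"
  using z1 by (auto intro!: derivative_eq_intros)
 hence 1: "((%z. Gamma z * Gamma (1 - z)) has_field_derivative - F * (Digamma (1 - z) - Digamma z)) (at z)"
  by (simp add: F_def algebra_simps)
 have "((%z. of_real pi / sin (of_real pi * z)) has_field_derivative
   - (of_real pi * (cos (of_real pi * z) * of_real pi)) / (sin (of_real pi * z) * sin (of_real pi * z))) (at z)"
  using sn by (auto intro!: derivative_eq_intros)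
 hence "((%z. Gamma z * Gamma (1 - z)) has_field_derivative
   - (of_real pi * (cos (of_real pi * z) * of_real pi)) / (sin (of_real pi * z) * sin (of_real pi * z))) (at z)"
  by (simp only: Gamma_reflection_complex)
 from DERIV_unique[OF 1 this]
 have "F * (Digamma (1 - z) - Digamma z) = F * (of_real pi * cos (of_real pi * z) / sin (of_real pi * z))"
  unfolding F_def Gamma_reflection_complex using sn by (simp add: field_simps)
 thus ?thesis by (simp only: mult_left_cancel[OF F0])
qed

text \<open>At \<open>z = i y\<close> the imaginary part of the digamma difference is, up to sign, a
  sum of terms \<open>y / (n^2 + y^2)\<close> by the limit formula and a hyperbolic cotangent by
  reflection.\<close>

lemma coth_partial_fractions:
 fixes y :: real
 assumes y: "y > 0"
 shows "(%n. 2 * y / ((real (Suc n))\<^sup>2 + y\<^sup>2)) sums (pi * cosh (pi * y) / sinh (pi * y) - 1 / y)"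
proof -
 define z where "z = \<i> * of_real y"
 have zI: "z \<notin> \<int>" using y by (auto simp: z_def complex_is_Int_iff)
 have nz: "z ~= 0" "1 - z ~= 0" using y by (auto simp: z_def complex_eq_iff)
 define a where "a n = y / ((real n)\<^sup>2 + y\<^sup>2)" for n
 have "(%m. (of_real (ln (real m)) - (\<Sum>n<m. inverse (1 - z + of_nat n))) - (of_real (ln (real m)) - (\<Sum>n<m. inverse (z + of_nat n)))) \<longlonglongrightarrow> Digamma (1 - z) - Digamma z"
  by (intro tendsto_diff Digamma_LIMSEQ nz)
 hence "(%m. Im ((of_real (ln (real m)) - (\<Sum>n<m. inverse (1 - z + of_nat n))) - (of_real (ln (real m)) - (\<Sum>n<m. inverse (z + of_nat n))))) \<longlonglongrightarrow> Im (Digamma (1 - z) - Digamma z)"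
  by (rule tendsto_Im)
 moreover have "Im ((of_real (ln (real m)) - (\<Sum>n<m. inverse (1 - z + of_nat n))) - (of_real (ln (real m)) - (\<Sum>n<m. inverse (z + of_nat n))))
   = - (\<Sum>n<m. a (Suc n) + a n)" for m
 proof -
  have "Im (inverse (1 - z + of_nat n)) = a (Suc n)" "Im (inverse (z + of_nat n)) = - a n" for n
   by (simp_all add: z_def a_def Im_inverse power2_eq_square add.commute)
  thus ?thesis by (simp add: sum.distrib sum_negf)
 qed
 moreover have "(\<Sum>n<m. a (Suc n) + a n) = a 0 + 2 * (\<Sum>n<m. a (Suc n)) - a m" for m
  by (induction m) (auto simp: algebra_simps)
 ultimately have 1: "(%m. - (a 0 + 2 * (\<Sum>n<m. a (Suc n)) - a m)) \<longlonglongrightarrow> Im (Digamma (1 - z) - Digamma z)" by simp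
 have am: "a \<longlonglongrightarrow> 0"
 proof (rule tendsto_sandwich[of "%_. 0"])
  have "(%n. y * inverse (real (Suc n))) \<longlonglongrightarrow> y * 0" by (intro tendsto_mult tendsto_const LIMSEQ_inverse_real_of_nat)
  thus "(%n. y * inverse (real n)) \<longlonglongrightarrow> 0"
   by (subst (asm) filterlim_sequentially_Suc) simp
  show "\<forall>\<^sub>F n in sequentially. a n <= y * inverse (real n)"
  proof (rule eventually_sequentiallyI[of 1])
   fix n :: nat assume "1 <= n"
   hence "real n <= (real n)\<^sup>2 + y\<^sup>2" by (simp add: self_le_power add_increasing2)
   hence "y / ((real n)\<^sup>2 + y\<^sup>2) <= y / real n" using y \<open>1 <= n\<close> by (intro divide_left_mono mult_pos_pos) (auto intro: add_pos_pos)
   thus "a n <= y * inverse (real n)" by (simp add: a_def divide_inverse)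
  qed
 qed (use y in \<open>auto simp: a_def\<close>)
 have "(%m. - (- (a 0 + 2 * (\<Sum>n<m. a (Suc n)) - a m)) + a m - a 0) \<longlonglongrightarrow> - Im (Digamma (1 - z) - Digamma z) + 0 - a 0"
  by (intro tendsto_intros 1 am)
 hence 2: "(%m. \<Sum>n<m. 2 * a (Suc n)) \<longlonglongrightarrow> - Im (Digamma (1 - z) - Digamma z) - a 0"
  by (simp add: sum_distrib_left)
 have "Im (Digamma (1 - z) - Digamma z) = - (pi * cosh (pi * y) / sinh (pi * y))"
 proof -
  have e: "of_real pi * z = \<i> * of_real (pi * y)" by (simp add: z_def)
  have c: "cos (\<i> * of_real u) = of_real (cosh u)" "sin (\<i> * of_real u) = \<i> * of_real (sinh u)" for u
   by (simp_all add: complex_eq_iff cos_exp_eq sin_exp_eq cosh_def sinh_def Re_exp Im_exp Re_divide Im_divide power2_eq_square field_simps exp_of_real flip: of_real_minus)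
  have "sinh (pi * y) > 0" using y by simp
  thus ?thesis unfolding Digamma_reflection_diff[OF zI] e c
   by (simp add: Im_divide power2_eq_square)
 qed
 moreover have "a 0 = 1 / y" using y by (simp add: a_def power2_eq_square)
 ultimately show ?thesis using 2 unfolding sums_def a_def by (simp add: times_divide_eq_right)
qed

text \<open>The Bose-Einstein kernel without its first two terms at 0: it vanishes like
  \<open>x\<close> at 0 and tends to 1/2 at infinity, so its Mellin transform converges for
  \<open>-1 < s < 0\<close>. Evaluating that transform in two ways yields the functional
  equation.\<close>

definition bose :: "real => real" where "bose x = 1 / (exp x - 1) - 1 / x + 1 / 2"

text \<open>With \<open>x = 2 * pi * y\<close> the hyperbolic cotangent of \<open>pi * y\<close> is
  \<open>1 + 2 / (exp x - 1)\<close>.\<close>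

lemma bose_sums:
 assumes x: "x > 0"
 shows "(%n. 2 * x / (x\<^sup>2 + (2 * pi * real (Suc n))\<^sup>2)) sums bose x"
proof -
 define y where "y = x / (2 * pi)"
 have y: "y > 0" "x = 2 * pi * y" using x by (auto simp: y_def)
 have "(%n. 1 / (2 * pi) * (2 * y / ((real (Suc n))\<^sup>2 + y\<^sup>2))) sums (1 / (2 * pi) * (pi * cosh (pi * y) / sinh (pi * y) - 1 / y))"
  by (intro sums_mult coth_partial_fractions y)
 moreover have "1 / (2 * pi) * (2 * y / ((real (Suc n))\<^sup>2 + y\<^sup>2)) = 2 * x / (x\<^sup>2 + (2 * pi * real (Suc n))\<^sup>2)" for n
 proof -
  have "x\<^sup>2 + (2 * pi * real (Suc n))\<^sup>2 = 4 * pi\<^sup>2 * ((real (Suc n))\<^sup>2 + y\<^sup>2)"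
   by (simp add: y power_mult_distrib algebra_simps del: of_nat_Suc)
  moreover have "1 / (2 * pi) * (2 * y / Q) = 2 * x / (4 * pi\<^sup>2 * Q)" for Q
   unfolding y(2) by (simp add: power2_eq_square)
  ultimately show ?thesis by simp
 qed
 moreover have "1 / (2 * pi) * (pi * cosh (pi * y) / sinh (pi * y) - 1 / y) = bose x"
 proof -
  define e where "e = exp (pi * y)"
  have e: "e > 1" using y by (simp add: e_def)
  have ex: "exp x = e * e" unfolding e_def y(2) by (simp flip: exp_add)
  have "cosh (pi * y) = (e + 1 / e) / 2" "sinh (pi * y) = (e - 1 / e) / 2"
   by (simp_all add: cosh_def sinh_def e_def exp_minus inverse_eq_divide)
  hence "cosh (pi * y) / sinh (pi * y) = (e * e + 1) / (e * e - 1)"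
  proof -
   have cs: "cosh (pi * y) = (e * e + 1) / (2 * e)" "sinh (pi * y) = (e * e - 1) / (2 * e)"
    unfolding \<open>cosh (pi * y) = _\<close> \<open>sinh (pi * y) = _\<close> using e by (simp_all add: field_simps)
   have "(A / (2 * e)) / (B / (2 * e)) = A / B" for A B using e by simp
   thus ?thesis unfolding cs .
  qed
  moreover have "1 / (2 * pi) * (pi * c - 1 / y) = c / 2 - 1 / x" for c using y by (simp add: field_simps)
  ultimately have "1 / (2 * pi) * (pi * cosh (pi * y) / sinh (pi * y) - 1 / y) = (e * e + 1) / (e * e - 1) / 2 - 1 / x"
   by (metis times_divide_eq_right)
  also have "(e * e + 1) / (e * e - 1) = 1 + 2 / (e * e - 1)"
  proof -
   have "e * e > 1" using e by (metis less_1_mult)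
   thus ?thesis by (simp add: divide_simps)
  qed
  finally have "1 / (2 * pi) * (pi * cosh (pi * y) / sinh (pi * y) - 1 / y) = (1 + 2 / (e * e - 1)) / 2 - 1 / x" .
  moreover have "(1 + 2 / Q) / 2 = 1 / Q + 1 / 2" for Q :: real by (simp add: add_divide_distrib)
  ultimately show ?thesis unfolding bose_def ex by simp
 qed
 ultimately show ?thesis by simp
qed

text \<open>Integrals over the half line are reached through \<open>{0..k}\<close>: this passes to
  the truncations, \<open>has_integral_atLeast_0I\<close> comes back.\<close>

lemma truncated_integral_tendsto:
 fixes f :: "real => real"
 assumes f: "(f has_integral I) {0..}" and nn: "\<And>x. x >= 0 ==> f x >= 0"
 shows "f integrable_on {0..real k}" "(%k. integral {0..real k} f) \<longlonglongrightarrow> I"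
proof -
 have abs: "f absolutely_integrable_on {0..}"
  using f nn by (intro nonnegative_absolutely_integrable_1) auto
 have ab: "f absolutely_integrable_on {0..real k}" for k
  by (rule absolutely_integrable_on_subinterval[OF abs]) auto
 thus "f integrable_on {0..real k}" for k by (simp add: absolutely_integrable_on_def)
 have int: "f integrable_on {0..real k}" for k using ab by (simp add: absolutely_integrable_on_def)
 have r: "integral {0..} (%x. if x \<in> {0..real k} then f x else 0) = integral {0..real k} f" for k
 proof (rule integral_unique)
  show "((%x. if x \<in> {0..real k} then f x else 0) has_integral integral {0..real k} f) {0..}"
   using integrable_integral[OF int[of k]] by (subst has_integral_restrict) auto
 qed
 have "f integrable_on {0..} \<and> (%k. integral {0..} (%x. if x \<in> {0..real k} then f x else 0)) \<longlonglongrightarrow> integral {0..} f"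
 proof (rule monotone_convergence_increasing)
  show "(%x. if x \<in> {0..real k} then f x else 0) integrable_on {0..}" for k
   using integrable_integral[OF int[of k]] unfolding integrable_on_def
   by (intro exI, subst has_integral_restrict) auto
  show "(if x \<in> {0..real k} then f x else 0) <= (if x \<in> {0..real (Suc k)} then f x else 0)" if "x \<in> {0..}" for k x
   using nn[of x] that by auto
  show "(%k. if x \<in> {0..real k} then f x else 0) \<longlonglongrightarrow> f x" if "x \<in> {0..}" for x
  proof (rule tendsto_eventually, rule eventually_sequentiallyI[of "nat \<lceil>x\<rceil>"])
   fix k assume "nat \<lceil>x\<rceil> <= k"
   hence "x <= real k" by linarith
   thus "(if x \<in> {0..real k} then f x else 0) = f x" using that by simp
  qed
  have "norm (integral {0..real k} f) <= I" for k
  proof -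
   have "0 <= integral {0..real k} f" using nn by (intro integral_nonneg int) auto
   moreover have "integral {0..real k} f <= integral {0..} f"
    using nn f by (intro integral_subset_le int) auto
   ultimately show ?thesis using integral_unique[OF f] by simp
  qed
  thus "bounded (range (%k. integral {0..} (%x. if x \<in> {0..real k} then f x else 0)))"
   unfolding r by (auto simp: bounded_iff)
 qed
 thus "(%k. integral {0..real k} f) \<longlonglongrightarrow> I" unfolding r integral_unique[OF f] by simp
qed

lemma has_integral_atLeast_0I:
 fixes f :: "real => real"
 assumes f: "\<And>k. (f has_integral J k) {0..real k}" and nn: "\<And>x. x >= 0 ==> f x >= 0" and J: "J \<longlonglongrightarrow> I"
 shows "(f has_integral I) {0..}"
proof (rule has_integral_monotone_convergence_increasing)
 show "((%x. if x \<in> {0..real k} then f x else 0) has_integral J k) {0..}" for k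
  using f[of k] by (subst has_integral_restrict) auto
 show "(if x \<in> {0..real k} then f x else 0) <= (if x \<in> {0..real (Suc k)} then f x else 0)" if "x \<in> {0..}" for k x
  using nn[of x] that by auto
 show "(%k. if x \<in> {0..real k} then f x else 0) \<longlonglongrightarrow> f x" if "x \<in> {0..}" for x
 proof (rule tendsto_eventually, rule eventually_sequentiallyI[of "nat \<lceil>x\<rceil>"])
  fix k assume "nat \<lceil>x\<rceil> <= k"
  hence "x <= real k" by linarith
  thus "(if x \<in> {0..real k} then f x else 0) = f x" using that by simp
 qed
qed (rule J)

text \<open>Lowers the exponent of a Mellin transform by one while passing to an antiderivative:
  from \<open>exp (- x)\<close> to \<open>1 - exp (- x)\<close>, and on to
  \<open>exp (- x) - 1 + x\<close>.\<close>

lemma mellin_by_parts: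
 fixes \<phi> \<psi> :: "real => real"
 assumes p: "p < 0" and \<phi>0: "\<And>x. x >= 0 ==> \<phi> x >= 0" and \<psi>0: "\<And>x. x >= 0 ==> \<psi> x >= 0"
  and d: "\<And>x. x > 0 ==> (\<phi> has_real_derivative \<psi> x) (at x)"
  and I: "((%x. \<psi> x * x powr p) has_integral I) {0..}"
  and lim0: "((%x. \<phi> x * x powr p) \<longlongrightarrow> 0) (at_right 0)"
  and lim1: "(%k. \<phi> (real k) * real k powr p) \<longlonglongrightarrow> 0"
 shows "((%x. \<phi> x * x powr (p - 1)) has_integral - I / p) {0..}"
proof (rule has_integral_atLeast_0I)
 note tr = truncated_integral_tendsto[OF I]
 have nn: "\<psi> x * x powr p >= 0" if "x >= 0" for x using \<psi>0[OF that] by simp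
 fix k :: nat
 have "((%x. \<psi> x * x powr p + \<phi> x * (p * x powr (p - 1))) has_integral \<phi> (real k) * real k powr p - \<phi> 0 * 0 powr p) {0..real k}"
 proof (rule fundamental_theorem_of_calculus_interior)
  show "continuous_on {0..real k} (%x. \<phi> x * x powr p)"
  proof (cases "k = 0")
   case False
   have cont: "isCont (%x. \<phi> x * x powr p) x" if "x > 0" for x
    using that DERIV_isCont[OF d[OF that]] by (intro continuous_intros) auto
   show ?thesis
   proof (rule continuous_on_IccI)
    \<comment> \<open>\<open>0 powr p\<close> is 0, so the assumed limit at 0 is precisely
      continuity at the left endpoint.\<close>
    show "((%x. \<phi> x * x powr p) \<longlongrightarrow> \<phi> 0 * 0 powr p) (at_right 0)" using lim0 by simp
    show "((%x. \<phi> x * x powr p) \<longlongrightarrow> \<phi> (real k) * real k powr p) (at_left (real k))"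
     using cont[of "real k"] False unfolding isCont_def filterlim_at_split by simp
    show "((%x. \<phi> x * x powr p) \<longlongrightarrow> \<phi> y * y powr p) (at y)" if "0 < y" for y
     using cont[OF that] unfolding isCont_def .
   qed (use False in auto)
  qed auto
 next
  fix x assume "x \<in> {0<..<real k}"
  hence x: "x > 0" by simp
  have "((%x. \<phi> x * x powr p) has_real_derivative \<psi> x * x powr p + (p * x powr (p - 1)) * \<phi> x) (at x)"
   using x by (intro DERIV_mult d has_real_derivative_powr)
  thus "((%x. \<phi> x * x powr p) has_vector_derivative \<psi> x * x powr p + \<phi> x * (p * x powr (p - 1))) (at x)"
   unfolding has_real_derivative_iff_has_vector_derivative by (simp add: mult.commute)
 qed simp
 from has_integral_diff[OF this integrable_integral[OF tr(1)[OF nn]]]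
 have "((%x. \<phi> x * (p * x powr (p - 1))) has_integral \<phi> (real k) * real k powr p - integral {0..real k} (%x. \<psi> x * x powr p)) {0..real k}"
  by simp
 from has_integral_mult_right[OF this, of "1 / p"] p
 show "((%x. \<phi> x * x powr (p - 1)) has_integral (1 / p) * (\<phi> (real k) * real k powr p - integral {0..real k} (%x. \<psi> x * x powr p))) {0..real k}"
  by (simp add: field_simps)
next
 have nn: "\<psi> x * x powr p >= 0" if "x >= 0" for x using \<psi>0[OF that] by simp
 have "(%k. (1 / p) * (\<phi> (real k) * real k powr p - integral {0..real k} (%x. \<psi> x * x powr p))) \<longlonglongrightarrow> (1 / p) * (0 - I)"
  by (intro tendsto_intros lim1 truncated_integral_tendsto(2)[OF I nn])
 thus "(%k. (1 / p) * (\<phi> (real k) * real k powr p - integral {0..real k} (%x. \<psi> x * x powr p))) \<longlonglongrightarrow> - I / p"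
  by simp
qed (use \<phi>0 in auto)

lemma has_integral_scale:
 fixes f :: "real => real"
 assumes f: "(f has_integral I) {0..}" and nn: "\<And>x. x >= 0 ==> f x >= 0" and c: "c > 0"
 shows "((%x. f (c * x)) has_integral I / c) {0..}"
proof -
 have im: "(*) c ` {0..} = {0..}"
 proof
  show "{0..} \<subseteq> (*) c ` {0..}"
  proof
   fix x :: real assume "x \<in> {0..}"
   hence "x = c * (x / c)" "x / c \<in> {0..}" using c by auto
   thus "x \<in> (*) c ` {0..}" by blast
  qed
 qed (use c in auto)
 have "f absolutely_integrable_on {0..}"
  using f nn by (intro nonnegative_absolutely_integrable_1) auto
 hence "(%x. \<bar>c\<bar> * f (c * x)) absolutely_integrable_on {0..} \<and> integral {0..} (%x. \<bar>c\<bar> * f (c * x)) = I"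
  using c by (subst has_absolute_integral_change_of_variables_1'[where g = "(*) c"])
   (auto simp: im integral_unique[OF f] inj_on_def intro!: derivative_eq_intros)
 hence "((%x. c * f (c * x)) has_integral I) {0..}"
  using c by (auto simp: absolutely_integrable_on_def has_integral_iff)
 from has_integral_mult_right[OF this, of "1 / c"] show ?thesis using c by simp
qed

lemma powr_tendsto_0:
 fixes p :: real
 assumes "p > 0"
 shows "((%x. x powr p) \<longlongrightarrow> 0) (at_right 0)"
proof -
 have "\<forall>\<^sub>F x in at_right 0. (0::real) <= x"
  by (rule eventually_mono[OF eventually_at_right_less]) simp
 hence "((%x. x powr p) \<longlongrightarrow> 0 powr p) (at_right (0::real))"
  using assms by (intro tendsto_powr' tendsto_const tendsto_ident_at) auto
 thus ?thesis by simp
qed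

lemma Gamma_integral_powr:
 fixes s :: real
 assumes "s > -1"
 shows "((%x. exp (- x) * x powr s) has_integral Gamma (s + 1)) {0..}"
proof -
 have "((%t. t powr ((s + 1) - 1) / exp t) has_integral Gamma (s + 1)) {0..}"
  using assms by (intro Gamma_integral_real) auto
 moreover have "t powr ((s + 1) - 1) / exp t = exp (- t) * t powr s" for t
  by (simp add: exp_minus field_simps)
 ultimately show ?thesis by simp
qed

lemma mellin_one_minus_exp:
 fixes s :: real
 assumes s: "-1 < s" "s < 0"
 shows "((%x. (1 - exp (- x)) * x powr (s - 1)) has_integral - Gamma s) {0..}"
proof -
 have "((%x. (1 - exp (- x)) * x powr (s - 1)) has_integral - Gamma (s + 1) / s) {0..}"
 proof (rule mellin_by_parts[where \<phi> = "%x. 1 - exp (- x)" and \<psi> = "%x. exp (- x)", OF s(2) _ _ _ Gamma_integral_powr[OF s(1)]])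
  show "((%x. 1 - exp (- x)) has_real_derivative exp (- x)) (at x)" for x
   by (auto intro!: derivative_eq_intros)
  show "((%x. (1 - exp (- x)) * x powr s) \<longlongrightarrow> 0) (at_right 0)"
  proof (rule tendsto_sandwich[of "%_. 0"])
   show "\<forall>\<^sub>F x in at_right 0. (1 - exp (- x)) * x powr s <= x powr (1 + s)"
   proof (rule eventually_at_rightI[of 0 1])
    fix x :: real assume "x \<in> {0<..<1}"
    hence "(1 - exp (- x)) * x powr s <= x * x powr s"
     using exp_ge_add_one_self[of "- x"] by (intro mult_right_mono) auto
    also have "... = x powr (1 + s)" using \<open>x \<in> {0<..<1}\<close> powr_add[of x 1 s] by simp
    finally show "(1 - exp (- x)) * x powr s <= x powr (1 + s)" .
   qed simp
   show "((%x. x powr (1 + s)) \<longlongrightarrow> 0) (at_right 0)"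
    using s by (intro powr_tendsto_0) simp
  qed (auto intro!: eventually_at_rightI[of 0 1])
  show "(%k. (1 - exp (- real k)) * real k powr s) \<longlonglongrightarrow> 0"
  proof (rule tendsto_sandwich[of "%_. 0"])
   show "(%k. real k powr s) \<longlonglongrightarrow> 0" using s by (intro tendsto_neg_powr filterlim_real_sequentially) auto
   show "\<forall>\<^sub>F k in sequentially. (1 - exp (- real k)) * real k powr s <= real k powr s"
    by (auto intro!: always_eventually mult_left_le_one_le)
  qed (auto intro!: always_eventually)
 qed auto
 moreover have "Gamma (s + 1) = s * Gamma s"
  using s by (intro Gamma_plus1) (auto simp: nonpos_Ints_def dest!: arg_cong[of _ _ real_of_int])
 ultimately show ?thesis using s by simp
qed

lemma mellin_second_order:
 fixes s :: real
 assumes s: "-1 < s" "s < 0"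
 shows "((%x. (exp (- x) - 1 + x) * x powr (s - 2)) has_integral Gamma s / (s - 1)) {0..}"
proof -
 have "((%x. (exp (- x) - 1 + x) * x powr ((s - 1) - 1)) has_integral - (- Gamma s) / (s - 1)) {0..}"
 proof (rule mellin_by_parts[where \<phi> = "%x. exp (- x) - 1 + x" and \<psi> = "%x. 1 - exp (- x)" and p = "s - 1", OF _ _ _ _ mellin_one_minus_exp[OF s]])
  show "exp (- x) - 1 + x >= 0" for x :: real using exp_ge_add_one_self[of "- x"] by simp
  show "((%x. exp (- x) - 1 + x) has_real_derivative 1 - exp (- x)) (at x)" for x
   by (auto intro!: derivative_eq_intros)
  show "((%x. (exp (- x) - 1 + x) * x powr (s - 1)) \<longlongrightarrow> 0) (at_right 0)"
  proof (rule tendsto_sandwich[of "%_. 0"])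
   show "\<forall>\<^sub>F x in at_right 0. (exp (- x) - 1 + x) * x powr (s - 1) <= x powr (1 + s)"
   proof (rule eventually_at_rightI[of 0 1])
    fix x :: real assume x: "x \<in> {0<..<1}"
    have "exp (- x) <= 1 - x + x\<^sup>2"
    proof -
     have "1 + x <= exp x" by (rule exp_ge_add_one_self)
     hence "exp (- x) <= 1 / (1 + x)" using x by (simp add: exp_minus divide_simps)
     also have "... <= 1 - x + x\<^sup>2" using x by (simp add: divide_simps power2_eq_square algebra_simps)
     finally show ?thesis .
    qed
    hence "(exp (- x) - 1 + x) * x powr (s - 1) <= x\<^sup>2 * x powr (s - 1)"
     by (intro mult_right_mono) auto
    also have "... = x powr (1 + s)" using x powr_add[of x 2 "s - 1"] by simp
    finally show "(exp (- x) - 1 + x) * x powr (s - 1) <= x powr (1 + s)" .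
   qed simp
   show "((%x. x powr (1 + s)) \<longlongrightarrow> 0) (at_right 0)"
    using s by (intro powr_tendsto_0) simp
   show "\<forall>\<^sub>F x in at_right 0. 0 <= (exp (- x) - 1 + x) * x powr (s - 1)"
   proof (rule eventually_at_rightI[of 0 1])
    fix x :: real
    show "0 <= (exp (- x) - 1 + x) * x powr (s - 1)" using exp_ge_add_one_self[of "- x"] by simp
   qed simp
  qed auto
  show "(%k. (exp (- real k) - 1 + real k) * real k powr (s - 1)) \<longlonglongrightarrow> 0"
  proof (rule tendsto_sandwich[of "%_. 0"])
   show "(%k. real k powr s) \<longlonglongrightarrow> 0" using s by (intro tendsto_neg_powr filterlim_real_sequentially) auto
   show "\<forall>\<^sub>F k in sequentially. (exp (- real k) - 1 + real k) * real k powr (s - 1) <= real k powr s"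
   proof (rule eventually_sequentiallyI[of 1])
    fix k :: nat assume k: "k >= 1"
    have "(exp (- real k) - 1 + real k) * real k powr (s - 1) <= real k * real k powr (s - 1)"
     by (intro mult_right_mono) auto
    also have "... = real k powr s" using k powr_add[of "real k" 1 "s - 1"] by simp
    finally show "(exp (- real k) - 1 + real k) * real k powr (s - 1) <= real k powr s" .
   qed
   show "\<forall>\<^sub>F k in sequentially. 0 <= (exp (- real k) - 1 + real k) * real k powr (s - 1)"
   proof (rule always_eventually, rule allI)
    fix k show "0 <= (exp (- real k) - 1 + real k) * real k powr (s - 1)"
     using exp_ge_add_one_self[of "- real k"] by simp
   qed
  qed auto
 qed (use s in auto)
 thus ?thesis by simp
qed

text \<open>The substitution \<open>x = sqrt (t / (1 - t))\<close> turns the case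
  \<open>c = 1\<close> into a Beta integral, evaluated by the reflection formula; scaling gives
  general \<open>c\<close>.\<close>

lemma integral_power_over_quadratic:
 assumes s: "-1 < s" "s < 1" and c: "c > 0"
 shows "((%x. x powr s / (x\<^sup>2 + c\<^sup>2)) has_integral c powr (s - 1) * (pi / (2 * cos (pi * s / 2)))) {0..}"
proof -
 define g where "g t = (t / (1 - t)) powr (1 / 2)" for t :: real
 define f where "f x = x powr s / (x\<^sup>2 + 1)" for x :: real
 define S where "S = {0<..<1::real}"
 have gd: "(g has_real_derivative 1 / 2 * (t / (1 - t)) powr (- (1 / 2)) * (1 / (1 - t)\<^sup>2)) (at t within S)" if t: "t \<in> S" for t
 proof -
  have t01: "0 < t" "t < 1" using t by (auto simp: S_def)
  have "((%t. t / (1 - t)) has_real_derivative 1 / (1 - t)\<^sup>2) (at t within S)"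
   using t01 by (auto intro!: derivative_eq_intros simp: power2_eq_square divide_simps)
  hence "((%t. (t / (1 - t)) powr (1 / 2)) has_real_derivative (1 / 2 * (t / (1 - t)) powr (1 / 2 - 1)) * (1 / (1 - t)\<^sup>2)) (at t within S)"
   using t01 by (intro DERIV_chain2[OF has_real_derivative_powr]) auto
  thus ?thesis unfolding g_def by simp
 qed
 have inj: "inj_on g S"
 proof (rule inj_onI)
  fix u v assume uv: "u \<in> S" "v \<in> S" "g u = g v"
  hence p: "0 < u / (1 - u)" "0 < v / (1 - v)" by (auto simp: S_def)
  have "(g u)\<^sup>2 = (g v)\<^sup>2" using uv by simp
  hence "u / (1 - u) = v / (1 - v)" using p by (simp add: g_def powr_half_sqrt)
  thus "u = v" using uv by (simp add: S_def divide_simps algebra_simps)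
 qed
 have im: "g ` S = {0<..}"
 proof
  show "g ` S \<subseteq> {0<..}" by (auto simp: S_def g_def)
  show "{0<..} \<subseteq> g ` S"
  proof
   fix x :: real assume x: "x \<in> {0<..}"
   define t where "t = x\<^sup>2 / (1 + x\<^sup>2)"
   have p: "1 + x\<^sup>2 > 0" by (simp add: add_pos_nonneg)
   have "t \<in> S" using x p by (auto simp: t_def S_def divide_simps)
   moreover have "1 - t = 1 / (1 + x\<^sup>2)" using p by (simp add: t_def divide_simps)
   hence "t / (1 - t) = x\<^sup>2" using p by (simp add: t_def)
   hence "g t = x" using x by (simp add: g_def powr_half_sqrt)
   ultimately show "x \<in> g ` S" by blast
  qed
 qed
 have ptw: "\<bar>1 / 2 * (t / (1 - t)) powr (- (1 / 2)) * (1 / (1 - t)\<^sup>2)\<bar> * f (g t)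
   = 1 / 2 * (t powr ((s + 1) / 2 - 1) * (1 - t) powr ((1 - s) / 2 - 1))" if t: "t \<in> S" for t
 proof -
  have t01: "0 < t" "t < 1" using t by (auto simp: S_def)
  have g2: "(g t)\<^sup>2 = t / (1 - t)" using t01 by (simp add: g_def powr_half_sqrt)
  have "(g t)\<^sup>2 + 1 = 1 / (1 - t)" unfolding g2 using t01 by (simp add: divide_simps)
  moreover have "g t powr s = (t / (1 - t)) powr (s / 2)" by (simp add: g_def powr_powr)
  ultimately have fg: "f (g t) = (t / (1 - t)) powr (s / 2) * (1 - t)" by (simp add: f_def)
  have "\<bar>1 / 2 * (t / (1 - t)) powr (- (1 / 2)) * (1 / (1 - t)\<^sup>2)\<bar> * f (g t)
    = 1 / 2 * ((t / (1 - t)) powr (- (1 / 2)) * (t / (1 - t)) powr (s / 2)) * ((1 - t) / (1 - t)\<^sup>2)"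
   unfolding fg by (simp add: abs_mult)
  also have "(t / (1 - t)) powr (- (1 / 2)) * (t / (1 - t)) powr (s / 2) = (t / (1 - t)) powr ((s + 1) / 2 - 1)"
   by (subst powr_add[symmetric]) (simp add: field_simps)
  also have "... = t powr ((s + 1) / 2 - 1) * (1 - t) powr (- ((s + 1) / 2 - 1))"
  proof -
   have "(t / (1 - t)) powr a = t powr a * (1 - t) powr (- a)" for a
    using t01 by (subst powr_divide) (auto simp: powr_minus divide_inverse)
   thus ?thesis by (simp only: mult.assoc)
  qed
  also have "(1 - t) / (1 - t)\<^sup>2 = (1 - t) powr (- 1)"
  proof -
   have "(1 - t) / (1 - t)\<^sup>2 = inverse (1 - t)" using t01 by (simp add: power2_eq_square divide_inverse)
   thus ?thesis using t01 by (simp add: powr_minus)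
  qed
  also have "1 / 2 * (t powr ((s + 1) / 2 - 1) * (1 - t) powr (- ((s + 1) / 2 - 1))) * (1 - t) powr (- 1)
    = 1 / 2 * (t powr ((s + 1) / 2 - 1) * ((1 - t) powr (- ((s + 1) / 2 - 1)) * (1 - t) powr (- 1)))" by simp
  also have "(1 - t) powr (- ((s + 1) / 2 - 1)) * (1 - t) powr (- 1) = (1 - t) powr ((1 - s) / 2 - 1)"
   by (subst powr_add[symmetric]) (simp add: field_simps)
  finally show ?thesis .
 qed
 define B where "B = 1 / 2 * Beta ((s + 1) / 2) ((1 - s) / 2)"
 have "((%t. 1 / 2 * (t powr ((s + 1) / 2 - 1) * (1 - t) powr ((1 - s) / 2 - 1))) has_integral B) {0..1}"
  unfolding B_def using s by (intro has_integral_mult_right has_integral_Beta_real) auto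
 hence hS: "((%t. 1 / 2 * (t powr ((s + 1) / 2 - 1) * (1 - t) powr ((1 - s) / 2 - 1))) has_integral B) S"
  unfolding S_def by (simp add: has_integral_Icc_iff_Ioo)
 hence hS': "((%t. \<bar>1 / 2 * (t / (1 - t)) powr (- (1 / 2)) * (1 / (1 - t)\<^sup>2)\<bar> * f (g t)) has_integral B) S"
  by (rule has_integral_eq[rotated]) (erule ptw[symmetric])
 moreover have "(%t. \<bar>1 / 2 * (t / (1 - t)) powr (- (1 / 2)) * (1 / (1 - t)\<^sup>2)\<bar> * f (g t)) absolutely_integrable_on S"
  using hS' by (intro nonnegative_absolutely_integrable_1) (auto simp: f_def integrable_on_def)
 ultimately have "(%t. \<bar>1 / 2 * (t / (1 - t)) powr (- (1 / 2)) * (1 / (1 - t)\<^sup>2)\<bar> * f (g t)) absolutely_integrable_on S \<and>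
   integral S (%t. \<bar>1 / 2 * (t / (1 - t)) powr (- (1 / 2)) * (1 / (1 - t)\<^sup>2)\<bar> * f (g t)) = B"
  by (simp only: integral_unique)
 hence "f absolutely_integrable_on g ` S \<and> integral (g ` S) f = B"
  using has_absolute_integral_change_of_variables_1'[OF _ gd inj, of f B] by (simp add: S_def)
 hence "(f has_integral B) {0<..}" unfolding im by (auto simp: absolutely_integrable_on_def has_integral_iff)
 hence "(f has_integral B) {0..}"
 proof (rule has_integral_spike_set_eq[THEN iffD1, rotated 2])
  show "negligible {x \<in> {0..} - {0<..}. f x ~= 0}" by (rule negligible_subset[of "{0}"]) auto
  have "{x \<in> {0<..} - {0..}. f x ~= 0} = {}" by auto
  thus "negligible {x \<in> {0<..} - {0..}. f x ~= 0}" by (simp only: negligible_empty)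
 qed
 moreover have "f x >= 0" for x by (simp add: f_def)
 ultimately have "((%x. f (1 / c * x)) has_integral B / (1 / c)) {0..}" using c by (intro has_integral_scale) auto
 from has_integral_mult_right[OF this, of "c powr (s - 2)"]
 have "((%x. c powr (s - 2) * f (x / c)) has_integral c powr (s - 2) * (B * c)) {0..}" by simp
 moreover have "c powr (s - 2) * (B * c) = c powr (s - 1) * B"
  using c powr_add[of c "s - 2" 1] by simp
 moreover have "c powr (s - 2) * f (x / c) = x powr s / (x\<^sup>2 + c\<^sup>2)" if "x >= 0" for x
 proof -
  have "c powr s = c powr (s - 2) * c\<^sup>2" using c powr_add[of c "s - 2" 2] by simp
  moreover have "(x / c)\<^sup>2 + 1 = (x\<^sup>2 + c\<^sup>2) / c\<^sup>2" using c by (simp add: power_divide divide_simps)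
  ultimately show ?thesis using c that by (simp add: f_def powr_divide)
 qed
 ultimately have "((%x. x powr s / (x\<^sup>2 + c\<^sup>2)) has_integral c powr (s - 1) * B) {0..}"
  using has_integral_eq[of "{0..}" "%x. c powr (s - 2) * f (x / c)" "%x. x powr s / (x\<^sup>2 + c\<^sup>2)" "c powr (s - 1) * B"]
  by (metis atLeast_iff)
 moreover have "B = pi / (2 * cos (pi * s / 2))"
 proof -
  have ab: "(s + 1) / 2 + (1 - s) / 2 = 1" "(1 - s) / 2 = 1 - (s + 1) / 2" by (simp_all add: field_simps)
  have "Beta ((s + 1) / 2) ((1 - s) / 2) = Gamma ((s + 1) / 2) * Gamma (1 - (s + 1) / 2)"
   unfolding Beta_def ab(1) ab(2)[symmetric] by simp
  also have "... = pi / sin (pi * ((s + 1) / 2))"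
  proof -
   have "complex_of_real (Gamma ((s + 1) / 2) * Gamma (1 - (s + 1) / 2)) = of_real (pi / sin (pi * ((s + 1) / 2)))"
    using Gamma_reflection_complex[of "of_real ((s + 1) / 2)"]
    by (simp only: of_real_mult of_real_divide sin_of_real[symmetric] Gamma_complex_of_real[symmetric] of_real_diff of_real_1)
   thus ?thesis by (simp only: of_real_eq_iff)
  qed
  also have "sin (pi * ((s + 1) / 2)) = cos (pi * s / 2)"
   using sin_add[of "pi * s / 2" "pi / 2"] by (simp add: field_simps)
  finally show ?thesis by (simp add: B_def)
 qed
 ultimately show ?thesis by simp
qed

lemma mellin_one_minus_exp_scaled:
 fixes s c :: real
 assumes s: "-1 < s" "s < 0" and c: "c > 0"
 shows "((%x. (1 - exp (- (c * x))) * x powr (s - 1)) has_integral - (Gamma s * c powr (- s))) {0..}"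
proof -
 have nn: "(1 - exp (- x)) * x powr (s - 1) >= 0" if "x >= 0" for x :: real
  using that by (intro mult_nonneg_nonneg) auto
 have "((%x. c powr (1 - s) * ((1 - exp (- (c * x))) * (c * x) powr (s - 1))) has_integral c powr (1 - s) * (- Gamma s / c)) {0..}"
  by (intro has_integral_mult_right has_integral_scale[OF mellin_one_minus_exp[OF s] nn c])
 moreover have "c powr (1 - s) * ((1 - exp (- (c * x))) * (c * x) powr (s - 1)) = (1 - exp (- (c * x))) * x powr (s - 1)"
  if "x \<in> {0..}" for x
 proof -
  have "c powr (1 - s) * c powr (s - 1) = 1" using c by (simp flip: powr_add)
  thus ?thesis using that c by (simp add: powr_mult mult_ac)
 qed
 moreover have "c powr (1 - s) * (- Gamma s / c) = - (Gamma s * c powr (- s))"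
  using c by (simp add: powr_diff powr_minus field_simps)
 ultimately show ?thesis using has_integral_eq[of "{0..}"] by (metis (no_types, lifting))
qed

lemma mellin_second_order_scaled:
 fixes s c :: real
 assumes s: "-1 < s" "s < 0" and c: "c > 0"
 shows "((%x. (exp (- (c * x)) - 1 + c * x) * x powr (s - 2)) has_integral - (Gamma s * (c powr (1 - s) / (1 - s)))) {0..}"
proof -
 have nn: "(exp (- x) - 1 + x) * x powr (s - 2) >= 0" for x :: real
  using exp_ge_add_one_self[of "- x"] by (intro mult_nonneg_nonneg) auto
 have "((%x. c powr (2 - s) * ((exp (- (c * x)) - 1 + c * x) * (c * x) powr (s - 2))) has_integral c powr (2 - s) * (Gamma s / (s - 1) / c)) {0..}"
  by (intro has_integral_mult_right has_integral_scale[OF mellin_second_order[OF s] nn c])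
 moreover have "c powr (2 - s) * ((exp (- (c * x)) - 1 + c * x) * (c * x) powr (s - 2)) = (exp (- (c * x)) - 1 + c * x) * x powr (s - 2)"
  if "x \<in> {0..}" for x
 proof -
  have "c powr (2 - s) * c powr (s - 2) = 1" using c by (simp flip: powr_add)
  thus ?thesis using that c by (simp add: powr_mult mult_ac)
 qed
 moreover have "c powr (2 - s) * (Gamma s / (s - 1) / c) = - (Gamma s * (c powr (1 - s) / (1 - s)))"
 proof -
  have "c powr (2 - s) = c * c powr (1 - s)" using c powr_add[of c 1 "1 - s"] by (simp add: add.commute)
  moreover have "s - 1 = - (1 - s)" by simp
  ultimately show ?thesis using c s by (simp only: divide_minus_right) simp
 qed
 ultimately show ?thesis using has_integral_eq[of "{0..}"] by (metis (no_types, lifting))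
qed

lemma bose_nonneg: "x > 0 ==> bose x >= 0"
 using sums_le[OF _ sums_zero bose_sums[of x]] by simp

text \<open>The factor on the left cuts the geometric series of \<open>1 / (exp x - 1)\<close> down
  to finitely many terms. What remains is a combination of functions with known Mellin transforms,
  and it increases to \<open>bose x\<close> with \<open>N\<close>.\<close>

lemma geometric_bose:
 assumes x: "x > 0"
 shows "(1 - exp (- (real (N + 1) * x))) * bose x =
  - (\<Sum>n=1..<N+1. 1 - exp (- (real n * x))) - (1 - exp (- (real (N + 1) * x))) / 2 + (exp (- (real (N + 1) * x)) - 1 + real (N + 1) * x) / x"
proof -
 have g: "(\<Sum>n=1..<N+1. exp (- (real n * x))) * (exp x - 1) = 1 - exp (- (real N * x))" for N
 proof (induction N)
  case (Suc N)
  have "(\<Sum>n=1..<Suc N+1. exp (- (real n * x))) = (\<Sum>n=1..<N+1. exp (- (real n * x))) + exp (- (real (Suc N) * x))" by simp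
  moreover have "exp (- (real (Suc N) * x)) * exp x = exp (- (real N * x))" by (simp flip: exp_add add: algebra_simps)
  ultimately show ?case using Suc by (simp only: distrib_right) (simp add: algebra_simps)
 qed simp
 define E where "E = exp (- (real (N + 1) * x))"
 have ex: "exp x - 1 > 0" using x by simp
 have gN: "(\<Sum>n=1..<N+1. exp (- (real n * x))) + E = (1 - E) / (exp x - 1)"
  using g[of "N + 1"] ex unfolding E_def by (simp add: field_simps)
 have "(\<Sum>n=1..<N+1. 1 - exp (- (real n * x))) = real N - (\<Sum>n=1..<N+1. exp (- (real n * x)))" by (simp add: sum_subtractf)
 also have "... = real N - ((1 - E) / (exp x - 1) - E)" using gN by linarith
 finally have 1: "(\<Sum>n=1..<N+1. 1 - exp (- (real n * x))) = real N - ((1 - E) / (exp x - 1) - E)" .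
 have 2: "(E - 1 + real (N + 1) * x) / x = - (1 - E) / x + real N + 1" using x by (simp add: field_simps)
 have 3: "(1 - E) * bose x = (1 - E) / (exp x - 1) - (1 - E) / x + (1 - E) / 2"
  by (simp add: bose_def algebra_simps diff_divide_distrib)
 show ?thesis unfolding E_def[symmetric] 1 2 3 minus_divide_left[symmetric] by (simp add: diff_divide_distrib)
qed

lemma mellin_bose_truncated:
 fixes s :: real
 assumes s: "-1 < s" "s < 0"
 shows "((%x. (1 - exp (- (real (N + 1) * x))) * bose x * x powr (s - 1)) has_integral
   Gamma s * ((\<Sum>n=1..<N+1. real n powr (- s)) + real (N + 1) powr (- s) / 2 - real (N + 1) powr (1 - s) / (1 - s))) {0..}"
proof -
 have "((%x. - (\<Sum>n=1..<N+1. (1 - exp (- (real n * x))) * x powr (s - 1)) - 1 / 2 * ((1 - exp (- (real (N + 1) * x))) * x powr (s - 1))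
   + (exp (- (real (N + 1) * x)) - 1 + real (N + 1) * x) * x powr (s - 2)) has_integral
   - (\<Sum>n=1..<N+1. - (Gamma s * real n powr (- s))) - 1 / 2 * (- (Gamma s * real (N + 1) powr (- s)))
   + - (Gamma s * (real (N + 1) powr (1 - s) / (1 - s)))) {0..}"
  using s by (intro has_integral_add has_integral_diff has_integral_neg has_integral_sum has_integral_mult_right
    mellin_one_minus_exp_scaled mellin_second_order_scaled) auto
 moreover have "- (\<Sum>n=1..<N+1. (1 - exp (- (real n * x))) * x powr (s - 1)) - 1 / 2 * ((1 - exp (- (real (N + 1) * x))) * x powr (s - 1))
   + (exp (- (real (N + 1) * x)) - 1 + real (N + 1) * x) * x powr (s - 2)
   = (1 - exp (- (real (N + 1) * x))) * bose x * x powr (s - 1)" if x: "x \<in> {0..}" for x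
 proof (cases "x = 0")
  case False
  hence x: "x > 0" using x by simp
  have xs: "x powr (s - 2) = x powr (s - 1) / x" using x powr_diff[of x "s - 1" 1] by simp
  have alg: "- A - 1 / 2 * (B * p) + C * (p / x) = (- a - B / 2 + C / x) * p" if "A = a * p" for A B C p a :: real
   unfolding that by (simp add: algebra_simps)
  show ?thesis unfolding geometric_bose[OF x] xs by (rule alg[OF sum_distrib_right[symmetric]])
 qed simp
 moreover have "- (\<Sum>n=1..<N+1. - (Gamma s * real n powr (- s))) - 1 / 2 * (- (Gamma s * real (N + 1) powr (- s)))
   + - (Gamma s * (real (N + 1) powr (1 - s) / (1 - s)))
   = Gamma s * ((\<Sum>n=1..<N+1. real n powr (- s)) + real (N + 1) powr (- s) / 2 - real (N + 1) powr (1 - s) / (1 - s))"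
  by (simp add: sum_negf sum_distrib_left right_diff_distrib distrib_left)
 ultimately show ?thesis using has_integral_eq[of "{0..}"] by (metis (no_types, lifting))
qed

lemma zeta_real_limit:
 fixes s :: real
 assumes s: "-1 < s" "s < 0"
 shows "(%N. (\<Sum>n=1..<N+1. real n powr (- s)) + real (N + 1) powr (- s) / 2 - real (N + 1) powr (1 - s) / (1 - s)) \<longlonglongrightarrow> Re (zeta (of_real s))"
  and "Im (zeta (of_real s)) = 0"
proof -
 define a where "a N = (\<Sum>n=1..<N+1. real n powr (- s)) + real (N + 1) powr (- s) / 2 - real (N + 1) powr (1 - s) / (1 - s)" for N
 have eq: "(\<Sum>n=1..<N+1. of_nat n powr (- of_real s)) + of_nat (N + 1) powr (- of_real s) / 2 - of_nat (N + 1) powr (1 - of_real s) / (1 - of_real s) = complex_of_real (a N)" for N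
 proof -
  have p: "of_nat n powr (- of_real s) = complex_of_real (real n powr (- s))" for n
   using nat_powr_of_real[of n "- s"] by (simp only: of_real_minus)
  have q: "of_nat n powr (1 - of_real s) = complex_of_real (real n powr (1 - s))" for n
   using nat_powr_of_real[of n "1 - s"] by (simp only: of_real_diff of_real_1)
  show ?thesis unfolding p q a_def by (simp del: of_nat_Suc of_nat_add)
 qed
 have L: "(%N. complex_of_real (a N)) \<longlonglongrightarrow> zeta (of_real s)"
  using zeta_limit[of "of_real s"] s unfolding eq by auto
 show "a \<longlonglongrightarrow> Re (zeta (of_real s))" using tendsto_Re[OF L] by simp
 have "(%N. 0) \<longlonglongrightarrow> Im (zeta (of_real s))" using tendsto_Im[OF L] by simp
 thus "Im (zeta (of_real s)) = 0" using LIMSEQ_unique tendsto_const by blast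
qed

text \<open>First evaluation: monotone convergence in the truncation \<open>N\<close>, with
  \<open>zeta_real_limit\<close> on the right side.\<close>

lemma mellin_bose:
 fixes s :: real
 assumes s: "-1 < s" "s < 0"
 shows "((%x. bose x * x powr (s - 1)) has_integral Gamma s * Re (zeta (of_real s))) {0..}"
proof (rule has_integral_monotone_convergence_increasing[OF mellin_bose_truncated[OF s]])
 fix N x assume "x \<in> {0 :: real..}"
 show "(1 - exp (- (real (N + 1) * x))) * bose x * x powr (s - 1) <= (1 - exp (- (real (Suc N + 1) * x))) * bose x * x powr (s - 1)"
 proof (cases "x = 0")
  case False
  hence "x > 0" using \<open>x \<in> {0..}\<close> by simp
  thus ?thesis using bose_nonneg[of x] by (intro mult_right_mono) auto
 qed simp
next
 fix x assume x: "x \<in> {0 :: real..}"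
 show "(%N. (1 - exp (- (real (N + 1) * x))) * bose x * x powr (s - 1)) \<longlonglongrightarrow> bose x * x powr (s - 1)"
 proof (cases "x = 0")
  case False
  hence x: "x > 0" using x by simp
  have "filterlim (%N. real (N + 1) * x) at_top sequentially"
   using x by (intro filterlim_at_top_mult_tendsto_pos[OF tendsto_const] filterlim_compose[OF filterlim_real_sequentially filterlim_add_const_nat_at_top])
  hence "(%N. exp (- (real (N + 1) * x))) \<longlonglongrightarrow> 0"
   by (intro filterlim_compose[OF exp_at_bot]) (simp add: filterlim_uminus_at_bot)
  hence "(%N. (1 - exp (- (real (N + 1) * x))) * bose x * x powr (s - 1)) \<longlonglongrightarrow> (1 - 0) * bose x * x powr (s - 1)"
   by (intro tendsto_intros)
  thus ?thesis by simp
 qed simp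
next
 show "(%N. Gamma s * ((\<Sum>n=1..<N+1. real n powr (- s)) + real (N + 1) powr (- s) / 2 - real (N + 1) powr (1 - s) / (1 - s))) \<longlonglongrightarrow> Gamma s * Re (zeta (of_real s))"
  by (intro tendsto_mult tendsto_const zeta_real_limit s)
qed

text \<open>Second evaluation: the partial fractions of \<open>bose\<close> are nonnegative and may
  be integrated term by term.\<close>

lemma mellin_bose_partial_fractions:
 fixes s :: real
 assumes s: "-1 < s" "s < 0"
 shows "((%x. bose x * x powr (s - 1)) has_integral (2 * pi) powr (s - 1) * (pi / cos (pi * s / 2)) * zr (1 - s)) {0..}"
proof (rule has_integral_monotone_convergence_increasing)
 define F where "F n x = 2 * (x powr s / (x\<^sup>2 + (2 * pi * real (Suc n))\<^sup>2))" for n x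
 show "((%x. \<Sum>n<N. F n x) has_integral (\<Sum>n<N. 2 * ((2 * pi * real (Suc n)) powr (s - 1) * (pi / (2 * cos (pi * s / 2)))))) {0..}" for N
  unfolding F_def using s by (intro has_integral_sum has_integral_mult_right integral_power_over_quadratic) auto
 show "(\<Sum>n<N. F n x) <= (\<Sum>n<Suc N. F n x)" for N x unfolding F_def by simp
 show "(%N. \<Sum>n<N. F n x) \<longlonglongrightarrow> bose x * x powr (s - 1)" if x: "x \<in> {0..}" for x
 proof (cases "x = 0")
  case False
  hence x: "x > 0" using x by simp
  have "2 * x / (x\<^sup>2 + (2 * pi * real (Suc n))\<^sup>2) * x powr (s - 1) = F n x" for n
  proof -
   have "x * x powr (s - 1) = x powr s" using x powr_add[of x 1 "s - 1"] by simp
   thus ?thesis unfolding F_def by (simp add: mult_ac)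
  qed
  hence "(%n. F n x) sums (bose x * x powr (s - 1))"
   using sums_mult2[OF bose_sums[OF x], of "x powr (s - 1)"] by simp
  thus ?thesis by (simp add: sums_def)
 qed (simp add: F_def)
 have "(%n. real n powr (- (1 - s))) sums zr (1 - s)" using s by (intro zr_sums) auto
 hence "(%n. real (Suc n) powr (s - 1)) sums zr (1 - s)" using sums_Suc_iff[of "%n. real n powr (s - 1)"] by simp
 hence "(%n. (2 * pi) powr (s - 1) * (pi / cos (pi * s / 2)) * real (Suc n) powr (s - 1)) sums ((2 * pi) powr (s - 1) * (pi / cos (pi * s / 2)) * zr (1 - s))"
  by (rule sums_mult)
 moreover have "(2 * pi) powr (s - 1) * (pi / cos (pi * s / 2)) * real (Suc n) powr (s - 1) = 2 * ((2 * pi * real (Suc n)) powr (s - 1) * (pi / (2 * cos (pi * s / 2))))" for n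
  by (simp only: powr_mult[of "2 * pi" "real (Suc n)" "s - 1"]) simp
 ultimately show "(%N. \<Sum>n<N. 2 * ((2 * pi * real (Suc n)) powr (s - 1) * (pi / (2 * cos (pi * s / 2))))) \<longlonglongrightarrow> (2 * pi) powr (s - 1) * (pi / cos (pi * s / 2)) * zr (1 - s)"
  by (simp only: sums_def)
qed

lemma functional_equation_real:
 fixes s :: real
 assumes s: "-1 < s" "s < 0"
 shows "zeta (1 - of_real s) = 2 * of_real (2 * pi) powr (- of_real s) * cos (of_real pi * of_real s / 2) * Gamma (of_real s) * zeta (of_real s)"
proof -
 have eq: "Gamma s * Re (zeta (of_real s)) = (2 * pi) powr (s - 1) * (pi / cos (pi * s / 2)) * zr (1 - s)"
  by (rule has_integral_unique[OF mellin_bose[OF s] mellin_bose_partial_fractions[OF s]])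
 have c: "cos (pi * s / 2) > 0"
 proof (rule cos_gt_zero_pi)
  have "pi * (s + 1) > 0" "pi * (1 - s) > 0" using s by auto
  hence "pi * s > - pi" "pi * s < pi" by (auto simp: algebra_simps)
  thus "- (pi / 2) < pi * s / 2" "pi * s / 2 < pi / 2" by auto
 qed
 have "(2 * pi) powr (- s) * (2 * pi) powr (s - 1) = (2 * pi) powr (- 1)" by (simp flip: powr_add)
 also have "... = 1 / (2 * pi)" by (simp add: powr_minus_divide)
 finally have p: "(2 * pi) powr (- s) * (2 * pi) powr (s - 1) * (2 * pi) = 1" by simp
 have "2 * (2 * pi) powr (- s) * cos (pi * s / 2) * (Gamma s * Re (zeta (of_real s)))
   = ((2 * pi) powr (- s) * (2 * pi) powr (s - 1) * (2 * pi)) * zr (1 - s)"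
  unfolding eq using c by (simp add: field_simps)
 hence fe: "zr (1 - s) = 2 * (2 * pi) powr (- s) * cos (pi * s / 2) * Gamma s * Re (zeta (of_real s))" unfolding p by simp
 have e1: "zeta (1 - of_real s) = of_real (zr (1 - s))" using zeta_of_real[of "1 - s"] s by simp
 have e2: "complex_of_real (Re (zeta (of_real s))) = zeta (of_real s)" using zeta_real_limit(2)[OF s] by (simp add: complex_eq_iff)
 have e3: "complex_of_real ((2 * pi) powr (- s)) = of_real (2 * pi) powr (- of_real s)"
  using powr_of_real[of "2 * pi" "- s"] by (simp only: of_real_minus) simp
 have "complex_of_real (pi * s / 2) = of_real pi * of_real s / 2" by simp
 hence e4: "complex_of_real (cos (pi * s / 2)) = cos (of_real pi * of_real s / 2)" by (simp only: cos_of_real[symmetric])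
 have e5: "complex_of_real (Gamma s) = Gamma (of_real s)" by (rule Gamma_complex_of_real[symmetric])
 show ?thesis unfolding e1 fe by (simp only: of_real_mult of_real_numeral e2 e3[unfolded of_real_mult of_real_numeral] e4 e5)
qed

text \<open>Identity theorem. The segment from -1 to 0, where
  \<open>functional_equation_real\<close> applies, lies in the strip, and the strip joined to the
  upper half plane is a connected open set free of 0, 1 and the poles of
  \<open>Gamma\<close>.\<close>

theorem functional_equation:
 assumes s: "Im s > 0"
 shows "zeta (1 - s) = 2 * of_real (2 * pi) powr (- s) * cos (of_real pi * s / 2) * Gamma s * zeta s"
proof -
 define S where "S = {s. Im s > 0} \<union> ({s. Re s > -1} \<inter> {s. Re s < 0})"
 define F where "F s = zeta (1 - s) - 2 * of_real (2 * pi) powr (- s) * cos (of_real pi * s / 2) * Gamma s * zeta s" for s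
 have op: "open S" unfolding S_def by (intro open_Un open_Int open_halfspace_Im_gt open_halfspace_Re_gt open_halfspace_Re_lt)
 have con: "connected S" unfolding S_def
 proof (rule connected_Un)
  show "connected {s. Im s > 0}" "connected ({s. Re s > -1} \<inter> {s. Re s < 0})"
   by (intro convex_connected convex_Int convex_halfspace_Im_gt convex_halfspace_Re_gt convex_halfspace_Re_lt)+
  have "Complex (-1/2) 1 \<in> {s. Im s > 0} \<inter> ({s. Re s > -1} \<inter> {s. Re s < 0})" by simp
  thus "{s. Im s > 0} \<inter> ({s. Re s > -1} \<inter> {s. Re s < 0}) ~= {}" by blast
 qed
 have n01: "s ~= 0" "s ~= 1" "s \<notin> \<int>\<^sub>\<le>\<^sub>0" if "s \<in> S" for s
 proof -
  show "s ~= 0" "s ~= 1" using that by (auto simp: S_def)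
  show "s \<notin> \<int>\<^sub>\<le>\<^sub>0"
  proof
   assume "s \<in> \<int>\<^sub>\<le>\<^sub>0"
   then obtain n where n: "s = of_int n" by (auto elim!: nonpos_Ints_cases)
   hence "of_int n > (-1 :: real)" "of_int n < (0 :: real)" using that by (auto simp: S_def)
   hence "of_int (-1) < (of_int n :: real)" "of_int n < (of_int 0 :: real)" by auto
   hence "-1 < n" "n < 0" by (simp_all only: of_int_less_iff)
   thus False by simp
  qed
 qed
 have h1: "(%s. zeta (1 - s)) holomorphic_on S"
  using holomorphic_on_compose_gen[OF _ zeta_holomorphic, of "%s. 1 - s" S] n01 by (force simp: o_def intro!: holomorphic_intros)
 have h2: "zeta holomorphic_on S" by (rule holomorphic_on_subset[OF zeta_holomorphic]) (use n01 in auto)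
 have hol: "F holomorphic_on S" unfolding F_def
  by (intro holomorphic_intros h1 h2) (use n01 in auto)
 have "F s = 0"
 proof (rule analytic_continuation[OF hol op con, of "of_real ` {-1<..<0}" "of_real (-1/2)"])
  show "complex_of_real ` {-1<..<0} \<subseteq> S" "complex_of_real (-1/2) \<in> S" by (auto simp: S_def)
  show "complex_of_real (-1/2) islimpt of_real ` {-1<..<0}"
  proof (unfold islimpt_approachable, intro allI impI)
   fix e :: real assume "e > 0"
   define d where "d = min (1 / 4) (e / 2)"
   have d: "d > 0" "d < 1 / 2" "d < e" using \<open>e > 0\<close> by (auto simp: d_def)
   have "complex_of_real (-1/2 + d) \<in> of_real ` {-1<..<0}" by (rule imageI) (use d in auto)
   moreover have "complex_of_real (-1/2 + d) ~= of_real (-1/2)" using d by (simp only: of_real_eq_iff)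
   moreover have "dist (complex_of_real (-1/2 + d)) (of_real (-1/2)) = d" using d by (simp only: dist_of_real dist_real_def)
   ultimately show "\<exists>x'\<in>complex_of_real ` {-1<..<0}. x' ~= complex_of_real (-1/2) \<and> dist x' (complex_of_real (-1/2)) < e"
    using d by metis
  qed
  show "s \<in> S" using s by (simp add: S_def)
  fix z assume "z \<in> complex_of_real ` {-1<..<0}"
  then obtain x where "z = of_real x" "-1 < x" "x < 0" by auto
  thus "F z = 0" unfolding F_def using functional_equation_real[of x] by simp
 qed
 thus ?thesis by (simp add: F_def)
qed

text \<open>The conjugated function also satisfies \<open>is_zeta\<close>, and that description is
  unique.\<close>

lemma zeta_cnj: "zeta (cnj s) = cnj (zeta s)"
proof -
 have "is_zeta (cnj \<circ> zeta \<circ> cnj)"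
  unfolding is_zeta_def
 proof (intro conjI allI impI)
  have "x \<in> cnj ` (- {1})" if "x ~= 1" for x using that by (intro image_eqI[of _ _ "cnj x"]) auto
  hence "cnj ` (- {1}) = - {1}" by auto
  thus "cnj \<circ> zeta \<circ> cnj holomorphic_on - {1}"
   by (intro holomorphic_on_compose_cnj_cnj) (auto simp: zeta_holomorphic)
  show "(cnj \<circ> zeta \<circ> cnj) 1 = 0" using is_zeta_zeta by (simp add: is_zeta_def)
  fix s assume "Re s > 1"
  hence "(%n. 1 / of_nat (Suc n) powr cnj s) sums zeta (cnj s)" by (intro zeta_sums) simp
  hence "(%n. cnj (1 / of_nat (Suc n) powr cnj s)) sums cnj (zeta (cnj s))" by (simp only: sums_cnj)
  moreover have "cnj (1 / of_nat (Suc n) powr cnj s) = 1 / of_nat (Suc n) powr s" for n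
   using cnj_powr[of "of_nat (Suc n)" "cnj s"] by (simp del: of_nat_Suc)
  ultimately show "(%n. 1 / of_nat (Suc n) powr s) sums (cnj \<circ> zeta \<circ> cnj) s" by (simp del: of_nat_Suc)
 qed
 hence "cnj \<circ> zeta \<circ> cnj = zeta" using is_zeta_zeta zeta_ex1 by blast
 from fun_cong[OF this, of "cnj s"] show ?thesis by simp
qed

section \<open>The size of Gamma and the reflection of bounds for zeta\<close>

text \<open>On the line \<open>Re z = 1/2\<close> the point \<open>1 - z\<close> is the conjugate of
  \<open>z\<close>, so the reflection formula evaluates the squared modulus.\<close>

lemma norm_Gamma_half_squared: "(norm (Gamma (Complex (1/2) y)))\<^sup>2 = pi / cosh (pi * y)"
proof -
 define z where "z = Complex (1/2) y"
 have "1 - z = cnj z" by (simp add: z_def complex_eq_iff)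
 hence "Gamma z * cnj (Gamma z) = of_real pi / sin (of_real pi * z)"
  using Gamma_reflection_complex[of z] by (simp add: cnj_Gamma)
 moreover have "sin (of_real pi * z) = of_real (cosh (pi * y))"
 proof -
  have "of_real pi * z = Complex (pi / 2) (pi * y)" by (simp add: z_def complex_eq_iff)
  thus ?thesis by (simp only:) (simp add: complex_eq_iff Re_sin Im_sin cosh_def)
 qed
 ultimately have "complex_of_real ((norm (Gamma z))\<^sup>2) = of_real (pi / cosh (pi * y))"
  by (simp only: complex_norm_square of_real_divide)
 thus ?thesis unfolding z_def by (simp only: of_real_eq_iff)
qed

text \<open>
  The chord defect of \<open>ln (x\<^sup>2 + y\<^sup>2)\<close> over an interval is at most its length times the
  variation of the derivative \<open>2 * x / (x\<^sup>2 + y\<^sup>2)\<close>, which increases up to \<open>x = y\<close> and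
  decreases afterwards; \<open>log_slope_variation\<close> is the total variation.
\<close>

definition log_slope_variation :: "real => real => real" where
 "log_slope_variation y x = (if x <= y then 2 * x / (x\<^sup>2 + y\<^sup>2) else 2 / y - 2 * x / (x\<^sup>2 + y\<^sup>2))"

lemma slope_diff:
 fixes a b y :: real
 assumes "y > 0"
 shows "2 * b / (b\<^sup>2 + y\<^sup>2) - 2 * a / (a\<^sup>2 + y\<^sup>2) = 2 * (b - a) * (y\<^sup>2 - a * b) / ((a\<^sup>2 + y\<^sup>2) * (b\<^sup>2 + y\<^sup>2))"
proof -
 have "A ~= 0 ==> B ~= 0 ==> p / B - q / A = (p * A - q * B) / (A * B)" for A B p q :: real
  by (simp add: field_simps)
 moreover have "a\<^sup>2 + y\<^sup>2 ~= 0" "b\<^sup>2 + y\<^sup>2 ~= 0" using assms by (simp_all add: sum_power2_eq_zero_iff)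
 moreover have "2 * b * (a\<^sup>2 + y\<^sup>2) - 2 * a * (b\<^sup>2 + y\<^sup>2) = 2 * (b - a) * (y\<^sup>2 - a * b)"
  by (simp add: power2_eq_square algebra_simps)
 ultimately show ?thesis by simp
qed

lemma log_slope_variation:
 fixes a b y :: real
 assumes y: "y > 0" and ab: "0 <= a" "a <= b"
 shows "\<bar>2 * a / (a\<^sup>2 + y\<^sup>2) - 2 * b / (b\<^sup>2 + y\<^sup>2)\<bar> <= log_slope_variation y b - log_slope_variation y a"
  and "0 <= log_slope_variation y a" "log_slope_variation y a <= 2 / y"
proof -
 define h where "h x = 2 * x / (x\<^sup>2 + y\<^sup>2)" for x
 have D: "(p\<^sup>2 + y\<^sup>2) * (q\<^sup>2 + y\<^sup>2) > 0" for p q using y by (intro mult_pos_pos add_nonneg_pos) auto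
 have inc: "h p <= h q" if "0 <= p" "p <= q" "q <= y" for p q
 proof -
  have "p * q <= y\<^sup>2" unfolding power2_eq_square using that by (intro mult_mono) auto
  hence "h q - h p >= 0" unfolding h_def slope_diff[OF y]
   using that less_imp_le[OF D] by (intro divide_nonneg_nonneg mult_nonneg_nonneg) auto
  thus ?thesis by simp
 qed
 have dec: "h q <= h p" if "y <= p" "p <= q" for p q
 proof -
  have "y\<^sup>2 <= p * q" unfolding power2_eq_square using that y by (intro mult_mono) auto
  hence "h p - h q >= 0" unfolding h_def slope_diff[OF y]
   using that less_imp_le[OF D] by (intro divide_nonneg_nonneg) (auto intro!: mult_nonpos_nonpos simp: mult.commute)
  thus ?thesis by simp
 qed
 have hy: "h y = 1 / y" using y by (simp add: h_def power2_eq_square)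
 have h0: "0 <= h x" if "x >= 0" for x using that by (simp add: h_def)
 have le: "h x <= 1 / y" if "x >= 0" for x
  using inc[of x y] dec[of y x] that hy by (cases "x <= y") auto
 have v: "log_slope_variation y x = (if x <= y then h x else 2 / y - h x)" for x by (simp add: log_slope_variation_def h_def)
 have "1 / y > 0" "2 / y = 1 / y + 1 / y" using y by (auto simp: field_simps)
 thus "0 <= log_slope_variation y a" "log_slope_variation y a <= 2 / y"
  using h0[OF ab(1)] le[OF ab(1)] by (auto simp: v)
 show "\<bar>2 * a / (a\<^sup>2 + y\<^sup>2) - 2 * b / (b\<^sup>2 + y\<^sup>2)\<bar> <= log_slope_variation y b - log_slope_variation y a"
  unfolding v h_def[symmetric] using inc[of a b] dec[of a b] le[of a] le[of b] ab \<open>2 / y = 1 / y + 1 / y\<close> by auto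
qed

text \<open>Two applications of the mean value theorem write the left side as \<open>u\<close> times
  a difference of slopes at two points of \<open>[x, x + 3]\<close>.\<close>

lemma log_chord_defect:
 fixes x y u :: real
 assumes y: "y > 0" and x: "0 <= x" and u: "0 <= u" "u <= 3"
 shows "ln (x\<^sup>2 + y\<^sup>2) - ln ((x + u)\<^sup>2 + y\<^sup>2) + u / 3 * (ln ((x + 3)\<^sup>2 + y\<^sup>2) - ln (x\<^sup>2 + y\<^sup>2))
   <= u * (log_slope_variation y (x + 3) - log_slope_variation y x)"
proof -
 define L where "L x = ln (x\<^sup>2 + y\<^sup>2)" for x
 have pos: "p\<^sup>2 + y\<^sup>2 > 0" for p using y by (intro add_nonneg_pos) auto
 have dL: "(L has_real_derivative 2 * p / (p\<^sup>2 + y\<^sup>2)) (at p)" for p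
  unfolding L_def using pos[of p] by (auto intro!: derivative_eq_intros)
 have mvt: "\<exists>z. x <= z \<and> z <= x + w \<and> L (x + w) - L x = w * (2 * z / (z\<^sup>2 + y\<^sup>2))" if "w >= 0" for w
 proof (cases "w = 0")
  case False
  then obtain z where "z > x" "z < x + w" "L (x + w) - L x = (x + w - x) * (2 * z / (z\<^sup>2 + y\<^sup>2))"
   using MVT2[of x "x + w" L "%p. 2 * p / (p\<^sup>2 + y\<^sup>2)"] dL \<open>w >= 0\<close> by auto
  thus ?thesis by (intro exI[of _ z]) auto
 qed auto
 obtain a where a: "x <= a" "a <= x + u" "L (x + u) - L x = u * (2 * a / (a\<^sup>2 + y\<^sup>2))" using mvt[OF u(1)] by blast
 obtain b where b: "x <= b" "b <= x + 3" "L (x + 3) - L x = 3 * (2 * b / (b\<^sup>2 + y\<^sup>2))" using mvt[of 3] by auto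
 have V: "log_slope_variation y p <= log_slope_variation y q" if "0 <= p" "p <= q" for p q
  using log_slope_variation(1)[OF y that] by linarith
 have "2 * b / (b\<^sup>2 + y\<^sup>2) - 2 * a / (a\<^sup>2 + y\<^sup>2) <= log_slope_variation y (x + 3) - log_slope_variation y x"
  using log_slope_variation(1)[OF y, of a b] log_slope_variation(1)[OF y, of b a] V[of x a] V[of x b] V[of a "x + 3"] V[of b "x + 3"] a b x u
  by (cases "a <= b") linarith+
 hence "u * (2 * b / (b\<^sup>2 + y\<^sup>2) - 2 * a / (a\<^sup>2 + y\<^sup>2)) <= u * (log_slope_variation y (x + 3) - log_slope_variation y x)"
  using u by (intro mult_left_mono)
 moreover have "L x - L (x + u) + u / 3 * (L (x + 3) - L x) = u * (2 * b / (b\<^sup>2 + y\<^sup>2) - 2 * a / (a\<^sup>2 + y\<^sup>2))"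
 proof -
  have "u / 3 * (L (x + 3) - L x) = u * (2 * b / (b\<^sup>2 + y\<^sup>2))" unfolding b(3) by simp
  moreover have "L x - L (x + u) = - (u * (2 * a / (a\<^sup>2 + y\<^sup>2)))" using a(3) by linarith
  ultimately show ?thesis unfolding right_diff_distrib by linarith
 qed
 ultimately show ?thesis by (simp only: L_def)
qed

lemma telescope_three:
 fixes W :: "nat => real"
 shows "(\<Sum>k\<le>n. W (k + 3) - W k) = W (n + 1) + W (n + 2) + W (n + 3) - W 0 - W 1 - W 2"
 by (induction n) (simp_all add: numeral_eq_Suc)

lemma norm_Gamma_series:
 assumes x: "x > 0" and n: "n >= 1"
 shows "norm (Gamma_series (Complex x y) n) = exp (ln (fact n) + x * ln (real n) - (\<Sum>k\<le>n. ln ((x + real k)\<^sup>2 + y\<^sup>2)) / 2)"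
proof -
 have e: "norm (Complex x y + of_nat k) = exp (ln ((x + real k)\<^sup>2 + y\<^sup>2) / 2)" for k
 proof -
  have "(x + real k)\<^sup>2 + y\<^sup>2 > 0" using x by (intro add_pos_nonneg) auto
  hence "sqrt ((x + real k)\<^sup>2 + y\<^sup>2) = exp (ln ((x + real k)\<^sup>2 + y\<^sup>2) / 2)"
   using exp_ln[of "sqrt ((x + real k)\<^sup>2 + y\<^sup>2)", symmetric] by (simp only: ln_sqrt real_sqrt_gt_0_iff)
  thus ?thesis by (simp add: cmod_def)
 qed
 have "norm (pochhammer (Complex x y) (n + 1)) = (\<Prod>k\<le>n. norm (Complex x y + of_nat k))"
  unfolding pochhammer_prod prod_norm[symmetric] by (simp add: atLeast0LessThan lessThan_Suc_atMost)
 also have "... = exp (\<Sum>k\<le>n. ln ((x + real k)\<^sup>2 + y\<^sup>2) / 2)" unfolding e by (simp add: exp_sum)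
 finally have "norm (pochhammer (Complex x y) (n + 1)) = exp ((\<Sum>k\<le>n. ln ((x + real k)\<^sup>2 + y\<^sup>2)) / 2)" by (simp add: sum_divide_distrib)
 thus ?thesis unfolding Gamma_series_def norm_divide norm_mult
  by (simp add: exp_add exp_diff)
qed

text \<open>Log-linear interpolation between \<open>x\<close> and \<open>x + 3\<close>, where the
  recurrence gives the ratio. The chord defects of the factors of \<open>Gamma_series\<close>
  telescope with stride 3; three end terms of at most \<open>2 / y\<close> each survive, and the
  square root in the modulus halves their sum, which gives \<open>exp (3 * u / y)\<close>.\<close>

lemma norm_Gamma_interpolation:
 assumes y: "y > 0" and x: "x > 0" and u: "0 <= u" "u <= 3"
 shows "norm (Gamma (Complex (x + u) y)) <= norm (Gamma (Complex x y)) *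
   (norm (Complex x y) * norm (Complex (x + 1) y) * norm (Complex (x + 2) y)) powr (u / 3) * exp (3 * u / y)"
proof -
 define G where "G w n = norm (Gamma_series (Complex (x + w) y) n)" for w n
 define g where "g w n = ln (fact n) + (x + w) * ln (real n) - (\<Sum>k\<le>n. ln ((x + w + real k)\<^sup>2 + y\<^sup>2)) / 2" for w n
 have Gg: "G w n = exp (g w n)" if "w >= 0" "n >= 1" for w n
  unfolding G_def g_def using norm_Gamma_series[of "x + w" n y] that x by simp
 have lim: "G w \<longlonglongrightarrow> norm (Gamma (Complex (x + w) y))" for w
  unfolding G_def by (intro tendsto_norm Gamma_series_LIMSEQ)
 have step: "g u n <= g 0 n + u / 3 * (g 3 n - g 0 n) + 3 * u / y" for n
 proof -
  let ?L = "%w k. ln ((x + w + real k)\<^sup>2 + y\<^sup>2)"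
  let ?W = "%k. log_slope_variation y (x + real k)"
  have "?L 0 k - ?L u k + u / 3 * (?L 3 k - ?L 0 k) <= u * (?W (k + 3) - ?W k)" for k
   using log_chord_defect[OF y, of "x + real k" u] x u by (simp add: algebra_simps)
  hence "(\<Sum>k\<le>n. ?L 0 k - ?L u k + u / 3 * (?L 3 k - ?L 0 k)) <= (\<Sum>k\<le>n. u * (?W (k + 3) - ?W k))"
   by (intro sum_mono)
  also have "... = u * (?W (n + 1) + ?W (n + 2) + ?W (n + 3) - ?W 0 - ?W 1 - ?W 2)"
   using telescope_three[of ?W n] by (simp only: sum_distrib_left[symmetric])
  also have "... <= u * (6 / y)"
  proof -
   have b: "0 <= ?W k" "?W k <= 2 / y" for k using log_slope_variation(2,3)[OF y, of "x + real k" "x + real k"] x by auto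
   have "6 / y = 2 / y + 2 / y + 2 / y" by simp
   hence "?W (n + 1) + ?W (n + 2) + ?W (n + 3) - ?W 0 - ?W 1 - ?W 2 <= 6 / y"
    using b(1)[of 0] b(1)[of 1] b(1)[of 2] b(2)[of "n + 1"] b(2)[of "n + 2"] b(2)[of "n + 3"] by linarith
   thus ?thesis using u by (intro mult_left_mono)
  qed
  finally have s: "(\<Sum>k\<le>n. ?L 0 k - ?L u k + u / 3 * (?L 3 k - ?L 0 k)) <= u * (6 / y)" .
  have "(\<Sum>k\<le>n. ?L 0 k - ?L u k + u / 3 * (?L 3 k - ?L 0 k)) = sum (?L 0) {..n} - sum (?L u) {..n} + u / 3 * (sum (?L 3) {..n} - sum (?L 0) {..n})"
   by (simp only: sum.distrib sum_subtractf sum_distrib_left[symmetric])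
  moreover have "g u n - (g 0 n + u / 3 * (g 3 n - g 0 n)) = (sum (?L 0) {..n} - sum (?L u) {..n} + u / 3 * (sum (?L 3) {..n} - sum (?L 0) {..n})) / 2"
   unfolding g_def by (simp add: field_simps)
  ultimately have "g u n - (g 0 n + u / 3 * (g 3 n - g 0 n)) <= u * (6 / y) / 2" using s by simp
  thus ?thesis by simp
 qed
 define R where "R = norm (Complex x y) * norm (Complex (x + 1) y) * norm (Complex (x + 2) y)"
 have nz: "Complex (x + w) y \<notin> \<int>\<^sub>\<le>\<^sub>0" if "w >= 0" for w
  using y by (auto elim!: nonpos_Ints_cases simp: complex_eq_iff)
 have G0: "norm (Gamma (Complex x y)) > 0" using Gamma_eq_zero_iff[of "Complex x y"] nz[of 0] by simp
 have rec: "Gamma (Complex (x + w + 1) y) = Complex (x + w) y * Gamma (Complex (x + w) y)" if "w >= 0" for w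
 proof -
  have "Complex (x + w + 1) y = Complex (x + w) y + 1" by (simp add: complex_eq_iff)
  thus ?thesis using Gamma_plus1[OF nz[OF that]] by simp
 qed
 have "norm (Gamma (Complex (x + 3) y)) = R * norm (Gamma (Complex x y))"
  using rec[of 0] rec[of 1] rec[of 2] by (simp add: R_def norm_mult add.assoc)
 hence R: "norm (Gamma (Complex (x + 3) y)) / norm (Gamma (Complex x y)) = R" using G0 by simp
 have R0: "R > 0" unfolding R_def using y by (auto simp: complex_eq_iff intro!: mult_pos_pos)
 have "norm (Gamma (Complex (x + u) y)) <= norm (Gamma (Complex (x + 0) y)) * (norm (Gamma (Complex (x + 3) y)) / norm (Gamma (Complex (x + 0) y))) powr (u / 3) * exp (3 * u / y)"
 proof (rule LIMSEQ_le[OF lim])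
  show "(%n. G 0 n * (G 3 n / G 0 n) powr (u / 3) * exp (3 * u / y)) \<longlonglongrightarrow> norm (Gamma (Complex (x + 0) y)) * (norm (Gamma (Complex (x + 3) y)) / norm (Gamma (Complex (x + 0) y))) powr (u / 3) * exp (3 * u / y)"
   using G0 R R0 by (intro tendsto_intros lim) auto
  show "\<exists>N. \<forall>n\<ge>N. G u n <= G 0 n * (G 3 n / G 0 n) powr (u / 3) * exp (3 * u / y)"
  proof (intro exI allI impI)
   fix n :: nat assume "n >= 1"
   thus "G u n <= G 0 n * (G 3 n / G 0 n) powr (u / 3) * exp (3 * u / y)"
    using step[of n] u by (simp add: Gg powr_def flip: exp_diff exp_add)
  qed
 qed
 thus ?thesis using R by (simp add: R_def)
qed

text \<open>
  The factor \<open>(norm (Complex x y) * norm (Complex (x + 1) y) * norm (Complex (x + 2) y)) powr (u / 3) * exp (3 * u / y)\<close>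
  above is smaller than \<open>(2 * y) powr u\<close> at \<open>x = 1 / 2\<close>, so the power of \<open>2 * pi\<close> in the
  functional equation leaves the clean factor \<open>y powr u\<close>.
\<close>

theorem zeta_reflection_bound:
 assumes y: "y >= 10" and u: "0 <= u" "u <= 3"
 shows "norm (zeta (Complex (1/2 - u) y)) <= 1001 / 1000 * y powr u * norm (zeta (Complex (1/2 + u) y))"
proof -
 define s where "s = Complex (1/2 + u) y"
 have "1 - s = cnj (Complex (1/2 - u) y)" by (simp add: s_def complex_eq_iff)
 hence 1: "norm (zeta (1 - s)) = norm (zeta (Complex (1/2 - u) y))" by (simp add: zeta_cnj)
 have p: "norm (complex_of_real (2 * pi) powr (- s)) = (2 * pi) powr (- (1/2 + u))"
  using norm_of_real_powr[of "2 * pi" "- s"] by (simp add: s_def)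
 have E: "exp (pi * y) >= 1000"
 proof -
  have "pi * y >= 3 * 10" using pi_gt3 y by (intro mult_mono) auto
  hence "exp (pi * y) >= exp (of_nat 10 * 3)" by simp
  moreover have "exp (3::real) ^ 10 >= 4 ^ 10" using exp_ge_add_one_self[of 3] by (intro power_mono) auto
  ultimately show ?thesis unfolding exp_of_nat_mult by simp
 qed
 define C where "C = cosh (pi * y)"
 have C: "C >= 500" using E exp_gt_zero[of "- (pi * y)"] unfolding C_def cosh_def by (simp add: add_increasing2)
 have c: "(norm (cos (of_real pi * s / 2)))\<^sup>2 <= (C + 1) / 2"
 proof -
  define q where "q = exp (pi * y / 2)"
  have q: "q > 0" "q\<^sup>2 = exp (pi * y)" "inverse (q\<^sup>2) = exp (- (pi * y))"
   by (auto simp: q_def power2_eq_square exp_minus simp flip: exp_add)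
  have "(q - inverse q)\<^sup>2 = q\<^sup>2 + inverse (q\<^sup>2) - 2" using q(1) by (simp add: power2_diff power_inverse)
  hence "(q - inverse q)\<^sup>2 / 4 = (C - 1) / 2" unfolding C_def cosh_def q(2) q(3)[unfolded q(2)] by simp
  moreover have ri: "Re (of_real pi * s / 2) = pi * (1/2 + u) / 2" "Im (of_real pi * s / 2) = pi * y / 2" by (simp_all add: s_def)
  moreover have "(cos (pi * (1/2 + u) / 2))\<^sup>2 <= 1" by (simp add: abs_square_le_1)
  ultimately show ?thesis unfolding norm_cos_squared ri q_def[symmetric] by argo
 qed
 define g where "g = norm (Gamma (Complex (1/2) y))"
 have g: "g\<^sup>2 = pi / C" unfolding g_def C_def by (rule norm_Gamma_half_squared)
 \<comment> \<open>The squared cosine is at most about \<open>C / 2\<close> and the squared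
   \<open>Gamma\<close> factor is \<open>pi / C\<close>, so the exponential growth cancels;
   \<open>C >= 500\<close> leaves the factor 1001/1000.\<close>
 have cg: "norm (cos (of_real pi * s / 2)) * g <= 1001 / 1000 * sqrt (pi / 2)"
 proof (rule power2_le_imp_le)
  have "(norm (cos (of_real pi * s / 2)) * g)\<^sup>2 <= (C + 1) / 2 * (pi / C)"
   unfolding power_mult_distrib g using c C by (intro mult_right_mono) auto
  also have "... = (1 + 1 / C) * (pi / 2)" using C by (simp add: field_simps)
  also have "... <= (1 + 1 / 500) * (pi / 2)" using C by (intro mult_right_mono add_left_mono divide_left_mono) auto
  also have "... <= (1001 / 1000)\<^sup>2 * (pi / 2)" by (intro mult_right_mono) (auto simp: power2_eq_square)
  also have "... = (1001 / 1000 * sqrt (pi / 2))\<^sup>2" unfolding power_mult_distrib by (subst real_sqrt_pow2) auto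
  finally show "(norm (cos (of_real pi * s / 2)) * g)\<^sup>2 <= (1001 / 1000 * sqrt (pi / 2))\<^sup>2" .
 qed simp
 have G: "norm (Gamma s) <= g * (2 * y) powr u"
 proof -
  define R where "R = norm (Complex (1/2) y) * norm (Complex (3/2) y) * norm (Complex (5/2) y)"
  have nb: "norm (Complex a y) <= 11 / 10 * y" if "0 <= a" "a <= 5 / 2" for a
  proof -
   have "a * a <= 5 / 2 * (5 / 2)" using that by (intro mult_mono) auto
   moreover have "10 * 10 <= y * y" using y by (intro mult_mono) auto
   ultimately have "a\<^sup>2 + y\<^sup>2 <= (11 / 10 * y)\<^sup>2" by (simp add: power2_eq_square)
   thus ?thesis unfolding cmod_def complex.sel using y by (intro real_le_lsqrt) auto
  qed
  have "R <= 11 / 10 * y * (11 / 10 * y) * (11 / 10 * y)"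
   unfolding R_def using y by (intro mult_mono nb) auto
  also have "... = (11 / 10 * y) powr 3" using y by (simp add: powr_numeral power3_eq_cube)
  finally have "R powr (u / 3) <= ((11 / 10 * y) powr 3) powr (u / 3)" using u by (intro powr_mono2) (auto simp: R_def)
  also have "... = (11 / 10 * y) powr u" by (simp add: powr_powr)
  finally have R: "R powr (u / 3) <= (11 / 10 * y) powr u" .
  \<comment> \<open>For \<open>y >= 10\<close> the losses are 11/10 and 7/5 per unit of
    \<open>u\<close>, and \<open>77/50 <= 2\<close>.\<close>
  have e: "exp (3 * u / y) <= (7 / 5) powr u"
  proof -
   have "3 / y <= 3 / 10" using y by (intro divide_left_mono) auto
   moreover have "(3 / 10 :: real) <= ln (7 / 5)"
   proof -
    have "(0::real) <= 2/7" by simp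
    have "exp (3 / 10 :: real) <= 1 + 3 / 10 + (3 / 10)\<^sup>2" by (rule exp_bound) auto
    also have "... <= 7 / 5" by (simp add: power2_eq_square)
    finally show ?thesis by (subst ln_ge_iff) auto
   qed
   ultimately have "u * (3 / y) <= u * ln (7 / 5)" using u by (intro mult_left_mono) auto
   thus ?thesis by (simp add: powr_def mult_ac)
  qed
  have "norm (Gamma s) <= g * R powr (u / 3) * exp (3 * u / y)"
   using norm_Gamma_interpolation[of y "1/2" u] y u by (simp add: s_def g_def R_def)
  also have "... <= g * (11 / 10 * y) powr u * (7 / 5) powr u"
   using R e by (intro mult_mono) (auto simp: g_def)
  also have "... = g * (77 / 50 * y) powr u" using y powr_mult[of "11 / 10 * y" "7 / 5" u] by (simp add: mult_ac)
  also have "... <= g * (2 * y) powr u" using y u by (intro mult_left_mono powr_mono2) (auto simp: g_def)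
  finally show ?thesis .
 qed
 have "norm (zeta (1 - s)) = 2 * (2 * pi) powr (- (1/2 + u)) * norm (cos (of_real pi * s / 2)) * norm (Gamma s) * norm (zeta s)"
 proof -
  have "Im s > 0" using y by (simp add: s_def)
  thus ?thesis by (simp only: functional_equation norm_mult p norm_numeral)
 qed
 also have "... <= 2 * (2 * pi) powr (- (1/2 + u)) * norm (cos (of_real pi * s / 2)) * (g * (2 * y) powr u) * norm (zeta s)"
  by (intro mult_right_mono mult_left_mono G) auto
 also have "... = 2 * (2 * pi) powr (- (1/2 + u)) * (2 * y) powr u * (norm (cos (of_real pi * s / 2)) * g) * norm (zeta s)"
  by (simp add: mult_ac)
 also have "... <= 2 * (2 * pi) powr (- (1/2 + u)) * (2 * y) powr u * (1001 / 1000 * sqrt (pi / 2)) * norm (zeta s)"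
  by (intro mult_right_mono mult_left_mono cg) auto
 also have "... = 1001 / 1000 * (2 * (2 * pi) powr (- (1/2)) * sqrt (pi / 2)) * ((2 * pi) powr (- u) * (2 * y) powr u) * norm (zeta s)"
 proof -
  have "(2 * pi) powr (- (1/2 + u)) = (2 * pi) powr (- (1/2)) * (2 * pi) powr (- u)" by (simp flip: powr_add)
  thus ?thesis by (simp only: mult_ac)
 qed
 also have "2 * (2 * pi) powr (- (1/2)) * sqrt (pi / 2) = 1"
  by (simp add: powr_minus powr_half_sqrt real_sqrt_mult real_sqrt_divide field_simps)
 also have "(2 * pi) powr (- u) * (2 * y) powr u = pi powr (- u) * y powr u"
  using y by (simp add: powr_mult powr_minus field_simps)
 also have "1001 / 1000 * 1 * (pi powr (- u) * y powr u) * norm (zeta s) <= 1001 / 1000 * 1 * (1 * y powr u) * norm (zeta s)"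
 proof -
  have "pi powr (- u) <= 1 powr (- u)" using pi_gt3 u by (intro powr_mono2') auto
  thus ?thesis by (intro mult_right_mono mult_left_mono) auto
 qed
 finally show ?thesis unfolding 1 by (simp add: s_def)
qed

section \<open>Jensen's formula and its cosine-weighted companion\<close>

lemma circlepath_cis: "circlepath c R x = c + of_real R * cis (2 * pi * x)"
 by (simp add: circlepath cis_conv_exp mult_ac)

lemma has_contour_integral_circlepath_iff:
 "(f has_contour_integral I) (circlepath c R) \<longleftrightarrow>
  ((%x. f (c + of_real R * cis (2 * pi * x)) * (2 * pi * \<i> * of_real R * cis (2 * pi * x))) has_integral I) {0..1}"
 unfolding has_contour_integral_def
proof (rule has_integral_cong)
 fix x :: real assume x: "x \<in> {0..1}"
 have "exp (2 * of_real pi * \<i> * of_real x) = cis (2 * pi * x)"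
  by (simp add: cis_conv_exp mult_ac)
 thus "f (circlepath c R x) * vector_derivative (circlepath c R) (at x within {0..1})
   = f (c + of_real R * cis (2 * pi * x)) * (2 * pi * \<i> * of_real R * cis (2 * pi * x))"
  using x by (simp add: vector_derivative_circlepath01 circlepath_cis)
qed

lemma circle_mean:
 assumes f: "f holomorphic_on ball c R'" and R: "0 < R" "R < R'"
 shows "((%x. f (c + of_real R * cis (2 * pi * x))) has_integral f c) {0..1}"
proof -
 have "f holomorphic_on cball c R" using f R by (auto intro: holomorphic_on_subset)
 hence "((%u. f u / (u - c)) has_contour_integral (2 * of_real pi * \<i> * f c)) (circlepath c R)"
  using R by (intro Cauchy_integral_circlepath_simple) auto
 hence "((%x. (1 / (2 * pi * \<i>)) * (f (c + of_real R * cis (2 * pi * x)) / (c + of_real R * cis (2 * pi * x) - c)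
   * (2 * pi * \<i> * of_real R * cis (2 * pi * x)))) has_integral (1 / (2 * pi * \<i>)) * (2 * of_real pi * \<i> * f c)) {0..1}"
  unfolding has_contour_integral_circlepath_iff by (rule has_integral_mult_right)
 thus ?thesis using R by (simp add: field_simps)
qed

text \<open>The cosine is the mean of \<open>cis (2 * pi * x)\<close> and its inverse. The inverse
  gives Cauchy's formula for the derivative, the other one the value 0 of
  \<open>f z * (z - c)\<close> at the centre.\<close>

lemma circle_mean_deriv:
 assumes f: "f holomorphic_on ball c R'" and R: "0 < R" "R < R'"
 shows "((%x. of_real (cos (2 * pi * x)) * f (c + of_real R * cis (2 * pi * x))) has_integral of_real R / 2 * deriv f c) {0..1}"
proof -
 have "f holomorphic_on cball c R" using f R by (auto intro: holomorphic_on_subset)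
 hence "((%u. f u / (u - c) ^ Suc 1) has_contour_integral ((2 * pi * \<i>) / (fact 1) * (deriv ^^ 1) f c)) (circlepath c R)"
  using R by (intro Cauchy_has_contour_integral_higher_derivative_circlepath)
    (auto intro: holomorphic_on_imp_continuous_on holomorphic_on_subset)
 hence "((%x. (of_real R / (2 * pi * \<i>)) * (f (c + of_real R * cis (2 * pi * x)) / (c + of_real R * cis (2 * pi * x) - c) ^ Suc 1
   * (2 * pi * \<i> * of_real R * cis (2 * pi * x)))) has_integral (of_real R / (2 * pi * \<i>)) * ((2 * pi * \<i>) / (fact 1) * (deriv ^^ 1) f c)) {0..1}"
  unfolding has_contour_integral_circlepath_iff by (rule has_integral_mult_right)
 hence 1: "((%x. f (c + of_real R * cis (2 * pi * x)) * cis (- (2 * pi * x))) has_integral of_real R * deriv f c) {0..1}"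
  using R by (simp add: field_simps cis_inverse[symmetric] inverse_eq_divide)
 have "(%z. f z * (z - c)) holomorphic_on ball c R'" using f by (intro holomorphic_intros)
 from circle_mean[OF this R]
 have "((%x. (1 / of_real R) * (f (c + of_real R * cis (2 * pi * x)) * (of_real R * cis (2 * pi * x)))) has_integral (1 / of_real R) * 0) {0..1}"
  by (intro has_integral_mult_right) simp
 hence 2: "((%x. f (c + of_real R * cis (2 * pi * x)) * cis (2 * pi * x)) has_integral 0) {0..1}"
  using R by simp
 have "((%x. 1 / 2 * (f (c + of_real R * cis (2 * pi * x)) * cis (- (2 * pi * x)) + f (c + of_real R * cis (2 * pi * x)) * cis (2 * pi * x)))
   has_integral 1 / 2 * (of_real R * deriv f c + 0)) {0..1}"
  by (intro has_integral_mult_right has_integral_add 1 2)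
 moreover have "1 / 2 * (w * cis (- y) + w * cis y) = of_real (cos y) * w" for w y
  by (simp add: complex_eq_iff)
 ultimately show ?thesis by simp
qed

text \<open>A zero-free holomorphic function on a disc has a logarithm, with real part
  \<open>ln (norm (f z))\<close>; the disc is first enlarged a little so that the circle lies inside
  it.\<close>

lemma log_norm_circle_means:
 assumes f: "f holomorphic_on ball c R'" and R: "0 < R" "R < R'" and nz: "\<And>z. z \<in> cball c R ==> f z ~= 0"
 shows "((%x. ln (norm (f (c + of_real R * cis (2 * pi * x))))) has_integral ln (norm (f c))) {0..1}"
  and "((%x. cos (2 * pi * x) * ln (norm (f (c + of_real R * cis (2 * pi * x)))))
      has_integral R / 2 * Re (deriv f c / f c)) {0..1}"
proof -
 have cont: "continuous_on (ball c R') f" using f by (rule holomorphic_on_imp_continuous_on)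
 have "open (ball c R' \<inter> f -` (- {0}))"
  using cont by (rule continuous_open_preimage) auto
 moreover have "cball c R \<subseteq> ball c R' \<inter> f -` (- {0})" using nz R by auto
 ultimately obtain e where e: "e > 0" "(\<Union>x\<in>cball c R. cball x e) \<subseteq> ball c R' \<inter> f -` (- {0})"
  using compact_subset_open_imp_cball_epsilon_subset[OF compact_cball] by metis
 have sub: "ball c (R + e) \<subseteq> ball c R' \<inter> f -` (- {0})"
 proof (rule order_trans[OF _ e(2)], rule subsetI)
  fix z assume z: "z \<in> ball c (R + e)"
  show "z \<in> (\<Union>x\<in>cball c R. cball x e)"
  proof (cases "z \<in> cball c R")
   case True
   thus ?thesis using e(1) by (intro UN_I[of z]) auto
  next
   case False
   define d where "d = dist c z"
   have d: "d > R" "d < R + e" using False z by (auto simp: d_def)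
   \<comment> \<open>Radial projection of \<open>z\<close> onto the circle, at distance less than
     \<open>e\<close>.\<close>
   define w where "w = c + of_real (R / d) * (z - c)"
   have n: "norm (z - c) = d" by (simp add: d_def dist_norm norm_minus_commute)
   have wR: "dist c w = R" using d R n by (simp add: w_def dist_norm norm_mult norm_divide)
   have "w - z = of_real (R / d - 1) * (z - c)" by (simp add: w_def algebra_simps)
   hence "norm (w - z) = \<bar>R / d - 1\<bar> * d" using n by (simp only: norm_mult norm_of_real)
   moreover have "\<bar>R / d - 1\<bar> * d = d - R"
   proof -
    have "R / d < 1" using d R by simp
    hence "\<bar>R / d - 1\<bar> = 1 - R / d" by simp
    thus ?thesis using d R by (simp add: left_diff_distrib)
   qed
   ultimately have "dist w z = d - R" by (simp add: dist_norm)
   with wR show ?thesis using d by (intro UN_I[of w]) auto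
  qed
 qed
 have "f holomorphic_on ball c (R + e)" using sub f by (auto intro: holomorphic_on_subset)
 moreover have "\<And>z. z \<in> ball c (R + e) ==> f z ~= 0" using sub by auto
 ultimately obtain L where L: "L holomorphic_on ball c (R + e)" "\<And>z. z \<in> ball c (R + e) ==> f z = exp (L z)"
  using holomorphic_logarithm_exists[OF convex_ball open_ball, of f c "R + e" c] R e by (metis add_pos_pos centre_in_ball)
 have Re: "R < R + e" using e by simp
 have lnf: "ln (norm (f z)) = Re (L z)" if "z \<in> ball c (R + e)" for z
  using L(2)[OF that] by simp
 have inb: "c + of_real R * cis (2 * pi * x) \<in> ball c (R + e)" for x
  using R e by (simp add: dist_norm norm_mult)
 have "c \<in> ball c (R + e)" using R e by simp
 have "((Re \<circ> (%x. L (c + of_real R * cis (2 * pi * x)))) has_integral Re (L c)) {0..1}"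
  by (rule has_integral_linear[OF circle_mean[OF L(1) R(1) Re] bounded_linear_Re])
 thus "((%x. ln (norm (f (c + of_real R * cis (2 * pi * x))))) has_integral ln (norm (f c))) {0..1}"
  unfolding lnf[OF inb] lnf[OF \<open>c \<in> ball c (R + e)\<close>] by (simp add: o_def)
 have "((Re \<circ> (%x. of_real (cos (2 * pi * x)) * L (c + of_real R * cis (2 * pi * x)))) has_integral Re (of_real R / 2 * deriv L c)) {0..1}"
  by (rule has_integral_linear[OF circle_mean_deriv[OF L(1) R(1) Re] bounded_linear_Re])
 moreover have "deriv L c = deriv f c / f c"
 proof -
  have dL: "(L has_field_derivative deriv L c) (at c)"
   using L(1) \<open>c \<in> ball c (R + e)\<close> by (intro holomorphic_derivI[of _ "ball c (R + e)"]) auto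
  have "((%z. exp (L z)) has_field_derivative exp (L c) * deriv L c) (at c)"
   using dL by (rule DERIV_chain2[OF DERIV_exp])
  hence "(f has_field_derivative exp (L c) * deriv L c) (at c)"
   by (rule has_field_derivative_transform_within_open[of _ _ _ "ball c (R + e)"])
    (use L(2) R e in auto)
  thus ?thesis using L(2)[OF \<open>c \<in> ball c (R + e)\<close>] by (simp add: DERIV_imp_deriv)
 qed
 ultimately show "((%x. cos (2 * pi * x) * ln (norm (f (c + of_real R * cis (2 * pi * x)))))
      has_integral R / 2 * Re (deriv f c / f c)) {0..1}"
 proof -
  have "Re (of_real R / 2 * w) = R / 2 * Re w" for w by simp
  moreover assume "deriv L c = deriv f c / f c"
   "((Re \<circ> (%x. of_real (cos (2 * pi * x)) * L (c + of_real R * cis (2 * pi * x)))) has_integral Re (of_real R / 2 * deriv L c)) {0..1}"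
  ultimately show ?thesis unfolding lnf[OF inb] by (simp only: o_def) simp
 qed
qed

text \<open>Dividing out one zero by a Blaschke factor changes neither the modulus on the circle nor the other zeros.\<close>

lemma divide_zero:
 assumes f: "f holomorphic_on ball c R'" and R: "0 < R" "R < R'" and fc: "f c ~= 0"
  and \<rho>: "\<rho> \<in> ball c R" "f \<rho> = 0"
 obtains g where "g holomorphic_on ball c R'"
  "\<And>z. z \<in> sphere c R ==> norm (g z) = norm (f z)"
  "\<And>z. z \<in> cball c R ==> g z = 0 \<longleftrightarrow> f z = 0 \<and> z ~= \<rho>"
  "\<And>z. z \<in> ball c R ==> f z = 0 ==> z ~= \<rho> ==> zorder g z = zorder f z"
  "ln (norm (g c)) = ln (norm (f c)) + of_int (zorder f \<rho>) * ln (R / dist \<rho> c)"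
  "Re (deriv g c / g c) = Re (deriv f c / f c) + of_int (zorder f \<rho>) * Re (1 / (\<rho> - c) - cnj (\<rho> - c) / of_real (R\<^sup>2))"
proof -
 define n where "n = nat (zorder f \<rho>)"
 have \<rho>R: "\<rho> \<in> ball c R'" using \<rho> R by auto
 have "\<exists>w\<in>ball c R'. f w ~= 0" using fc R by (intro bexI[of _ c]) auto
 from zorder_exist_zero[OF f open_ball connected_ball \<rho>R this] \<rho>(2)
 obtain r where r: "zorder f \<rho> > 0" "r > 0" "cball \<rho> r \<subseteq> ball c R'" "zor_poly f \<rho> holomorphic_on cball \<rho> r"
  "\<And>w. w \<in> cball \<rho> r ==> f w = zor_poly f \<rho> w * (w - \<rho>) ^ n \<and> zor_poly f \<rho> w ~= 0"
  unfolding n_def by auto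
 have n: "of_int (zorder f \<rho>) = real n" "n > 0" using r(1) by (auto simp: n_def)
 define h where "h z = (if z = \<rho> then zor_poly f \<rho> \<rho> else f z / (z - \<rho>) ^ n)" for z
 have hz: "h z = zor_poly f \<rho> z" if "z \<in> ball \<rho> r" for z
  using r(5)[of z] that by (auto simp: h_def)
 have "h holomorphic_on ball \<rho> r \<union> (ball c R' - {\<rho>})"
 proof (rule holomorphic_on_Un)
  show "h holomorphic_on ball \<rho> r"
   using hz by (subst holomorphic_cong[OF refl hz]) (auto intro: holomorphic_on_subset[OF r(4)])
  have "(%z. f z / (z - \<rho>) ^ n) holomorphic_on ball c R' - {\<rho>}"
   by (intro holomorphic_intros holomorphic_on_subset[OF f]) auto
  thus "h holomorphic_on ball c R' - {\<rho>}"
   by (rule holomorphic_transform) (auto simp: h_def)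
 qed (auto intro: open_delete)
 moreover have "ball \<rho> r \<union> (ball c R' - {\<rho>}) = ball c R'" using r(2,3) by (auto simp: subset_iff)
 ultimately have h: "h holomorphic_on ball c R'" by simp
 have fh: "f z = (z - \<rho>) ^ n * h z" if "z \<in> ball c R'" for z
  using r(5)[of \<rho>] \<rho>(2) r(2) n by (auto simp: h_def)
 have h\<rho>: "h \<rho> ~= 0" using r(5)[of \<rho>] r(2) by (auto simp: h_def)
 define a where "a = \<rho> - c"
 \<comment> \<open>\<open>(z - \<rho>) / q z\<close> is the Blaschke factor. The function
   \<open>g\<close> exchanges each factor \<open>z - \<rho>\<close> for \<open>q z\<close>, which
   has no zero in the closed disc and the same modulus on the circle.\<close>
 define q where "q z = (of_real R ^ 2 - cnj a * (z - c)) / of_real R" for z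
 have aR: "norm a < R" "a ~= 0" using \<rho> fc by (auto simp: a_def dist_norm norm_minus_commute)
 have q0: "q z ~= 0" if "z \<in> cball c R" for z
 proof
  assume "q z = 0"
  hence "of_real R ^ 2 = cnj a * (z - c)" using R by (simp add: q_def)
  hence "norm (of_real R ^ 2 :: complex) = norm a * norm (z - c)" by (simp only: norm_mult complex_mod_cnj)
  hence "R ^ 2 = norm a * norm (z - c)" using R by (simp add: norm_power)
  also have "... <= norm a * R" using that by (intro mult_left_mono) (auto simp: dist_norm norm_minus_commute)
  also have "... < R * R" using aR R by simp
  finally show False by (simp add: power2_eq_square)
 qed
 have qn: "norm (q z) = norm (z - \<rho>)" if "z \<in> sphere c R" for z
 proof -
  define w where "w = z - c"
  have w: "norm w = R" using that by (simp add: w_def dist_norm norm_minus_commute)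
  have "of_real R ^ 2 = w * cnj w" using w by (simp add: complex_norm_square[symmetric])
  hence "q z * of_real R = w * cnj w - cnj a * w" using R by (simp add: q_def w_def)
  also have "... = w * cnj (z - \<rho>)" by (simp add: w_def a_def algebra_simps)
  finally have "norm (q z) * R = R * norm (z - \<rho>)"
   using w R by (metis norm_mult complex_mod_cnj norm_of_real abs_of_pos)
  thus ?thesis using R by simp
 qed
 have qh: "q holomorphic_on A" for A unfolding q_def by (intro holomorphic_intros) (use R in auto)
 define g where "g z = q z ^ n * h z" for z
 show thesis
 proof (rule that[of g])
  show "g holomorphic_on ball c R'" unfolding g_def by (intro holomorphic_intros qh h)
  show "norm (g z) = norm (f z)" if "z \<in> sphere c R" for z
   using qn[OF that] fh[of z] that R by (simp add: g_def norm_mult norm_power)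
  show "g z = 0 \<longleftrightarrow> f z = 0 \<and> z ~= \<rho>" if "z \<in> cball c R" for z
   using q0[OF that] fh[of z] that R h\<rho> by (auto simp: g_def)
  show "zorder g z = zorder f z" if z: "z \<in> ball c R" "f z = 0" "z ~= \<rho>" for z
  proof -
   have zR: "z \<in> ball c R'" using z R by auto
   have "\<exists>w\<in>ball c R'. f w ~= 0" using fc R by (intro bexI[of _ c]) auto
   from zorder_exist_zero[OF f open_ball connected_ball zR this] z(2)
   obtain s where s: "zorder f z > 0" "s > 0" "zor_poly f z holomorphic_on cball z s"
    "\<And>w. w \<in> cball z s ==> f w = zor_poly f z w * (w - z) ^ nat (zorder f z) \<and> zor_poly f z w ~= 0"
    by auto
   define S where "S = (ball z s \<inter> ball c R) - {\<rho>}"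
   show ?thesis
   proof (rule zorder_eqI[of S z "%w. (q w / (w - \<rho>)) ^ n * zor_poly f z w"])
    show "open S" unfolding S_def by auto
    show "z \<in> S" using z s by (auto simp: S_def)
    show "(%w. (q w / (w - \<rho>)) ^ n * zor_poly f z w) holomorphic_on S"
     by (intro holomorphic_intros qh holomorphic_on_subset[OF s(3)]) (auto simp: S_def)
    show "(q z / (z - \<rho>)) ^ n * zor_poly f z z ~= 0"
     using q0[of z] z s(2) s(4)[of z] by auto
    fix w assume w: "w \<in> S" "w ~= z"
    hence "f w = zor_poly f z w * (w - z) ^ nat (zorder f z)" "f w = (w - \<rho>) ^ n * h w" "w ~= \<rho>"
     using s(4)[of w] fh[of w] R by (auto simp: S_def)
    thus "g w = (q w / (w - \<rho>)) ^ n * zor_poly f z w * (w - z) powi zorder f z"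
     using s(1) by (simp add: g_def power_divide field_simps power_int_def)
   qed
  qed
  have cR: "c \<in> ball c R'" using R by simp
  have hc: "h c ~= 0" using fc fh[OF cR] by auto
  have nf: "norm (f c) = norm a ^ n * norm (h c)" using fh[OF cR] by (simp add: a_def norm_mult norm_power norm_minus_commute)
  have ng: "norm (g c) = R ^ n * norm (h c)" using R by (simp add: g_def q_def norm_mult norm_power power2_eq_square)
  have "dist \<rho> c = norm a" by (simp add: a_def dist_norm)
  thus "ln (norm (g c)) = ln (norm (f c)) + of_int (zorder f \<rho>) * ln (R / dist \<rho> c)"
   unfolding nf ng n using R aR hc by (simp add: ln_mult ln_div ln_realpow algebra_simps)
  have dh: "(h has_field_derivative deriv h c) (at c)"
   using h R by (intro holomorphic_derivI[of _ "ball c R'"]) auto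
  have "((%z. (z - \<rho>) ^ n * h z) has_field_derivative
    (of_nat n * (c - \<rho>) ^ (n - 1)) * h c + (c - \<rho>) ^ n * deriv h c) (at c)"
   by (rule derivative_eq_intros dh refl | simp)+
  hence "(f has_field_derivative (of_nat n * (c - \<rho>) ^ (n - 1)) * h c + (c - \<rho>) ^ n * deriv h c) (at c)"
   by (rule has_field_derivative_transform_within_open[of _ _ _ "ball c R'"]) (use fh R in auto)
  hence df: "deriv f c = of_nat n * (c - \<rho>) ^ (n - 1) * h c + (c - \<rho>) ^ n * deriv h c"
   by (rule DERIV_imp_deriv)
  have "(q has_field_derivative - cnj a / of_real R) (at c)"
   unfolding q_def by (rule derivative_eq_intros refl | use R in simp)+
  from DERIV_power[OF this, where n = n] dh
  have "((%z. q z ^ n * h z) has_field_derivative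
    (of_nat n * (- cnj a / of_real R * q c ^ (n - 1))) * h c + deriv h c * q c ^ n) (at c)"
   by (intro DERIV_mult) auto
  hence dg: "deriv g c = (of_nat n * (- cnj a / of_real R * q c ^ (n - 1))) * h c + deriv h c * q c ^ n"
   unfolding g_def by (rule DERIV_imp_deriv)
  have ca: "c - \<rho> = - a" by (simp add: a_def)
  have qc: "q c = of_real R" using R by (simp add: q_def power2_eq_square)
  obtain m where m: "n = Suc m" using n(2) by (cases n) auto
  have lf: "deriv f c / f c = - of_nat n / a + deriv h c / h c"
   unfolding df fh[OF cR] ca using aR hc by (simp add: m field_simps)
  have lg: "deriv g c / g c = - of_nat n * cnj a / of_real R ^ 2 + deriv h c / h c"
   unfolding dg g_def qc using R hc by (simp add: m field_simps power2_eq_square)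
  have "deriv g c / g c = deriv f c / f c + of_nat n * (1 / a - cnj a / of_real (R\<^sup>2))"
   unfolding lf lg by (simp add: algebra_simps)
  hence "Re (deriv g c / g c) = Re (deriv f c / f c) + Re (of_nat n * (1 / a - cnj a / of_real (R\<^sup>2)))"
   by simp
  also have "Re (of_nat n * w) = real n * Re w" for w by simp
  finally show "Re (deriv g c / g c) = Re (deriv f c / f c) + of_int (zorder f \<rho>) * Re (1 / (\<rho> - c) - cnj (\<rho> - c) / of_real (R\<^sup>2))"
   unfolding n a_def .
 qed
qed

text \<open>Induction over the zeros by \<open>divide_zero\<close>, from the zero-free case. The
  second formula is the differentiated form: it expresses the real part of \<open>f' / f\<close> at
  the centre by boundary values and a kernel over the zeros.\<close>

theorem jensen_formula:
 assumes "finite Z" "f holomorphic_on ball c R'" and R: "0 < R" "R < R'" and "f c ~= 0"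
  and "\<And>z. z \<in> sphere c R ==> f z ~= 0" and "Z = {z \<in> ball c R. f z = 0}"
 shows "((%x. ln (norm (f (c + of_real R * cis (2 * pi * x)))))
    has_integral (ln (norm (f c)) + (\<Sum>\<rho>\<in>Z. of_int (zorder f \<rho>) * ln (R / dist \<rho> c)))) {0..1} \<and>
   ((%x. cos (2 * pi * x) * ln (norm (f (c + of_real R * cis (2 * pi * x)))))
    has_integral R / 2 * (Re (deriv f c / f c)
     + (\<Sum>\<rho>\<in>Z. of_int (zorder f \<rho>) * Re (1 / (\<rho> - c) - cnj (\<rho> - c) / of_real (R\<^sup>2))))) {0..1}"
 using assms(1,2,5,6,7)
proof (induction Z arbitrary: f rule: finite_induct)
 case empty
 have nz: "f z ~= 0" if "z \<in> cball c R" for z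
  using empty.prems(3)[of z] empty.prems(4) that by (cases "z \<in> ball c R") auto
 from log_norm_circle_means[OF empty.prems(1) R nz] show ?case by simp
next
 case (insert \<rho> Z)
 have \<rho>: "\<rho> \<in> ball c R" "f \<rho> = 0" using insert.prems(4) by auto
 obtain g where g: "g holomorphic_on ball c R'"
  "\<And>z. z \<in> sphere c R ==> norm (g z) = norm (f z)"
  "\<And>z. z \<in> cball c R ==> g z = 0 \<longleftrightarrow> f z = 0 \<and> z ~= \<rho>"
  "\<And>z. z \<in> ball c R ==> f z = 0 ==> z ~= \<rho> ==> zorder g z = zorder f z"
  "ln (norm (g c)) = ln (norm (f c)) + of_int (zorder f \<rho>) * ln (R / dist \<rho> c)"
  "Re (deriv g c / g c) = Re (deriv f c / f c) + of_int (zorder f \<rho>) * Re (1 / (\<rho> - c) - cnj (\<rho> - c) / of_real (R\<^sup>2))"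
  using divide_zero[OF insert.prems(1) R insert.prems(2) \<rho>] by blast
 have "g c ~= 0" using g(3)[of c] R insert.prems(2) by auto
 moreover have "\<And>z. z \<in> sphere c R ==> g z ~= 0" using g(3) insert.prems(3) by (metis cball_def mem_Collect_eq mem_sphere mem_cball order_refl)
 moreover have "Z = {z \<in> ball c R. g z = 0}"
 proof -
  have "{z \<in> ball c R. g z = 0} = {z \<in> ball c R. f z = 0} - {\<rho>}" using g(3) by auto
  thus ?thesis using insert.prems(4) insert.hyps by auto
 qed
 ultimately have IH: "((%x. ln (norm (g (c + of_real R * cis (2 * pi * x)))))
    has_integral (ln (norm (g c)) + (\<Sum>\<rho>\<in>Z. of_int (zorder g \<rho>) * ln (R / dist \<rho> c)))) {0..1} \<and>
   ((%x. cos (2 * pi * x) * ln (norm (g (c + of_real R * cis (2 * pi * x)))))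
    has_integral R / 2 * (Re (deriv g c / g c)
     + (\<Sum>\<rho>\<in>Z. of_int (zorder g \<rho>) * Re (1 / (\<rho> - c) - cnj (\<rho> - c) / of_real (R\<^sup>2))))) {0..1}"
  by (intro insert.IH g(1))
 have zo: "zorder g z = zorder f z" if "z \<in> Z" for z
  using g(4)[of z] that insert.prems(4) insert.hyps by auto
 have ng: "norm (g (c + of_real R * cis (2 * pi * x))) = norm (f (c + of_real R * cis (2 * pi * x)))" for x
  using R by (intro g(2)) (simp add: dist_norm norm_mult)
 have s1: "(\<Sum>\<rho>\<in>Z. of_int (zorder g \<rho>) * ln (R / dist \<rho> c)) = (\<Sum>\<rho>\<in>Z. of_int (zorder f \<rho>) * ln (R / dist \<rho> c))"
  by (intro sum.cong refl) (simp add: zo)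
 have s2: "(\<Sum>\<rho>\<in>Z. of_int (zorder g \<rho>) * Re (1 / (\<rho> - c) - cnj (\<rho> - c) / of_real (R\<^sup>2)))
   = (\<Sum>\<rho>\<in>Z. of_int (zorder f \<rho>) * Re (1 / (\<rho> - c) - cnj (\<rho> - c) / of_real (R\<^sup>2)))"
  by (intro sum.cong refl) (simp add: zo)
 show ?case
  using IH unfolding ng s1 s2 g(5,6) sum.insert[OF insert.hyps] by (simp only: add.assoc)
qed

section \<open>Van der Corput bounds for dyadic blocks\<close>

text \<open>A \<open>k\<close>-th difference is a value of the \<open>k\<close>-th derivative
  nearby. The induction differences the whole family \<open>D\<close> once and applies the mean
  value theorem to its top member.\<close>

lemma fwd_bounds:
 fixes D :: "nat => real => real"
 assumes "\<And>j x. j < k ==> a <= x ==> (D j has_real_derivative D (Suc j) x) (at x)"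
  and "\<And>x. a + real i <= x ==> x <= a + real (i + k) ==> c <= D k x \<and> D k x <= C"
 shows "c <= fwd k (%i. D 0 (a + real i)) i \<and> fwd k (%i. D 0 (a + real i)) i <= C"
 using assms
proof (induction k arbitrary: D)
 case (Suc k)
 define D' where "D' j x = D j (x + 1) - D j x" for j x
 have "c <= fwd k (%i. D' 0 (a + real i)) i \<and> fwd k (%i. D' 0 (a + real i)) i <= C"
 proof (rule Suc.IH)
  fix j x assume j: "j < k" and x: "a <= x"
  have "(D j has_real_derivative D (Suc j) (x + 1)) (at (x + 1))" using Suc.prems(1)[of j "x + 1"] j x by simp
  hence "((%x. D j (x + 1)) has_real_derivative D (Suc j) (x + 1)) (at x)" by (simp add: DERIV_shift)
  thus "(D' j has_real_derivative D' (Suc j) x) (at x)"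
   unfolding D'_def using Suc.prems(1)[of j x] j x by (intro DERIV_diff) auto
 next
  fix x assume x: "a + real i <= x" "x <= a + real (i + k)"
  have "\<exists>z>x. z < x + 1 \<and> D k (x + 1) - D k x = (x + 1 - x) * D (Suc k) z"
   using x by (intro MVT2 Suc.prems(1)) auto
  then obtain z where "x < z" "z < x + 1" "D' k x = D (Suc k) z" by (auto simp: D'_def)
  thus "c <= D' k x \<and> D' k x <= C" using Suc.prems(2)[of z] x by auto
 qed
 moreover have "fwd k (%i. D' 0 (a + real i)) i = fwd (Suc k) (%i. D 0 (a + real i)) i"
  using fwd_shift_diff[of k "%i. D 0 (a + real i)" 1 i] by (simp add: D'_def add_ac)
 ultimately show ?case by simp
qed auto

text \<open>The sign makes the \<open>k\<close>-th derivative of the logarithm positive. Over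
  \<open>[N, 2 * N]\<close> it varies by the factor \<open>2 ^ k\<close>, so \<open>vdc\<close> is
  used with \<open>h = 2 ^ k\<close>.\<close>

lemma fwd_ln_bounds:
 fixes N :: nat and t :: real
 assumes k: "k >= 1" and N: "N >= 1" and i: "i + k <= N" and t: "t >= 0"
 shows "t * fact (k - 1) / (2 * real N) ^ k <= fwd k (%i. (-1) ^ (k - 1) * (t * ln (real N + real i))) i"
  and "fwd k (%i. (-1) ^ (k - 1) * (t * ln (real N + real i))) i <= 2 ^ k * (t * fact (k - 1) / (2 * real N) ^ k)"
proof -
 define D where "D j x = (if j = 0 then (-1) ^ (k - 1) * (t * ln x) else (-1) ^ (k - 1) * (t * ((-1) ^ (j - 1) * fact (j - 1) / x ^ j)))" for j and x :: real
 have "t * fact (k - 1) / (2 * real N) ^ k <= fwd k (%i. D 0 (real N + real i)) i \<and> fwd k (%i. D 0 (real N + real i)) i <= t * fact (k - 1) / real N ^ k"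
 proof (rule fwd_bounds)
  fix j x assume j: "j < k" and x: "real N <= x"
  hence x: "x > 0" using N by simp
  show "(D j has_real_derivative D (Suc j) x) (at x)"
  proof (cases j)
   case 0
   thus ?thesis unfolding D_def using x by (auto intro!: derivative_eq_intros simp: field_simps)
  next
   case (Suc l)
   have "((%x. x powi (- int (Suc l))) has_real_derivative (of_int (- int (Suc l)) * x powi (- int (Suc l) - 1))) (at x)"
    using DERIV_power_int[OF DERIV_ident, where x = x and s = UNIV and n = "- int (Suc l)"] x by (simp only: mult_1_right) simp
   moreover have "x powi (- int (Suc l)) = 1 / x ^ Suc l" for x :: real by (simp only: power_int_minus_divide power_int_of_nat)
   moreover have "- int (Suc l) - 1 = - int (Suc (Suc l))" by simp
   moreover have "x powi (- int (Suc (Suc l))) = 1 / x ^ Suc (Suc l)" by (simp only: power_int_minus_divide power_int_of_nat)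
   ultimately have "((%x. 1 / x ^ Suc l) has_real_derivative of_int (- int (Suc l)) * (1 / x ^ Suc (Suc l))) (at x)" by (simp only:)
   hence "((%x. (-1) ^ (k - 1) * (t * ((-1) ^ l * fact l * (1 / x ^ Suc l)))) has_real_derivative (-1) ^ (k - 1) * (t * ((-1) ^ l * fact l * (of_int (- int (Suc l)) * (1 / x ^ Suc (Suc l)))))) (at x)"
    by (intro DERIV_cmult)
   thus ?thesis unfolding D_def Suc by (simp add: algebra_simps)
  qed
 next
  fix x assume x: "real N + real i <= x" "x <= real N + real (i + k)"
  hence x: "real N <= x" "x <= 2 * real N" using i by auto
  have p: "(-1) ^ (k - 1) * ((-1) ^ (k - 1) :: real) = 1" by (simp flip: power_mult_distrib)
  have "D k x = ((-1) ^ (k - 1) * (-1) ^ (k - 1)) * (t * fact (k - 1) / x ^ k)" unfolding D_def using k by simp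
  hence "D k x = t * fact (k - 1) / x ^ k" unfolding p by simp
  moreover have "t * fact (k - 1) / (2 * real N) ^ k <= t * fact (k - 1) / x ^ k"
   using x N t by (intro divide_left_mono power_mono mult_pos_pos mult_nonneg_nonneg) auto
  moreover have "t * fact (k - 1) / x ^ k <= t * fact (k - 1) / real N ^ k"
   using x N t by (intro divide_left_mono power_mono mult_pos_pos mult_nonneg_nonneg) auto
  ultimately show "t * fact (k - 1) / (2 * real N) ^ k <= D k x \<and> D k x <= t * fact (k - 1) / real N ^ k" by simp
 qed
 moreover have "D 0 x = (-1) ^ (k - 1) * (t * ln x)" for x by (simp add: D_def)
 ultimately show "t * fact (k - 1) / (2 * real N) ^ k <= fwd k (%i. (-1) ^ (k - 1) * (t * ln (real N + real i))) i"
  "fwd k (%i. (-1) ^ (k - 1) * (t * ln (real N + real i))) i <= 2 ^ k * (t * fact (k - 1) / (2 * real N) ^ k)"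
  by (simp_all add: power_mult_distrib)
qed

definition block :: "real => nat => nat => complex" where
 "block \<tau> N M = (\<Sum>i<M. of_nat (N + i) powr (- (\<i> * of_real \<tau>)))"

text \<open>Conjugation allows either sign of the phase, hence the one that makes the relevant
  difference positive.\<close>

lemma norm_block:
 assumes N: "N >= 1" and c: "c = 1 \<or> c = -1"
 shows "norm (block \<tau> N M) = norm (\<Sum>i<M. ee (c * (\<tau> / (2 * pi) * ln (real N + real i))))"
proof -
 have e: "of_nat (N + i) powr (- (\<i> * of_real \<tau>)) = cis (- (\<tau> * ln (real N + real i)))" for i
 proof -
  have "Ln (of_nat (N + i)) = complex_of_real (ln (real (N + i)))" using N Ln_of_real[of "real (N + i)"] by simp
  hence "of_nat (N + i) powr (- (\<i> * of_real \<tau>)) = exp (- (\<i> * of_real \<tau>) * complex_of_real (ln (real (N + i))))"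
   using N by (simp add: powr_def del: of_nat_add)
  also have "- (\<i> * of_real \<tau>) * complex_of_real (ln (real (N + i))) = \<i> * of_real (- (\<tau> * ln (real N + real i)))" by simp
  finally show ?thesis by (simp only: cis_conv_exp)
 qed
 show ?thesis
 proof (cases "c = 1")
  case True
  have "(\<Sum>i<M. ee (c * (\<tau> / (2 * pi) * ln (real N + real i)))) = cnj (block \<tau> N M)"
   unfolding block_def e cnj_sum cis_cnj ee_def True by (intro sum.cong) auto
  thus ?thesis by simp
 next
  case False
  hence "(\<Sum>i<M. ee (c * (\<tau> / (2 * pi) * ln (real N + real i)))) = block \<tau> N M"
   using c unfolding block_def e ee_def by (intro sum.cong) auto
  thus ?thesis by simp
 qed
qed

text \<open>The \<open>q\<close>-th derivative test bounds a block of length \<open>N\<close> by a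
  constant times \<open>N powr ta q * \<tau> powr nu q\<close>. For \<open>q = k + 3\<close> with
  \<open>k >= 0\<close> the pair \<open>(ta q, nu q)\<close> is the node
  \<open>(sigma_k k, v_k k)\<close>.\<close>

definition nu :: "nat => real" where "nu q = 1 / (2 ^ q - 2)"
definition ta :: "nat => real" where "ta q = 1 - real q * nu q"
text \<open>Up to \<open>N = \<tau> powr wq q\<close> the second term of the test of order
  \<open>q\<close> is absorbed by the first. By \<open>nu_ta_diff\<close> the bounds of orders
  \<open>q - 1\<close> and \<open>q\<close> cross at the same length.\<close>

definition wq :: "nat => real" where "wq q = 1 / (real q - 2 + 4 / 2 ^ q)"

lemma two_power_ge_8: "q >= 3 ==> (2::real) ^ q >= 8"
 using power_increasing[of 3 q "2::real"] by simp

lemma nu_pos: "q >= 3 ==> nu q > 0" using two_power_ge_8[of q] by (simp add: nu_def)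

lemma wq_pos: "q >= 3 ==> wq q > 0" by (simp add: wq_def add_pos_pos)

lemma ta_less: assumes q: "q >= 3" shows "ta q < ta (Suc q)"
 and nu_ta_diff: "nu q - nu (Suc q) = wq (Suc q) * (ta (Suc q) - ta q)"
proof -
 define P :: real where "P = 2 ^ q"
 have P: "P >= 8" using two_power_ge_8[OF q] by (simp add: P_def)
 have n: "nu q = 1 / (P - 2)" "nu (Suc q) = 1 / (2 * P - 2)" by (simp_all add: nu_def P_def)
 have d: "(real q - 1) * P + 2 > 0" using P q by (intro add_nonneg_pos mult_nonneg_nonneg) auto
 have t: "ta (Suc q) - ta q = ((real q - 1) * P + 2) / ((P - 2) * (2 * P - 2))"
  unfolding ta_def n using P by (simp add: field_simps)
 have v: "nu q - nu (Suc q) = P / ((P - 2) * (2 * P - 2))" unfolding n using P by (simp add: field_simps)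
 have w: "wq (Suc q) = P / ((real q - 1) * P + 2)"
 proof -
  have "real (Suc q) - 2 + 4 / 2 ^ Suc q = ((real q - 1) * P + 2) / P" using P unfolding P_def by (simp add: field_simps)
  thus ?thesis unfolding wq_def by (simp only: divide_divide_eq_right mult_1_left)
 qed
 have "ta (Suc q) - ta q > 0" unfolding t using d P by (intro divide_pos_pos mult_pos_pos) auto
 thus "ta q < ta (Suc q)" by simp
 show "nu q - nu (Suc q) = wq (Suc q) * (ta (Suc q) - ta q)" unfolding t v w using d by simp
qed

text \<open>The \<open>k\<close>-th difference is about \<open>g * \<tau> / N ^ k\<close>. Apart
  from powers of \<open>g\<close>, the \<open>B\<close> term stays below the \<open>A\<close> term
  as long as \<open>ln N <= wq k * ln \<tau>\<close>.\<close>

lemma block_vdc_raw: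
 assumes v: "vdc k (2 ^ k) A B" and k: "k >= 3" and N: "N >= 1" "M <= N" and \<tau>: "\<tau> > 0" and AB: "A >= 0" "B >= 0"
  and g: "g = fact (k - 1) / (2 * pi * 2 ^ k)"
  and w: "ln (real N) <= wq k * ln \<tau>"
 shows "norm (block \<tau> N M) <= (A * g powr nu k + B * g powr (- nu k)) * exp (ta k * ln (real N) + nu k * ln \<tau>)"
proof -
 define lm where "lm = \<tau> / (2 * pi) * fact (k - 1) / (2 * real N) ^ k"
 have lm: "lm > 0" using \<tau> N by (simp add: lm_def)
 have g0: "g > 0" by (simp add: g)
 have nup: "nu k > 0" by (rule nu_pos[OF k])
 have lmg: "lm = g * \<tau> / real N ^ k" by (simp add: lm_def g power_mult_distrib mult_ac)
 have lnlm: "ln lm = ln g + ln \<tau> - real k * ln (real N)"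
  unfolding lmg using g0 \<tau> N by (simp add: ln_mult ln_div ln_realpow)
 have pw: "lm powr p = g powr p * exp (p * ln \<tau> - p * real k * ln (real N))" for p
  using lm g0 by (simp add: powr_def lnlm algebra_simps flip: exp_add)
 have "norm (block \<tau> N M) = norm (\<Sum>i<M. ee ((-1) ^ (k - 1) * (\<tau> / (2 * pi) * ln (real N + real i))))"
  by (rule norm_block[OF N(1)]) (use neg_one_even_power neg_one_odd_power in blast)
 also have "... <= A * real M * lm powr (1 / (2 ^ k - 2)) + B * real M powr (1 - 4 / 2 ^ k) * lm powr (- 1 / (2 ^ k - 2))"
 proof -
  have "lm <= fwd k (%i. (-1) ^ (k - 1) * (\<tau> / (2 * pi) * ln (real N + real i))) i \<and>
   fwd k (%i. (-1) ^ (k - 1) * (\<tau> / (2 * pi) * ln (real N + real i))) i <= 2 ^ k * lm" if "i + k <= M" for i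
   unfolding lm_def using fwd_ln_bounds[of k N i "\<tau> / (2 * pi)"] k N \<tau> that by simp
  thus ?thesis using v lm unfolding vdc_def by blast
 qed
 also have "... <= A * real N * lm powr nu k + B * real N powr (1 - 4 / 2 ^ k) * lm powr (- nu k)"
 proof -
  have "4 / 2 ^ k <= (4 / 8 :: real)" using two_power_ge_8[OF k] by (intro divide_left_mono) auto
  thus ?thesis unfolding nu_def minus_divide_left using N AB
   by (intro add_mono mult_right_mono mult_left_mono powr_mono2) auto
 qed
 also have "real N = exp (ln (real N))" using N by simp
 also have "A * exp (ln (real N)) * lm powr nu k = A * g powr nu k * exp (ta k * ln (real N) + nu k * ln \<tau>)"
  unfolding pw ta_def by (simp add: algebra_simps flip: exp_add)
 also have "exp (ln (real N)) = real N" using N by simp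
 also have "B * real N powr (1 - 4 / 2 ^ k) * lm powr (- nu k) <= B * g powr (- nu k) * exp (ta k * ln (real N) + nu k * ln \<tau>)"
 proof -
  have "real N powr (1 - 4 / 2 ^ k) = exp ((1 - 4 / 2 ^ k) * ln (real N))" using N by (simp add: powr_def)
  hence "B * real N powr (1 - 4 / 2 ^ k) * lm powr (- nu k) = B * g powr (- nu k) * exp ((1 - 4 / 2 ^ k) * ln (real N) + (nu k * real k * ln (real N) - nu k * ln \<tau>))"
   unfolding pw by (simp add: algebra_simps flip: exp_add)
  also have "... <= B * g powr (- nu k) * exp (ta k * ln (real N) + nu k * ln \<tau>)"
  proof -
   have q: "2 * nu k * real k - 4 / 2 ^ k = 2 * nu k * (real k - 2 + 4 / 2 ^ k)"
   proof -
    define P :: real where "P = 2 ^ k"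
    have P: "P >= 8" using two_power_ge_8[OF k] by (simp add: P_def)
    show ?thesis unfolding nu_def P_def[symmetric] using P by (simp add: field_simps)
   qed
   have d: "real k - 2 + 4 / 2 ^ k > 0" using k by (intro add_nonneg_pos) auto
   have "(real k - 2 + 4 / 2 ^ k) * ln (real N) <= ln \<tau>" using w d unfolding wq_def by (simp add: field_simps)
   hence "2 * nu k * ((real k - 2 + 4 / 2 ^ k) * ln (real N)) <= 2 * nu k * ln \<tau>" using nup by (intro mult_left_mono) auto
   hence "(2 * nu k * real k - 4 / 2 ^ k) * ln (real N) <= 2 * nu k * ln \<tau>" unfolding q by (simp only: mult.assoc)
   hence "(1 - 4 / 2 ^ k) * ln (real N) + (nu k * real k * ln (real N) - nu k * ln \<tau>) <= ta k * ln (real N) + nu k * ln \<tau>"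
    unfolding ta_def by (simp add: algebra_simps)
   thus ?thesis using AB by (intro mult_left_mono) auto
  qed
  finally show ?thesis .
 qed
 finally show ?thesis by (simp add: distrib_right)
qed

lemma inverse_power_le:
 fixes a b :: real
 assumes "a > 0" "b > 0" "a <= b ^ n" "n >= 1" "p = 1 / real n"
 shows "a powr p <= b"
proof -
 have "a powr p <= (b ^ n) powr p" using assms by (intro powr_mono2) auto
 also have "b ^ n = b powr real n" using assms by (simp add: powr_realpow)
 also have "(b powr real n) powr p = b" using assms by (simp add: powr_powr)
 finally show ?thesis .
qed

lemma nu_nat: "q >= 3 ==> nu q = 1 / real (2 ^ q - 2)"
proof -
 assume "q >= 3"
 hence "(2::nat) ^ q >= 2 ^ 3" by (intro power_increasing) auto
 thus ?thesis by (simp add: nu_def of_nat_diff)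
qed

text \<open>One constant for all orders. Order 3 decides 47/5 and uses the sharper
  \<open>vdc_3\<close>. For \<open>k >= 4\<close> the powers of \<open>g\<close> stay bounded, since
  the factorial in \<open>g\<close> grows far more slowly than \<open>b ^ (2 ^ k)\<close>.\<close>

lemma block_bound:
 assumes k: "k >= 3" and N: "N >= 1" "M <= N" and \<tau>: "\<tau> > 0" and w: "ln (real N) <= wq k * ln \<tau>"
 shows "norm (block \<tau> N M) <= 47 / 5 * exp (ta k * ln (real N) + nu k * ln \<tau>)"
proof (cases "k = 3")
 case True
 define g where "g = fact (3 - 1) / (2 * pi * 2 ^ 3)"
 have g: "g = 1 / (8 * pi)" by (simp add: g_def fact_numeral)
 have nu3: "nu 3 = 1 / real 6" by (simp add: nu_def)
 have pi: "pi > 31415/10000" "pi < 31416/10000" using pi_approx by auto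
 have "g powr nu 3 <= 5849/10000"
  by (rule inverse_power_le[OF _ _ _ _ nu3]) (use pi in \<open>auto simp: g field_simps\<close>)
 hence 1: "1508/1000 * (2 ^ 3) powr (1 / 2) * g powr nu 3 <= 1508/1000 * (2829/1000) * (5849/10000)"
 proof (intro mult_mono)
  show "(2 ^ 3 :: real) powr (1 / 2) <= 2829/1000"
   by (rule inverse_power_le[of _ _ 2]) (auto simp: power2_eq_square)
 qed auto
 have "g powr (- nu 3) = (1 / g) powr nu 3" unfolding g by (simp add: powr_minus powr_divide)
 also have "... <= 17123/10000"
  by (rule inverse_power_le[OF _ _ _ _ nu3]) (use pi in \<open>auto simp: g field_simps\<close>)
 finally have "1508/1000 * (2 ^ 3) powr (1 / 2) * g powr nu 3 + 4 * g powr (- nu 3) <= 47 / 5" using 1 by simp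
 hence 2: "(1508/1000 * (2 ^ 3) powr (1 / 2) * g powr nu 3 + 4 * g powr (- nu 3)) * exp (ta 3 * ln (real N) + nu 3 * ln \<tau>)
   <= 47 / 5 * exp (ta 3 * ln (real N) + nu 3 * ln \<tau>)" by (intro mult_right_mono) auto
 have "norm (block \<tau> N M) <= (1508/1000 * (2 ^ 3) powr (1 / 2) * g powr nu 3 + 4 * g powr (- nu 3)) * exp (ta 3 * ln (real N) + nu 3 * ln \<tau>)"
  by (rule block_vdc_raw[OF vdc_3 _ N \<tau> _ _ g_def]) (use w True in auto)
 thus ?thesis using 2 unfolding True by (rule order_trans)
next
 case False
 hence k4: "k >= 4" using k by simp
 define g where "g = (fact (k - 1) / (2 * pi * 2 ^ k) :: real)"
 have g0: "g > 0" by (simp add: g_def)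
 have n: "2 ^ k - 2 >= (1::nat)"
 proof -
  have "(2::nat) ^ k >= 2 ^ 3" using k by (intro power_increasing) auto
  thus ?thesis by simp
 qed
 have bern: "1 + real n * (7/100) <= (107/100) ^ n" for n using Bernoulli_inequality[of "7/100" n] by simp
 have g_up: "g <= (107/100) ^ (2 ^ k - 2)"
  using k4 unfolding g_def
 proof (induction k rule: dec_induct)
  case base
  have "fact (4 - 1) / (2 * pi * 2 ^ 4) <= (1 :: real)" using pi_gt3 by (simp add: fact_numeral)
  also have "1 <= (107/100 :: real) ^ (2 ^ 4 - 2)" by (rule one_le_power) simp
  finally show ?case .
 next
  case (step k)
  have p: "(2::nat) ^ k >= 2" using power_increasing[of 1 k "2::nat"] step.hyps by simp
  \<comment> \<open>Passing from \<open>k\<close> to \<open>k + 1\<close> multiplies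
    \<open>g\<close> by \<open>k / 2\<close> but adds \<open>2 ^ k\<close> to the exponent on the
    right; Bernoulli's inequality shows that this suffices.\<close>
  have kk: "real k / 2 <= (107/100) ^ (2 ^ k)"
  proof -
   have "1 + real (2 ^ k) * (7/100) >= real k / 2" using step.hyps
   proof (induction k rule: dec_induct)
    case (step k)
    have "(2::real) ^ k >= 2 ^ 4" using step.hyps by (intro power_increasing) auto
    thus ?case using step by simp
   qed simp
   thus ?thesis using bern[of "2 ^ k"] by linarith
  qed
  have "fact (Suc k - 1) / (2 * pi * 2 ^ Suc k) = (fact (k - 1) / (2 * pi * 2 ^ k)) * (real k / 2)"
  proof -
   have "fact (Suc k - 1) = real k * fact (k - 1)" using step.hyps fact_reduce[of k, where 'a = real] by simp
   thus ?thesis by simp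
  qed
  also have "... <= (107/100) ^ (2 ^ k - 2) * (107/100) ^ (2 ^ k)" using step.IH kk by (intro mult_mono) auto
  also have "... = (107/100) ^ (2 ^ Suc k - 2)" using p by (simp flip: power_add)
  finally show ?case .
 qed
 have g_lo: "1 / g <= (5/4) ^ (2 ^ k - 2)"
 proof -
  have "g >= 6 / (2 * pi * 2 ^ 4)" using k4 unfolding g_def
  proof (induction k rule: dec_induct)
   case base show ?case by (simp add: fact_numeral)
  next
   case (step k)
   have "fact (Suc k - 1) = real k * fact (k - 1)" using step.hyps fact_reduce[of k, where 'a = real] by simp
   hence "fact (Suc k - 1) / (2 * pi * 2 ^ Suc k) = (fact (k - 1) / (2 * pi * 2 ^ k)) * (real k / 2)" by simp
   moreover have "(fact (k - 1) / (2 * pi * 2 ^ k)) * 1 <= (fact (k - 1) / (2 * pi * 2 ^ k)) * (real k / 2)"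
    using step.hyps by (intro mult_left_mono) auto
   ultimately show ?case using step.IH by linarith
  qed
  hence "1 / g <= 1 / (6 / (2 * pi * 2 ^ 4))" using g0 by (intro divide_left_mono mult_pos_pos divide_pos_pos) auto
  also have "... <= 17" using pi_approx by simp
  also have "... <= (5/4) ^ 14" by (simp add: field_simps)
  also have "... <= (5/4) ^ (2 ^ k - 2)"
  proof (rule power_increasing)
   have "(2::nat) ^ k >= 2 ^ 4" using k4 by (intro power_increasing) auto
   thus "14 <= (2::nat) ^ k - 2" by simp
  qed simp
  finally show ?thesis .
 qed
 have gp: "g powr nu k <= 107/100" by (rule inverse_power_le[OF g0 _ g_up n nu_nat[OF k]]) simp
 have "g powr (- nu k) = (1 / g) powr nu k" using g0 by (simp add: powr_minus powr_divide field_simps)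
 also have "... <= 5/4" by (rule inverse_power_le[OF _ _ g_lo n nu_nat[OF k]]) (use g0 in auto)
 finally have gm: "g powr (- nu k) <= 5/4" .
 have h: "(2 ^ k) powr (4 / 2 ^ k) <= (2 :: real)"
 proof -
  have "4 * real k <= 2 ^ k" using k4
  proof (induction k rule: dec_induct)
   case (step k)
   have "(2::real) ^ k >= 2 ^ 4" using step.hyps by (intro power_increasing) auto
   thus ?case using step by simp
  qed simp
  hence "real k * (4 / 2 ^ k) <= 1" by (simp add: field_simps)
  hence "2 powr (real k * (4 / 2 ^ k)) <= 2 powr (1 :: real)" by (intro powr_mono) auto
  thus ?thesis by (simp add: powr_realpow[symmetric] powr_powr)
 qed
 have "18/10 * (2 ^ k) powr (4 / 2 ^ k) * g powr nu k <= 18/10 * 2 * (107/100)"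
  using gp h by (intro mult_mono) auto
 hence "18/10 * (2 ^ k) powr (4 / 2 ^ k) * g powr nu k + 4 * g powr (- nu k) <= 47 / 5" using gm by linarith
 hence 2: "(18/10 * (2 ^ k) powr (4 / 2 ^ k) * g powr nu k + 4 * g powr (- nu k)) * exp (ta k * ln (real N) + nu k * ln \<tau>)
   <= 47 / 5 * exp (ta k * ln (real N) + nu k * ln \<tau>)" by (intro mult_right_mono) auto
 have "norm (block \<tau> N M) <= (18/10 * (2 ^ k) powr (4 / 2 ^ k) * g powr nu k + 4 * g powr (- nu k)) * exp (ta k * ln (real N) + nu k * ln \<tau>)"
  by (rule block_vdc_raw[OF vdc_ge_3[OF two_power_ge_8[OF k] k] k N \<tau> _ _ g_def w]) auto
 thus ?thesis using 2 by (rule order_trans)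
qed

text \<open>For longer blocks a lower order does better: beyond the crossing point the exponent of
  order \<open>k\<close> is below that of order \<open>k + 1\<close>. The induction finds the order
  whose range contains \<open>N\<close>; order 3 reaches \<open>\<tau> powr (2/3)\<close>.\<close>

lemma block_bound_low:
 assumes k: "k >= 3" and N: "N >= 1" "M <= N" and \<tau>: "\<tau> > 0" and w: "ln (real N) <= 2 / 3 * ln \<tau>"
  and x: "wq (Suc k) * ln \<tau> <= ln (real N)"
 shows "norm (block \<tau> N M) <= 47 / 5 * exp (ta k * ln (real N) + nu k * ln \<tau>)"
 using k x
proof (induction k rule: dec_induct)
 case base
 have "wq 3 = 2 / 3" by (simp add: wq_def)
 hence "ln (real N) <= wq 3 * ln \<tau>" using w by (simp only:)
 thus ?case using block_bound[of 3 N M \<tau>] N \<tau> by simp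
next
 case (step k)
 show ?case
 proof (cases "ln (real N) <= wq (Suc k) * ln \<tau>")
  case True
  thus ?thesis using block_bound[of "Suc k"] step.hyps N \<tau> by simp
 next
  case False
  hence le: "wq (Suc k) * ln \<tau> <= ln (real N)" by simp
  hence "(ta (Suc k) - ta k) * (wq (Suc k) * ln \<tau>) <= (ta (Suc k) - ta k) * ln (real N)"
   using ta_less[of k] step.hyps by (intro mult_left_mono) auto
  hence "(nu k - nu (Suc k)) * ln \<tau> <= (ta (Suc k) - ta k) * ln (real N)"
   unfolding nu_ta_diff[OF step.hyps(1)] by (simp add: mult_ac)
  hence "ta k * ln (real N) + nu k * ln \<tau> <= ta (Suc k) * ln (real N) + nu (Suc k) * ln \<tau>" by (simp add: algebra_simps)
  hence "47 / 5 * exp (ta k * ln (real N) + nu k * ln \<tau>) <= 47 / 5 * exp (ta (Suc k) * ln (real N) + nu (Suc k) * ln \<tau>)" by simp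
  thus ?thesis using step.IH[OF le] by linarith
 qed
qed

text \<open>
  On the segment between two consecutive nodes the exponent is a convex combination of the
  exponents belonging to the nodes; \<open>wq (Suc k)\<close> is the point where these two agree, so one of
  the two bounds is always good enough.
\<close>

lemma block_bound_interpolated:
 assumes k: "k >= 3" and N: "N >= 1" "M <= N" and \<tau>: "\<tau> > 0" and w: "ln (real N) <= 2 / 3 * ln \<tau>"
  and l: "0 <= l" "l <= 1"
 shows "norm (block \<tau> N M) <= 47 / 5 * exp (((1 - l) * ta k + l * ta (Suc k)) * ln (real N) + ((1 - l) * nu k + l * nu (Suc k)) * ln \<tau>)"
proof -
 define a where "a = ta k * ln (real N) + nu k * ln \<tau>"
 define b where "b = ta (Suc k) * ln (real N) + nu (Suc k) * ln \<tau>"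
 have ab: "b - a = (ta (Suc k) - ta k) * (ln (real N) - wq (Suc k) * ln \<tau>)"
 proof -
  have "b - a = (ta (Suc k) - ta k) * ln (real N) - (nu k - nu (Suc k)) * ln \<tau>" unfolding a_def b_def by (simp add: algebra_simps)
  thus ?thesis unfolding nu_ta_diff[OF k] by (simp add: algebra_simps)
 qed
 have t: "ta (Suc k) - ta k >= 0" using ta_less[OF k] by simp
 have eq: "((1 - l) * ta k + l * ta (Suc k)) * ln (real N) + ((1 - l) * nu k + l * nu (Suc k)) * ln \<tau> = a + l * (b - a)"
  unfolding a_def b_def by (simp add: algebra_simps)
 show ?thesis
 proof (cases "ln (real N) <= wq (Suc k) * ln \<tau>")
  case True
  hence "b - a <= 0" unfolding ab using t by (intro mult_nonneg_nonpos) auto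
  hence "(1 - l) * (b - a) <= 0" using l by (intro mult_nonneg_nonpos) auto
  hence "b <= a + l * (b - a)" by (simp add: algebra_simps)
  moreover have "norm (block \<tau> N M) <= 47 / 5 * exp b" using block_bound[of "Suc k" N M \<tau>] True k N \<tau> by (simp add: b_def)
  ultimately show ?thesis unfolding eq using exp_le_cancel_iff[of b "a + l * (b - a)"] by linarith
 next
  case False
  hence "b - a >= 0" unfolding ab using t by (intro mult_nonneg_nonneg) auto
  hence "a <= a + l * (b - a)" using l by simp
  moreover have "norm (block \<tau> N M) <= 47 / 5 * exp a" using block_bound_low[OF k N \<tau> w] False by (simp add: a_def)
  ultimately show ?thesis unfolding eq using exp_le_cancel_iff[of a "a + l * (b - a)"] by linarith
 qed
qed

text \<open>Used for lengths between \<open>\<tau> powr (2/3)\<close> and \<open>\<tau>\<close>,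
  beyond the reach of order 3. The increments of the phase change in total by at most
  \<open>\<tau> / (2 * pi * N)\<close>.\<close>

lemma block_second:
 assumes N: "N >= 1" "M <= N" and \<tau>: "\<tau> > 0" and s: "sqrt \<tau> <= real N"
 shows "norm (block \<tau> N M) <= (\<tau> / (2 * pi * real N) + 2) * (34 / 3 * (real N / sqrt \<tau>) + 1)"
proof (cases "M = 0")
 case True
 thus ?thesis using N \<tau> by (simp add: block_def)
next
 case False
 define f where "f i = (-1) * (\<tau> / (2 * pi) * ln (real N + real i))" for i :: nat
 define lm where "lm = \<tau> / (2 * pi) / (2 * real N) ^ 2"
 \<comment> \<open>The exactly balancing value has \<open>2 * sqrt 2\<close> in place of 3.\<close>
 define th where "th = sqrt \<tau> / (3 * pi * real N)"
 have N0: "real N > 0" using N by simp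
 have st: "sqrt \<tau> > 0" "sqrt \<tau> * sqrt \<tau> = \<tau>" using \<tau> by auto
 have "norm (block \<tau> N M) = norm (\<Sum>i<M. ee (f i))" unfolding f_def by (rule norm_block[OF N(1)]) simp
 also have "... <= (\<tau> / (2 * pi * real N) + 2) * (2 * th / lm + 1 + 2 / (pi * th))"
 proof (rule second_difference_test)
  show "lm > 0" "th > 0" using \<tau> N by (simp_all add: lm_def th_def)
  have "sqrt \<tau> / (3 * pi * real N) <= real N / (3 * pi * real N)" using s N by (intro divide_right_mono) auto
  also have "... <= 1 / 2" using N0 pi_gt3 by (simp add: field_simps)
  finally show "th <= 1 / 2" by (simp add: th_def)
  show "M >= 1" using False by simp
  fix i assume i: "Suc (Suc i) <= M"
  show "lm <= (f (Suc (Suc i)) - f (Suc i)) - (f (Suc i) - f i)"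
   using fwd_ln_bounds(1)[of 2 N i "\<tau> / (2 * pi)"] i N \<tau> unfolding lm_def f_def by (simp add: numeral_2_eq_2)
 next
  have "f M <= f (M - 1)" unfolding f_def using \<tau> N0 by (simp add: divide_right_mono)
  moreover have "- (f 1 - f 0) <= \<tau> / (2 * pi * real N)"
  proof -
   have "ln (real N + 1) - ln (real N) = ln ((real N + 1) / real N)" using N0 by (simp add: ln_div)
   also have "(real N + 1) / real N = 1 + 1 / real N" using N0 by (simp add: field_simps)
   finally have "ln (real N + 1) - ln (real N) = ln (1 + 1 / real N)" .
   also have "... <= 1 / real N" using N0 by (intro ln_add_one_self_le_self2) (auto intro: order_less_trans[of _ 0])
   finally have "\<tau> / (2 * pi) * (ln (real N + 1) - ln (real N)) <= \<tau> / (2 * pi) * (1 / real N)" using \<tau> by (intro mult_left_mono) auto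
   thus ?thesis unfolding f_def by (simp add: algebra_simps)
  qed
  ultimately show "(f M - f (M - 1)) - (f 1 - f 0) <= \<tau> / (2 * pi * real N)" by simp
 qed
 also have "2 * th / lm + 1 + 2 / (pi * th) = 34 / 3 * (real N / sqrt \<tau>) + 1"
 proof -
  have "2 * th / lm = 16 / 3 * (real N * sqrt \<tau> / \<tau>)" unfolding th_def lm_def using N0 \<tau> by (simp add: field_simps power2_eq_square)
  moreover have "real N * sqrt \<tau> / \<tau> = real N / sqrt \<tau>" using st by (simp add: field_simps)
  moreover have "2 / (pi * th) = 6 * (real N / sqrt \<tau>)" unfolding th_def using N0 st by (simp add: field_simps)
  ultimately show ?thesis by simp
 qed
 finally show ?thesis .
qed

text \<open>For \<open>N >= \<tau>\<close> every increment of the phase lies in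
  \<open>[- 2 * th, - th]\<close>, so Kusmin-Landau with \<open>\<nu> = -1\<close> takes the block
  in one piece.\<close>

lemma block_first:
 assumes N: "N >= 1" "M <= N" and \<tau>: "\<tau> > 0" and s: "\<tau> <= real N"
 shows "norm (block \<tau> N M) <= 8 * real N / \<tau>"
proof -
 define f where "f i = (-1) * (\<tau> / (2 * pi) * ln (real N + real i))" for i :: nat
 define th where "th = \<tau> / (4 * pi * real N)"
 have N0: "real N > 0" using N by simp
 have d: "f (Suc i) - f i = - (\<tau> / (2 * pi) * ln (1 + 1 / (real N + real i)))" for i
 proof -
  have "ln (real N + real (Suc i)) - ln (real N + real i) = ln (1 + 1 / (real N + real i))"
  proof -
   define x where "x = real N + real i"
   have x: "x > 0" using N0 by (simp add: x_def)
   have "ln (x + 1) - ln x = ln ((x + 1) / x)" using x by (simp add: ln_div)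
   also have "(x + 1) / x = 1 + 1 / x" using x by (simp add: field_simps)
   finally show ?thesis by (simp add: x_def add_ac)
  qed
  thus ?thesis unfolding f_def by (simp only: right_diff_distrib[symmetric] mult_minus1 minus_diff_minus minus_mult_right[symmetric])
 qed
 have "norm (block \<tau> N M) = norm (\<Sum>i=0..<M. ee (f i))"
  unfolding f_def atLeast0LessThan by (rule norm_block[OF N(1)]) simp
 also have "... <= 2 / (pi * th)"
 proof (rule kusmin_landau[where \<nu> = "-1"])
  show "th > 0" using \<tau> N0 by (simp add: th_def)
  have th4: "th <= 1 / (4 * pi)" unfolding th_def using s N0 by (simp add: field_simps)
  have p: "1 / (4 * pi) <= 1 / 12" using pi_gt3 by (intro divide_left_mono) auto
  hence th12: "th <= 1 / 12" using th4 by linarith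
  thus "th <= 1 / 2" by simp
  fix i assume i: "0 <= i" "Suc i < M"
  have "ln (1 + 1 / (real N + real i)) <= 1 / (real N + real i)" using N0 by (intro ln_add_one_self_le_self) auto
  also have "... <= 1 / real N" using N0 by (intro divide_left_mono) auto
  finally have "\<tau> / (2 * pi) * ln (1 + 1 / (real N + real i)) <= \<tau> / (2 * pi) * (1 / real N)" using \<tau> by (intro mult_left_mono) auto
  also have "... = 2 * th" using N0 by (simp add: th_def field_simps)
  finally have up: "\<tau> / (2 * pi) * ln (1 + 1 / (real N + real i)) <= 2 * th" .
  have "1 / (2 * real N) <= ln (1 + 1 / (real N + real i))"
  proof -
   define x where "x = real N + real i"
   have x: "x > 0" "x + 1 <= 2 * real N" using N0 i N by (auto simp: x_def)
   have "1 / (2 * real N) <= 1 / (x + 1)" using x by (intro divide_left_mono) auto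
   moreover have "ln (x / (x + 1)) <= x / (x + 1) - 1" using x by (intro ln_le_minus_one) auto
   moreover have "x / (x + 1) - 1 = - (1 / (x + 1))" using x by (simp add: field_simps)
   moreover have "ln (1 + 1 / x) = - ln (x / (x + 1))"
   proof -
    have "1 + 1 / x = inverse (x / (x + 1))" using x by (simp add: field_simps)
    thus ?thesis using x by (simp only: ln_inverse divide_pos_pos)
   qed
   ultimately show ?thesis unfolding x_def by linarith
  qed
  hence "\<tau> / (2 * pi) * (1 / (2 * real N)) <= \<tau> / (2 * pi) * ln (1 + 1 / (real N + real i))" using \<tau> by (intro mult_left_mono) auto
  moreover have "\<tau> / (2 * pi) * (1 / (2 * real N)) = th" by (simp add: th_def)
  ultimately show "of_int (-1) + th <= f (Suc i) - f i \<and> f (Suc i) - f i <= of_int (-1) + 1 - th"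
   unfolding d using up th12 by simp
 next
  fix i assume i: "0 <= i" "Suc (Suc i) < M"
  have "ln (1 + 1 / (real N + real (Suc i))) <= ln (1 + 1 / (real N + real i))"
   using N0 by (intro ln_mono add_left_mono divide_left_mono) (auto intro: add_pos_nonneg)
  thus "f (Suc i) - f i <= f (Suc (Suc i)) - f (Suc i)" unfolding d using \<tau> by (simp add: mult_left_mono divide_right_mono)
 qed simp
 also have "2 / (pi * th) = 8 * real N / \<tau>" using N0 \<tau> by (simp add: th_def field_simps)
 finally show ?thesis .
qed

lemma abel_bound:
 fixes a :: "nat => real" and b :: "nat => complex"
 assumes a: "\<And>i. 0 <= a i" "\<And>i. a (Suc i) <= a i" and B: "\<And>m. m <= n ==> norm (\<Sum>i<m. b i) <= B"
 shows "norm (\<Sum>i<n. of_real (a i) * b i) <= a 0 * B"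
proof -
 have eq: "(\<Sum>i<m. of_real (a i) * b i) = (\<Sum>i<m. of_real (a i - a (Suc i)) * (\<Sum>j<Suc i. b j)) + of_real (a m) * (\<Sum>i<m. b i)" for m
  by (induction m) (simp_all add: algebra_simps)
 have "norm (\<Sum>i<n. of_real (a i - a (Suc i)) * (\<Sum>j<Suc i. b j)) <= (\<Sum>i<n. (a i - a (Suc i)) * B)"
 proof (rule sum_norm_le)
  fix i assume "i \<in> {..<n}"
  hence "norm (\<Sum>j<Suc i. b j) <= B" using B[of "Suc i"] by simp
  thus "norm (of_real (a i - a (Suc i)) * (\<Sum>j<Suc i. b j)) <= (a i - a (Suc i)) * B"
   unfolding norm_mult norm_of_real using a(2)[of i] by (simp add: mult_left_mono)
 qed
 also have "... = (a 0 - a n) * B" unfolding sum_distrib_right[symmetric] sum_lessThan_telescope' ..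
 finally have 1: "norm (\<Sum>i<n. of_real (a i - a (Suc i)) * (\<Sum>j<Suc i. b j)) <= (a 0 - a n) * B" .
 have 2: "norm (of_real (a n) * (\<Sum>i<n. b i)) <= a n * B"
  unfolding norm_mult norm_of_real using a(1)[of n] B[of n] by (simp add: mult_left_mono)
 have "norm (\<Sum>i<n. of_real (a i) * b i) <= (a 0 - a n) * B + a n * B"
  unfolding eq by (rule order_trans[OF norm_triangle_ineq add_mono[OF 1 2]])
 thus ?thesis by (simp add: algebra_simps)
qed

text \<open>Partial summation: the decreasing weight \<open>n powr (- \<sigma>)\<close> costs its
  value at the start of the block. This is why the block bounds cover all
  \<open>M <= N\<close>.\<close>

lemma dirichlet_block:
 assumes \<sigma>: "\<sigma> >= 0" and N: "N >= 1" and B: "\<And>M. M <= N ==> norm (block \<tau> N M) <= B"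
 shows "norm (\<Sum>n=N..<2*N. of_nat n powr (- Complex \<sigma> \<tau>)) <= exp (- \<sigma> * ln (real N)) * B"
proof -
 have "(\<Sum>n=N..<2*N. of_nat n powr (- Complex \<sigma> \<tau>)) = (\<Sum>i<N. of_nat (N + i) powr (- Complex \<sigma> \<tau>))"
  by (rule sum.reindex_bij_witness[of _ "%i. N + i" "%n. n - N"]) auto
 also have "... = (\<Sum>i<N. of_real (real (N + i) powr (- \<sigma>)) * of_nat (N + i) powr (- (\<i> * of_real \<tau>)))"
 proof (rule sum.cong)
  fix i assume "i \<in> {..<N}"
  have "- Complex \<sigma> \<tau> = of_real (- \<sigma>) + - (\<i> * of_real \<tau>)" by (simp add: complex_eq_iff)
  hence "of_nat (N + i) powr (- Complex \<sigma> \<tau>) = of_nat (N + i) powr of_real (- \<sigma>) * of_nat (N + i) powr (- (\<i> * of_real \<tau>))"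
   by (simp only: powr_add)
  thus "of_nat (N + i) powr (- Complex \<sigma> \<tau>) = of_real (real (N + i) powr (- \<sigma>)) * of_nat (N + i) powr (- (\<i> * of_real \<tau>))"
   by (simp only: nat_powr_of_real)
 qed simp
 also have "norm ... <= real (N + 0) powr (- \<sigma>) * B"
 proof (rule abel_bound)
  show "real (N + Suc i) powr (- \<sigma>) <= real (N + i) powr (- \<sigma>)" for i using \<sigma> N by (intro powr_mono2') auto
 qed (use B in \<open>auto simp: block_def\<close>)
 also have "real (N + 0) powr (- \<sigma>) = exp (- \<sigma> * ln (real N))" using N by (simp add: powr_def)
 finally show ?thesis .
qed

lemma sum_dyadic:
 fixes f :: "nat => complex"
 shows "(\<Sum>n=1..<2 ^ J. f n) = (\<Sum>j<J. \<Sum>n=2 ^ j..<2 * 2 ^ j. f n)"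
proof (induction J)
 case (Suc J)
 have "(\<Sum>n=1..<2 ^ Suc J. f n) = (\<Sum>n=1..<2 ^ J. f n) + (\<Sum>n=2 ^ J..<2 ^ Suc J. f n)"
  by (rule sum.atLeastLessThan_concat[symmetric]) auto
 thus ?case using Suc by simp
qed simp

section \<open>Explicit bounds for zeta on and to the right of the critical line\<close>

text \<open>The line with slope -4/9 passes through the nodes of orders 3 and 4, and the later nodes
  lie above it; it stands in for the exponent wherever a lower bound is enough. The second part is
  \<open>1 - ta q = q * nu q\<close> with \<open>q >= 2\<close>.\<close>

lemma nu_lower: "q >= 3 ==> 7 / 18 - 4 / 9 * ta q <= nu q" and nu_upper: "q >= 3 ==> nu q <= (1 - ta q) / 2"
proof -
 assume q: "q >= 3"
 define P :: real where "P = 2 ^ q"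
 have P: "P >= 8" using two_power_ge_8[OF q] by (simp add: P_def)
 have "P + 16 >= 8 * real q" unfolding P_def using q
 proof (induction q rule: dec_induct)
  case (step n)
  thus ?case using two_power_ge_8[of n] by simp
 qed simp
 hence "0 <= (P + 16 - 8 * real q) / (18 * (P - 2))" using P by (intro divide_nonneg_nonneg) auto
 also have "... = nu q - (7 / 18 - 4 / 9 * ta q)"
 proof -
  have n: "nu q * (P - 2) = 1" unfolding nu_def P_def[symmetric] using P by simp
  have "18 * (nu q - (7 / 18 - 4 / 9 * ta q)) = 18 * nu q + 1 - 8 * real q * nu q"
   unfolding ta_def by (simp add: field_simps)
  hence "18 * (nu q - (7 / 18 - 4 / 9 * ta q)) * (P - 2) = 18 * (nu q * (P - 2)) + (P - 2) - 8 * real q * (nu q * (P - 2))"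
   by (simp only:) (simp add: algebra_simps)
  hence "18 * (nu q - (7 / 18 - 4 / 9 * ta q)) * (P - 2) = P + 16 - 8 * real q" unfolding n by simp
  thus ?thesis using P by (simp add: field_simps)
 qed
 finally show "7 / 18 - 4 / 9 * ta q <= nu q" by simp
 show "nu q <= (1 - ta q) / 2" using nu_pos[OF q] q unfolding ta_def by (simp add: mult_right_mono)
qed

lemma card_multiples_le:
 fixes Y a :: real
 assumes "a > 0" "Y >= 0"
 shows "(\<Sum>j<J. of_bool (real j * a <= Y)) <= Y / a + (1 :: real)"
proof -
 have "{j. j < J \<and> real j * a <= Y} \<subseteq> {..nat \<lfloor>Y / a\<rfloor>}"
 proof
  fix j assume "j \<in> {j. j < J \<and> real j * a <= Y}"
  hence "real j <= Y / a" using assms by (simp add: field_simps)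
  thus "j \<in> {..nat \<lfloor>Y / a\<rfloor>}" by (simp add: le_nat_floor)
 qed
 hence "card {j. j < J \<and> real j * a <= Y} <= card {..nat \<lfloor>Y / a\<rfloor>}" by (intro card_mono) auto
 hence "real (card {j. j < J \<and> real j * a <= Y}) <= real (nat \<lfloor>Y / a\<rfloor>) + 1" by simp
 also have "... <= Y / a + 1" using assms by (simp add: of_nat_nat)
 also have "real (card {j. j < J \<and> real j * a <= Y}) = (\<Sum>j<J. of_bool (real j * a <= Y))"
  by (simp add: of_bool_def sum.If_cases lessThan_def Int_def)
 finally show ?thesis .
qed

lemma e_bounds: "27182 / 10000 <= exp (1 :: real)" "exp 1 <= (27183 / 10000 :: real)"
proof -
 have "inverse (2 ^ 32) <= (1 / 1000000 :: real)" by simp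
 with e_approx_32 have "\<bar>exp 1 - 5837465777 / 2147483648\<bar> <= (1 / 1000000 :: real)" by (rule order_trans)
 thus "27182 / 10000 <= exp (1 :: real)" "exp 1 <= (27183 / 10000 :: real)" unfolding abs_le_iff by linarith+
qed

text \<open>Reduces numerical values of \<open>exp\<close> to integer powers of a rational just
  above \<open>exp 1\<close>.\<close>

lemma exp_rational_le:
 assumes "(27183/10000) ^ p <= b ^ q" "q > 0" "b > 0"
 shows "exp (real p / real q) <= b"
proof -
 have "exp 1 ^ p <= (27183/10000 :: real) ^ p" using e_bounds by (intro power_mono) auto
 hence "exp (real p) <= b ^ q" using assms(1) by (simp add: exp_of_nat_mult[of p 1, simplified])
 also have "exp (real p) = exp (real p / real q) ^ q" using assms(2) by (simp flip: exp_of_nat_mult)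
 finally show ?thesis using assms by (subst (asm) power_mono_iff) auto
qed

text \<open>\<open>V\<close> is the exponent in the bound
  \<open>A * \<tau> powr V * ln \<tau>\<close> to be proved. Of it only the line of
  \<open>nu_lower\<close> is assumed, which controls every term other than the blocks of order 3 and
  higher.\<close>

locale zeta_exponent =
 fixes \<sigma> V L \<tau> :: real
 assumes sg: "1 / 2 <= \<sigma>" "\<sigma> <= 1" and V: "0 <= V" "7 / 18 - 4 / 9 * \<sigma> <= V" and L: "L = ln \<tau>" and tau: "\<tau> >= 10"
begin

lemma tauL: "\<tau> = exp L" "L > 0" using tau by (simp_all add: L)

lemma approx_terms:
 assumes X: "X >= 1"
 shows "norm (zeta (Complex \<sigma> \<tau>)) <= norm (\<Sum>n=1..<X. of_nat n powr (- Complex \<sigma> \<tau>))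
  + real X powr (- \<sigma>) / 2 + real X powr (1 - \<sigma>) / \<tau> + (\<sigma> + \<tau>) / (2 * \<sigma>) * real X powr (- \<sigma>)"
proof -
 let ?s = "Complex \<sigma> \<tau>"
 have s: "Re ?s > 0" "?s ~= 1" using sg tau by (auto simp: complex_eq_iff)
 have "norm (zeta ?s) <= norm ((\<Sum>n=1..X. of_nat n powr (- ?s)) + of_nat X powr (1 - ?s) / (?s - 1) - of_nat X powr (- ?s) / 2)
   + norm ?s / (2 * Re ?s) * real X powr (- Re ?s)"
  using zeta_approx[OF s X] norm_triangle_sub[of "zeta ?s"] by (smt (verit))
 also have "(\<Sum>n=1..X. of_nat n powr (- ?s)) = (\<Sum>n=1..<X. of_nat n powr (- ?s)) + of_nat X powr (- ?s)"
  using X by (simp add: sum.last_plus add.commute atLeastLessThanSuc_atLeastAtMost[symmetric])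
 also have "(\<Sum>n=1..<X. of_nat n powr (- ?s)) + of_nat X powr (- ?s) + of_nat X powr (1 - ?s) / (?s - 1) - of_nat X powr (- ?s) / 2
   = (\<Sum>n=1..<X. of_nat n powr (- ?s)) + of_nat X powr (- ?s) / 2 + of_nat X powr (1 - ?s) / (?s - 1)" by simp
 also have "norm ... <= norm (\<Sum>n=1..<X. of_nat n powr (- ?s)) + real X powr (- \<sigma>) / 2 + real X powr (1 - \<sigma>) / \<tau>"
 proof -
  have "\<tau> <= norm (?s - 1)" using abs_Im_le_cmod[of "?s - 1"] tau by simp
  hence 1: "norm (of_nat X powr (1 - ?s) / (?s - 1)) <= real X powr (1 - \<sigma>) / \<tau>"
   unfolding norm_divide norm_nat_powr using tau by (simp add: frac_le)
  have 2: "norm (of_nat X powr (- ?s) / 2) = real X powr (- \<sigma>) / 2" by (simp add: norm_divide norm_nat_powr)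
  show ?thesis using 1 2 norm_triangle_ineq[of "(\<Sum>n=1..<X. of_nat n powr (- ?s)) + of_nat X powr (- ?s) / 2" "of_nat X powr (1 - ?s) / (?s - 1)"]
    norm_triangle_ineq[of "\<Sum>n=1..<X. of_nat n powr (- ?s)" "of_nat X powr (- ?s) / 2"] by linarith
 qed
 also have "norm ?s / (2 * Re ?s) * real X powr (- Re ?s) <= (\<sigma> + \<tau>) / (2 * \<sigma>) * real X powr (- \<sigma>)"
  using sg tau cmod_le[of ?s] by (auto intro!: mult_right_mono divide_right_mono)
 finally show ?thesis by simp
qed

text \<open>Here \<open>x\<close> is the logarithm of the block length. The product from
  \<open>block_second\<close> splits into four exponentials; one is at most
  \<open>exp (V * L)\<close> and the others are smaller by \<open>exp (- L / 6)\<close>, hence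
  \<open>L >= 23/2\<close>.\<close>

lemma dyadic_block_middle:
 fixes x :: real
 assumes L': "L >= 23 / 2" and x: "2 / 3 * L <= x" "x <= L"
 shows "exp (- \<sigma> * x) * ((exp (L - x) / (2 * pi) + 2) * (34 / 3 * exp (x - L / 2) + 1)) <= 56 / 10 * exp (V * L)"
proof -
 have sx: "2 / 3 * \<sigma> * L <= \<sigma> * x" using sg x mult_left_mono[of "2 / 3 * L" x \<sigma>] by (simp add: mult_ac)
 have VL: "(7 / 18 - 4 / 9 * \<sigma>) * L <= V * L" using V tauL by (intro mult_right_mono) auto
 have sL: "1 / 2 * L <= \<sigma> * L" using sg tauL by (intro mult_right_mono) auto
 have sxL: "(1 - \<sigma>) * x <= (1 - \<sigma>) * L" using sg x by (intro mult_left_mono) auto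
 define q where "q = exp (- (L / 6))"
 have q: "q <= 15 / 100"
 proof -
  have "exp (23 / 12 :: real) >= 20 / 3"
  proof -
   have "(20 / 3 :: real) ^ 12 <= (27182/10000) ^ 23" by (simp add: field_simps)
   also have "... <= exp 1 ^ 23" using e_bounds by (intro power_mono) auto
   also have "... = exp (23 / 12) ^ 12" by (simp flip: exp_of_nat_mult)
   finally show ?thesis by (subst (asm) power_mono_iff) auto
  qed
  hence "inverse (exp (23 / 12 :: real)) <= inverse (20 / 3)" by (intro le_imp_inverse_le) auto
  moreover have "q <= exp (- (23 / 12))" unfolding q_def using L' by simp
  ultimately show ?thesis by (simp add: exp_minus)
 qed
 have q3: "exp (- (L / 2)) <= q" unfolding q_def using tauL by simp
 define T where "T = exp (V * L)"
 have T: "T > 0" by (simp add: T_def)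
 have e1: "exp (L / 2 - \<sigma> * x) <= T" unfolding T_def using sx VL sL by (simp add: algebra_simps)
 have e2: "exp (L - x - \<sigma> * x) <= T * q" unfolding T_def q_def exp_add[symmetric] using sx VL sL x by (simp add: algebra_simps)
 have e3: "exp (x - L / 2 - \<sigma> * x) <= T * q" unfolding T_def q_def exp_add[symmetric] using sxL VL sL by (simp add: algebra_simps)
 have e4: "exp (- \<sigma> * x) <= T * q"
 proof -
  have "exp (- \<sigma> * x) <= T * exp (- (L / 2))" unfolding T_def exp_add[symmetric] using sx VL sL by (simp add: algebra_simps)
  also have "... <= T * q" using q3 T by (intro mult_left_mono) auto
  finally show ?thesis .
 qed
 have e: "exp (- \<sigma> * x) * ((exp (L - x) / (2 * pi) + 2) * (34 / 3 * exp (x - L / 2) + 1))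
  = 17 / 3 / pi * exp (L / 2 - \<sigma> * x) + 1 / (2 * pi) * exp (L - x - \<sigma> * x) + 68 / 3 * exp (x - L / 2 - \<sigma> * x) + 2 * exp (- \<sigma> * x)"
  (is "?lhs = _")
 proof -
  have "?lhs = 17 / 3 / pi * (exp (L - x) * exp (x - L / 2) * exp (- \<sigma> * x)) + 1 / (2 * pi) * (exp (L - x) * exp (- \<sigma> * x))
    + 68 / 3 * (exp (x - L / 2) * exp (- \<sigma> * x)) + 2 * exp (- \<sigma> * x)" by (simp add: field_simps)
  moreover have "exp (L - x) * exp (x - L / 2) * exp (- \<sigma> * x) = exp (L / 2 - \<sigma> * x)"
   "exp (L - x) * exp (- \<sigma> * x) = exp (L - x - \<sigma> * x)" "exp (x - L / 2) * exp (- \<sigma> * x) = exp (x - L / 2 - \<sigma> * x)"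
   by (simp_all flip: exp_add)
  ultimately show ?thesis by simp
 qed
 have p: "17 / 3 / pi <= 181 / 100" "1 / (2 * pi) <= 1 / 6" using pi_approx by (simp_all add: field_simps)
 have "?lhs <= 181 / 100 * T + 1 / 6 * (T * q) + 68 / 3 * (T * q) + 2 * (T * q)"
  unfolding e by (intro add_mono mult_mono p e1 e2 e3 e4 mult_left_mono) (use T q_def in auto)
 also have "... = 181 / 100 * T + (149 / 6 * q) * T" by (simp add: algebra_simps)
 also have "... <= 181 / 100 * T + (149 / 6 * (15 / 100)) * T" using q T by (intro add_left_mono mult_right_mono mult_left_mono) auto
 also have "... <= 56 / 10 * T" using T by simp
 finally show ?thesis by (simp add: T_def)
qed

text \<open>For blocks between \<open>\<tau>\<close> and \<open>\<tau> powr (5/3)\<close> the line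
  of \<open>nu_lower\<close> leaves a saving of \<open>exp (- L / 3)\<close>.\<close>

lemma dyadic_block_long:
 fixes x :: real
 assumes L': "L >= 23 / 2" and x: "L <= x" "x <= 5 / 3 * L"
 shows "exp (- \<sigma> * x) * (8 * exp (x - L)) <= 3 / 10 * exp (V * L)"
proof -
 have VL: "(7 / 18 - 4 / 9 * \<sigma>) * L <= V * L" using V tauL by (intro mult_right_mono) auto
 have sL: "1 / 2 * L <= \<sigma> * L" using sg tauL by (intro mult_right_mono) auto
 have sxL: "(1 - \<sigma>) * x <= (1 - \<sigma>) * (5 / 3 * L)" using sg x by (intro mult_left_mono) auto
 have "exp (- \<sigma> * x) * (8 * exp (x - L)) = 8 * exp (x - L - \<sigma> * x)" by (simp flip: exp_add)
 also have "exp (x - L - \<sigma> * x) <= exp (V * L) * exp (- (L / 3))"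
  unfolding exp_add[symmetric] using sxL VL sL by (simp add: algebra_simps)
 also have "exp (- (L / 3)) <= inverse (exp (23 / 6))" using L' by (simp flip: exp_minus)
 also have "... <= inverse 40"
 proof -
  have "(40 :: real) ^ 6 <= (27182/10000) ^ 23" by (simp add: field_simps)
  also have "... <= exp 1 ^ 23" using e_bounds by (intro power_mono) auto
  also have "... = exp (23 / 6) ^ 6" by (simp flip: exp_of_nat_mult)
  finally have "40 <= exp (23 / 6 :: real)" by (subst (asm) power_mono_iff) auto
  thus ?thesis by (intro le_imp_inverse_le) auto
 qed
 finally have "exp (- \<sigma> * x) * (8 * exp (x - L)) <= 8 * (exp (V * L) * inverse 40)" by simp
 also have "... <= 3 / 10 * exp (V * L)" by simp
 finally show ?thesis .
qed

end

text \<open>The sum is cut at \<open>2 ^ J\<close>, just above \<open>\<tau> powr (5/3)\<close>: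
  this power brings the remainder \<open>\<tau> * X powr (- \<sigma>)\<close> down to
  \<open>\<tau> powr (1/6)\<close> at \<open>\<sigma> = 1/2\<close>. Every dyadic block costs a
  constant times \<open>T\<close>, and their number supplies the factor
  \<open>ln \<tau>\<close>.\<close>

lemma zeta_bound_large:
 assumes k: "k >= 3" and l: "0 <= l" "l <= 1" and hs: "\<sigma> = (1 - l) * ta k + l * ta (Suc k)" "1 / 2 <= \<sigma>"
  and v: "v = (1 - l) * nu k + l * nu (Suc k)" and \<tau>: "\<tau> >= 10" and hL: "ln \<tau> >= 23 / 2"
 shows "norm (zeta (Complex \<sigma> \<tau>)) <= 1398 / 100 * exp (v * ln \<tau>) * ln \<tau>"
proof -
 define T where "T = exp (v * ln \<tau>)"
 interpret zeta_exponent \<sigma> v "ln \<tau>" \<tau>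
 proof
  have ta1: "ta q <= 1" if "q >= 3" for q using nu_pos[OF that] by (simp add: ta_def)
  show "1 / 2 <= \<sigma>" "\<tau> >= 10" "ln \<tau> = ln \<tau>" using hs \<tau> by auto
  have "\<sigma> <= (1 - l) * 1 + l * 1" unfolding hs using l ta1 k by (intro add_mono mult_left_mono) auto
  thus "\<sigma> <= 1" by simp
  show "0 <= v" unfolding v using nu_pos[of k] nu_pos[of "Suc k"] k l by (intro add_nonneg_nonneg mult_nonneg_nonneg) auto
  have "(1 - l) * (7 / 18 - 4 / 9 * ta k) + l * (7 / 18 - 4 / 9 * ta (Suc k)) <= v"
   unfolding v using nu_lower k l by (intro add_mono mult_left_mono) auto
  moreover have "(1 - l) * (7 / 18 - 4 / 9 * ta k) + l * (7 / 18 - 4 / 9 * ta (Suc k)) = 7 / 18 - 4 / 9 * \<sigma>"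
   unfolding hs by (simp add: field_simps)
  ultimately show "7 / 18 - 4 / 9 * \<sigma> <= v" by simp
 qed
 have T1: "T >= 1" unfolding T_def using V tauL by simp
 define J where "J = nat \<lceil>5 / 3 * ln \<tau> / ln 2\<rceil>"
 have l2: "ln 2 > (0::real)" "1 / ln 2 <= (3 / 2 :: real)" using ln2_ge_two_thirds by (auto simp: field_simps)
 have J: "5 / 3 * ln \<tau> <= real J * ln 2" "real J <= 5 / 3 * ln \<tau> / ln 2 + 1"
 proof -
  have "0 <= 5 / 3 * ln \<tau> / ln 2" using tauL l2 by simp
  hence "5 / 3 * ln \<tau> / ln 2 <= real J" "real J <= 5 / 3 * ln \<tau> / ln 2 + 1" unfolding J_def by linarith+
  thus "5 / 3 * ln \<tau> <= real J * ln 2" "real J <= 5 / 3 * ln \<tau> / ln 2 + 1" using l2 by (simp_all add: pos_divide_le_eq)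
 qed
 let ?x = "%j. real j * ln 2"
 have lnj: "ln (real (2 ^ j)) = ?x j" for j by (simp add: ln_realpow)
 \<comment> \<open>Nested indicators: the weights add up to 47/5 for short blocks, 56/10 for middle
   ones and 3/10 for long ones, so that the sum over \<open>j\<close> is a combination of
   counts.\<close>
 have bl: "norm (\<Sum>n=2 ^ j..<2 * 2 ^ j. of_nat n powr (- Complex \<sigma> \<tau>))
   <= T * (38 / 10 * of_bool (?x j <= 2 / 3 * ln \<tau>) + 53 / 10 * of_bool (?x j <= ln \<tau>) + 3 / 10)" if j: "j < J" for j
 proof -
  have N: "(2::nat) ^ j >= 1" by simp
  have \<tau>0: "\<tau> > 0" using \<tau> by simp
  have eN: "real (2 ^ j) = exp (?x j)" unfolding lnj[symmetric] by simp
  consider "?x j <= 2 / 3 * ln \<tau>" | "2 / 3 * ln \<tau> <= ?x j" "\<not> ?x j <= 2 / 3 * ln \<tau>" "?x j <= ln \<tau>" | "\<not> ?x j <= ln \<tau>" by linarith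
  thus ?thesis
  proof cases
   case 1
   have "norm (\<Sum>n=2 ^ j..<2 * 2 ^ j. of_nat n powr (- Complex \<sigma> \<tau>)) <= exp (- \<sigma> * ?x j) * (47 / 5 * exp (\<sigma> * ?x j + v * ln \<tau>))"
    using dirichlet_block[OF _ N, of \<sigma> \<tau> "47 / 5 * exp (\<sigma> * ?x j + v * ln \<tau>)"] hs(2) block_bound_interpolated[OF k N _ \<tau>0 _ l] 1
    unfolding lnj hs(1)[symmetric] v[symmetric] by auto
   also have "... = 47 / 5 * T" unfolding T_def by (simp flip: exp_add)
   finally show ?thesis using 1 tauL by simp
  next
   case 2
   have nt: "exp (?x j) / sqrt \<tau> = exp (?x j - ln \<tau> / 2)" "\<tau> / (2 * pi * exp (?x j)) = exp (ln \<tau> - ?x j) / (2 * pi)"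
   proof -
    have "sqrt \<tau> = exp (ln \<tau> / 2)" using exp_ln[of "sqrt \<tau>"] \<tau>0 by (simp only: ln_sqrt real_sqrt_gt_0_iff)
    thus "exp (?x j) / sqrt \<tau> = exp (?x j - ln \<tau> / 2)" by (simp add: exp_diff)
    show "\<tau> / (2 * pi * exp (?x j)) = exp (ln \<tau> - ?x j) / (2 * pi)" using \<tau>0 by (simp add: exp_diff)
   qed
   have "sqrt \<tau> = exp (ln \<tau> / 2)" using exp_ln[of "sqrt \<tau>"] \<tau>0 by (simp only: ln_sqrt real_sqrt_gt_0_iff)
   also have "... <= exp (?x j)" using 2 tauL by simp
   finally have "sqrt \<tau> <= real (2 ^ j)" unfolding eN .
   from block_second[OF N _ \<tau>0 this]
   have "norm (\<Sum>n=2 ^ j..<2 * 2 ^ j. of_nat n powr (- Complex \<sigma> \<tau>)) <= exp (- \<sigma> * ?x j) * ((\<tau> / (2 * pi * real (2 ^ j)) + 2) * (34 / 3 * (real (2 ^ j) / sqrt \<tau>) + 1))"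
    using dirichlet_block[OF _ N, of \<sigma> \<tau>] hs(2) unfolding lnj by simp
   also have "... = exp (- \<sigma> * ?x j) * ((exp (ln \<tau> - ?x j) / (2 * pi) + 2) * (34 / 3 * exp (?x j - ln \<tau> / 2) + 1))" unfolding eN nt ..
   also have "... <= 56 / 10 * T" unfolding T_def by (rule dyadic_block_middle[OF hL 2(1,3)])
   finally show ?thesis using 2 by simp
  next
   case 3
   have "real (Suc j) <= real J" using j by simp
   hence "?x j <= (real J - 1) * ln 2" using l2 by (intro mult_right_mono) auto
   also have "... <= 5 / 3 * ln \<tau> / ln 2 * ln 2" using J(2) l2 by (intro mult_right_mono) auto
   finally have x: "?x j <= 5 / 3 * ln \<tau>" using l2 by simp
   have "\<tau> = exp (ln \<tau>)" using \<tau>0 by simp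
   also have "... <= exp (?x j)" using 3 by simp
   finally have "\<tau> <= real (2 ^ j)" unfolding eN .
   note bf = block_first[OF N _ \<tau>0 this]
   have "norm (\<Sum>n=2 ^ j..<2 * 2 ^ j. of_nat n powr (- Complex \<sigma> \<tau>)) <= exp (- \<sigma> * ?x j) * (8 * real (2 ^ j) / \<tau>)"
    unfolding lnj[symmetric] by (rule dirichlet_block[OF _ N bf]) (use hs(2) in auto)
   also have "8 * real (2 ^ j) / \<tau> = 8 * exp (?x j - ln \<tau>)" unfolding eN using \<tau>0 by (simp add: exp_diff)
   also have "exp (- \<sigma> * ?x j) * (8 * exp (?x j - ln \<tau>)) <= 3 / 10 * T" unfolding T_def by (rule dyadic_block_long[OF hL _ x]) (use 3 in simp)
   finally show ?thesis using 3 tauL T1 by simp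
  qed
 qed
 have "norm (\<Sum>n=1..<2 ^ J. of_nat n powr (- Complex \<sigma> \<tau>)) <= (\<Sum>j<J. T * (38 / 10 * of_bool (?x j <= 2 / 3 * ln \<tau>) + 53 / 10 * of_bool (?x j <= ln \<tau>) + 3 / 10))"
  unfolding sum_dyadic by (rule sum_norm_le) (use bl in auto)
 also have "... = T * (38 / 10 * (\<Sum>j<J. of_bool (?x j <= 2 / 3 * ln \<tau>)) + 53 / 10 * (\<Sum>j<J. of_bool (?x j <= ln \<tau>)) + 3 / 10 * real J)"
 proof -
  have "(\<Sum>j<J. 3 / 10) = 3 / 10 * real J" by simp
  thus ?thesis unfolding sum_distrib_left[symmetric] sum.distrib by (simp only:)
 qed
 also have "... <= T * (38 / 10 * (2 / 3 * ln \<tau> / ln 2 + 1) + 53 / 10 * (ln \<tau> / ln 2 + 1) + 3 / 10 * (5 / 3 * ln \<tau> / ln 2 + 1))"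
  using T1 tauL l2 J by (intro mult_left_mono add_mono card_multiples_le) auto
 also have "... = T * ((38 / 10 * (2 / 3) + 53 / 10 + 3 / 10 * (5 / 3)) * (ln \<tau> * (1 / ln 2)) + 94 / 10)"
 proof -
  define x where "x = ln \<tau> * (1 / ln 2)"
  have e: "2 / 3 * ln \<tau> / ln 2 = 2 / 3 * x" "ln \<tau> / ln 2 = x" "5 / 3 * ln \<tau> / ln 2 = 5 / 3 * x" by (simp_all add: x_def)
  have "38 / 10 * (2 / 3 * x + 1) + 53 / 10 * (x + 1) + 3 / 10 * (5 / 3 * x + 1) = (38 / 10 * (2 / 3) + 53 / 10 + 3 / 10 * (5 / 3)) * x + 94 / 10"
   by (simp add: field_simps)
  thus ?thesis unfolding e x_def[symmetric] by (simp only:)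
 qed
 also have "... <= T * ((38 / 10 * (2 / 3) + 53 / 10 + 3 / 10 * (5 / 3)) * (ln \<tau> * (3 / 2)) + 94 / 10)"
  using T1 tauL l2 by (intro mult_left_mono add_right_mono) auto
 finally have main: "norm (\<Sum>n=1..<2 ^ J. of_nat n powr (- Complex \<sigma> \<tau>)) <= T * (125 / 10 * ln \<tau> + 94 / 10)" by simp
 define y where "y = real J * ln 2"
 have y: "5 / 3 * ln \<tau> <= y" "y <= 5 / 3 * ln \<tau> + ln 2"
  using J l2 mult_right_mono[OF J(2), of "ln 2"] by (auto simp: y_def distrib_right)
 have Xp: "real (2 ^ J) powr p = exp (p * y)" for p unfolding powr_def lnj y_def by simp
 have VL: "(7 / 18 - 4 / 9 * \<sigma>) * ln \<tau> <= v * ln \<tau>" using V tauL by (intro mult_right_mono) auto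
 have sL: "1 / 2 * ln \<tau> <= \<sigma> * ln \<tau>" "\<sigma> * ln \<tau> <= 1 * ln \<tau>" using sg tauL by (auto intro!: mult_right_mono simp del: mult_1_left)
 have sy: "\<sigma> * (5 / 3 * ln \<tau>) <= \<sigma> * y" using y hs by (intro mult_left_mono) auto
 have r1: "exp (- \<sigma> * y) <= T"
 proof -
  have "0 <= y" using y(1) tauL(2) by linarith
  hence "0 <= \<sigma> * y" using hs(2) by simp
  moreover have "0 <= v * ln \<tau>" using V(1) tauL(2) by simp
  ultimately have "- \<sigma> * y <= v * ln \<tau>" by simp
  thus ?thesis unfolding T_def by (simp only: exp_le_cancel_iff)
 qed
 have sg1: "\<sigma> <= 1" by (rule sg)
 have r2: "exp ((1 - \<sigma>) * y) / \<tau> <= 2 * T"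
 proof -
  have "(1 - \<sigma>) * y <= (1 - \<sigma>) * (5 / 3 * ln \<tau>) + 1 * ln 2"
  proof -
   have "(1 - \<sigma>) * y <= (1 - \<sigma>) * (5 / 3 * ln \<tau> + ln 2)" using y sg1 by (intro mult_left_mono) auto
   moreover have "(1 - \<sigma>) * ln 2 <= 1 * ln 2" using l2 hs by (intro mult_right_mono) auto
   ultimately show ?thesis unfolding distrib_left by linarith
  qed
  moreover define w where "w = \<sigma> * ln \<tau>"
  have "(1 - \<sigma>) * (5 / 3 * ln \<tau>) <= 5 / 3 * ln \<tau> - 5 / 3 * w" unfolding w_def left_diff_distrib by simp
  moreover have "7 / 18 * ln \<tau> - 4 / 9 * w <= (7 / 18 - 4 / 9 * \<sigma>) * ln \<tau>" by (simp add: w_def left_diff_distrib)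
  ultimately have "(1 - \<sigma>) * y - ln \<tau> <= v * ln \<tau> + ln 2" using VL sL[folded w_def] tauL(2) by linarith
  hence "exp ((1 - \<sigma>) * y - ln \<tau>) <= exp (v * ln \<tau> + ln 2)" by simp
  thus ?thesis using \<tau> by (simp add: exp_diff exp_add T_def)
 qed
 have r3: "(\<sigma> + \<tau>) / (2 * \<sigma>) * exp (- \<sigma> * y) <= 2 * T"
 proof -
  have "(\<sigma> + \<tau>) / (2 * \<sigma>) <= (\<tau> + \<tau>) / 1" using hs sg1 \<tau> by (intro frac_le) auto
  hence "(\<sigma> + \<tau>) / (2 * \<sigma>) * exp (- \<sigma> * y) <= 2 * \<tau> * exp (- \<sigma> * y)" by (intro mult_right_mono) auto
  also have "... = 2 * exp (ln \<tau> - \<sigma> * y)" using \<tau> by (simp add: exp_diff exp_minus field_simps)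
  \<comment> \<open>With the line of \<open>nu_lower\<close> this amounts to
    \<open>11/18 <= 11/9 * \<sigma>\<close>, that is \<open>\<sigma> >= 1/2\<close>.\<close>
  also have "exp (ln \<tau> - \<sigma> * y) <= T" unfolding T_def using sy sL VL by (simp add: algebra_simps)
  finally show ?thesis by simp
 qed
 have "norm (zeta (Complex \<sigma> \<tau>)) <= T * (125 / 10 * ln \<tau> + 94 / 10) + T / 2 + 2 * T + 2 * T"
  using approx_terms[of "2 ^ J"] main r1 r2 r3 unfolding Xp by simp
 also have "... = T * (125 / 10 * ln \<tau> + 139 / 10)" by (simp add: algebra_simps)
 also have "... <= T * (1398 / 100 * ln \<tau>)" using T1 hL by (intro mult_left_mono) auto
 finally show ?thesis by (simp add: T_def mult_ac)
qed

lemma sum_powr_le: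
 assumes y: "0 < y" "y <= 1" and X: "X >= 2"
 shows "(\<Sum>n=1..<X. real n powr (y - 1)) <= 1 + ((real X - 1) powr y - 1) / y"
 using X
proof (induction X rule: dec_induct)
 case (step X)
 have x: "real X - 1 > 0" using step.hyps by simp
 have "\<exists>z>real X - 1. z < real X \<and> real X powr y - (real X - 1) powr y = (real X - (real X - 1)) * (y * z powr (y - 1))"
  using x by (intro MVT2) (auto intro!: derivative_eq_intros)
 then obtain z where z: "z > real X - 1" "z < real X" "real X powr y - (real X - 1) powr y = y * z powr (y - 1)" by auto
 have "real X powr (y - 1) <= z powr (y - 1)" using z x y by (intro powr_mono2') auto
 hence "y * real X powr (y - 1) <= real X powr y - (real X - 1) powr y" unfolding z(3) using y by (intro mult_left_mono) auto
 hence "real X powr (y - 1) <= (real X powr y - (real X - 1) powr y) / y" using y by (simp add: field_simps)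
 hence "(\<Sum>n=1..<Suc X. real n powr (y - 1)) <= 1 + ((real X - 1) powr y - 1) / y + (real X powr y - (real X - 1) powr y) / y"
  using step by simp
 also have "... = 1 + ((real (Suc X) - 1) powr y - 1) / y" by (simp add: diff_divide_distrib)
 finally show ?case .
qed (simp add: numeral_2_eq_2)

lemma sum_inverse_le:
 assumes X: "X >= 2"
 shows "(\<Sum>n=1..<X. 1 / real n) <= 1 + ln (real X - 1)"
 using X
proof (induction X rule: dec_induct)
 case (step X)
 have x: "real X - 1 > 0" using step.hyps by simp
 have "ln ((real X - 1) / real X) <= (real X - 1) / real X - 1" using x by (intro ln_le_minus_one) auto
 moreover have "(real X - 1) / real X - 1 = - (1 / real X)" using x by (simp add: field_simps)
 moreover have "ln ((real X - 1) / real X) = ln (real X - 1) - ln (real X)" using x by (simp add: ln_div)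
 ultimately show ?case using step by simp
qed (simp add: numeral_2_eq_2)

text \<open>Convexity of \<open>sinh\<close>. It keeps \<open>(\<tau> powr y - 1) / y\<close>
  bounded as \<open>y\<close> tends to 0.\<close>

lemma sinh_le_chord:
 fixes w w0 :: real
 assumes "0 <= w" "w <= w0" "w0 > 0"
 shows "sinh w <= w / w0 * sinh w0"
proof -
 have "convex_on {0..} (sinh :: real => real)"
 proof (rule f''_ge0_imp_convex)
  show "(sinh has_real_derivative cosh x) (at x)" "(cosh has_real_derivative sinh x) (at x)" for x :: real
   by (auto intro!: derivative_eq_intros)
 qed auto
 from convex_onD[OF this, of "w / w0" 0 w0] assms show ?thesis by simp
qed

context zeta_exponent
begin

lemma ceiling_X:
 defines "X \<equiv> nat \<lceil>\<tau>\<rceil>"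
 shows "X >= 2" "real X >= \<tau>" "real X - 1 <= \<tau>" "real X - 1 > 0" "real X <= 11 / 10 * \<tau>"
 unfolding X_def using tau by linarith+

text \<open>For moderate \<open>\<tau>\<close> the trivial estimate of the sum up to
  \<open>\<tau>\<close> is strong enough. The parameters \<open>G\<close>, \<open>E\<close> and
  \<open>c\<close> hold numerical values for the sum, for the remainder and for
  \<open>exp (- L / 2)\<close>, with \<open>G\<close> evaluated at the right end \<open>Lb\<close>
  of a range of \<open>L\<close>.\<close>

lemma bound_small:
 assumes s1: "\<sigma> < 1" and Lb: "L <= Lb" and G: "2 * (exp (Lb / 3) - exp (- (Lb / 6))) <= G * Lb"
  and E: "exp (L / 3) <= E * L" and c: "exp (- (L / 2)) <= c" and A: "(G + E) * L + 1 + 21 / 10 * c <= A * L"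
 shows "norm (zeta (Complex \<sigma> \<tau>)) <= A * exp (V * L) * L"
proof -
 define X where "X = nat \<lceil>\<tau>\<rceil>"
 note X = ceiling_X[folded X_def]
 define T where "T = exp (V * L)"
 have L0: "L > 0" by (rule tauL)
 have T1: "T >= 1" unfolding T_def using V L0 by simp
 have G0: "0 <= G * Lb" using G L0 Lb by (intro order_trans[OF _ G]) simp
 have VL: "(7 / 18 - 4 / 9 * \<sigma>) * L <= V * L" using V L0 by (intro mult_right_mono) auto
 have sL: "1 / 2 * L <= \<sigma> * L" using sg L0 by (intro mult_right_mono) auto
 have tp: "\<tau> powr p = exp (p * L)" for p using tau by (simp add: powr_def L)
 define y where "y = 1 - \<sigma>"
 have y: "0 < y" "y <= 1 / 2" using s1 sg by (auto simp: y_def)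
 have "norm (\<Sum>n=1..<X. of_nat n powr (- Complex \<sigma> \<tau>)) <= (\<Sum>n=1..<X. real n powr (y - 1))"
  by (rule sum_norm_le) (simp add: norm_nat_powr y_def)
 also have "... <= 1 + ((real X - 1) powr y - 1) / y" using y X by (intro sum_powr_le) auto
 also have "... <= 1 + (\<tau> powr y - 1) / y" using y X by (intro add_left_mono divide_right_mono diff_right_mono powr_mono2) auto
 also have "(\<tau> powr y - 1) / y <= T * (G * L)"
 proof -
  \<comment> \<open>Through \<open>sinh\<close> the chord bound extracts the factor
    \<open>y\<close>, uniformly as \<open>\<sigma>\<close> approaches 1.\<close>
  have "\<tau> powr y - 1 = 2 * (exp (y * L / 2) * sinh (y * L / 2))"
   unfolding tp sinh_def by (simp add: right_diff_distrib flip: exp_add)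
  also have "... <= 2 * (exp (V * L + Lb / 12) * (y * L / 2 / (Lb / 4) * sinh (Lb / 4)))"
  proof (intro mult_left_mono mult_mono)
   have "y * L / 2 <= V * L + L / 12" using VL sL unfolding y_def by (simp add: algebra_simps)
   thus "exp (y * L / 2) <= exp (V * L + Lb / 12)" using Lb by simp
   have "y * L <= 1 / 2 * Lb" using y Lb L0 by (intro mult_mono) auto
   hence "y * L / 2 <= Lb / 4" by linarith
   thus "sinh (y * L / 2) <= y * L / 2 / (Lb / 4) * sinh (Lb / 4)" using y L0 Lb by (intro sinh_le_chord) auto
  qed (use y L0 in auto)
  also have "... = T * (y * L / Lb) * (4 * (exp (Lb / 12) * sinh (Lb / 4)))" using L0 Lb by (simp add: T_def exp_add)
  also have "4 * (exp (Lb / 12) * sinh (Lb / 4)) = 2 * (exp (Lb / 3) - exp (- (Lb / 6)))"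
  proof -
   have "exp (Lb / 12) * exp (Lb / 4) = exp (Lb / 3)" "exp (Lb / 12) * exp (- (Lb / 4)) = exp (- (Lb / 6))" by (simp_all flip: exp_add)
   thus ?thesis by (simp add: sinh_def right_diff_distrib)
  qed
  also have "T * (y * L / Lb) * ... <= T * (y * L / Lb) * (G * Lb)" using T1 y L0 Lb G by (intro mult_left_mono) auto
  also have "... = y * (T * (G * L))" using L0 Lb by simp
  finally show ?thesis using y by (simp add: pos_divide_le_eq mult_ac)
 qed
 finally have 1: "norm (\<Sum>n=1..<X. of_nat n powr (- Complex \<sigma> \<tau>)) <= 1 + T * (G * L)" by simp
 have c0: "c >= 0" using c exp_ge_zero order_trans by blast
 have "real X powr (- \<sigma>) <= \<tau> powr (- \<sigma>)" using X tau sg by (intro powr_mono2') auto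
 hence Xs: "real X powr (- \<sigma>) <= exp (- \<sigma> * L)" by (simp add: tp)
 also have ec: "exp (- \<sigma> * L) <= exp (- (L / 2))" using sL by simp
 finally have 2: "real X powr (- \<sigma>) <= c" using c by simp
 have 3: "real X powr (1 - \<sigma>) / \<tau> <= 21 / 20 * c"
 proof -
  have "real X powr (1 - \<sigma>) <= real X powr (1 / 2)" using X sg by (intro powr_mono) auto
  also have "... <= (11 / 10 * \<tau>) powr (1 / 2)" using X by (intro powr_mono2) auto
  also have "... = (11 / 10) powr (1 / 2) * exp (L / 2)" using tau powr_mult[of "11 / 10" \<tau> "1 / 2"] tp[of "1 / 2"] by simp
  also have "... <= 21 / 20 * exp (L / 2)"
  proof (intro mult_right_mono)
   show "(11 / 10 :: real) powr (1 / 2) <= 21 / 20" by (rule inverse_power_le[of _ _ 2]) (auto simp: power2_eq_square)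
  qed simp
  finally have f: "real X powr (1 - \<sigma>) <= 21 / 20 * exp (L / 2)" .
  have "real X powr (1 - \<sigma>) / \<tau> <= 21 / 20 * exp (L / 2) / exp L" unfolding tauL(1) by (rule divide_right_mono[OF f]) simp
  also have "... = 21 / 20 * exp (L / 2 - L)" unfolding exp_diff by simp
  also have "L / 2 - L = - (L / 2)" by simp
  finally show ?thesis using c by simp
 qed
 have 4: "(\<sigma> + \<tau>) / (2 * \<sigma>) * real X powr (- \<sigma>) <= 1 / 2 * c + T * (E * L)"
 proof -
  have "\<tau> / (2 * \<sigma>) <= \<tau> / 1" using sg tau by (intro divide_left_mono) auto
  hence "(\<sigma> + \<tau>) / (2 * \<sigma>) <= 1 / 2 + \<tau>" using sg by (simp add: add_divide_distrib)
  hence "(\<sigma> + \<tau>) / (2 * \<sigma>) * real X powr (- \<sigma>) <= (1 / 2 + \<tau>) * exp (- \<sigma> * L)"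
   using Xs sg tau by (intro mult_mono) auto
  also have "... = 1 / 2 * exp (- \<sigma> * L) + exp (L - \<sigma> * L)" using tauL by (simp add: distrib_right flip: exp_add)
  also have "... <= 1 / 2 * c + T * exp (L / 3)"
  proof (intro add_mono)
   show "exp (L - \<sigma> * L) <= T * exp (L / 3)" unfolding T_def exp_add[symmetric] using VL sL by (simp add: algebra_simps)
   show "1 / 2 * exp (- \<sigma> * L) <= 1 / 2 * c" using ec c by linarith
  qed
  also have "... <= 1 / 2 * c + T * (E * L)" using E T1 by (intro add_left_mono mult_left_mono) auto
  finally show ?thesis .
 qed
 have "norm (zeta (Complex \<sigma> \<tau>)) <= T * ((G + E) * L) + 1 * (1 + 21 / 10 * c)"
  using approx_terms[of X] 1 2 3 4 c0 X by (simp add: algebra_simps)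
 also have "... <= T * ((G + E) * L) + T * (1 + 21 / 10 * c)" using T1 c0 by (intro add_left_mono mult_right_mono) auto
 also have "... = T * ((G + E) * L + 1 + 21 / 10 * c)" by (simp add: algebra_simps)
 also have "... <= T * (A * L)" using A T1 by (intro mult_left_mono) auto
 finally show ?thesis by (simp add: T_def mult_ac)
qed

text \<open>\<open>exp (L / 3) / L\<close> increases for \<open>L >= 3\<close>, so the right end of
  the range decides.\<close>

lemma exp_third_le:
 assumes "3 <= L" "L <= Lb" "exp (Lb / 3) <= E * Lb"
 shows "exp (L / 3) <= E * L"
proof -
 have "exp (L / 3) * (Lb / L) <= exp (L / 3) * exp ((Lb - L) / 3)"
 proof (rule mult_left_mono)
  have "Lb / L = 1 + (Lb - L) / L" using assms by (simp add: field_simps)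
  also have "... <= 1 + (Lb - L) / 3" using assms by (intro add_left_mono divide_left_mono) auto
  also have "... <= exp ((Lb - L) / 3)" by (rule exp_ge_add_one_self)
  finally show "Lb / L <= exp ((Lb - L) / 3)" .
 qed simp
 also have "... = exp (Lb / 3)" by (simp add: diff_divide_distrib flip: exp_add)
 also have "... <= E * Lb" by fact
 finally show ?thesis using assms by (simp add: field_simps)
qed

text \<open>Six ranges of \<open>L\<close>, each with its numerical values for
  \<open>bound_small\<close>. The first ones are short because the additive terms
  \<open>1 + 21/10 * c\<close> weigh most there.\<close>

lemma bound_cases:
 assumes s1: "\<sigma> < 1" and L11: "L <= 23 / 2"
  and A: "A = 349 / 100 \<and> L <= 5 \<or> A = 699 / 100 \<and> L <= 9 \<or> A = 999 / 100 \<and> L <= 21 / 2 \<or> A = 1398 / 100"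
 shows "norm (zeta (Complex \<sigma> \<tau>)) <= A * exp (V * L) * L"
proof -
 have em: "inverse b <= exp (- x)" if "exp x <= b" for x b :: real
  unfolding exp_minus using that by (intro le_imp_inverse_le) auto
 have x1: "exp (14 / 15) <= (25435 / 10000 :: real)" using exp_rational_le[of 14 "25435/10000" 15] by (simp add: power_divide)
 have x2: "exp (14 / 30) <= (1595 / 1000 :: real)" using exp_rational_le[of 14 "1595/1000" 30] by (simp add: power_divide)
 have x3: "exp (11 / 10) <= (3005 / 1000 :: real)" using exp_rational_le[of 11 "3005/1000" 10] by (simp add: power_divide)
 have x4: "exp (11 / 20) <= (1734 / 1000 :: real)" using exp_rational_le[of 11 "1734/1000" 20] by (simp add: power_divide)
 have x5: "exp (5 / 3) <= (5295 / 1000 :: real)" using exp_rational_le[of 5 "5295/1000" 3] by (simp add: power_divide)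
 have x6: "exp (5 / 6) <= (2302 / 1000 :: real)" using exp_rational_le[of 5 "2302/1000" 6] by (simp add: power_divide)
 have x7: "exp 3 <= (2009 / 100 :: real)" using exp_rational_le[of 3 "2009/100" 1] by (simp add: power_divide)
 have x8: "exp (3 / 2) <= (4482 / 1000 :: real)" using exp_rational_le[of 3 "4482/1000" 2] by (simp add: power_divide)
 have x9: "exp (23 / 6) <= (47 :: real)" using exp_rational_le[of 23 47 6] by (simp add: power_divide)
 have lo: "L >= 23 / 10"
 proof -
  have "exp (23 / 10 :: real) <= 10" using exp_rational_le[of 23 10 10] by (simp add: power_divide)
  thus ?thesis unfolding L using tau ln_ge_iff[of \<tau> "23 / 10"] by simp
 qed
 have c1: "exp (- (L / 2)) <= 32 / 100"
 proof -
  have "(100 / 32 :: real) ^ 20 <= (27182/10000) ^ 23" by (simp add: field_simps)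
  also have "... <= exp 1 ^ 23" using e_bounds by (intro power_mono) auto
  also have "... = exp (23 / 20) ^ 20" by (simp flip: exp_of_nat_mult)
  finally have "100 / 32 <= exp (23 / 20 :: real)" by (subst (asm) power_mono_iff) auto
  hence "exp (- (23 / 20)) <= (32 / 100 :: real)" using le_imp_inverse_le[of "100/32" "exp (23/20 :: real)"] by (simp add: exp_minus)
  moreover have "exp (- (L / 2)) <= exp (- (23 / 20))" using lo by simp
  ultimately show ?thesis by linarith
 qed
 have c2: "exp (- (L / 2)) <= 2 / 10" if "L >= 33 / 10"
 proof -
  have "(5 :: real) ^ 20 <= (27182/10000) ^ 33" by (simp add: field_simps)
  also have "... <= exp 1 ^ 33" using e_bounds by (intro power_mono) auto
  also have "... = exp (33 / 20) ^ 20" by (simp flip: exp_of_nat_mult)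
  finally have "5 <= exp (33 / 20 :: real)" by (subst (asm) power_mono_iff) auto
  hence "exp (- (33 / 20)) <= (2 / 10 :: real)" using le_imp_inverse_le[of 5 "exp (33/20 :: real)"] by (simp add: exp_minus)
  moreover have "exp (- (L / 2)) <= exp (- (33 / 20))" using that by simp
  ultimately show ?thesis by linarith
 qed
 have A3: "A * L >= 349 / 100 * L" using A lo by (intro mult_right_mono) auto
 consider "L <= 28 / 10" | "28 / 10 <= L" "L <= 33 / 10" | "33 / 10 <= L" "L <= 5" | "5 < L" "L <= 9" | "9 < L" "L <= 21 / 2" | "21 / 2 < L" by linarith
 thus ?thesis
 proof cases
  case 1
  have "exp (L / 3) <= exp (14 / 15)" using 1 by simp
  hence E: "exp (L / 3) <= 111 / 100 * L" using x1 lo by linarith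
  show ?thesis
  proof (rule bound_small[OF s1 1, of "137 / 100" "111 / 100" "32 / 100"])
   show "2 * (exp ((28 / 10) / 3 :: real) - exp (- (28 / 10 / 6))) <= 137 / 100 * (28 / 10)" using x1 em[OF x2] by simp
   show "exp (L / 3) <= 111 / 100 * L" by (rule E)
   show "exp (- (L / 2)) <= 32 / 100" by (rule c1)
   show "(137 / 100 + 111 / 100) * L + 1 + 21 / 10 * (32 / 100) <= A * L" unfolding distrib_right using A3 lo by linarith
  qed
 next
  case 2
  have "exp (L / 3) <= exp (11 / 10)" using 2 by simp
  hence E: "exp (L / 3) <= 108 / 100 * L" using x3 2 by linarith
  show ?thesis
  proof (rule bound_small[OF s1 2(2), of "148 / 100" "108 / 100" "32 / 100"])
   show "2 * (exp ((33 / 10) / 3 :: real) - exp (- (33 / 10 / 6))) <= 148 / 100 * (33 / 10)" using x3 em[OF x4] by simp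
   show "exp (L / 3) <= 108 / 100 * L" by (rule E)
   show "exp (- (L / 2)) <= 32 / 100" by (rule c1)
   show "(148 / 100 + 108 / 100) * L + 1 + 21 / 10 * (32 / 100) <= A * L" unfolding distrib_right using A3 2 by linarith
  qed
 next
  case 3
  show ?thesis
  proof (rule bound_small[OF s1 3(2), of "1945 / 1000" "106 / 100" "2 / 10"])
   show "2 * (exp ((5) / 3 :: real) - exp (- (5 / 6))) <= 1945 / 1000 * (5)" using x5 em[OF x6] by simp
   show "exp (L / 3) <= 106 / 100 * L" using 3 x5 by (intro exp_third_le[of 5]) auto
   show "exp (- (L / 2)) <= 2 / 10" using 3 by (intro c2) auto
   show "(1945 / 1000 + 106 / 100) * L + 1 + 21 / 10 * (2 / 10) <= A * L" unfolding distrib_right using A3 3 by linarith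
  qed
 next
  case 4
  have A4: "A * L >= 699 / 100 * L" using A 4 lo by (intro mult_right_mono) auto
  show ?thesis
  proof (rule bound_small[OF s1 4(2), of "442 / 100" "224 / 100" "2 / 10"])
   show "2 * (exp ((9) / 3 :: real) - exp (- (9 / 6))) <= 442 / 100 * (9)" using x7 em[OF x8] by simp
   show "exp (L / 3) <= 224 / 100 * L" using 4 x7 by (intro exp_third_le[of 9]) auto
   show "exp (- (L / 2)) <= 2 / 10" using 4 by (intro c2) auto
   show "(442 / 100 + 224 / 100) * L + 1 + 21 / 10 * (2 / 10) <= A * L" unfolding distrib_right using A4 4 by linarith
  qed
 next
  case 5
  have x10: "exp (7 / 2) <= (3312 / 100 :: real)" using exp_rational_le[of 7 "3312/100" 2] by (simp add: power_divide)
  have A5: "A * L >= 999 / 100 * L" using A 5 lo by (intro mult_right_mono) auto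
  show ?thesis
  proof (rule bound_small[OF s1 5(2), of "631 / 100" "316 / 100" "2 / 10"])
   show "2 * (exp ((21 / 2) / 3 :: real) - exp (- (21 / 2 / 6))) <= 631 / 100 * (21 / 2)"
   proof -
    have "2 * (a - b) <= 631 / 100 * (21 / 2)" if "a <= 3312 / 100" "0 <= b" for a b :: real using that by simp
    moreover have "exp ((21 / 2) / 3 :: real) <= 3312 / 100" using x10 by simp
    ultimately show ?thesis by (simp only: exp_ge_zero)
   qed
   show "exp (L / 3) <= 316 / 100 * L" using 5 x10 by (intro exp_third_le[of "21/2"]) auto
   show "exp (- (L / 2)) <= 2 / 10" using 5 by (intro c2) auto
   show "(631 / 100 + 316 / 100) * L + 1 + 21 / 10 * (2 / 10) <= A * L" unfolding distrib_right using A5 5 by linarith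
  qed
 next
  case 6
  have A6: "A * L = 1398 / 100 * L" using A 6 by auto
  show ?thesis
  proof (rule bound_small[OF s1 L11, of "82 / 10" "41 / 10" "2 / 10"])
   show "2 * (exp ((23 / 2) / 3 :: real) - exp (- (23 / 2 / 6))) <= 82 / 10 * (23 / 2)"
   proof -
    have "2 * (a - b) <= 82 / 10 * (23 / 2)" if "a <= 47" "0 <= b" for a b :: real using that by simp
    moreover have "exp ((23 / 2) / 3 :: real) <= 47" using x9 by simp
    ultimately show ?thesis by (simp only: exp_ge_zero)
   qed
   show "exp (L / 3) <= 41 / 10 * L" using 6 x9 L11 by (intro exp_third_le[of "23/2"]) auto
   show "exp (- (L / 2)) <= 2 / 10" using 6 by (intro c2) auto
   show "(82 / 10 + 41 / 10) * L + 1 + 21 / 10 * (2 / 10) <= A * L" unfolding distrib_right using A6 6 by linarith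
  qed
 qed
qed

end

text \<open>A relation rather than a function of \<open>\<tau>\<close>: a constant admissible at the
  greatest height on a circle stays admissible at all lower heights
  (\<open>zeta_constant_mono\<close>), and 13.98 is admissible everywhere.\<close>

definition zeta_constant :: "real => real => bool" where
 "zeta_constant A \<tau> \<longleftrightarrow> A = 349 / 100 \<and> ln \<tau> <= 5 \<or> A = 699 / 100 \<and> ln \<tau> <= 9 \<or> A = 999 / 100 \<and> ln \<tau> <= 21 / 2 \<or> A = 1398 / 100"

lemma zeta_bound_right_half:
 assumes k: "k >= 3" and l: "0 <= l" "l <= 1" and sg: "\<sigma> = (1 - l) * ta k + l * ta (Suc k)" "1 / 2 <= \<sigma>"
  and v: "v = (1 - l) * nu k + l * nu (Suc k)" and \<tau>: "\<tau> >= 10" and A: "zeta_constant A \<tau>"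
 shows "norm (zeta (Complex \<sigma> \<tau>)) <= A * exp (v * ln \<tau>) * ln \<tau>"
proof (cases "ln \<tau> <= 23 / 2")
 case False
 hence "A = 1398 / 100" using A unfolding zeta_constant_def by auto
 thus ?thesis using zeta_bound_large[OF k l sg v \<tau>] False by (simp only: not_le)
next
 case True
 have ta1: "ta q < 1" if "q >= 3" for q using nu_pos[OF that] that by (simp add: ta_def)
 have s1: "\<sigma> < 1"
 proof (cases "l = 0")
  case False
  have "(1 - l) * ta k + l * ta (Suc k) < (1 - l) * 1 + l * 1"
   using l False ta1[of k] ta1[of "Suc k"] k by (intro add_le_less_mono mult_left_mono mult_strict_left_mono) auto
  thus ?thesis by (simp add: sg)
 qed (use ta1[OF k] sg in auto)
 interpret zeta_exponent \<sigma> v "ln \<tau>" \<tau>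
 proof
  show "1 / 2 <= \<sigma>" "\<tau> >= 10" "ln \<tau> = ln \<tau>" "\<sigma> <= 1" using sg \<tau> s1 by auto
  show "0 <= v" unfolding v using nu_pos[of k] nu_pos[of "Suc k"] k l by (intro add_nonneg_nonneg mult_nonneg_nonneg) auto
  have "(1 - l) * (7 / 18 - 4 / 9 * ta k) + l * (7 / 18 - 4 / 9 * ta (Suc k)) <= v"
   unfolding v using nu_lower k l by (intro add_mono mult_left_mono) auto
  moreover have "(1 - l) * (7 / 18 - 4 / 9 * ta k) + l * (7 / 18 - 4 / 9 * ta (Suc k)) = 7 / 18 - 4 / 9 * \<sigma>"
   unfolding sg by (simp add: field_simps)
  ultimately show "7 / 18 - 4 / 9 * \<sigma> <= v" by simp
 qed
 show ?thesis by (rule bound_cases[OF s1 True]) (use A in \<open>auto simp: zeta_constant_def\<close>)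
qed

text \<open>For \<open>\<sigma> >= 1\<close> the sum up to \<open>\<tau>\<close> is at most
  harmonic, which gives \<open>2 * ln \<tau>\<close>, and every admissible \<open>A\<close> exceeds
  2.\<close>

lemma zeta_bound_right:
 assumes \<sigma>: "\<sigma> >= 1" and \<tau>: "\<tau> >= 10" and A: "zeta_constant A \<tau>"
 shows "norm (zeta (Complex \<sigma> \<tau>)) <= A * ln \<tau>"
proof -
 interpret zeta_exponent 1 1 "ln \<tau>" \<tau> by unfold_locales (use \<tau> in auto)
 define X where "X = nat \<lceil>\<tau>\<rceil>"
 note X = ceiling_X[folded X_def]
 let ?s = "Complex \<sigma> \<tau>"
 have s: "Re ?s > 0" "?s ~= 1" using \<sigma> \<tau> by (auto simp: complex_eq_iff)
 have Xs: "real X powr (- \<sigma>) <= 1 / \<tau>"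
 proof -
  have "real X powr (- \<sigma>) <= real X powr (- 1)" using X \<sigma> by (intro powr_mono) auto
  also have "... = 1 / real X" using X by (simp add: powr_minus_divide)
  also have "... <= 1 / \<tau>" using X \<tau> by (intro divide_left_mono) auto
  finally show ?thesis .
 qed
 have "norm (zeta ?s) <= norm ((\<Sum>n=1..X. of_nat n powr (- ?s)) + of_nat X powr (1 - ?s) / (?s - 1) - of_nat X powr (- ?s) / 2)
   + norm ?s / (2 * Re ?s) * real X powr (- Re ?s)"
  using zeta_approx[OF s, of X] X norm_triangle_sub[of "zeta ?s" "(\<Sum>n=1..X. of_nat n powr (- ?s)) + of_nat X powr (1 - ?s) / (?s - 1) - of_nat X powr (- ?s) / 2"] by linarith
 also have "norm ?s / (2 * Re ?s) * real X powr (- Re ?s) <= (1 + \<tau>) / 2 * (1 / \<tau>)"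
 proof (intro mult_mono)
  have "norm ?s / (2 * \<sigma>) <= (\<sigma> + \<tau>) / (2 * \<sigma>)" using cmod_le[of ?s] \<sigma> \<tau> by (intro divide_right_mono) auto
  also have "... <= (1 + \<tau>) / 2" using \<sigma> \<tau> by (simp add: field_simps)
  finally show "norm ?s / (2 * Re ?s) <= (1 + \<tau>) / 2" by simp
 qed (use Xs \<tau> in auto)
 also have "norm ((\<Sum>n=1..X. of_nat n powr (- ?s)) + of_nat X powr (1 - ?s) / (?s - 1) - of_nat X powr (- ?s) / 2)
   <= (1 + ln \<tau> + 1 / \<tau>) + 1 / \<tau> + 1 / \<tau>"
 proof -
  have "norm (\<Sum>n=1..X. of_nat n powr (- ?s)) <= (\<Sum>n=1..X. 1 / real n)"
  proof (rule sum_norm_le)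
   fix n assume "n \<in> {1..X}"
   hence "real n powr (- \<sigma>) <= real n powr (- 1)" using \<sigma> by (intro powr_mono) auto
   thus "norm (of_nat n powr (- ?s)) <= 1 / real n" using \<open>n \<in> {1..X}\<close> unfolding norm_nat_powr by (simp add: powr_minus_divide)
  qed
  also have "... = (\<Sum>n=1..<X. 1 / real n) + 1 / real X"
   using X by (simp add: sum.last_plus add.commute atLeastLessThanSuc_atLeastAtMost[symmetric])
  also have "... <= (1 + ln (real X - 1)) + 1 / \<tau>" using X \<tau> by (intro add_mono sum_inverse_le divide_left_mono) auto
  also have "... <= 1 + ln \<tau> + 1 / \<tau>" using X by simp
  finally have 1: "norm (\<Sum>n=1..X. of_nat n powr (- ?s)) <= 1 + ln \<tau> + 1 / \<tau>" .
  have "\<tau> <= norm (?s - 1)" using abs_Im_le_cmod[of "?s - 1"] \<tau> by simp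
  moreover have "real X powr (1 - \<sigma>) <= 1" using X \<sigma> powr_mono[of "1 - \<sigma>" 0 "real X"] by simp
  ultimately have 2: "norm (of_nat X powr (1 - ?s) / (?s - 1)) <= 1 / \<tau>"
   unfolding norm_divide norm_nat_powr using \<tau> by (simp add: frac_le)
  have 3: "norm (of_nat X powr (- ?s) / 2) <= 1 / \<tau>"
  proof -
   have "norm (of_nat X powr (- ?s) / 2) = real X powr (- \<sigma>) / 2" by (simp add: norm_divide norm_nat_powr)
   moreover have "0 <= 1 / \<tau>" using \<tau> by simp
   ultimately show ?thesis using Xs by linarith
  qed
  show ?thesis using 1 2 3 norm_triangle_ineq4[of "(\<Sum>n=1..X. of_nat n powr (- ?s)) + of_nat X powr (1 - ?s) / (?s - 1)" "of_nat X powr (- ?s) / 2"]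
    norm_triangle_ineq[of "\<Sum>n=1..X. of_nat n powr (- ?s)" "of_nat X powr (1 - ?s) / (?s - 1)"] by linarith
 qed
 finally have "norm (zeta ?s) <= 1 + ln \<tau> + 3 * (1 / \<tau>) + (1 + \<tau>) / 2 * (1 / \<tau>)" by simp
 also have "(1 + \<tau>) / 2 * (1 / \<tau>) = 1 / 2 * (1 / \<tau>) + 1 / 2" using \<tau> by (simp add: field_simps)
 also have "1 + ln \<tau> + 3 * (1 / \<tau>) + (1 / 2 * (1 / \<tau>) + 1 / 2) <= 2 + ln \<tau>"
 proof -
  have "1 / \<tau> <= 1 / 10" using \<tau> by (intro divide_left_mono) auto
  thus ?thesis by linarith
 qed
 also have "... <= 2 * ln \<tau>"
 proof -
  have "exp (2 :: real) <= 10" using exp_rational_le[of 2 10 1] by (simp add: power_divide)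
  thus ?thesis using \<tau> ln_ge_iff[of \<tau> 2] by simp
 qed
 also have "... <= A * ln \<tau>" using A \<tau> unfolding zeta_constant_def by (intro mult_right_mono) auto
 finally show ?thesis .
qed

section \<open>The coefficients c1, c2, c3 as integrals over a quarter circle\<close>

lemma sigma_ta: "sigma_k k = (if k >= 0 then ta (nat k + 3) else 1 - ta (nat (- k) + 3))"
 by (simp add: sigma_k_def ta_def nu_def add_ac)

lemma v_nu: "v_k k = (if k >= 0 then nu (nat k + 3) else ta (nat (- k) + 3) - 1 / 2 + nu (nat (- k) + 3))"
 by (simp add: v_k_def sigma_ta nu_def)

text \<open>A segment with \<open>k < 0\<close> is the mirror image under \<open>1 - x\<close> of
  the segment from \<open>ta q\<close> to \<open>ta (Suc q)\<close>; at \<open>k = -1\<close> this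
  uses that the two formulas agree at the node 1/2.\<close>

lemma int_step_cases:
 fixes k :: int
 obtains q where "q >= 3" "sigma_k k = ta q" "sigma_k (k + 1) = ta (Suc q)" "v_k k = nu q" "v_k (k + 1) = nu (Suc q)" "k >= 0"
 | q where "q >= 3" "sigma_k k = 1 - ta (Suc q)" "sigma_k (k + 1) = 1 - ta q"
   "v_k k = ta (Suc q) - 1 / 2 + nu (Suc q)" "v_k (k + 1) = ta q - 1 / 2 + nu q" "k < 0"
proof (cases "k >= 0")
 case True
 hence "nat (k + 1) + 3 = Suc (nat k + 3)" by simp
 thus ?thesis using True by (intro that(1)[of "nat k + 3"]) (auto simp: sigma_ta v_nu)
next
 case False
 define q where "q = nat (- k - 1) + 3"
 have q: "nat (- k) + 3 = Suc q" "k + 1 < 0 ==> nat (- (k + 1)) + 3 = q" "\<not> k + 1 < 0 ==> q = 3 \<and> k + 1 = 0"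
  using False by (auto simp: q_def)
 have 3: "ta 3 = 1 / 2" "nu 3 = 1 / 6" by (simp_all add: ta_def nu_def)
 show ?thesis
 proof (rule that(2)[of q])
  show "q >= 3" "k < 0" using False by (auto simp: q_def)
  show "sigma_k k = 1 - ta (Suc q)" "v_k k = ta (Suc q) - 1 / 2 + nu (Suc q)" unfolding sigma_ta v_nu q(1) using False by simp_all
  show "sigma_k (k + 1) = 1 - ta q" "v_k (k + 1) = ta q - 1 / 2 + nu q"
  proof -
   have "sigma_k (k + 1) = 1 - ta q \<and> v_k (k + 1) = ta q - 1 / 2 + nu q"
   proof (cases "k + 1 < 0")
    case True
    thus ?thesis unfolding sigma_ta v_nu q(2)[OF True] by simp
   next
    case False
    thus ?thesis using q(3)[OF False] 3 by (simp add: sigma_ta v_nu)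
   qed
   thus "sigma_k (k + 1) = 1 - ta q" "v_k (k + 1) = ta q - 1 / 2 + nu q" by auto
  qed
 qed
qed

lemma wq_le: "q >= 3 ==> wq (Suc q) <= 1 / 2"
proof -
 assume "q >= 3"
 hence "2 <= real (Suc q) - 2" by simp
 moreover have "0 <= (4 :: real) / 2 ^ Suc q" by simp
 ultimately have "2 <= real (Suc q) - 2 + 4 / 2 ^ Suc q" by linarith
 thus ?thesis unfolding wq_def using frac_le[of 1 1 2 "real (Suc q) - 2 + 4 / 2 ^ Suc q"] by linarith
qed

lemma sigma_less: "sigma_k k < sigma_k (k + 1)"
 by (cases k rule: int_step_cases) (use ta_less in auto)

text \<open>On the negative side \<open>v_k\<close> adds \<open>ta\<close> to \<open>nu\<close>; by
  \<open>wq_le\<close> the change of \<open>ta\<close> outweighs that of \<open>nu\<close>.\<close>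

lemma v_decreasing: "v_k (k + 1) <= v_k k"
proof (cases k rule: int_step_cases)
 case (1 q)
 have "0 <= wq (Suc q) * (ta (Suc q) - ta q)" using ta_less[OF 1(1)] wq_pos[of "Suc q"] 1(1) by (intro mult_nonneg_nonneg) auto
 thus ?thesis using 1 nu_ta_diff[OF 1(1)] by simp
next
 case (2 q)
 have "wq (Suc q) * (ta (Suc q) - ta q) <= 1 * (ta (Suc q) - ta q)"
  using ta_less[OF 2(1)] wq_le[OF 2(1)] by (intro mult_right_mono) auto
 thus ?thesis using 2 nu_ta_diff[OF 2(1)] by simp
qed

lemma int_mono_step:
 fixes f :: "int => real"
 assumes "\<And>k. f k <= f (k + 1)" "k <= l"
 shows "f k <= f l"
 using assms(2)
proof (induction l rule: int_ge_induct)
 case (step i)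
 thus ?case using assms(1)[of i] by simp
qed simp

lemma sigma_mono: "k <= l ==> sigma_k k <= sigma_k l"
 by (rule int_mono_step) (use sigma_less less_imp_le in blast)

lemma v_antimono: "k <= l ==> v_k l <= v_k k"
 using int_mono_step[of "%k. - v_k k" k l] v_decreasing by simp

lemma ta_tendsto: "ta \<longlonglongrightarrow> 1" and nu_tendsto: "nu \<longlonglongrightarrow> 0"
 unfolding ta_def nu_def by real_asymp+

lemma ta_lt_1: "q >= 3 ==> ta q < 1" using nu_pos[of q] by (simp add: ta_def)

lemma sigma_range: "0 < sigma_k k" "sigma_k k < 1"
proof -
 have half: "1 / 2 <= ta q" if "q >= 3" for q
  using that
 proof (induction q rule: dec_induct)
  case base show ?case by (simp add: ta_def nu_def)
 next
  case (step n) thus ?case using ta_less[of n] by simp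
 qed
 show "0 < sigma_k k" "sigma_k k < 1" using half[of "nat k + 3"] half[of "nat (- k) + 3"] ta_lt_1[of "nat k + 3"] ta_lt_1[of "nat (- k) + 3"]
  by (auto simp: sigma_ta)
qed

lemma sigma_tendsto: "(%n. sigma_k (k + int n)) \<longlonglongrightarrow> 1"
proof -
 have "(%n. ta (n + 3)) \<longlonglongrightarrow> 1" by (rule LIMSEQ_ignore_initial_segment[OF ta_tendsto])
 hence s: "(%n. sigma_k (int n)) \<longlonglongrightarrow> 1" by (simp add: sigma_ta)
 have "\<forall>\<^sub>F n in sequentially. n >= nat (- k)" by (rule eventually_ge_at_top)
 hence ev: "\<forall>\<^sub>F n in sequentially. sigma_k (int (nat (k + int n))) = sigma_k (k + int n)"
 proof eventually_elim
  case (elim n)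
  hence "int (nat (k + int n)) = k + int n" by linarith
  thus ?case by (simp only:)
 qed
 have "filterlim (%n. nat (k + int n)) at_top sequentially"
 proof (rule filterlim_at_top[THEN iffD2], intro allI)
  fix Z :: nat
  have "\<forall>\<^sub>F n in sequentially. n >= nat (int Z - k)" by (rule eventually_ge_at_top)
  thus "\<forall>\<^sub>F n in sequentially. Z <= nat (k + int n)" by eventually_elim linarith
 qed
 from filterlim_compose[OF s this] show ?thesis using ev by (simp cong: tendsto_cong)
qed

lemma K_index_eq:
 assumes "1 - r <= sigma_k k" "sigma_k (k - 1) < 1 - r"
 shows "K_index r = k"
 unfolding K_index_def
proof (rule Least_equality)
 show "1 - sigma_k k <= r" using assms by simp
 fix l assume "1 - sigma_k l <= r"
 thus "k <= l" using sigma_mono[of l "k - 1"] assms by (cases "k <= l") auto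
qed

text \<open>The least integer exists because \<open>sigma_k\<close> exceeds \<open>1 - r\<close> far
  to the right and falls below it far to the left; the offset \<open>b\<close> turns the search into
  one over the naturals.\<close>

lemma K_index:
 assumes "0 < r" "r < 1"
 shows "1 - r <= sigma_k (K_index r)" "sigma_k (K_index r - 1) < 1 - r"
proof -
 have "\<forall>\<^sub>F n in sequentially. 1 - r < sigma_k (0 + int n)"
  using order_tendstoD(1)[OF sigma_tendsto[of 0], of "1 - r"] assms by simp
 then obtain a where a: "1 - r < sigma_k (int a)" by (auto dest: eventually_happens)
 have "(%n. ta (n + 3)) \<longlonglongrightarrow> 1" by (rule LIMSEQ_ignore_initial_segment[OF ta_tendsto])
 hence "\<forall>\<^sub>F n in sequentially. r < ta (n + 3)" using order_tendstoD(1)[of _ 1 sequentially r] assms by auto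
 hence "\<forall>\<^sub>F n in sequentially. r < ta (n + 3) \<and> n >= 1" using eventually_ge_at_top[of 1] by eventually_elim auto
 then obtain b where b: "r < ta (b + 3)" "b >= 1" by (auto dest: eventually_happens)
 hence b': "sigma_k (- int b) < 1 - r" by (simp add: sigma_ta)
 define n where "n = (LEAST n. 1 - r <= sigma_k (int n - int b))"
 have ex: "1 - r <= sigma_k (int (a + b) - int b)" using a by simp
 have n1: "1 - r <= sigma_k (int n - int b)" unfolding n_def by (rule LeastI[of _ "a + b"]) (rule ex)
 have n0: "n ~= 0" using n1 b' by (cases "n = 0") auto
 have nl: "\<not> 1 - r <= sigma_k (int (n - 1) - int b)" unfolding n_def by (rule not_less_Least) (use n0 n_def in auto)
 have "int (n - 1) - int b = int n - int b - 1" using n0 by simp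
 hence n2: "sigma_k (int n - int b - 1) < 1 - r" using nl by (simp only: not_le)
 hence "K_index r = int n - int b" using n1 by (intro K_index_eq)
 thus "1 - r <= sigma_k (K_index r)" "sigma_k (K_index r - 1) < 1 - r"
  using n1 n2 by (simp_all only:)
qed

definition line :: "(int => real) => int => real => real" where
 "line w k x = slope w k * x + intercept w k"

lemma line_interpolates:
 assumes x: "x = (1 - l) * sigma_k k + l * sigma_k (k + 1)"
 shows "line w k x = (1 - l) * w k + l * w (k + 1)"
proof -
 have d: "sigma_k (k + 1) - sigma_k k ~= 0" using sigma_less[of k] by simp
 have "slope w k = (w (k + 1) - w k) / (sigma_k (k + 1) - sigma_k k)"
  unfolding slope_def using minus_divide_divide[of "w k - w (k + 1)" "sigma_k k - sigma_k (k + 1)"] by simp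
 hence m: "slope w k * (sigma_k (k + 1) - sigma_k k) = w (k + 1) - w k" using d by simp
 have "line w k x = w k + l * (slope w k * (sigma_k (k + 1) - sigma_k k))"
  unfolding line_def intercept_def x by (simp add: algebra_simps)
 thus ?thesis unfolding m by (simp add: algebra_simps)
qed

lemma between_nodes:
 assumes "sigma_k k <= x" "x <= sigma_k (k + 1)"
 obtains l where "0 <= l" "l <= 1" "x = (1 - l) * sigma_k k + l * sigma_k (k + 1)"
proof -
 define l where "l = (x - sigma_k k) / (sigma_k (k + 1) - sigma_k k)"
 have d: "sigma_k (k + 1) - sigma_k k > 0" using sigma_less[of k] by simp
 have e: "l * (sigma_k (k + 1) - sigma_k k) = x - sigma_k k" using d by (simp add: l_def)
 show ?thesis
 proof (rule that[of l])
  show "0 <= l" "l <= 1" unfolding l_def using assms d by (auto simp: divide_le_eq)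
  show "x = (1 - l) * sigma_k k + l * sigma_k (k + 1)" using e by (simp add: algebra_simps)
 qed
qed

lemma line_bounds:
 assumes x: "sigma_k k <= x" "x <= sigma_k (k + 1)" and "\<And>k. lo <= w k" "\<And>k. w k <= hi"
 shows "lo <= line w k x" "line w k x <= hi"
proof -
 obtain l where l: "0 <= l" "l <= 1" "x = (1 - l) * sigma_k k + l * sigma_k (k + 1)" by (rule between_nodes[OF x])
 have "(1 - l) * lo + l * lo <= (1 - l) * w k + l * w (k + 1)" using l assms by (intro add_mono mult_left_mono) auto
 thus "lo <= line w k x" unfolding line_interpolates[OF l(3)] by (simp add: algebra_simps)
 have "(1 - l) * w k + l * w (k + 1) <= (1 - l) * hi + l * hi" using l assms by (intro add_mono mult_left_mono) auto
 thus "line w k x <= hi" unfolding line_interpolates[OF l(3)] by (simp add: algebra_simps)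
qed

text \<open>This closed form is a summand of \<open>c_coeff\<close>. Hence each coefficient is the
  integral, over the quarter circle, of the polygon through the nodes taken at the abscissa
  \<open>1 - r * sin \<theta>\<close>.\<close>

lemma theta_piece:
 assumes "a <= b"
 shows "((%\<theta>. line w k (1 - r * sin \<theta>)) has_integral (slope w k + intercept w k) * (b - a) + slope w k * r * (cos b - cos a)) {a..b}"
proof -
 have "((%\<theta>. line w k (1 - r * sin \<theta>)) has_integral
   ((slope w k + intercept w k) * b + slope w k * r * cos b) - ((slope w k + intercept w k) * a + slope w k * r * cos a)) {a..b}"
  unfolding line_def
  by (rule fundamental_theorem_of_calculus[OF assms])
   (auto intro!: derivative_eq_intros simp: algebra_simps simp flip: has_real_derivative_iff_has_vector_derivative)
 thus ?thesis by (simp add: algebra_simps)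
qed

locale angles =
 fixes r :: real
 assumes r: "0 < r" "r < 1"
begin

abbreviation "K \<equiv> K_index r"
text \<open>The angle at which \<open>1 - r * sin \<theta>\<close> meets the node with index
  \<open>K + n\<close>; these angles decrease to 0.\<close>

definition th :: "nat => real" where "th n = theta_k (K + int n) r"

lemma arg: "0 < (1 - sigma_k (K + int n)) / r" "(1 - sigma_k (K + int n)) / r <= 1"
 using sigma_range[of "K + int n"] K_index(1)[OF r] sigma_mono[of K "K + int n"] r by auto

lemma sin_th: "r * sin (th n) = 1 - sigma_k (K + int n)"
 unfolding th_def theta_k_def using arg[of n] r by (subst sin_arcsin) auto

lemma th_range: "0 < th n" "th n <= pi / 2"
 unfolding th_def theta_k_def using arg[of n] arcsin_less_arcsin[of 0 "(1 - sigma_k (K + int n)) / r"] arcsin_ubound by auto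

lemma th_decreasing: "th (Suc n) <= th n"
 unfolding th_def theta_k_def using arg[of n] arg[of "Suc n"] sigma_mono[of "K + int n" "K + int (Suc n)"] r
 by (intro arcsin_le_arcsin divide_right_mono) auto

lemma th_tendsto: "th \<longlonglongrightarrow> 0"
proof -
 have "(%n. (1 - sigma_k (K + int n)) / r) \<longlonglongrightarrow> (1 - 1) / r" using r by (intro tendsto_intros sigma_tendsto) auto
 hence "(%n. (1 - sigma_k (K + int n)) / r) \<longlonglongrightarrow> 0" by simp
 moreover have "continuous (at 0) arcsin" by (rule isCont_arcsin) auto
 ultimately have "(%n. arcsin ((1 - sigma_k (K + int n)) / r)) \<longlonglongrightarrow> arcsin 0"
  using isCont_tendsto_compose by blast
 thus ?thesis unfolding th_def theta_k_def by simp
qed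

lemma th_diff_sums: "(%n. th n - th (Suc n)) sums th 0"
 using telescope_sums'[OF th_tendsto] by simp

lemma on_piece:
 assumes "th (Suc n) <= \<theta>" "\<theta> <= th n"
 shows "sigma_k (K + int n) <= 1 - r * sin \<theta>" "1 - r * sin \<theta> <= sigma_k (K + int n + 1)"
proof -
 have "sin (th (Suc n)) <= sin \<theta>" "sin \<theta> <= sin (th n)"
  using assms th_range[of n] th_range[of "Suc n"] by (auto intro!: sin_monotone_2pi_le)
 hence "r * sin (th (Suc n)) <= r * sin \<theta>" "r * sin \<theta> <= r * sin (th n)" using r by auto
 thus "sigma_k (K + int n) <= 1 - r * sin \<theta>" "1 - r * sin \<theta> <= sigma_k (K + int n + 1)"
  unfolding sin_th by (simp_all add: add_ac)
qed

lemma on_first_piece: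
 assumes "th 0 <= \<theta>" "\<theta> <= pi / 2"
 shows "sigma_k (K - 1) <= 1 - r * sin \<theta>" "1 - r * sin \<theta> <= sigma_k (K - 1 + 1)"
proof -
 have "sin (th 0) <= sin \<theta>" using assms th_range[of 0] by (auto intro!: sin_monotone_2pi_le)
 hence "r * sin (th 0) <= r * sin \<theta>" using r by auto
 thus "1 - r * sin \<theta> <= sigma_k (K - 1 + 1)" unfolding sin_th by simp
 have "r * sin \<theta> <= r * 1" using r by (intro mult_left_mono) auto
 thus "sigma_k (K - 1) <= 1 - r * sin \<theta>" using K_index(2)[OF r] by simp
qed

definition piece :: "(int => real) => nat => real" where
 "piece w n = (slope w (K + int n) + intercept w (K + int n)) * (th n - th (Suc n)) + slope w (K + int n) * r * (cos (th n) - cos (th (Suc n)))"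

definition first_piece :: "(int => real) => real" where
 "first_piece w = (slope w (K - 1) + intercept w (K - 1)) * (pi / 2 - th 0) + slope w (K - 1) * r * (cos (pi / 2) - cos (th 0))"

lemma c_coeff_pieces: "c_coeff w r = first_piece w + (\<Sum>n. piece w n)"
 unfolding c_coeff_def first_piece_def piece_def th_def Let_def by (simp add: add_ac)

lemma piece_integral: "((%\<theta>. line w (K + int n) (1 - r * sin \<theta>)) has_integral piece w n) {th (Suc n)..th n}"
 unfolding piece_def by (rule theta_piece[OF th_decreasing])

lemma first_piece_integral: "((%\<theta>. line w (K - 1) (1 - r * sin \<theta>)) has_integral first_piece w) {th 0..pi / 2}"
 unfolding first_piece_def by (rule theta_piece[OF th_range(2)])

lemma piece_bounds:
 assumes "\<And>k. lo <= w k" "\<And>k. w k <= hi"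
 shows "lo * (th n - th (Suc n)) <= piece w n" "piece w n <= hi * (th n - th (Suc n))"
proof -
 have c: "((%\<theta>. c) has_integral c * (th n - th (Suc n))) {th (Suc n)..th n}" for c :: real
  using has_integral_const_real[of c "th (Suc n)" "th n"] th_decreasing[of n] by (simp add: mult.commute)
 show "lo * (th n - th (Suc n)) <= piece w n"
  by (rule has_integral_le[OF c piece_integral]) (use line_bounds(1)[OF on_piece assms] in auto)
 show "piece w n <= hi * (th n - th (Suc n))"
  by (rule has_integral_le[OF piece_integral c]) (use line_bounds(2)[OF on_piece assms] in auto)
qed

lemma first_piece_bounds:
 assumes "\<And>k. lo <= w k" "\<And>k. w k <= hi"
 shows "lo * (pi / 2 - th 0) <= first_piece w" "first_piece w <= hi * (pi / 2 - th 0)"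
proof -
 have c: "((%\<theta>. c) has_integral c * (pi / 2 - th 0)) {th 0..pi / 2}" for c :: real
  using has_integral_const_real[of c "th 0" "pi / 2"] th_range[of 0] by (simp add: mult.commute)
 show "lo * (pi / 2 - th 0) <= first_piece w"
  by (rule has_integral_le[OF c first_piece_integral]) (use line_bounds(1)[OF on_first_piece assms] in auto)
 show "first_piece w <= hi * (pi / 2 - th 0)"
  by (rule has_integral_le[OF first_piece_integral c]) (use line_bounds(2)[OF on_first_piece assms] in auto)
qed

lemma piece_summable:
 assumes "\<And>k. lo <= w k" "\<And>k. w k <= hi"
 shows "summable (piece w)"
proof (rule summable_comparison_test')
 show "summable (%n. (\<bar>lo\<bar> + \<bar>hi\<bar>) * (th n - th (Suc n)))" using th_diff_sums by (intro summable_mult) (rule sums_summable)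
 fix n
 have d: "th n - th (Suc n) >= 0" using th_decreasing[of n] by simp
 have "hi * (th n - th (Suc n)) <= (\<bar>lo\<bar> + \<bar>hi\<bar>) * (th n - th (Suc n))" "- ((\<bar>lo\<bar> + \<bar>hi\<bar>) * (th n - th (Suc n))) <= lo * (th n - th (Suc n))"
 proof -
  show "hi * (th n - th (Suc n)) <= (\<bar>lo\<bar> + \<bar>hi\<bar>) * (th n - th (Suc n))" by (rule mult_right_mono[OF _ d]) auto
  have "(- (\<bar>lo\<bar> + \<bar>hi\<bar>)) * (th n - th (Suc n)) <= lo * (th n - th (Suc n))" by (rule mult_right_mono[OF _ d]) auto
  thus "- ((\<bar>lo\<bar> + \<bar>hi\<bar>) * (th n - th (Suc n))) <= lo * (th n - th (Suc n))" by (simp only: mult_minus_left)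
 qed
 thus "norm (piece w n) <= (\<bar>lo\<bar> + \<bar>hi\<bar>) * (th n - th (Suc n))"
  using piece_bounds[of lo w hi n, OF assms] unfolding real_norm_def abs_le_iff by linarith
qed

text \<open>Bounds for the nodes pass to the polygon and then to its integral over an interval of
  length \<open>pi / 2\<close>.\<close>

lemma c_coeff_bounds:
 assumes "\<And>k. lo <= w k" "\<And>k. w k <= hi"
 shows "lo * (pi / 2) <= c_coeff w r" "c_coeff w r <= hi * (pi / 2)"
proof -
 have s: "(%n. c * (th n - th (Suc n))) sums (c * th 0)" for c by (rule sums_mult[OF th_diff_sums])
 have p: "piece w sums (\<Sum>n. piece w n)" using piece_summable[of lo w hi, OF assms] by (rule summable_sums)
 have "lo * th 0 <= (\<Sum>n. piece w n)" by (rule sums_le[OF _ s p]) (rule piece_bounds(1)[OF assms])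
 thus "lo * (pi / 2) <= c_coeff w r" using first_piece_bounds(1)[of lo w hi, OF assms] unfolding c_coeff_pieces by (simp add: algebra_simps)
 have "(\<Sum>n. piece w n) <= hi * th 0" by (rule sums_le[OF _ p s]) (rule piece_bounds(2)[OF assms])
 thus "c_coeff w r <= hi * (pi / 2)" using first_piece_bounds(2)[of lo w hi, OF assms] unfolding c_coeff_pieces by (simp add: algebra_simps)
qed

lemma c2: "c2 r = pi / 2"
 using c_coeff_bounds[of 1 v_k' 1] by (simp add: c2_def v_k'_def)

text \<open>The smallest node value is the one at \<open>k = 0\<close>; for \<open>k < 0\<close>
  this comes down to \<open>sqrt pi <= 1.546 / 0.611\<close>.\<close>

lemma c3_ge: "ln 0.611 * (pi / 2) <= c3 r"
proof -
 have l: "ln 0.611 <= (ln 1.546 :: real)" by simp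
 have p: "ln pi > 0" using pi_gt3 by simp
 have half: "ln pi / 2 <= ln 1.546 - ln (0.611 :: real)"
 proof -
  have "sqrt pi <= 1.546 / 0.611"
  proof (rule real_le_lsqrt)
   show "pi <= (1.546 / 0.611)\<^sup>2" using pi_less_4 by (simp add: power2_eq_square field_simps)
  qed simp
  hence "ln (sqrt pi) <= ln (1.546 / 0.611)" by (intro ln_mono) auto
  moreover have "ln (a / b) = ln a - ln b" if "a > 0" "b > 0" for a b :: real using that by (simp add: ln_div)
  from this[of "1.546" "0.611"] have "ln (1.546 / 0.611 :: real) = ln 1.546 - ln 0.611" by simp
  ultimately show ?thesis by (simp add: ln_sqrt)
 qed
 have s: "- (ln pi / 2) <= (sigma_k k - 1 / 2) * ln pi" "(sigma_k k - 1 / 2) * ln pi <= ln pi / 2" for k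
  using mult_right_mono[of "- (1 / 2)" "sigma_k k - 1 / 2" "ln pi"] mult_right_mono[of "sigma_k k - 1 / 2" "1 / 2" "ln pi"] sigma_range[of k] p by auto
 have lo: "ln 0.611 <= v_k'' k" for k using l half s(1)[of k] unfolding v_k''_def by auto
 have hi: "v_k'' k <= ln 1.546 + ln pi / 2" for k
 proof -
  have "ln 0.611 <= ln 1.546 + ln pi / 2" using l p by linarith
  moreover have "v_k'' k = ln 0.611 \<or> v_k'' k = ln 1.546 \<or> v_k'' k = ln 1.546 + (sigma_k k - 1 / 2) * ln pi"
   by (auto simp: v_k''_def)
  ultimately show ?thesis using p s(2)[of k] by (elim disjE; linarith)
 qed
 show ?thesis unfolding c3_def by (rule c_coeff_bounds(1)[OF lo hi])
qed

end

text \<open>The growth exponent of zeta used on the left half circle: the polygon through the nodes,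
  continued by 0. \<open>K_index (1 - x) - 1\<close> is the index of the segment containing
  \<open>x\<close>.\<close>

definition vexp :: "real => real" where
 "vexp x = (if x >= 1 then 0 else line v_k (K_index (1 - x) - 1) x)"

lemma line_at_nodes: "line w k (sigma_k k) = w k" "line w k (sigma_k (k + 1)) = w (k + 1)"
 using line_interpolates[of "sigma_k k" 0 k w] line_interpolates[of "sigma_k (k + 1)" 1 k w] by simp_all

lemma vexp_on:
 assumes "sigma_k k <= x" "x <= sigma_k (k + 1)"
 shows "vexp x = line v_k k x"
proof -
 have x1: "x < 1" using assms sigma_range(2)[of "k + 1"] by linarith
 show ?thesis
 proof (cases "x = sigma_k k")
  case False
  hence "K_index (1 - x) = k + 1" using assms by (intro K_index_eq) auto
  thus ?thesis using x1 by (simp add: vexp_def)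
 next
  case True
  hence "K_index (1 - x) = k" using sigma_less[of "k - 1"] by (intro K_index_eq) auto
  thus ?thesis using x1 True line_at_nodes(2)[of v_k "k - 1"] line_at_nodes(1)[of v_k k] by (simp add: vexp_def)
 qed
qed

lemma node_interval:
 assumes "0 < x" "x < 1"
 shows "\<exists>k. sigma_k k < x \<and> x <= sigma_k (k + 1)"
 using K_index[of "1 - x"] assms by (intro exI[of _ "K_index (1 - x) - 1"]) simp

text \<open>For \<open>k >= 0\<close> the lower bound is \<open>q^2 <= 2 * (2 ^ q - 2)\<close>; for
  \<open>k < 0\<close> it follows by \<open>y^2 / 2 = (1 - y)^2 / 2 + y - 1/2\<close>. The two
  bounds are what later places \<open>c1\<close> between \<open>r^2 * pi / 8\<close> and
  \<open>r / 2\<close>.\<close>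

lemma node_bounds: "(1 - sigma_k k)\<^sup>2 / 2 <= v_k k" "v_k k <= (1 - sigma_k k) / 2"
proof -
 have sq: "(1 - ta q)\<^sup>2 / 2 <= nu q" if q: "q >= 3" for q
 proof -
  define P :: real where "P = 2 ^ q"
  have P: "P >= 8" using two_power_ge_8[OF q] by (simp add: P_def)
  have "(real q)\<^sup>2 <= 2 * (P - 2)" unfolding P_def using q
  proof (induction q rule: dec_induct)
   case (step n)
   have "(real (Suc n))\<^sup>2 = (real n)\<^sup>2 + 2 * real n + 1" by (simp add: power2_eq_square algebra_simps)
   moreover have "2 * real n + 1 <= (real n)\<^sup>2"
   proof -
    have "3 * real n <= real n * real n" using step.hyps by (intro mult_right_mono) auto
    moreover have "real n >= 1" using step.hyps by simp
    ultimately show ?thesis unfolding power2_eq_square by linarith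
   qed
   ultimately show ?case using step.IH by simp
  qed (simp add: power2_eq_square)
  moreover have n: "nu q * (P - 2) = 1" unfolding nu_def P_def[symmetric] using P by simp
  ultimately have "nu q * nu q * (real q)\<^sup>2 <= nu q * nu q * (2 * (P - 2))" using nu_pos[OF q] by (intro mult_left_mono) auto
  also have "... = 2 * nu q * (nu q * (P - 2))" by (simp add: mult_ac)
  finally show ?thesis unfolding n ta_def by (simp add: power2_eq_square mult_ac)
 qed
 have "(1 - sigma_k k)\<^sup>2 / 2 <= v_k k \<and> v_k k <= (1 - sigma_k k) / 2"
 proof (cases k rule: int_step_cases)
  case (1 q)
  thus ?thesis using sq[OF 1(1)] nu_upper[OF 1(1)] by simp
 next
  case (2 q)
  have "(ta (Suc q))\<^sup>2 / 2 = (1 - ta (Suc q))\<^sup>2 / 2 + ta (Suc q) - 1 / 2" by (simp add: power2_eq_square field_simps)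
  thus ?thesis using sq[of "Suc q"] nu_upper[of "Suc q"] 2 by simp
 qed
 thus "(1 - sigma_k k)\<^sup>2 / 2 <= v_k k" "v_k k <= (1 - sigma_k k) / 2" by auto
qed

text \<open>Convexity of the square carries the lower bound from the nodes to the chords; the upper
  bound is linear.\<close>

lemma vexp_bounds:
 assumes "0 < x" "x <= 1"
 shows "(1 - x)\<^sup>2 / 2 <= vexp x" "vexp x <= (1 - x) / 2"
proof -
 have "(1 - x)\<^sup>2 / 2 <= vexp x \<and> vexp x <= (1 - x) / 2"
 proof (cases "x = 1")
  case False
  then obtain k where k: "sigma_k k < x" "x <= sigma_k (k + 1)" using node_interval[of x] assms by auto
  obtain l where l: "0 <= l" "l <= 1" "x = (1 - l) * sigma_k k + l * sigma_k (k + 1)"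
   by (rule between_nodes[OF less_imp_le[OF k(1)] k(2)])
  have v: "vexp x = (1 - l) * v_k k + l * v_k (k + 1)"
   using vexp_on[of k x] k line_interpolates[OF l(3), of v_k] by simp
  define a b where "a = 1 - sigma_k k" and "b = 1 - sigma_k (k + 1)"
  have xe: "1 - x = (1 - l) * a + l * b" unfolding l(3) a_def b_def by (simp add: algebra_simps)
  have "(1 - l) * (a\<^sup>2 / 2) + l * (b\<^sup>2 / 2) - (1 - x)\<^sup>2 / 2 = (1 - l) * l * (a - b)\<^sup>2 / 2"
   unfolding xe by (simp add: power2_eq_square field_simps)
  also have "... >= 0" using l by (intro divide_nonneg_nonneg mult_nonneg_nonneg) auto
  finally have "(1 - x)\<^sup>2 / 2 <= (1 - l) * (a\<^sup>2 / 2) + l * (b\<^sup>2 / 2)" by simp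
  also have "... <= vexp x" unfolding v a_def b_def using l by (intro add_mono mult_left_mono node_bounds) auto
  finally have 1: "(1 - x)\<^sup>2 / 2 <= vexp x" .
  have "vexp x <= (1 - l) * (a / 2) + l * (b / 2)" unfolding v a_def b_def using l by (intro add_mono mult_left_mono node_bounds) auto
  also have "... = (1 - x) / 2" unfolding xe by (simp add: field_simps)
  finally show ?thesis using 1 by simp
 qed (simp add: vexp_def)
 thus "(1 - x)\<^sup>2 / 2 <= vexp x" "vexp x <= (1 - x) / 2" by auto
qed

lemma vexp_nonneg: "0 < x ==> 0 <= vexp x"
 using vexp_bounds(1)[of x] order_trans[of 0 "(1 - x)\<^sup>2 / 2" "vexp x"] by (cases "x <= 1") (auto simp: vexp_def)

lemma line_v_antimono:
 assumes "x <= y"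
 shows "line v_k k y <= line v_k k x"
proof -
 have "slope v_k k <= 0" unfolding slope_def
  using v_decreasing[of k] sigma_less[of k] by (intro divide_nonneg_neg) auto
 thus ?thesis unfolding line_def using assms by (intro add_right_mono mult_left_mono_neg)
qed

text \<open>Allows the exponent at \<open>1 + \<delta> + R * y\<close> to be replaced by the one at
  \<open>1 + r * y\<close> on the left half circle.\<close>

lemma vexp_antimono:
 assumes "0 < x" "x <= y"
 shows "vexp y <= vexp x"
proof (cases "y < 1")
 case False
 thus ?thesis using vexp_nonneg[OF assms(1)] by (simp add: vexp_def)
next
 case True
 obtain k where k: "sigma_k k < x" "x <= sigma_k (k + 1)" using node_interval[of x] assms True by auto
 obtain l where l: "sigma_k l < y" "y <= sigma_k (l + 1)" using node_interval[of y] assms True by auto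
 have vk: "vexp x = line v_k k x" "vexp y = line v_k l y" using vexp_on k l by (simp_all add: less_imp_le)
 have "k <= l"
 proof (rule ccontr)
  assume "\<not> k <= l"
  hence "sigma_k (l + 1) <= sigma_k k" by (intro sigma_mono) simp
  thus False using k l assms by simp
 qed
 show ?thesis
 proof (cases "k = l")
  case True
  thus ?thesis unfolding vk using line_v_antimono[OF assms(2)] by simp
 next
  case False
  hence "v_k l <= v_k (k + 1)" using \<open>k <= l\<close> by (intro v_antimono) simp
  moreover have "v_k (k + 1) <= line v_k k x" using line_v_antimono[OF k(2), of k] by (simp add: line_at_nodes)
  moreover have "line v_k l y <= v_k l" using line_v_antimono[of "sigma_k l" y l] l by (simp add: line_at_nodes)
  ultimately show ?thesis unfolding vk by linarith
 qed
qed

context angles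
begin

lemma vexp_partial_integral:
 "((%\<theta>. vexp (1 - r * sin \<theta>)) has_integral first_piece v_k + (\<Sum>n<N. piece v_k n)) {th N..pi / 2}"
proof (induction N)
 case 0
 have "((%\<theta>. vexp (1 - r * sin \<theta>)) has_integral first_piece v_k) {th 0..pi / 2}"
  by (rule has_integral_eq[OF _ first_piece_integral]) (use vexp_on[OF on_first_piece] in auto)
 thus ?case by simp
next
 case (Suc N)
 have "((%\<theta>. vexp (1 - r * sin \<theta>)) has_integral piece v_k N) {th (Suc N)..th N}"
  by (rule has_integral_eq[OF _ piece_integral]) (use vexp_on[OF on_piece] in auto)
 from has_integral_combine[OF th_decreasing th_range(2) this Suc] show ?case by (simp add: add_ac)
qed

lemma v_k_range: "0 <= v_k k" "v_k k <= 1 / 2"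
 using node_bounds[of k] sigma_range[of k] order_trans[of 0 "(1 - sigma_k k)\<^sup>2 / 2" "v_k k"] by auto

text \<open>The polygon is nonnegative and its pieces exhaust the angles in
  \<open>(0, pi/2]\<close>, so monotone convergence sums the series in \<open>c1\<close>.\<close>

lemma c1_integral: "((%\<theta>. vexp (1 - r * sin \<theta>)) has_integral c1 r) {0..pi / 2}"
proof (rule has_integral_monotone_convergence_increasing)
 show "((%\<theta>. if \<theta> \<in> {th N..pi / 2} then vexp (1 - r * sin \<theta>) else 0) has_integral first_piece v_k + (\<Sum>n<N. piece v_k n)) {0..pi / 2}" for N
  using vexp_partial_integral[of N] th_range[of N] by (subst has_integral_restrict) auto
 have pos: "0 <= vexp (1 - r * sin \<theta>)" for \<theta>
 proof (rule vexp_nonneg)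
  have "r * sin \<theta> <= r * 1" using r by (intro mult_left_mono) auto
  thus "0 < 1 - r * sin \<theta>" using r by linarith
 qed
 show "(if \<theta> \<in> {th N..pi / 2} then vexp (1 - r * sin \<theta>) else 0) <= (if \<theta> \<in> {th (Suc N)..pi / 2} then vexp (1 - r * sin \<theta>) else 0)" for N \<theta>
  using th_decreasing[of N] pos by auto
 show "(%N. if \<theta> \<in> {th N..pi / 2} then vexp (1 - r * sin \<theta>) else 0) \<longlonglongrightarrow> vexp (1 - r * sin \<theta>)" if t: "\<theta> \<in> {0..pi / 2}" for \<theta>
 proof (cases "\<theta> = 0")
  case True
  have "\<not> th N <= 0" for N using th_range(1)[of N] by simp
  thus ?thesis using True by (simp add: vexp_def)
 next
  case False
  hence "\<forall>\<^sub>F N in sequentially. th N < \<theta>" using order_tendstoD(2)[OF th_tendsto, of \<theta>] t by auto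
  hence "\<forall>\<^sub>F N in sequentially. (if \<theta> \<in> {th N..pi / 2} then vexp (1 - r * sin \<theta>) else 0) = vexp (1 - r * sin \<theta>)"
   by eventually_elim (use t in auto)
  thus ?thesis by (rule tendsto_eventually)
 qed
 have "(%N. first_piece v_k + (\<Sum>n<N. piece v_k n)) \<longlonglongrightarrow> first_piece v_k + (\<Sum>n. piece v_k n)"
  using piece_summable[of 0 v_k "1/2", OF v_k_range] by (intro tendsto_intros summable_LIMSEQ)
 thus "(%N. first_piece v_k + (\<Sum>n<N. piece v_k n)) \<longlonglongrightarrow> c1 r" by (simp add: c1_def c_coeff_pieces)
qed

lemma c1_bounds: "r\<^sup>2 * pi / 8 <= c1 r" "c1 r <= r / 2"
proof -
 have s: "0 < 1 - r * sin \<theta>" "1 - r * sin \<theta> <= 1" if "\<theta> \<in> {0..pi / 2}" for \<theta>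
 proof -
  have "r * sin \<theta> <= r * 1" using r by (intro mult_left_mono) auto
  thus "0 < 1 - r * sin \<theta>" using r by linarith
  show "1 - r * sin \<theta> <= 1" using that r by (simp add: sin_ge_zero)
 qed
 have "((%\<theta>. (r * sin \<theta>)\<^sup>2 / 2) has_integral (r\<^sup>2 / 4 * (pi / 2 - sin (pi / 2) * cos (pi / 2))) - (r\<^sup>2 / 4 * (0 - sin 0 * cos 0))) {0..pi / 2}"
 proof (rule fundamental_theorem_of_calculus)
  fix \<theta> :: real
  have "((%\<theta>. r\<^sup>2 / 4 * (\<theta> - sin \<theta> * cos \<theta>)) has_real_derivative r\<^sup>2 / 4 * (1 - (cos \<theta> * cos \<theta> + sin \<theta> * (- sin \<theta>)))) (at \<theta> within {0..pi / 2})"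
   by (auto intro!: derivative_eq_intros)
  moreover have "r\<^sup>2 / 4 * (1 - (cos \<theta> * cos \<theta> + sin \<theta> * (- sin \<theta>))) = (r * sin \<theta>)\<^sup>2 / 2"
  proof -
   have "cos \<theta> * cos \<theta> = 1 - sin \<theta> * sin \<theta>" using sin_cos_squared_add[of \<theta>] by (simp add: power2_eq_square)
   thus ?thesis by (simp add: power2_eq_square)
  qed
  ultimately show "((%\<theta>. r\<^sup>2 / 4 * (\<theta> - sin \<theta> * cos \<theta>)) has_vector_derivative (r * sin \<theta>)\<^sup>2 / 2) (at \<theta> within {0..pi / 2})"
   by (simp add: has_real_derivative_iff_has_vector_derivative)
 qed simp
 hence l: "((%\<theta>. (r * sin \<theta>)\<^sup>2 / 2) has_integral r\<^sup>2 * pi / 8) {0..pi / 2}" by simp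
 show "r\<^sup>2 * pi / 8 <= c1 r"
  by (rule has_integral_le[OF l c1_integral]) (use vexp_bounds(1)[OF s] in simp)
 have "((%\<theta>. r * sin \<theta> / 2) has_integral - (r / 2 * cos (pi / 2)) - - (r / 2 * cos 0)) {0..pi / 2}"
  by (rule fundamental_theorem_of_calculus)
   (auto intro!: derivative_eq_intros simp flip: has_real_derivative_iff_has_vector_derivative)
 hence u: "((%\<theta>. r * sin \<theta> / 2) has_integral r / 2) {0..pi / 2}" by simp
 show "c1 r <= r / 2"
  by (rule has_integral_le[OF c1_integral u]) (use vexp_bounds(2)[OF s] in simp)
qed

end

section \<open>The coefficient c4 as an integral of ln zeta\<close>

lemma zr_eq: "\<sigma> > 1 ==> zr \<sigma> = Re (zeta (of_real \<sigma>))"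
 by (simp add: zeta_of_real)

lemma zeta_derivative: "s ~= 1 ==> (zeta has_field_derivative deriv zeta s) (at s)"
 by (rule holomorphic_derivI[OF zeta_holomorphic]) auto

lemma zr_derivative:
 assumes "\<sigma> > 1"
 shows "(zr has_real_derivative Re (deriv zeta (of_real \<sigma>))) (at \<sigma>)"
proof -
 have "((%x. zeta (of_real x)) has_vector_derivative deriv zeta (of_real \<sigma>)) (at \<sigma>)"
  using assms by (intro has_vector_derivative_real_field zeta_derivative) auto
 hence "((%x. Re (zeta (of_real x))) has_real_derivative Re (deriv zeta (of_real \<sigma>))) (at \<sigma>)"
  unfolding has_real_derivative_iff_has_vector_derivative by (rule bounded_linear.has_vector_derivative[OF bounded_linear_Re])
 thus ?thesis
  by (rule has_field_derivative_transform_within_open[of _ _ _ "{1<..}"]) (use assms zr_eq in auto)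
qed

definition zlog :: "real => real" where
 "zlog x = Re (deriv zeta (of_real x) / zeta (of_real x))"

lemma zlog:
 assumes "\<sigma> > 1"
 shows "zlog \<sigma> <= 0" "- zlog \<sigma> <= 1 / (\<sigma> - 1)" "zlog \<sigma> = Re (deriv zeta (of_real \<sigma>)) / zr \<sigma>"
proof -
 have "zeta (of_real \<sigma>) ~= 0" using assms by (intro zeta_nonzero) auto
 hence e: "zlog \<sigma> = - Re (one.vser (of_real \<sigma>))"
  unfolding zlog_def using assms zeta_log_deriv[of "of_real \<sigma>"] by simp
 show "zlog \<sigma> <= 0" using one.Re_vser_nonneg_combination[of \<sigma> 1 0 0 0] assms unfolding e by simp
 show "- zlog \<sigma> <= 1 / (\<sigma> - 1)" using vser_real_le[OF assms] unfolding e by simp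
 show "zlog \<sigma> = Re (deriv zeta (of_real \<sigma>)) / zr \<sigma>" unfolding zlog_def zeta_of_real[OF assms] by (rule Re_divide_of_real)
qed

lemma zlog_continuous: "continuous_on {1<..} zlog"
proof -
 have d: "continuous_on (- {1}) (deriv zeta)" "continuous_on (- {1}) zeta"
  by (intro holomorphic_on_imp_continuous_on holomorphic_deriv zeta_holomorphic open_Compl closed_singleton)+
 have "continuous_on {1<..} (%x. deriv zeta (complex_of_real x))"
  by (rule continuous_on_compose2[OF d(1) continuous_on_of_real[OF continuous_on_id]]) auto
 moreover have "continuous_on {1<..} (%x. zeta (complex_of_real x))"
  by (rule continuous_on_compose2[OF d(2) continuous_on_of_real[OF continuous_on_id]]) auto
 moreover have "zeta (of_real x) ~= 0" if "x \<in> {1<..}" for x using that by (intro zeta_nonzero) auto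
 ultimately show ?thesis unfolding zlog_def by (intro continuous_on_Re continuous_on_divide) auto
qed

lemma zr_lower: "\<sigma> > 1 ==> 1 + 2 powr (- \<sigma>) <= zr \<sigma>"
proof -
 assume s: "\<sigma> > 1"
 have "(\<Sum>n<3. real n powr (- \<sigma>)) <= zr \<sigma>"
  unfolding zr_def using zr_sums[OF s] by (intro sum_le_suminf) (auto simp: sums_iff)
 thus ?thesis by (simp add: numeral_3_eq_3)
qed

text \<open>Integration by parts of \<open>1 * g (sin x)\<close>, then \<open>u = sin x\<close>,
  under which the angle becomes \<open>arcsin u\<close>. Because of the pole at 1 this is done on
  \<open>[e k, pi/2]\<close>, and the limit is taken by monotone convergence. At
  \<open>x = 0\<close> the integrand is set to 0, since the series for \<open>zr 1\<close>
  diverges.\<close>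

lemma c4_integral:
 assumes r: "0 < r" "r < 1"
 shows "((%x. if x = 0 then 0 else ln (zr (1 + r * sin x))) has_integral pi * c4 r) {0..pi / 2}"
  and "ln (zr (1 + r)) / 2 <= c4 r"
proof -
 define g where "g u = ln (zr (1 + r * u))" for u
 define D where "D u = r * zlog (1 + r * u)" for u
 have zr1: "zr (1 + r * u) >= 1" if "u > 0" for u using zr_bounds(3)[of "1 + r * u"] r that by simp
 have g0: "g u >= 0" if "u > 0" for u unfolding g_def using zr1[OF that] by simp
 have dg: "(g has_real_derivative D u) (at u)" if u: "u > 0" for u
 proof -
  have s: "1 + r * u > 1" using r u by simp
  have "((%u. zr (1 + r * u)) has_real_derivative Re (deriv zeta (of_real (1 + r * u))) * r) (at u)"
   by (rule DERIV_chain2[where f = zr and g = "%u. 1 + r * u", OF zr_derivative[OF s]]) (auto intro!: derivative_eq_intros)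
  hence "(g has_real_derivative 1 / zr (1 + r * u) * (Re (deriv zeta (of_real (1 + r * u))) * r)) (at u)"
   unfolding g_def using zr1[OF u] by (intro DERIV_chain2[where f = ln and g = "%u. zr (1 + r * u)", OF DERIV_ln_divide]) auto
  thus ?thesis unfolding D_def zlog(3)[OF s] by (simp add: mult_ac)
 qed
 have D0: "D u <= 0" "- (u * D u) <= 1" if u: "u > 0" for u
 proof -
  have s: "1 + r * u > 1" using r u by simp
  show "D u <= 0" unfolding D_def using r zlog(1)[OF s] by (simp add: mult_nonneg_nonpos)
  have "(r * u) * (- zlog (1 + r * u)) <= (r * u) * (1 / (1 + r * u - 1))" using r u by (intro mult_left_mono zlog(2)[OF s]) auto
  also have "... = 1" using r u by simp
  finally show "- (u * D u) <= 1" unfolding D_def by (simp add: mult_ac)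
 qed
 have Dc: "continuous_on {e..} D" if "e > 0" for e
  unfolding D_def using r that by (intro continuous_intros continuous_on_compose2[OF zlog_continuous]) (auto simp: add_pos_pos)
 define e where "e k = 1 / (real k + 1)" for k
 have e: "0 < e k" "e k <= 1" "e (Suc k) <= e k" for k by (auto simp: e_def field_simps)
 have pi2: "1 < pi / 2" using pi_gt3 by simp
 have sinp: "0 < sin x" if "0 < x" "x <= pi / 2" for x using that by (intro sin_gt_zero) auto
 \<comment> \<open>The integrand left by the integration by parts. It lies between 0 and 1, by
   \<open>mult_cos_le_sin\<close> and the bound for \<open>zlog\<close>, so its integrals increase
   to a limit.\<close>
 define q where "q x = - (x * (D (sin x) * cos x))" for x
 have q: "0 <= q x" "q x <= 1" if x: "0 < x" "x <= pi / 2" for x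
 proof -
  have c: "cos x >= 0" using x by (intro cos_ge_zero) auto
  have "0 <= x * ((- D (sin x)) * cos x)" using x c D0(1)[OF sinp[OF x]] by (intro mult_nonneg_nonneg) auto
  thus "0 <= q x" by (simp add: q_def)
  have "q x = (x * cos x) * (- D (sin x))" by (simp add: q_def)
  also have "... <= sin x * (- D (sin x))"
   using x D0(1)[OF sinp[OF x]] mult_cos_le_sin[of x] by (intro mult_right_mono) auto
  also have "... <= 1" using D0(2)[OF sinp[OF x]] by simp
  finally show "q x <= 1" .
 qed
 define J where "J k = integral {e k..pi / 2} q" for k
 have qi: "q integrable_on {e k..pi / 2}" for k
 proof (rule integrable_continuous_real)
  have sk: "0 < sin (e k)" using e[of k] pi2 by (intro sinp) auto
  have "sin (e k) <= sin x" if "x \<in> {e k..pi / 2}" for x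
   using that e(1)[of k] by (intro sin_monotone_2pi_le) auto
  thus "continuous_on {e k..pi / 2} q" unfolding q_def
   by (intro continuous_intros continuous_on_compose2[OF Dc[OF sk]]) auto
 qed
 have Ji: "(q has_integral J k) {e k..pi / 2}" for k unfolding J_def using qi by (rule integrable_integral)
 have H: "((%x. g (sin x)) has_integral (pi / 2 * g 1 - e k * g (sin (e k))) + J k) {e k..pi / 2}" for k
 proof -
  have "((%x. g (sin x) - q x) has_integral pi / 2 * g (sin (pi / 2)) - e k * g (sin (e k))) {e k..pi / 2}"
  proof (rule fundamental_theorem_of_calculus)
   fix x assume x: "x \<in> {e k..pi / 2}"
   hence sx: "0 < sin x" using e(1)[of k] by (intro sinp) auto
   have "((%x. g (sin x)) has_real_derivative D (sin x) * cos x) (at x)"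
    by (rule DERIV_chain2[where f = g and g = sin, OF dg[OF sx] DERIV_sin])
   hence "((%x. x * g (sin x)) has_real_derivative 1 * g (sin x) + D (sin x) * cos x * x) (at x)"
    by (rule DERIV_mult[OF DERIV_ident])
   moreover have "1 * g (sin x) + D (sin x) * cos x * x = g (sin x) - q x" by (simp add: q_def)
   ultimately have "((%x. x * g (sin x)) has_real_derivative g (sin x) - q x) (at x)" by (simp only:)
   from has_field_derivative_at_within[OF this, of "{e k..pi / 2}"]
   show "((%x. x * g (sin x)) has_vector_derivative g (sin x) - q x) (at x within {e k..pi / 2})"
    by (simp only: has_real_derivative_iff_has_vector_derivative)
  qed (use e[of k] pi2 in auto)
  from has_integral_add[OF this Ji] show ?thesis by simp
 qed
 have S: "((%u. - (arcsin u * D u)) has_integral J k) {sin (e k)..1}" for k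
 proof -
  have ek: "0 < sin (e k)" "e k <= pi / 2" using e[of k] pi2 by (auto intro!: sinp)
  have "continuous_on {sin (e k)..1} arcsin" by (rule continuous_on_subset[OF continuous_on_arcsin']) (use ek in auto)
  moreover have "continuous_on {sin (e k)..1} D" by (rule continuous_on_subset[OF Dc[OF ek(1)]]) auto
  ultimately have c: "continuous_on {sin (e k)..1} (%u. - (arcsin u * D u))" by (intro continuous_on_minus continuous_on_mult)
  have "((%x. cos x *\<^sub>R (- (arcsin (sin x) * D (sin x)))) has_integral integral {sin (e k)..sin (pi / 2)} (%u. - (arcsin u * D u))) {e k..pi / 2}"
  proof (rule has_integral_substitution[where c = "sin (e k)" and d = 1])
   show "sin ` {e k..pi / 2} \<subseteq> {sin (e k)..1}"
    using e(1)[of k] by (auto intro!: sin_monotone_2pi_le)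
   show "sin (e k) <= sin (pi / 2)" by simp
  qed (use ek c in \<open>auto intro!: derivative_eq_intros\<close>)
  moreover have "cos x *\<^sub>R (- (arcsin (sin x) * D (sin x))) = q x" if "x \<in> {e k..pi / 2}" for x
   using that e(1)[of k] by (subst arcsin_sin) (auto simp: q_def)
  ultimately have "(q has_integral integral {sin (e k)..sin (pi / 2)} (%u. - (arcsin u * D u))) {e k..pi / 2}"
   by (rule has_integral_eq[rotated])
  hence "integral {sin (e k)..1} (%u. - (arcsin u * D u)) = J k" using has_integral_unique[OF Ji] by simp
  thus ?thesis using integrable_integral[OF integrable_continuous_real[OF c]] by simp
 qed
 have Jm: "J k <= J (Suc k)" for k
  unfolding J_def using e[of k] e[of "Suc k"] qi q(1) by (intro integral_subset_le) auto
 have J0: "0 <= J k" for k by (rule has_integral_nonneg[OF Ji]) (use q e(1)[of k] in auto)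
 have Jb: "J k <= pi / 2" for k
 proof -
  have "((%x. 1 :: real) has_integral (pi / 2 - e k)) {e k..pi / 2}"
   using has_integral_const_real[of "1::real" "e k" "pi / 2"] e[of k] pi2 by simp
  hence "J k <= pi / 2 - e k" by (rule has_integral_le[OF Ji]) (use q(2) e(1)[of k] in auto)
  thus ?thesis using e(1)[of k] by simp
 qed
 have "incseq J" by (rule incseq_SucI) (rule Jm)
 then obtain JJ where JJ: "J \<longlonglongrightarrow> JJ" "\<And>k. J k <= JJ" using incseq_convergent[of J "pi / 2"] Jb by blast
 \<comment> \<open>The boundary term at \<open>e k\<close> vanishes in the limit, as
   \<open>g\<close> grows only like the logarithm of \<open>1 / e k\<close>.\<close>
 have lim0: "(%k. e k * g (sin (e k))) \<longlonglongrightarrow> 0"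
 proof (rule tendsto_sandwich)
  have "0 <= e k * g (sin (e k))" for k
  proof -
   have "e k <= pi / 2" using e(2)[of k] pi2 by linarith
   hence "0 < sin (e k)" using e(1)[of k] by (intro sinp) auto
   thus ?thesis using g0 e(1)[of k] by (intro mult_nonneg_nonneg) auto
  qed
  thus "\<forall>\<^sub>F k in sequentially. 0 <= e k * g (sin (e k))" by simp
  have "e k * g (sin (e k)) <= e k * ln (1 + 2 * (real k + 1) / r)" for k
  proof (intro mult_left_mono)
   have "1 / 2 <= cos (1 :: real)" using cos_monotone_0_pi_le[of 1 "pi / 3"] pi_gt3 by (simp add: cos_60)
   also have "cos 1 <= cos (e k)" using e[of k] pi_gt3 by (intro cos_monotone_0_pi_le) auto
   finally have "e k * (1 / 2) <= e k * cos (e k)" using e(1)[of k] by (intro mult_left_mono) auto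
   also have "... <= sin (e k)" using e[of k] pi2 by (intro mult_cos_le_sin) auto
   finally have s: "e k / 2 <= sin (e k)" by simp
   have sp: "sin (e k) > 0" using e[of k] pi2 by (intro sinp) auto
   have "zr (1 + r * sin (e k)) <= 1 + 1 / (r * sin (e k))" using zr_bounds(1)[of "1 + r * sin (e k)"] r sp by simp
   also have "1 / (r * sin (e k)) <= 1 / (r * (e k / 2))" using r s e(1)[of k] by (intro divide_left_mono mult_left_mono mult_pos_pos) auto
   also have "1 / (r * (e k / 2)) = 2 * (real k + 1) / r" by (simp add: e_def)
   finally show "g (sin (e k)) <= ln (1 + 2 * (real k + 1) / r)" unfolding g_def using zr1[OF sp] by simp
  qed (rule less_imp_le[OF e(1)])
  thus "\<forall>\<^sub>F k in sequentially. e k * g (sin (e k)) <= e k * ln (1 + 2 * (real k + 1) / r)" by simp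
  show "(%k. e k * ln (1 + 2 * (real k + 1) / r)) \<longlonglongrightarrow> 0" unfolding e_def using r by real_asymp
 qed simp
 have ev: "\<forall>\<^sub>F k in sequentially. e k < x" if "x > 0" for x
 proof -
  have "e \<longlonglongrightarrow> 0" unfolding e_def by real_asymp
  thus ?thesis using order_tendstoD(2) that by blast
 qed
 have I1: "((%x. if x = 0 then 0 else g (sin x)) has_integral pi / 2 * g 1 + JJ) {0..pi / 2}"
 proof (rule has_integral_monotone_convergence_increasing)
  show "((%x. if x \<in> {e k..pi / 2} then g (sin x) else 0) has_integral (pi / 2 * g 1 - e k * g (sin (e k))) + J k) {0..pi / 2}" for k
   using H[of k] e(1)[of k] by (subst has_integral_restrict) auto
  show "(if x \<in> {e k..pi / 2} then g (sin x) else 0) <= (if x \<in> {e (Suc k)..pi / 2} then g (sin x) else 0)" if "x \<in> {0..pi / 2}" for k x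
  proof (cases "x \<in> {e (Suc k)..pi / 2}")
   case True
   thus ?thesis using g0[OF sinp[of x]] e(1)[of "Suc k"] by auto
  next
   case False
   thus ?thesis using e(3)[of k] by auto
  qed
  show "(%k. if x \<in> {e k..pi / 2} then g (sin x) else 0) \<longlonglongrightarrow> (if x = 0 then 0 else g (sin x))" if x: "x \<in> {0..pi / 2}" for x
  proof (cases "x = 0")
   case True
   have "\<not> e k <= 0" for k using e(1)[of k] by simp
   thus ?thesis using True by simp
  next
   case False
   hence "\<forall>\<^sub>F k in sequentially. e k < x" using ev x by auto
   hence "\<forall>\<^sub>F k in sequentially. (if x \<in> {e k..pi / 2} then g (sin x) else 0) = (if x = 0 then 0 else g (sin x))"
    by eventually_elim (use x False in auto)
   thus ?thesis by (rule tendsto_eventually)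
  qed
  show "(%k. (pi / 2 * g 1 - e k * g (sin (e k))) + J k) \<longlonglongrightarrow> pi / 2 * g 1 + JJ"
   using tendsto_add[OF tendsto_diff[OF tendsto_const[of "pi / 2 * g 1"] lim0] JJ(1)] by simp
 qed
 have I2: "((%u. - (arcsin u * D u)) has_integral JJ) {0..1}"
 proof (rule has_integral_monotone_convergence_increasing)
  have se: "0 < sin (e k)" for k using e[of k] pi2 by (intro sinp) auto
  show "((%u. if u \<in> {sin (e k)..1} then - (arcsin u * D u) else 0) has_integral J k) {0..1}" for k
   using S[of k] se[of k] by (subst has_integral_restrict) auto
  show "(if u \<in> {sin (e k)..1} then - (arcsin u * D u) else 0) <= (if u \<in> {sin (e (Suc k))..1} then - (arcsin u * D u) else 0)" if "u \<in> {0..1}" for k u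
  proof -
   have "sin (e (Suc k)) <= sin (e k)" using e[of k] e[of "Suc k"] pi2 by (intro sin_monotone_2pi_le) auto
   moreover have "0 <= - (arcsin u * D u)" if "u > 0" "u <= 1"
    using D0(1)[OF that(1)] arcsin_lbound[of u] that arcsin_le_arcsin[of 0 u] by (simp add: mult_nonneg_nonpos)
   ultimately show ?thesis using se[of "Suc k"] by auto
  qed
  show "(%k. if u \<in> {sin (e k)..1} then - (arcsin u * D u) else 0) \<longlonglongrightarrow> - (arcsin u * D u)" if u: "u \<in> {0..1}" for u
  proof (cases "u = 0")
   case True
   have "\<not> sin (e k) <= 0" for k using se[of k] by simp
   thus ?thesis using True by simp
  next
   case False
   hence "\<forall>\<^sub>F k in sequentially. e k < u" using ev u by auto
   hence "\<forall>\<^sub>F k in sequentially. (if u \<in> {sin (e k)..1} then - (arcsin u * D u) else 0) = - (arcsin u * D u)"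
   proof eventually_elim
    case (elim k)
    have "sin (e k) <= e k" by (rule sin_x_le_x) (use e(1)[of k] in simp)
    thus ?case using elim u by auto
   qed
   thus ?thesis by (rule tendsto_eventually)
  qed
 qed (rule JJ(1))
 have "((%u. - (1 / r) * - (arcsin u * D u)) has_integral - (1 / r) * JJ) {0..1}" by (rule has_integral_mult_right[OF I2])
 moreover have "(%u. - (1 / r) * - (arcsin u * D u)) = (%u. Re (deriv zeta (of_real (1 + r * u)) / zeta (of_real (1 + r * u))) * arcsin u)"
  using r unfolding D_def zlog_def by (auto simp: fun_eq_iff)
 ultimately have "integral {0..1} (%u. Re (deriv zeta (of_real (1 + r * u)) / zeta (of_real (1 + r * u))) * arcsin u) = - (1 / r) * JJ"
  by (metis integral_unique)
 moreover have "g 1 = ln (Re (zeta (of_real (1 + r))))" using r zr_eq[of "1 + r"] by (simp add: g_def)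
 ultimately have c4: "c4 r = 1 / 2 * g 1 + JJ / pi" unfolding c4_def using r by (simp only:) simp
 have "pi * c4 r = pi / 2 * g 1 + JJ" unfolding c4 by (simp add: field_simps)
 thus "((%x. if x = 0 then 0 else ln (zr (1 + r * sin x))) has_integral pi * c4 r) {0..pi / 2}"
  using I1 by (simp only: g_def)
 have "0 <= JJ" using J0[of 0] JJ(2)[of 0] by linarith
 thus "ln (zr (1 + r)) / 2 <= c4 r" unfolding c4 g_def by simp
qed

section \<open>Bounds for zeta along the circles\<close>

text \<open>For \<open>k >= 0\<close> this is \<open>zeta_bound_right_half\<close>. For
  \<open>k < 0\<close> the reflected point \<open>1/2 + u\<close> lies between the mirrored nodes
  with the weights exchanged, and the functional equation adds \<open>u\<close> to the exponent, as
  \<open>v_k\<close> prescribes, at the price of 1001/1000.\<close>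

lemma norm_zeta_vexp:
 assumes \<sigma>: "\<sigma> > 0" and \<tau>: "\<tau> >= 10" and A: "zeta_constant A \<tau>"
 shows "norm (zeta (Complex \<sigma> \<tau>)) <= 1001 / 1000 * A * exp (vexp \<sigma> * ln \<tau>) * ln \<tau>"
proof -
 have A0: "A > 0" using A by (auto simp: zeta_constant_def)
 have L0: "ln \<tau> > 0" using \<tau> by simp
 have up: "X <= 1001 / 1000 * A * E * ln \<tau>" if "X <= A * E * ln \<tau>" "E > 0" for X E
 proof -
  have "0 <= A * E * ln \<tau>" using A0 L0 that by simp
  thus ?thesis using that(1) by simp
 qed
 show ?thesis
 proof (cases "\<sigma> >= 1")
  case True
  thus ?thesis using zeta_bound_right[OF True \<tau> A] by (intro up) (auto simp: vexp_def)
 next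
  case False
  then obtain k where k: "sigma_k k < \<sigma>" "\<sigma> <= sigma_k (k + 1)" using node_interval[of \<sigma>] \<sigma> by auto
  obtain l where l: "0 <= l" "l <= 1" "\<sigma> = (1 - l) * sigma_k k + l * sigma_k (k + 1)"
   by (rule between_nodes[OF less_imp_le[OF k(1)] k(2)])
  have v: "vexp \<sigma> = (1 - l) * v_k k + l * v_k (k + 1)"
   using vexp_on[of k \<sigma>] k line_interpolates[OF l(3), of v_k] by simp
  show ?thesis
  proof (cases k rule: int_step_cases)
   case (1 q)
   have "sigma_k 0 = 1 / 2" by (simp add: sigma_k_def)
   hence "1 / 2 <= \<sigma>" using sigma_mono[of 0 k] 1(6) k(1) by linarith
   hence "norm (zeta (Complex \<sigma> \<tau>)) <= A * exp (vexp \<sigma> * ln \<tau>) * ln \<tau>"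
    by (intro zeta_bound_right_half[OF 1(1) l(1,2) _ _ _ \<tau> A]) (use l(3) v 1 in auto)
   thus ?thesis by (rule up) simp
  next
   case (2 q)
   define u where "u = 1 / 2 - \<sigma>"
   have "sigma_k 0 = 1 / 2" by (simp add: sigma_k_def)
   hence "\<sigma> <= 1 / 2" using sigma_mono[of "k + 1" 0] 2(6) k(2) by linarith
   hence u: "0 <= u" "u <= 3" using \<sigma> by (auto simp: u_def)
   have s': "1 / 2 + u = (1 - (1 - l)) * ta q + (1 - l) * ta (Suc q)" unfolding u_def l(3) 2 by (simp add: algebra_simps)
   define w where "w = (1 - (1 - l)) * nu q + (1 - l) * nu (Suc q)"
   have w: "vexp \<sigma> = u + w" unfolding v w_def 2 using s' by (simp add: field_simps)
   have "norm (zeta (Complex (1 / 2 - u) \<tau>)) <= 1001 / 1000 * \<tau> powr u * norm (zeta (Complex (1 / 2 + u) \<tau>))"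
    by (rule zeta_reflection_bound[OF \<tau> u])
   also have "... <= 1001 / 1000 * \<tau> powr u * (A * exp (w * ln \<tau>) * ln \<tau>)"
   proof (rule mult_left_mono)
    show "norm (zeta (Complex (1 / 2 + u) \<tau>)) <= A * exp (w * ln \<tau>) * ln \<tau>"
     by (rule zeta_bound_right_half[OF 2(1) _ _ s' _ w_def \<tau> A]) (use l u in auto)
   qed simp
   also have "... = 1001 / 1000 * A * (exp (u * ln \<tau>) * exp (w * ln \<tau>)) * ln \<tau>" using \<tau> by (simp add: powr_def mult_ac)
   also have "exp (u * ln \<tau>) * exp (w * ln \<tau>) = exp (vexp \<sigma> * ln \<tau>)" unfolding w by (simp add: distrib_right exp_add)
   finally show ?thesis by (simp add: u_def)
  qed
 qed
qed

text \<open>For circles of radius up to 3, where \<open>\<sigma>\<close> may be negative. The cubic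
  dominates both \<open>3/2 * s\<close>, from the linear bound for \<open>vexp\<close>, and
  \<open>3 * s - 1/2\<close>, from reflecting points with \<open>\<sigma> <= 0\<close>; as a
  polynomial it integrates exactly against the cosine weight.\<close>

lemma norm_zeta_left:
 assumes s: "0 <= s" "s <= 1" and \<sigma>: "1 - 3 * s <= \<sigma>" and \<tau>: "\<tau> >= 10" and A: "zeta_constant A \<tau>"
 shows "norm (zeta (Complex \<sigma> \<tau>)) <= 1001 / 1000 * A * exp ((3 / 2 * s + 3 / 2 * s\<^sup>2 - 1 / 2 * s ^ 3) * ln \<tau>) * ln \<tau>"
proof -
 define P where "P = 3 / 2 * s + 3 / 2 * s\<^sup>2 - 1 / 2 * s ^ 3"
 have A0: "A > 0" using A by (auto simp: zeta_constant_def)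
 have L0: "ln \<tau> > 0" using \<tau> by simp
 have "s ^ 3 <= s\<^sup>2" using s power_decreasing[of 2 3 s] by simp
 hence P1: "3 / 2 * s <= P" unfolding P_def using zero_le_power2[of s] by linarith
 have "0 <= (1 - s) ^ 3" using s by simp
 moreover have "P = 3 * s - 1 / 2 + (1 - s) ^ 3 / 2" unfolding P_def by (simp add: power3_eq_cube power2_eq_square field_simps)
 ultimately have P2: "3 * s - 1 / 2 <= P" by simp
 have fin: "1001 / 1000 * A * exp (v * ln \<tau>) * ln \<tau> <= 1001 / 1000 * A * exp (P * ln \<tau>) * ln \<tau>" if "v <= P" for v
  using that A0 L0 by (intro mult_right_mono mult_left_mono) auto
 show ?thesis
 proof (cases "\<sigma> > 0")
  case True
  have "vexp \<sigma> <= P"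
  proof (cases "\<sigma> <= 1")
   case le: True
   show ?thesis using vexp_bounds(2)[OF True le] P1 \<sigma> by simp
  next
   case False
   thus ?thesis using P1 s by (simp add: vexp_def)
  qed
  from order_trans[OF norm_zeta_vexp[OF True \<tau> A] fin[OF this]] show ?thesis by (simp add: P_def)
 next
  case False
  define u where "u = 1 / 2 - \<sigma>"
  have u: "0 <= u" "u <= 3" using False \<sigma> s by (auto simp: u_def)
  have "norm (zeta (Complex (1 / 2 - u) \<tau>)) <= 1001 / 1000 * \<tau> powr u * norm (zeta (Complex (1 / 2 + u) \<tau>))"
   by (rule zeta_reflection_bound[OF \<tau> u])
  also have "... <= 1001 / 1000 * \<tau> powr u * (A * ln \<tau>)"
   by (intro mult_left_mono zeta_bound_right \<tau> A) (use False in \<open>auto simp: u_def\<close>)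
  also have "... = 1001 / 1000 * A * exp (u * ln \<tau>) * ln \<tau>" using \<tau> by (simp add: powr_def mult_ac)
  also have "... <= 1001 / 1000 * A * exp (P * ln \<tau>) * ln \<tau>" by (rule fin) (use \<sigma> P2 in \<open>simp add: u_def\<close>)
  finally show ?thesis by (simp add: u_def P_def)
 qed
qed

lemma zeta_zeros_finite:
 assumes "compact K" "1 \<notin> K"
 shows "finite {z \<in> K. zeta z = 0}"
proof (rule holomorphic_compact_finite_zeros[OF zeta_holomorphic])
 show "connected (- {1 :: complex})" by (rule connected_punctured_universe) simp
 show "\<not> zeta constant_on - {1}"
 proof
  assume "zeta constant_on - {1}"
  then obtain y where y: "\<And>z. z \<in> - {1} ==> zeta z = y" unfolding constant_on_def by blast
  \<comment> \<open>The values at 2 and 11 differ: at least 5/4 against at most 11/10.\<close>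
  have "zeta (of_real 2) = zeta (of_real 11)" using y[of "of_real 2"] y[of "of_real 11"] by simp
  hence "zr 2 = zr 11" by (simp add: zr_eq)
  moreover have "zr 11 <= 1 + 1 / 10" using zr_bounds(1)[of 11] by simp
  moreover have "1 + 1 / 4 <= zr 2" using zr_lower[of 2] by (simp add: powr_minus)
  ultimately show False by linarith
 qed
qed (use assms in auto)

lemma zeta_zorder_pos:
 assumes "zeta \<rho> = 0" "\<rho> ~= 1"
 shows "zorder zeta \<rho> > 0"
proof -
 have "connected (- {1 :: complex})" by (rule connected_punctured_universe) simp
 moreover have "\<exists>w\<in>- {1}. zeta w ~= 0" using zeta_nonzero[of 2] by (intro bexI[of _ 2]) auto
 ultimately show ?thesis using zorder_exist_zero[OF zeta_holomorphic, of \<rho>] assms by auto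
qed

lemma between_avoiding:
 fixes a b :: real
 assumes "finite F" "a < b"
 obtains R where "a < R" "R < b" "R \<notin> F"
proof -
 have "infinite ({a<..<b} - F)" using assms by (simp add: infinite_Ioo)
 then obtain R where "R \<in> {a<..<b} - F" using infinite_imp_nonempty by blast
 thus ?thesis by (intro that[of R]) auto
qed

lemma affine_circle:
 fixes f :: "real => real"
 assumes "(f has_integral I) {a..b}"
 shows "((%x. f (2 * pi * x + c)) has_integral I / (2 * pi)) {(a - c) / (2 * pi)..(b - c) / (2 * pi)}"
proof -
 have e: "inverse (2 * pi) * y = y / (2 * pi)" for y :: real by (simp add: field_simps)
 have "((%x. f ((2 * pi) *\<^sub>R x + c)) has_integral (I /\<^sub>R (2 * pi) ^ DIM(real))) (cbox ((a - c) /\<^sub>R (2 * pi)) ((b - c) /\<^sub>R (2 * pi)))"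
  by (rule has_integral_affinity') (use assms in auto)
 thus ?thesis unfolding DIM_real power_one_right real_scaleR_def e box_real .
qed

text \<open>The majorants depend on a point of the circle only through its abscissa, so the circle
  splits into four quarter arcs, two for each half.\<close>

lemma circle_mean_halves:
 fixes F :: "real => real"
 assumes 1: "((%x. F (sin x)) has_integral I1) {0..pi / 2}" and 2: "((%x. F (- sin x)) has_integral I2) {0..pi / 2}"
 shows "((%x. F (cos (2 * pi * x))) has_integral (I1 + I2) / pi) {0..1}"
proof -
 have r1: "((%x. F (sin (- x))) has_integral I1) {- (pi / 2)..- 0}"
  using has_integral_reflect_real[where f = "%x. F (sin x)" and i = I1 and a = 0 and b = "pi / 2"] 1 by (simp only:)
 have r2: "((%x. F (- sin (- x))) has_integral I2) {- (pi / 2)..- 0}"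
  using has_integral_reflect_real[where f = "%x. F (- sin x)" and i = I2 and a = 0 and b = "pi / 2"] 2 by (simp only:)
 have s32: "sin (2 * pi * x + - (3 / 2 * pi)) = cos (2 * pi * x)" "sin (2 * pi * x + - (pi / 2)) = - cos (2 * pi * x)" for x
  unfolding sin_add by (simp_all only: cos_minus sin_minus sin_3over2_pi cos_3over2_pi sin_pi_half cos_pi_half mult_zero_right mult_1_right mult_minus_right minus_minus minus_zero add_0 add_0_right)
 have q1: "((%x. F (cos (2 * pi * x))) has_integral I1 / (2 * pi)) {0..1/4}"
  using affine_circle[OF r1, of "- (pi / 2)"] unfolding sin_minus s32 by simp
 have q2: "((%x. F (cos (2 * pi * x))) has_integral I2 / (2 * pi)) {1/4..1/2}"
  using affine_circle[OF 2, of "- (pi / 2)"] unfolding s32 by simp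
 have q3: "((%x. F (cos (2 * pi * x))) has_integral I2 / (2 * pi)) {1/2..3/4}"
  using affine_circle[OF r2, of "- (3 / 2 * pi)"] unfolding sin_minus s32 by (simp add: field_simps)
 have q4: "((%x. F (cos (2 * pi * x))) has_integral I1 / (2 * pi)) {3/4..1}"
  using affine_circle[OF 1, of "- (3 / 2 * pi)"] unfolding s32 by (simp add: field_simps)
 have "((%x. F (cos (2 * pi * x))) has_integral I1 / (2 * pi) + (I2 / (2 * pi) + (I2 / (2 * pi) + I1 / (2 * pi)))) {0..1}"
  by (rule has_integral_combine[OF _ _ q1 has_integral_combine[OF _ _ q2 has_integral_combine[OF _ _ q3 q4]]]) auto
 moreover have "I1 / (2 * pi) + (I2 / (2 * pi) + (I2 / (2 * pi) + I1 / (2 * pi))) = (I1 + I2) / pi" by (simp add: field_simps)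
 ultimately show ?thesis by simp
qed

lemma zeta_constant_mono: "zeta_constant A \<tau> ==> 0 < \<tau>' ==> \<tau>' <= \<tau> ==> zeta_constant A \<tau>'"
proof -
 assume a: "zeta_constant A \<tau>" "0 < \<tau>'" "\<tau>' <= \<tau>"
 hence "ln \<tau>' <= ln \<tau>" by simp
 thus "zeta_constant A \<tau>'" using a(1) unfolding zeta_constant_def by linarith
qed

lemma ln_product: "a > 0 ==> b > 0 ==> ln (a * exp v * b) = ln a + v + ln (b :: real)"
 by (simp add: ln_mult)

lemma zeta_constant_pos: "zeta_constant A \<tau> ==> A >= 349 / 100"
 unfolding zeta_constant_def by auto

lemma circle_point: "Complex \<sigma> t + of_real R * cis (2 * pi * x) = Complex (\<sigma> + R * cos (2 * pi * x)) (t + R * sin (2 * pi * x))"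
 by (simp add: complex_eq_iff)

lemma height_on_circle:
 fixes t R B x :: real
 assumes "0 < R" "R <= B"
 shows "t - B <= t + R * sin x" "t + R * sin x <= t + B"
proof -
 have "\<bar>R * sin x\<bar> <= R * 1" unfolding abs_mult using assms by (intro mult_mono) auto
 thus "t - B <= t + R * sin x" "t + R * sin x <= t + B" using assms unfolding abs_le_iff by linarith+
qed

lemma ln_norm_zeta_right:
 assumes "Re s > 1"
 shows "ln (norm (zeta s)) <= ln (zr (Re s))" "- ln (norm (zeta s)) <= ln (zr (Re s))"
  "- ln (norm (zeta s)) <= ln ((1 - 4 powr (- Re s)) * zr (Re s))"
proof -
 have p: "norm (zeta s) > 0" using zeta_nonzero[OF assms] by simp
 have z: "zr (Re s) >= 1" using zr_bounds(3)[OF assms] .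
 show "ln (norm (zeta s)) <= ln (zr (Re s))" using p norm_zeta_le[OF assms] z by simp
 have f: "0 < 1 - 4 powr (- Re s)" using assms powr_less_mono[of "- Re s" 0 4] by simp
 have "1 / norm (zeta s) <= (1 - 4 powr (- Re s)) * zr (Re s)" using zeta_lower_bound[OF assms] p by (simp add: field_simps)
 hence "ln (1 / norm (zeta s)) <= ln ((1 - 4 powr (- Re s)) * zr (Re s))" using p by (intro ln_mono) auto
 thus 3: "- ln (norm (zeta s)) <= ln ((1 - 4 powr (- Re s)) * zr (Re s))" using p by (simp add: ln_div)
 have "(1 - 4 powr (- Re s)) * zr (Re s) <= 1 * zr (Re s)" using z by (intro mult_right_mono) auto
 moreover have "0 < (1 - 4 powr (- Re s)) * zr (Re s)" using f z by simp
 ultimately have "ln ((1 - 4 powr (- Re s)) * zr (Re s)) <= ln (zr (Re s))" by simp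
 thus "- ln (norm (zeta s)) <= ln (zr (Re s))" using 3 by linarith
qed

section \<open>Counting zeros by Jensen's formula\<close>

locale zero_disc =
 fixes t \<alpha> :: real
 assumes t: "t > 13" and \<alpha>: "0 < \<alpha>" "\<alpha> < 1"
begin

definition Z :: "complex set" where "Z = {\<rho>. \<rho> ~= 1 \<and> zeta \<rho> = 0 \<and> dist \<rho> (Complex 1 t) <= \<alpha>}"
definition n :: int where "n = (\<Sum>\<rho>\<in>Z. zorder zeta \<rho>)"

lemma far_from_1: "Im z > 1 ==> z ~= 1" by auto

lemma Im_in_ball: "dist z (Complex \<sigma> u) < R ==> Im z > u - R"
 using abs_Im_le_cmod[of "z - Complex \<sigma> u"] by (auto simp: dist_norm abs_le_iff)

lemma Z: assumes "\<rho> \<in> Z" shows "zeta \<rho> = 0" "zorder zeta \<rho> > 0" "dist \<rho> (Complex 1 t) <= \<alpha>" "Re \<rho> <= 1"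
proof -
 show z: "zeta \<rho> = 0" "dist \<rho> (Complex 1 t) <= \<alpha>" using assms by (auto simp: Z_def)
 show "zorder zeta \<rho> > 0" by (rule zeta_zorder_pos) (use assms in \<open>auto simp: Z_def\<close>)
 show "Re \<rho> <= 1" using zeta_nonzero[of \<rho>] z by force
qed

lemma n_nonneg: "n >= 0" unfolding n_def by (rule sum_nonneg) (use Z(2) in \<open>auto intro: less_imp_le\<close>)

text \<open>Zeros on the boundary count fully in \<open>n\<close> but by half in
  \<open>zeta_zero_count\<close>.\<close>

lemma count_le: "zeta_zero_count (Complex 1 t) \<alpha> <= of_int n"
proof -
 have "(\<Sum>\<rho>\<in>Z. (if dist \<rho> (Complex 1 t) = \<alpha> then 1 / 2 else 1) * of_int (zorder zeta \<rho>)) <= (\<Sum>\<rho>\<in>Z. real_of_int (zorder zeta \<rho>))"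
  by (rule sum_mono) (use Z(2) in \<open>auto intro!: mult_left_le_one_le dest: less_imp_le\<close>)
 thus ?thesis unfolding zeta_zero_count_def n_def Z_def[symmetric] by simp
qed

lemma count_sum_le:
 fixes c :: real and g :: "complex => real"
 assumes W: "finite W" "Z \<subseteq> W" and z: "\<And>\<rho>. \<rho> \<in> W ==> zorder zeta \<rho> > 0"
  and g: "\<And>\<rho>. \<rho> \<in> Z ==> c <= g \<rho>" "\<And>\<rho>. \<rho> \<in> W ==> 0 <= g \<rho>"
 shows "of_int n * c <= (\<Sum>\<rho>\<in>W. of_int (zorder zeta \<rho>) * g \<rho>)"
proof -
 have "of_int n * c = (\<Sum>\<rho>\<in>Z. of_int (zorder zeta \<rho>) * c)" unfolding n_def by (simp add: sum_distrib_right)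
 also have "... <= (\<Sum>\<rho>\<in>Z. of_int (zorder zeta \<rho>) * g \<rho>)" using g(1) Z(2) by (intro sum_mono mult_left_mono) (auto dest: less_imp_le)
 also have "... <= (\<Sum>\<rho>\<in>W. of_int (zorder zeta \<rho>) * g \<rho>)"
 proof (rule sum_mono2[OF W])
  fix \<rho> assume "\<rho> \<in> W - Z"
  hence "0 <= real_of_int (zorder zeta \<rho>)" "0 <= g \<rho>" using z[of \<rho>] g(2)[of \<rho>] by auto
  thus "0 <= of_int (zorder zeta \<rho>) * g \<rho>" by simp
 qed
 finally show ?thesis .
qed

text \<open>Stated for any height \<open>u\<close> and radius up to 3, since it serves at
  \<open>t\<close> with radius near \<open>r\<close> and at both \<open>t\<close> and
  \<open>2 * t\<close> with radius near 3. The condition on \<open>u\<close> keeps the pole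
  away.\<close>

lemma zeta_jensen:
 assumes u: "u > 13" and \<delta>: "\<delta> > 0" and R: "0 < R" "R <= 3"
  and nz: "\<forall>z \<in> sphere (Complex (1 + \<delta>) u) R. zeta z ~= 0"
 defines "c \<equiv> Complex (1 + \<delta>) u" and "W \<equiv> {z \<in> ball (Complex (1 + \<delta>) u) R. zeta z = 0}"
 shows "finite W" "\<And>\<rho>. \<rho> \<in> W ==> zorder zeta \<rho> > 0 \<and> Re \<rho> <= 1 \<and> 0 < dist \<rho> c \<and> dist \<rho> c < R"
  "((%x. ln (norm (zeta (c + of_real R * cis (2 * pi * x)))))
    has_integral (ln (norm (zeta c)) + (\<Sum>\<rho>\<in>W. of_int (zorder zeta \<rho>) * ln (R / dist \<rho> c)))) {0..1}"
  "((%x. cos (2 * pi * x) * ln (norm (zeta (c + of_real R * cis (2 * pi * x)))))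
    has_integral R / 2 * (Re (deriv zeta c / zeta c)
     + (\<Sum>\<rho>\<in>W. of_int (zorder zeta \<rho>) * Re (1 / (\<rho> - c) - cnj (\<rho> - c) / of_real (R\<^sup>2))))) {0..1}"
proof -
 have im: "z ~= 1" if "dist c z < 4" for z
  using Im_in_ball[of z "1 + \<delta>" u 4] that u by (intro far_from_1) (auto simp: c_def dist_commute)
 have zc: "zeta c ~= 0" unfolding c_def by (rule zeta_nonzero) (use \<delta> in simp)
 have hol: "zeta holomorphic_on ball c 4" by (rule holomorphic_on_subset[OF zeta_holomorphic]) (use im in auto)
 have "1 \<notin> cball c R" using im[of 1] R by auto
 hence "finite {z \<in> cball c R. zeta z = 0}" by (intro zeta_zeros_finite) auto
 thus fin: "finite W" by (rule finite_subset[rotated]) (auto simp: W_def c_def)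
 show "zorder zeta \<rho> > 0 \<and> Re \<rho> <= 1 \<and> 0 < dist \<rho> c \<and> dist \<rho> c < R" if r: "\<rho> \<in> W" for \<rho>
 proof -
  have z: "zeta \<rho> = 0" "dist c \<rho> < R" using r by (auto simp: W_def c_def)
  hence "\<rho> ~= 1" using im R by auto
  moreover have "Re \<rho> <= 1" using zeta_nonzero[of \<rho>] z by force
  ultimately show ?thesis using zeta_zorder_pos[of \<rho>] z zc by (auto simp: dist_commute)
 qed
 show "((%x. ln (norm (zeta (c + of_real R * cis (2 * pi * x)))))
    has_integral (ln (norm (zeta c)) + (\<Sum>\<rho>\<in>W. of_int (zorder zeta \<rho>) * ln (R / dist \<rho> c)))) {0..1}"
  "((%x. cos (2 * pi * x) * ln (norm (zeta (c + of_real R * cis (2 * pi * x)))))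
    has_integral R / 2 * (Re (deriv zeta c / zeta c)
     + (\<Sum>\<rho>\<in>W. of_int (zorder zeta \<rho>) * Re (1 / (\<rho> - c) - cnj (\<rho> - c) / of_real (R\<^sup>2))))) {0..1}"
  using jensen_formula[OF fin hol R(1) _ zc] R nz by (auto simp: W_def c_def)
qed

text \<open>Only finitely many zeros lie in the disc of radius 3, so some radius avoids all their
  distances from the centre, as \<open>zeta_jensen\<close> requires.\<close>

lemma generic_radius:
 assumes "u > 13" "a < b" "b <= 3"
 shows "\<exists>R. a < R \<and> R < b \<and> (\<forall>z \<in> sphere (Complex \<sigma> u) R. zeta z ~= 0)"
proof -
 have "1 \<notin> cball (Complex \<sigma> u) 3" using Im_in_ball[of 1 \<sigma> u 4] assms by (auto simp: dist_commute)
 hence "finite {z \<in> cball (Complex \<sigma> u) 3. zeta z = 0}" by (intro zeta_zeros_finite) auto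
 hence "finite ((%z. dist (Complex \<sigma> u) z) ` {z \<in> cball (Complex \<sigma> u) 3. zeta z = 0})" by (rule finite_imageI)
 then obtain R where R: "a < R" "R < b" "R \<notin> (%z. dist (Complex \<sigma> u) z) ` {z \<in> cball (Complex \<sigma> u) 3. zeta z = 0}"
  using between_avoiding assms(2) by blast
 show ?thesis by (intro exI[of _ R]) (use R assms in auto)
qed

text \<open>Jensen's formula with a majorant depending on the abscissa alone. The hypothesis
  \<open>r - \<delta> <= R\<close> keeps the right half circle to the right of the points
  \<open>1 + r * y\<close>, where \<open>zr\<close> decreases.\<close>

lemma count_bound_radius:
 assumes r: "0 < r" "r < 1" and \<delta>: "\<delta> > 0" and R: "\<alpha> + \<delta> < R" "r - \<delta> <= R" "R < r"
  and nz: "\<forall>z \<in> sphere (Complex (1 + \<delta>) t) R. zeta z ~= 0" and A: "zeta_constant A (t + 1)"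
 shows "of_int n * ln (R / (\<alpha> + \<delta>)) <= c1 r / pi * ln (t + 1) + c4 r
   + (ln (1001 / 1000 * A) + ln (ln (t + 1))) / 2 - ln (norm (zeta (Complex (1 + \<delta>) t)))"
proof -
 interpret angles r by unfold_locales (use r in auto)
 define c where "c = Complex (1 + \<delta>) t"
 define W where "W = {z \<in> ball c R. zeta z = 0}"
 have R0: "0 < R" "R <= 3" using R r \<alpha> \<delta> by auto
 note jen = zeta_jensen[OF t \<delta> R0 nz, folded c_def, folded W_def]
 have A0: "1001 / 1000 * A > 0" using zeta_constant_pos[OF A] by simp
 define l where "l = ln (t + 1)"
 have "exp (1 :: real) <= 3" using e_bounds by simp
 hence l1: "l >= 1" using t unfolding l_def by (subst ln_ge_iff) auto
 \<comment> \<open>Here \<open>y\<close> is the cosine of the angle. The branch \<open>y > 0\<close>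
   has mean \<open>c4\<close>; the other has \<open>c1\<close> in its mean, and \<open>l\<close> is
   the logarithm of the greatest height \<open>t + 1\<close>.\<close>
 define F where "F y = (if y > 0 then ln (zr (1 + r * y)) else ln (1001 / 1000 * A) + ln l + vexp (1 + r * y) * l)" for y
 have I1: "((%x. F (sin x)) has_integral pi * c4 r) {0..pi / 2}"
 proof (rule has_integral_spike_finite[OF _ _ c4_integral(1)[OF r]])
  show "F (sin x) = (if x = 0 then 0 else ln (zr (1 + r * sin x)))" if "x \<in> {0..pi / 2} - {0}" for x
   using that sin_gt_zero[of x] pi_gt_zero by (auto simp: F_def)
 qed simp
 have I2: "((%x. F (- sin x)) has_integral (ln (1001 / 1000 * A) + ln l) * (pi / 2) + c1 r * l) {0..pi / 2}"
 proof -
  have "((%x. (ln (1001 / 1000 * A) + ln l) + vexp (1 - r * sin x) * l) has_integral (ln (1001 / 1000 * A) + ln l) * (pi / 2) + c1 r * l) {0..pi / 2}"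
   using has_integral_add[OF has_integral_const_real[of "ln (1001 / 1000 * A) + ln l" 0 "pi / 2"] has_integral_mult_left[OF c1_integral, of l]]
   by (simp add: mult.commute)
  moreover have "(ln (1001 / 1000 * A) + ln l) + vexp (1 - r * sin x) * l = F (- sin x)" if "x \<in> {0..pi / 2}" for x
   using that sin_ge_zero[of x] pi_gt_zero by (auto simp: F_def)
  ultimately show ?thesis by (rule has_integral_eq[rotated])
 qed
 have "ln (norm (zeta c)) + (\<Sum>\<rho>\<in>W. of_int (zorder zeta \<rho>) * ln (R / dist \<rho> c)) <= (pi * c4 r + ((ln (1001 / 1000 * A) + ln l) * (pi / 2) + c1 r * l)) / pi"
 proof (rule has_integral_le[OF jen(3) circle_mean_halves[OF I1 I2]])
  fix x :: real
  define y where "y = cos (2 * pi * x)"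
  define z where "z = c + of_real R * cis (2 * pi * x)"
  have "z \<in> sphere c R" using R0 by (simp add: z_def dist_norm norm_mult)
  hence zp: "norm (zeta z) > 0" using nz by (simp add: c_def)
  have y1: "-1 <= y" "y <= 1" by (auto simp: y_def)
  have zz: "z = Complex (1 + \<delta> + R * y) (t + R * sin (2 * pi * x))" unfolding z_def c_def circle_point y_def ..
  have "ln (norm (zeta z)) <= F y"
  proof (cases "y > 0")
   case True
   have "(r - R) * y <= (r - R) * 1" using y1 R by (intro mult_left_mono) auto
   hence re: "1 + r * y <= Re z" unfolding zz using R by (simp add: algebra_simps)
   have s: "1 < 1 + r * y" using True r by simp
   have "ln (norm (zeta z)) <= ln (zr (Re z))" using re s by (intro ln_norm_zeta_right) auto
   also have "... <= ln (zr (1 + r * y))" using zr_decreasing[OF s re] zr_bounds(3)[of "Re z"] re s by simp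
   finally show ?thesis using True by (simp add: F_def)
  next
   case False
   define \<tau> where "\<tau> = t + R * sin (2 * pi * x)"
   have \<tau>: "t - 1 <= \<tau>" "\<tau> <= t + 1" unfolding \<tau>_def using height_on_circle[of R 1] R r R0 by auto
   hence \<tau>': "\<tau> >= 10" "ln \<tau> <= l" using t by (auto simp: l_def)
   have l\<tau>: "ln \<tau> > 0" using \<tau>' by simp
   have ll: "ln (ln \<tau>) <= ln l" using l\<tau> \<tau>'(2) by simp
   have "r * (- y) <= r * 1" using y1 r by (intro mult_left_mono) auto
   hence p: "0 < 1 + r * y" using r by simp
   have "(r - R) * y <= 0" using False R by (intro mult_nonneg_nonpos) auto
   hence re: "1 + r * y <= 1 + \<delta> + R * y" using \<delta> by (simp add: algebra_simps)
   have "norm (zeta z) <= 1001 / 1000 * A * exp (vexp (1 + \<delta> + R * y) * ln \<tau>) * ln \<tau>"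
    unfolding zz \<tau>_def[symmetric] using p re \<tau> \<tau>' A by (intro norm_zeta_vexp) (auto intro: zeta_constant_mono)
   hence "ln (norm (zeta z)) <= ln (1001 / 1000 * A * exp (vexp (1 + \<delta> + R * y) * ln \<tau>) * ln \<tau>)" using zp by (intro ln_mono) auto
   also have "... = ln (1001 / 1000 * A) + vexp (1 + \<delta> + R * y) * ln \<tau> + ln (ln \<tau>)" by (rule ln_product[OF A0 l\<tau>])
   also have "... <= ln (1001 / 1000 * A) + vexp (1 + r * y) * l + ln l"
    using vexp_antimono[OF p re] vexp_nonneg[of "1 + \<delta> + R * y"] p re \<tau>'(2) l\<tau> by (intro add_mono mult_mono ll) auto
   finally show ?thesis using False by (simp add: F_def)
  qed
  thus "ln (norm (zeta (c + of_real R * cis (2 * pi * x)))) <= F (cos (2 * pi * x))" by (simp add: y_def z_def)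
 qed
 moreover have "of_int n * ln (R / (\<alpha> + \<delta>)) <= (\<Sum>\<rho>\<in>W. of_int (zorder zeta \<rho>) * ln (R / dist \<rho> c))"
 proof (rule count_sum_le[OF jen(1)])
  have dc: "dist \<rho> c <= \<alpha> + \<delta>" if "\<rho> \<in> Z" for \<rho>
  proof -
   have "dist (Complex 1 t) c = \<delta>" using \<delta> by (simp add: c_def dist_norm cmod_def)
   thus ?thesis using dist_triangle[of \<rho> c "Complex 1 t"] Z(3)[OF that] by linarith
  qed
  thus ZW: "Z \<subseteq> W" using Z(1) R by (force simp: W_def dist_commute)
  show "ln (R / (\<alpha> + \<delta>)) <= ln (R / dist \<rho> c)" if "\<rho> \<in> Z" for \<rho>
  proof -
   have "\<rho> \<in> W" using ZW that by blast
   from jen(2)[OF this] have d0: "0 < dist \<rho> c" by simp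
   have "R / (\<alpha> + \<delta>) <= R / dist \<rho> c" using dc[OF that] d0 R0 \<alpha> \<delta> by (intro divide_left_mono mult_pos_pos) auto
   thus ?thesis using R0 \<alpha> \<delta> by (intro ln_mono) auto
  qed
  show "0 <= ln (R / dist \<rho> c)" if "\<rho> \<in> W" for \<rho> using jen(2)[OF that] by (intro ln_ge_zero) (simp add: le_divide_eq)
 qed (use jen(2) in auto)
 ultimately have "ln (norm (zeta c)) + of_int n * ln (R / (\<alpha> + \<delta>)) <= (pi * c4 r + ((ln (1001 / 1000 * A) + ln l) * (pi / 2) + c1 r * l)) / pi" by linarith
 also have "... = c1 r / pi * l + c4 r + (ln (1001 / 1000 * A) + ln l) / 2" by (simp add: field_simps)
 finally show ?thesis by (simp add: l_def c_def)
qed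

text \<open>Limit of \<open>R\<close> to \<open>r\<close> through radii that avoid zeros: taking
  \<open>R\<close> above \<open>r * exp (- (e / (n + 1)))\<close> keeps the loss below
  \<open>e\<close>.\<close>

lemma count_bound:
 assumes r: "0 < r" "r < 1" and \<delta>: "\<delta> > 0" "\<alpha> + \<delta> < r" and A: "zeta_constant A (t + 1)"
 shows "of_int n * ln (r / (\<alpha> + \<delta>)) <= c1 r / pi * ln (t + 1) + c4 r
   + (ln (1001 / 1000 * A) + ln (ln (t + 1))) / 2 - ln (norm (zeta (Complex (1 + \<delta>) t)))" (is "?L <= ?Q")
proof (rule field_le_epsilon)
 fix e :: real assume e: "e > 0"
 define a where "a = max (\<alpha> + \<delta>) (max (r - \<delta>) (r * exp (- (e / (of_int n + 1)))))"
 have n1: "of_int n + 1 > (0 :: real)" using n_nonneg by simp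
 have "exp (- (e / (of_int n + 1))) < 1" using e n1 by simp
 hence "r * exp (- (e / (of_int n + 1))) < r * 1" using r by (intro mult_strict_left_mono)
 hence "a < r" unfolding a_def using \<delta> by simp
 moreover have "r <= 3" using r by simp
 ultimately obtain R where R: "a < R" "R < r" "\<forall>z \<in> sphere (Complex (1 + \<delta>) t) R. zeta z ~= 0"
  using generic_radius[OF t, of a r "1 + \<delta>"] by blast
 have Ra: "\<alpha> + \<delta> < R" "r - \<delta> < R" "r * exp (- (e / (of_int n + 1))) < R" using R(1) unfolding a_def by (simp_all only: max_less_iff_conj)
 have R0: "R > 0" using Ra \<alpha> \<delta> by linarith
 have "ln (r * exp (- (e / (of_int n + 1)))) <= ln R" using Ra r by (intro ln_mono) auto
 hence "ln r - e / (of_int n + 1) <= ln R" using r by (simp add: ln_mult)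
 hence "of_int n * (ln r - ln R) <= of_int n * (e / (of_int n + 1))" using n_nonneg by (intro mult_left_mono) auto
 also have "... <= e" using n1 e n_nonneg by (simp add: field_simps)
 finally have "of_int n * (ln r - ln R) <= e" .
 moreover have "of_int n * ln (R / (\<alpha> + \<delta>)) <= ?Q"
  by (rule count_bound_radius[OF r \<delta>(1) Ra(1) less_imp_le[OF Ra(2)] R(2,3) A])
 moreover have "ln (R / (\<alpha> + \<delta>)) = ln R - ln (\<alpha> + \<delta>)" "ln (r / (\<alpha> + \<delta>)) = ln r - ln (\<alpha> + \<delta>)"
  using R0 r \<alpha> \<delta> by (simp_all add: ln_div)
 ultimately show "?L <= ?Q + e" by (simp add: right_diff_distrib)
qed

end

section \<open>Zeros near 1 + it and the logarithmic derivative\<close>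

lemma sin_power_integrals:
 "((%x. sin x) has_integral 1) {0..pi / 2}"
 "((%x. (sin x)\<^sup>2) has_integral pi / 4) {0..pi / 2}"
 "((%x. (sin x) ^ 3) has_integral 2 / 3) {0..pi / 2}"
 "((%x. (sin x) ^ 4) has_integral 3 * pi / 16) {0..pi / 2}"
proof -
 have ftc: "(f has_integral F (pi / 2) - F 0) {0..pi / 2}" if "\<And>x. (F has_real_derivative f x) (at x)" for f F :: "real => real"
  using that by (intro fundamental_theorem_of_calculus)
   (auto simp flip: has_real_derivative_iff_has_vector_derivative intro: has_field_derivative_at_within)
 have c2: "cos x * cos x = 1 - sin x * sin x" for x :: real
  using sin_cos_squared_add[of x] by (simp add: power2_eq_square)
 have "((%x. - cos x) has_real_derivative sin x) (at x)" for x :: real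
  by (auto intro!: derivative_eq_intros)
 from ftc[OF this] show "((%x. sin x) has_integral 1) {0..pi / 2}" by simp
 have "((%x. (x - sin x * cos x) / 2) has_real_derivative (sin x)\<^sup>2) (at x)" for x :: real
 proof -
  have "((%x. (x - sin x * cos x) / 2) has_real_derivative (1 - (cos x * cos x + sin x * (- sin x))) / 2) (at x)"
   by (auto intro!: derivative_eq_intros)
  moreover have "(1 - (cos x * cos x + sin x * (- sin x))) / 2 = (sin x)\<^sup>2" unfolding c2 by (simp add: power2_eq_square)
  ultimately show ?thesis by (simp only:)
 qed
 from ftc[OF this] show "((%x. (sin x)\<^sup>2) has_integral pi / 4) {0..pi / 2}" by simp
 have "((%x. - cos x + cos x ^ 3 / 3) has_real_derivative (sin x) ^ 3) (at x)" for x :: real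
 proof -
  have "((%x. - cos x + cos x ^ 3 / 3) has_real_derivative sin x + (3 * cos x ^ 2 * (- sin x)) / 3) (at x)"
   by (auto intro!: derivative_eq_intros)
  moreover have "sin x + (3 * cos x ^ 2 * (- sin x)) / 3 = (sin x) ^ 3" unfolding power2_eq_square c2 power3_eq_cube by (simp add: field_simps)
  ultimately show ?thesis by (simp only:)
 qed
 from ftc[OF this] show "((%x. (sin x) ^ 3) has_integral 2 / 3) {0..pi / 2}" by simp
 have "((%x. 3 / 8 * (x - sin x * cos x) - (sin x ^ 3 * cos x) / 4) has_real_derivative (sin x) ^ 4) (at x)" for x :: real
 proof -
  have "((%x. 3 / 8 * (x - sin x * cos x) - (sin x ^ 3 * cos x) / 4) has_real_derivative
    3 / 8 * (1 - (cos x * cos x + sin x * (- sin x))) - (3 * sin x ^ 2 * cos x * cos x + sin x ^ 3 * (- sin x)) / 4) (at x)"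
   by (auto intro!: derivative_eq_intros simp: field_simps)
  moreover have "3 / 8 * (1 - (cos x * cos x + sin x * (- sin x))) - (3 * sin x ^ 2 * cos x * cos x + sin x ^ 3 * (- sin x)) / 4 = (sin x) ^ 4"
  proof -
   have e: "3 * sin x ^ 2 * cos x * cos x = 3 * sin x ^ 2 * (1 - sin x * sin x)" unfolding c2[symmetric] by simp
   show ?thesis unfolding c2 e by (simp add: power2_eq_square power3_eq_cube power4_eq_xxxx field_simps)
  qed
  ultimately show ?thesis by (simp only:)
 qed
 from ftc[OF this] show "((%x. (sin x) ^ 4) has_integral 3 * pi / 16) {0..pi / 2}" by simp
qed

text \<open>Estimate for the boundary part of the differentiated Jensen formula on a circle of
  radius just below 3: 0.213 exceeds \<open>2 / (pi * R)\<close>, 1.8836 exceeds the integral of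
  \<open>sin x\<close> times the cubic of \<open>norm_zeta_left\<close>, and 0.112 exceeds
  \<open>1 / R^2\<close>.\<close>

definition log_deriv_error :: "real => real => real" where
 "log_deriv_error A u = 213 / 1000 * (ln (1001 / 1000 * A) + ln (ln (u + 3)) + 18836 / 10000 * ln (u + 3)) + 112 / 1000"

context zero_disc
begin

text \<open>Where the cosine \<open>y\<close> is positive, \<open>- ln (norm zeta)\<close> is at
  most \<open>1 / (R * y)\<close>, and the weight \<open>y\<close> turns this into the constant
  \<open>1 / R\<close>; where it is negative, an upper bound for zeta is called for, which
  \<open>norm_zeta_left\<close> supplies.\<close>

lemma cos_mean_bound:
 assumes u: "u > 13" and \<delta>: "\<delta> > 0" and R: "299 / 100 < R" "R < 3" and A: "zeta_constant A (u + 3)"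
  and nz: "\<forall>z \<in> sphere (Complex (1 + \<delta>) u) R. zeta z ~= 0"
  and I: "((%x. cos (2 * pi * x) * ln (norm (zeta (Complex (1 + \<delta>) u + of_real R * cis (2 * pi * x))))) has_integral I) {0..1}"
 shows "- (2 / R * I) <= log_deriv_error A u"
proof -
 define c where "c = Complex (1 + \<delta>) u"
 define l where "l = ln (u + 3)"
 have A0: "1001 / 1000 * A > 1" using zeta_constant_pos[OF A] by simp
 have "exp (1 :: real) <= 3" using e_bounds by simp
 hence l1: "l >= 1" using u unfolding l_def by (subst ln_ge_iff) auto
 define B where "B = ln (1001 / 1000 * A) + ln l"
 have B0: "B >= 0" unfolding B_def using A0 l1 by (intro add_nonneg_nonneg ln_ge_zero) auto
 define P where "P s = 3 / 2 * s + 3 / 2 * s\<^sup>2 - 1 / 2 * s ^ 3" for s :: real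
 define F where "F y = (if y > 0 then 1 / R else (- y) * (B + P (- y) * l))" for y
 have I1: "((%x. F (sin x)) has_integral 1 / R * (pi / 2)) {0..pi / 2}"
 proof (rule has_integral_spike_finite[where S = "{0}" and f = "%x. 1 / R"])
  show "F (sin x) = 1 / R" if "x \<in> {0..pi / 2} - {0}" for x
   using that sin_gt_zero[of x] pi_gt_zero by (auto simp: F_def)
  show "((%x. 1 / R) has_integral 1 / R * (pi / 2)) {0..pi / 2}"
   using has_integral_const_real[of "1 / R" 0 "pi / 2"] by (simp add: mult.commute)
 qed simp
 define ka where "ka = 3 / 2 * (pi / 4) + 3 / 2 * (2 / 3) - 1 / 2 * (3 * pi / 16)"
 have ka0: "0 <= ka" using pi_gt_zero unfolding ka_def by linarith
 have I2: "((%x. F (- sin x)) has_integral B * 1 + l * ka) {0..pi / 2}"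
 proof -
  have "((%x. B * sin x + l * (3 / 2 * (sin x)\<^sup>2 + 3 / 2 * (sin x) ^ 3 - 1 / 2 * (sin x) ^ 4)) has_integral B * 1 + l * ka) {0..pi / 2}"
   unfolding ka_def by (intro has_integral_add has_integral_diff has_integral_mult_right sin_power_integrals)
  moreover have "B * sin x + l * (3 / 2 * (sin x)\<^sup>2 + 3 / 2 * (sin x) ^ 3 - 1 / 2 * (sin x) ^ 4) = F (- sin x)" if "x \<in> {0..pi / 2}" for x
  proof -
   have "sin x >= 0" using that pi_gt_zero by (intro sin_ge_zero) auto
   hence "F (- sin x) = sin x * (B + P (sin x) * l)" by (simp add: F_def)
   also have "... = B * sin x + l * (3 / 2 * (sin x)\<^sup>2 + 3 / 2 * (sin x) ^ 3 - 1 / 2 * (sin x) ^ 4)"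
    unfolding P_def by (simp add: power2_eq_square power3_eq_cube power4_eq_xxxx algebra_simps)
   finally show ?thesis by simp
  qed
  ultimately show ?thesis by (rule has_integral_eq[rotated])
 qed
 have "- I <= (1 / R * (pi / 2) + (B * 1 + l * ka)) / pi"
 proof (rule has_integral_le[OF has_integral_neg[OF I] circle_mean_halves[OF I1 I2]])
  fix x :: real
  define y where "y = cos (2 * pi * x)"
  define z where "z = c + of_real R * cis (2 * pi * x)"
  have R0: "R > 0" using R by simp
  have "z \<in> sphere c R" using R0 by (simp add: z_def dist_norm norm_mult)
  hence zp: "norm (zeta z) > 0" using nz by (simp add: c_def)
  have y1: "-1 <= y" "y <= 1" by (auto simp: y_def)
  have zz: "z = Complex (1 + \<delta> + R * y) (u + R * sin (2 * pi * x))" unfolding z_def c_def circle_point y_def ..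
  have "- (y * ln (norm (zeta z))) <= F y"
  proof (cases "y > 0")
   case True
   have s: "Re z > 1" "Re z - 1 >= R * y" unfolding zz using True R0 \<delta> by (auto intro!: add_pos_pos)
   have Ry: "R * y > 0" using True R0 by simp
   have "- ln (norm (zeta z)) <= ln (zr (Re z))" by (rule ln_norm_zeta_right(2)[OF s(1)])
   also have "... <= zr (Re z) - 1" using zr_bounds(3)[OF s(1)] by (intro ln_le_minus_one) auto
   also have "... <= 1 / (Re z - 1)" using zr_bounds(1)[OF s(1)] by simp
   also have "... <= 1 / (R * y)" using s Ry by (intro divide_left_mono) auto
   finally have "y * (- ln (norm (zeta z))) <= y * (1 / (R * y))" using True by (intro mult_left_mono) auto
   thus ?thesis using True R0 by (simp add: F_def)
  next
   case False
   define s where "s = - y"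
   have s: "0 <= s" "s <= 1" using False y1 by (auto simp: s_def)
   define \<tau> where "\<tau> = u + R * sin (2 * pi * x)"
   have \<tau>: "u - 3 <= \<tau>" "\<tau> <= u + 3" unfolding \<tau>_def using height_on_circle[of R 3] R by auto
   hence \<tau>': "\<tau> >= 10" "ln \<tau> <= l" using u by (auto simp: l_def)
   have l\<tau>: "ln \<tau> > 0" using \<tau>' by simp
   have ll: "ln (ln \<tau>) <= ln l" using l\<tau> \<tau>'(2) by simp
   have "R * s <= 3 * s" using s R by (intro mult_right_mono) auto
   hence re: "1 - 3 * s <= 1 + \<delta> + R * y" using \<delta> by (simp add: s_def)
   have "s ^ 3 <= s\<^sup>2" using s power_decreasing[of 2 3 s] by simp
   hence P0: "0 <= P s" unfolding P_def using zero_le_power2[of s] s by linarith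
   have "\<tau> > 0" using \<tau>' by simp
   hence "norm (zeta z) <= 1001 / 1000 * A * exp (P s * ln \<tau>) * ln \<tau>"
    unfolding zz \<tau>_def[symmetric] P_def by (intro norm_zeta_left s re \<tau>'(1) zeta_constant_mono[OF A _ \<tau>(2)])
   hence "ln (norm (zeta z)) <= ln (1001 / 1000 * A * exp (P s * ln \<tau>) * ln \<tau>)" using zp by (intro ln_mono) auto
   also have "... = ln (1001 / 1000 * A) + P s * ln \<tau> + ln (ln \<tau>)" by (rule ln_product) (use A0 l\<tau> in auto)
   also have "... <= ln (1001 / 1000 * A) + P s * l + ln l" using P0 \<tau>'(2) by (intro add_mono mult_left_mono ll) auto
   finally have "s * ln (norm (zeta z)) <= s * (B + P s * l)" using s unfolding B_def by (intro mult_left_mono) auto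
   thus ?thesis using False by (simp add: F_def s_def)
  qed
  thus "- (cos (2 * pi * x) * ln (norm (zeta (Complex (1 + \<delta>) u + of_real R * cis (2 * pi * x))))) <= F (cos (2 * pi * x))"
   by (simp only: y_def z_def c_def)
 qed
 hence "2 / R * (- I) <= 2 / R * ((1 / R * (pi / 2) + (B * 1 + l * ka)) / pi)" using R by (intro mult_left_mono) auto
 also have "... = 1 / (R * R) + 2 / (pi * R) * (B + l * ka)" using R by (simp add: field_simps)
 also have "... <= 112 / 1000 + 213 / 1000 * (B + l * (18836 / 10000))"
 proof (intro add_mono mult_mono)
  have "299 / 100 * (299 / 100) <= R * R" using R by (intro mult_mono) auto
  hence "1 / (R * R) <= 1 / (299 / 100 * (299 / 100))" using R by (intro divide_left_mono) auto
  thus "1 / (R * R) <= 112 / 1000" by simp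
  have "314159 / 100000 * (299 / 100) <= pi * R" using R pi_approx by (intro mult_mono) auto
  hence "2 / (pi * R) <= 2 / (314159 / 100000 * (299 / 100))" using R by (intro divide_left_mono) auto
  thus "2 / (pi * R) <= 213 / 1000" by simp
  show "ka <= 18836 / 10000" unfolding ka_def using pi_approx by simp
  show "0 <= B + l * ka" "0 <= l" using B0 l1 ka0 by (auto intro!: add_nonneg_nonneg mult_nonneg_nonneg)
 qed (use ka0 in auto)
 finally show ?thesis unfolding log_deriv_error_def B_def l_def by (simp add: algebra_simps)
qed

lemma kernel_eq:
 assumes "z ~= 0"
 shows "- Re (1 / (- z) - cnj (- z) / of_real (R\<^sup>2)) = Re z * (1 / (norm z)\<^sup>2 - 1 / R\<^sup>2)"
proof -
 have "1 / (- z) = - (cnj z / of_real ((norm z)\<^sup>2))" using assms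
  by (simp only: complex_div_cnj[of 1 "- z"]) simp
 hence "Re (1 / (- z)) = - (Re z / (norm z)\<^sup>2)" by (simp only: uminus_complex.sel Re_divide_of_real complex_cnj_cnj cnj.sel)
 moreover have "Re (cnj (- z) / of_real (R\<^sup>2)) = - Re z / R\<^sup>2" by (simp only: Re_divide_of_real) simp
 ultimately show ?thesis by (simp add: right_diff_distrib)
qed

text \<open>
  The zeros near \<open>1 + i u\<close> push the real part of the logarithmic derivative up; the other zeros
  in the disc of radius \<open>R\<close> contribute nonnegatively and are dropped.
\<close>

lemma log_deriv_lower:
 assumes u: "u > 13" and \<delta>: "\<delta> > 0" and A: "zeta_constant A (u + 3)"
  and k: "\<And>R W. 299 / 100 < R ==> R < 3 ==> finite W ==> W = {z \<in> ball (Complex (1 + \<delta>) u) R. zeta z = 0} ==>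
   (\<And>\<rho>. \<rho> \<in> W ==> zorder zeta \<rho> > 0) ==>
   (\<And>\<rho>. \<rho> \<in> W ==> 0 <= Re (Complex (1 + \<delta>) u - \<rho>) * (1 / (norm (Complex (1 + \<delta>) u - \<rho>))\<^sup>2 - 1 / R\<^sup>2)) ==>
   S <= (\<Sum>\<rho>\<in>W. of_int (zorder zeta \<rho>) * (Re (Complex (1 + \<delta>) u - \<rho>) * (1 / (norm (Complex (1 + \<delta>) u - \<rho>))\<^sup>2 - 1 / R\<^sup>2)))"
 shows "S <= Re (deriv zeta (Complex (1 + \<delta>) u) / zeta (Complex (1 + \<delta>) u)) + log_deriv_error A u"
proof -
 define c where "c = Complex (1 + \<delta>) u"
 obtain R where R: "299 / 100 < R" "R < 3" "\<forall>z \<in> sphere (Complex (1 + \<delta>) u) R. zeta z ~= 0"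
  using generic_radius[OF u, of "299 / 100" 3 "1 + \<delta>"] by auto
 have R0: "0 < R" "R <= 3" using R by auto
 define W where "W = {z \<in> ball c R. zeta z = 0}"
 note jen = zeta_jensen[OF u \<delta> R0 R(3), folded c_def, folded W_def]
 define h where "h \<rho> = Re (c - \<rho>) * (1 / (norm (c - \<rho>))\<^sup>2 - 1 / R\<^sup>2)" for \<rho>
 have hk: "Re (1 / (\<rho> - c) - cnj (\<rho> - c) / of_real (R\<^sup>2)) = - h \<rho>" if "\<rho> \<in> W" for \<rho>
  using kernel_eq[of "c - \<rho>" R] jen(2)[OF that] by (auto simp: h_def)
 have h0: "0 <= h \<rho>" if "\<rho> \<in> W" for \<rho>
 proof -
  have j: "Re \<rho> <= 1" "0 < norm (c - \<rho>)" "norm (c - \<rho>) < R" using jen(2)[OF that] by (auto simp: dist_norm norm_minus_commute)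
  have "(norm (c - \<rho>))\<^sup>2 <= R\<^sup>2" using j by (intro power_mono) auto
  hence "1 / R\<^sup>2 <= 1 / (norm (c - \<rho>))\<^sup>2" using j R0 by (intro divide_left_mono mult_pos_pos) auto
  moreover have "0 <= Re (c - \<rho>)" using j \<delta> by (simp add: c_def)
  ultimately show ?thesis unfolding h_def by (intro mult_nonneg_nonneg) auto
 qed
 have S: "S <= (\<Sum>\<rho>\<in>W. of_int (zorder zeta \<rho>) * h \<rho>)"
  using k[OF R(1,2) jen(1)] jen(2) h0 unfolding c_def W_def h_def by blast
 define I where "I = R / 2 * (Re (deriv zeta c / zeta c) + (\<Sum>\<rho>\<in>W. of_int (zorder zeta \<rho>) * Re (1 / (\<rho> - c) - cnj (\<rho> - c) / of_real (R\<^sup>2))))"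
 have "- (2 / R * I) <= log_deriv_error A u"
  by (rule cos_mean_bound[OF u \<delta> R(1,2) A R(3)]) (use jen(4) in \<open>simp_all only: I_def c_def\<close>)
 moreover have "(\<Sum>\<rho>\<in>W. of_int (zorder zeta \<rho>) * Re (1 / (\<rho> - c) - cnj (\<rho> - c) / of_real (R\<^sup>2))) = - (\<Sum>\<rho>\<in>W. of_int (zorder zeta \<rho>) * h \<rho>)"
  unfolding sum_negf[symmetric] by (intro sum.cong refl) (simp only: hk mult_minus_right)
 hence "2 / R * I = Re (deriv zeta c / zeta c) - (\<Sum>\<rho>\<in>W. of_int (zorder zeta \<rho>) * h \<rho>)"
  unfolding I_def using R0 by simp
 ultimately show ?thesis using S by (simp add: c_def)
qed

text \<open>With \<open>x = 1 - Re \<rho>\<close> and \<open>y\<close> the vertical distance,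
  \<open>\<alpha> <= \<delta>\<close> gives \<open>(\<delta> + x)^2 + y^2 <= (\<delta> + x) *
  (\<delta> + \<alpha>)\<close>. Equality, the least favourable case for the main term, occurs at
  the leftmost point of the disc.\<close>

lemma zero_kernel_lower:
 assumes "\<rho> \<in> Z" "\<alpha> <= \<delta>" "299 / 100 < R"
 shows "1 / (\<delta> + \<alpha>) - 112 / 1000 * (\<delta> + \<alpha>) <= Re (Complex (1 + \<delta>) t - \<rho>) * (1 / (norm (Complex (1 + \<delta>) t - \<rho>))\<^sup>2 - 1 / R\<^sup>2)"
proof -
 define x where "x = 1 - Re \<rho>"
 define y where "y = t - Im \<rho>"
 have xy: "x\<^sup>2 + y\<^sup>2 <= \<alpha>\<^sup>2"
 proof -
  have "norm (\<rho> - Complex 1 t) ^ 2 <= \<alpha>\<^sup>2" using Z(3)[OF assms(1)] by (intro power_mono) (auto simp: dist_norm)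
  thus ?thesis by (simp add: cmod_power2 x_def y_def power2_commute)
 qed
 have x: "0 <= x" "x <= \<alpha>"
 proof -
  show "0 <= x" using Z(4)[OF assms(1)] by (simp add: x_def)
  have "x\<^sup>2 <= \<alpha>\<^sup>2" using xy zero_le_power2[of y] by linarith
  thus "x <= \<alpha>" by (rule power2_le_imp_le) (use \<alpha> in simp)
 qed
 have \<delta>: "\<delta> > 0" using assms \<alpha> by simp
 have re: "Re (Complex (1 + \<delta>) t - \<rho>) = \<delta> + x" by (simp add: x_def)
 have nm: "(norm (Complex (1 + \<delta>) t - \<rho>))\<^sup>2 = (\<delta> + x)\<^sup>2 + y\<^sup>2" by (simp add: cmod_power2 x_def y_def algebra_simps)
 have dx: "\<delta> + x > 0" using \<delta> x by simp
 have pos: "(\<delta> + x)\<^sup>2 + y\<^sup>2 > 0" using dx by (intro add_pos_nonneg) auto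
 have "(\<delta> + x)\<^sup>2 + y\<^sup>2 <= (\<delta> + x) * (\<delta> + \<alpha>)"
 proof -
  have "0 <= (\<delta> - \<alpha>) * (\<alpha> - x)" using assms x by (intro mult_nonneg_nonneg) auto
  moreover have "(\<delta> + x) * (\<delta> + \<alpha>) - ((\<delta> + x)\<^sup>2 + y\<^sup>2) = (\<delta> - \<alpha>) * (\<alpha> - x) + (\<alpha>\<^sup>2 - (x\<^sup>2 + y\<^sup>2))"
   by (simp add: power2_eq_square algebra_simps)
  ultimately show ?thesis using xy by linarith
 qed
 hence 1: "1 / (\<delta> + \<alpha>) <= (\<delta> + x) / ((\<delta> + x)\<^sup>2 + y\<^sup>2)"
  using pos \<delta> \<alpha> by (simp add: divide_le_eq le_divide_eq mult_ac)
 have "299 / 100 * (299 / 100) <= R * R" using assms by (intro mult_mono) auto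
 hence "1 / R\<^sup>2 <= 1 / (299 / 100 * (299 / 100))" unfolding power2_eq_square using assms by (intro divide_left_mono mult_pos_pos) auto
 hence "1 / R\<^sup>2 <= 112 / 1000" by simp
 hence "(\<delta> + x) * (1 / R\<^sup>2) <= (\<delta> + \<alpha>) * (112 / 1000)" using x dx by (intro mult_mono) auto
 hence "1 / (\<delta> + \<alpha>) - 112 / 1000 * (\<delta> + \<alpha>) <= (\<delta> + x) / ((\<delta> + x)\<^sup>2 + y\<^sup>2) - (\<delta> + x) * (1 / R\<^sup>2)"
  using 1 by linarith
 thus ?thesis unfolding re nm right_diff_distrib by (simp only: times_divide_eq_right mult_1_right)
qed

lemma log_deriv_nonneg:
 assumes u: "u > 13" and \<delta>: "\<delta> > 0" and A: "zeta_constant A (u + 3)"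
 shows "0 <= Re (deriv zeta (Complex (1 + \<delta>) u) / zeta (Complex (1 + \<delta>) u)) + log_deriv_error A u"
proof (rule log_deriv_lower[OF u \<delta> A])
 fix R W
 assume zo: "\<And>\<rho>. \<rho> \<in> W ==> zorder zeta \<rho> > 0"
  and h0: "\<And>\<rho>. \<rho> \<in> W ==> 0 <= Re (Complex (1 + \<delta>) u - \<rho>) * (1 / (norm (Complex (1 + \<delta>) u - \<rho>))\<^sup>2 - 1 / R\<^sup>2)"
 show "0 <= (\<Sum>\<rho>\<in>W. of_int (zorder zeta \<rho>) * (Re (Complex (1 + \<delta>) u - \<rho>) * (1 / (norm (Complex (1 + \<delta>) u - \<rho>))\<^sup>2 - 1 / R\<^sup>2)))"
 proof (rule sum_nonneg)
  fix \<rho> assume "\<rho> \<in> W"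
  thus "0 <= of_int (zorder zeta \<rho>) * (Re (Complex (1 + \<delta>) u - \<rho>) * (1 / (norm (Complex (1 + \<delta>) u - \<rho>))\<^sup>2 - 1 / R\<^sup>2))"
   using zo[of \<rho>] h0[of \<rho>] by (intro mult_nonneg_nonneg[of "real_of_int (zorder zeta \<rho>)"]) auto
 qed
qed

text \<open>Three-four-one at abscissa \<open>1 + \<delta>\<close>: each zero in \<open>Z\<close>
  contributes about \<open>1 / (\<delta> + \<alpha>)\<close> four times, the pole
  \<open>3 / \<delta>\<close>. The condition \<open>\<delta> + \<alpha> < 29/10\<close> keeps
  \<open>Z\<close> inside the circle.\<close>

theorem zero_count_constraint:
 assumes \<delta>: "\<alpha> <= \<delta>" and big: "\<delta> + \<alpha> < 29 / 10" and A1: "zeta_constant A1 (t + 3)" and A2: "zeta_constant A2 (2 * t + 3)"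
 shows "4 * (of_int n * (1 / (\<delta> + \<alpha>) - 112 / 1000 * (\<delta> + \<alpha>))) <= 3 / \<delta> + (4 * log_deriv_error A1 t + log_deriv_error A2 (2 * t))"
proof -
 have d0: "\<delta> > 0" using \<delta> \<alpha> by simp
 have t2: "2 * t > 13" using t by simp
 define S where "S = of_int n * (1 / (\<delta> + \<alpha>) - 112 / 1000 * (\<delta> + \<alpha>))"
 have ex: "4 * Re (deriv zeta (Complex (1 + \<delta>) t) / zeta (Complex (1 + \<delta>) t)) + Re (deriv zeta (Complex (1 + \<delta>) (2 * t)) / zeta (Complex (1 + \<delta>) (2 * t))) <= 3 / \<delta>"
  using three_four_one[of "1 + \<delta>" t] d0 zeta_nonzero[of "Complex (1 + \<delta>) t"] zeta_nonzero[of "Complex (1 + \<delta>) (2 * t)"] by simp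
 have b2: "0 <= Re (deriv zeta (Complex (1 + \<delta>) (2 * t)) / zeta (Complex (1 + \<delta>) (2 * t))) + log_deriv_error A2 (2 * t)"
  by (rule log_deriv_nonneg[OF t2 d0 A2])
 have b1: "S <= Re (deriv zeta (Complex (1 + \<delta>) t) / zeta (Complex (1 + \<delta>) t)) + log_deriv_error A1 t"
 proof (rule log_deriv_lower[OF t d0 A1])
  fix R W assume R: "299 / 100 < R" "R < 3" and W: "finite W" "W = {z \<in> ball (Complex (1 + \<delta>) t) R. zeta z = 0}"
   and zo: "\<And>\<rho>. \<rho> \<in> W ==> zorder zeta \<rho> > 0"
   and h0: "\<And>\<rho>. \<rho> \<in> W ==> 0 <= Re (Complex (1 + \<delta>) t - \<rho>) * (1 / (norm (Complex (1 + \<delta>) t - \<rho>))\<^sup>2 - 1 / R\<^sup>2)"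
  show "S <= (\<Sum>\<rho>\<in>W. of_int (zorder zeta \<rho>) * (Re (Complex (1 + \<delta>) t - \<rho>) * (1 / (norm (Complex (1 + \<delta>) t - \<rho>))\<^sup>2 - 1 / R\<^sup>2)))"
   unfolding S_def
  proof (rule count_sum_le[OF W(1) _ zo])
   show "Z \<subseteq> W"
   proof
    fix \<rho> assume r: "\<rho> \<in> Z"
    have "dist (Complex 1 t) (Complex (1 + \<delta>) t) = \<delta>" using d0 by (simp add: dist_norm cmod_def)
    hence "dist \<rho> (Complex (1 + \<delta>) t) <= \<alpha> + \<delta>" using dist_triangle[of \<rho> "Complex (1 + \<delta>) t" "Complex 1 t"] Z(3)[OF r] by linarith
    thus "\<rho> \<in> W" unfolding W(2) using Z(1)[OF r] big R by (simp add: dist_commute)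
   qed
  qed (use zero_kernel_lower[OF _ \<delta> R(1)] h0 in auto)
 qed
 show ?thesis using b1 b2 ex by (simp add: S_def)
qed

end

section \<open>Numerical conclusion\<close>

lemma exp_rational_ge:
 assumes "b ^ q <= (27182/10000) ^ p" "q > 0" "b > 0"
 shows "b <= exp (real p / real q)"
proof -
 have "(27182/10000 :: real) ^ p <= exp 1 ^ p" using e_bounds by (intro power_mono) auto
 also have "... = exp (real p / real q) ^ q" using assms(2) by (simp flip: exp_of_nat_mult)
 finally have "b ^ q <= exp (real p / real q) ^ q" using assms(1) by linarith
 thus ?thesis using assms by (subst (asm) power_mono_iff) auto
qed

text \<open>The tangent of the logarithm at \<open>exp lc\<close> bounds \<open>ln l\<close> by a
  linear function of \<open>l\<close>, so the whole error becomes linear in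
  \<open>m\<close>.\<close>

lemma log_deriv_error_le:
 assumes u: "u > 0" and a: "1001 / 1000 * A <= exp a" "A > 0" and d: "1 / d <= exp lc" "d > 0" and m: "ln (u + 3) <= m"
 shows "log_deriv_error A u <= 213 / 1000 * (a + lc - 1 + (d + 18836 / 10000) * m) + 112 / 1000"
proof -
 define l where "l = ln (u + 3)"
 have "exp (1 :: real) <= 3" using e_bounds by simp
 hence l1: "l >= 1" using u unfolding l_def by (subst ln_ge_iff) auto
 have 1: "ln (1001 / 1000 * A) <= a"
 proof -
  have "ln (1001 / 1000 * A) <= ln (exp a)" by (rule ln_mono) (use a in auto)
  thus ?thesis by simp
 qed
 have "ln (l / exp lc) <= l / exp lc - 1" using l1 by (intro ln_le_minus_one) auto
 moreover have "ln (l / exp lc) = ln l - lc" using l1 by (simp add: ln_div)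
 moreover have "l / exp lc <= l / (1 / d)" using d l1 by (intro divide_left_mono) auto
 ultimately have 2: "ln l <= lc - 1 + d * l" using d by (simp add: mult.commute)
 have "ln (1001 / 1000 * A) + ln l + 18836 / 10000 * l <= a + lc - 1 + (d + 18836 / 10000) * l" using 1 2 by (simp add: distrib_right)
 also have "... <= a + lc - 1 + (d + 18836 / 10000) * m" using m d unfolding l_def by (intro add_left_mono mult_left_mono) auto
 finally show ?thesis unfolding log_deriv_error_def l_def by simp
qed

text \<open>The two factors are at most \<open>3/4 + 0.35 * \<delta>\<close>, as
  \<open>ln 4 / 4 <= 0.35\<close>, and \<open>1 + 1 / \<delta>\<close>.\<close>

lemma zr_factor_le:
 assumes \<delta>: "\<delta> > 0"
 shows "(1 - 4 powr (- (1 + \<delta>))) * zr (1 + \<delta>) <= 11 / 10 + 35 / 100 * \<delta> + 3 / 4 * (1 / \<delta>)"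
proof -
 have "4 <= exp (7 / 5 :: real)" using exp_rational_ge[of 4 5 7] by (simp add: power_divide)
 hence l4: "ln 4 <= (7 / 5 :: real)" using ln_le_cancel_iff[of 4 "exp (7 / 5)"] by simp
 have "1 + (- (\<delta> * ln 4)) <= exp (- (\<delta> * ln 4))" by (rule exp_ge_add_one_self)
 moreover have "\<delta> * ln 4 <= \<delta> * (7 / 5)" using \<delta> l4 by (intro mult_left_mono) auto
 moreover have "4 powr (- (1 + \<delta>)) = 1 / 4 * exp (- (\<delta> * ln 4))"
 proof -
  have "- (1 + \<delta>) = - 1 + - \<delta>" by simp
  hence "4 powr (- (1 + \<delta>)) = 4 powr (- 1) * (4 :: real) powr (- \<delta>)" by (simp only: powr_add)
  moreover have "4 powr (- \<delta>) = exp (- (\<delta> * ln 4))" by (simp add: powr_def)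
  moreover have "4 powr (- 1) = (1 / 4 :: real)" by (simp add: powr_minus_divide)
  ultimately show ?thesis by (simp only:)
 qed
 ultimately have 1: "1 - 4 powr (- (1 + \<delta>)) <= 3 / 4 + 35 / 100 * \<delta>" by simp
 have "(1 - 4 powr (- (1 + \<delta>))) * zr (1 + \<delta>) <= (3 / 4 + 35 / 100 * \<delta>) * (1 + 1 / \<delta>)"
  using 1 zr_bounds[of "1 + \<delta>"] \<delta> by (intro mult_mono) auto
 also have "... = 11 / 10 + 35 / 100 * \<delta> + 3 / 4 * (1 / \<delta>)" using \<delta> by (simp add: field_simps)
 finally show ?thesis .
qed

context zero_disc
begin

abbreviation "L \<equiv> ln t"

lemma L_ge: "L >= 256 / 100"
proof -
 have "exp (64 / 25 :: real) <= 13" using exp_rational_le[of 64 13 25] by (simp add: power_divide)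
 thus ?thesis using t ln_ge_iff[of t "64 / 25"] by simp
qed

lemma ln_shift: "c >= 0 ==> ln (t + c) <= L + c / t"
proof -
 assume c: "c >= 0"
 have "t * (1 + c / t) = t + c" using t by (simp add: distrib_left)
 hence "ln (t + c) = ln (t * (1 + c / t))" by (simp only:)
 also have "... = L + ln (1 + c / t)" using t c by (intro ln_mult_pos) (auto intro: add_pos_nonneg)
 also have "ln (1 + c / t) <= c / t" using t c by (intro ln_add_one_self_le_self) auto
 finally show ?thesis by simp
qed

text \<open>The classical zero-free region. For one zero, \<open>\<delta> = 7 * \<alpha>\<close> is
  close to maximising \<open>4 / (\<delta> + \<alpha>) - 3 / \<delta>\<close> and leaves
  \<open>1 / (14 * \<alpha>)\<close>. For two zeros, \<open>\<delta> = \<alpha>\<close> leaves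
  \<open>8 / (2 * \<alpha>) - 3 / \<alpha> = 1 / \<alpha>\<close>. With slack for the quadratic
  terms this gives 14.2 and 100/97 times \<open>3.6 * L\<close>.\<close>

lemma zero_free_from_constraint:
 assumes A1: "zeta_constant A1 (t + 3)" and A2: "zeta_constant A2 (2 * t + 3)"
  and K: "4 * log_deriv_error A1 t + log_deriv_error A2 (2 * t) <= 36 / 10 * L"
 shows "n >= 1 ==> 1 / \<alpha> <= 5112 / 100 * L" "n >= 2 ==> 1 / \<alpha> <= 36 / 97 * 10 * L"
proof -
 define k where "k = 36 / 10 * L"
 have k9: "k >= 92 / 10" using L_ge by (simp add: k_def)
 show "1 / \<alpha> <= 5112 / 100 * L" if n1: "n >= 1"
 proof (rule ccontr)
  assume "\<not> 1 / \<alpha> <= 5112 / 100 * L"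
  hence lt: "142 / 10 * k < 1 / \<alpha>" by (simp add: k_def)
  hence ka: "142 / 10 * (k * \<alpha>) < 1" using \<alpha> by (simp add: field_simps)
  have "92 / 10 * \<alpha> <= k * \<alpha>" using k9 \<alpha> by (intro mult_right_mono) auto
  hence a: "\<alpha> < 1 / 130" using ka by simp
  have "7 * \<alpha> + \<alpha> < 29 / 10" "\<alpha> <= 7 * \<alpha>" using a \<alpha> by simp_all
  from zero_count_constraint[OF this(2,1) A1 A2]
  have c: "4 * (of_int n * (1 / (8 * \<alpha>) - 112 / 1000 * (8 * \<alpha>))) <= 3 / (7 * \<alpha>) + k" using K unfolding k_def by simp
  have "112 / 1000 * (8 * \<alpha>) <= 1 / (8 * \<alpha>)"
  proof -
   have "\<alpha> * \<alpha> <= 1 / 130 * (1 / 130)" using a \<alpha> by (intro mult_mono) auto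
   thus ?thesis using \<alpha> by (simp add: field_simps)
  qed
  hence "1 * (1 / (8 * \<alpha>) - 112 / 1000 * (8 * \<alpha>)) <= of_int n * (1 / (8 * \<alpha>) - 112 / 1000 * (8 * \<alpha>))"
   using n1 by (intro mult_right_mono) auto
  hence "4 * (1 / (8 * \<alpha>) - 112 / 1000 * (8 * \<alpha>)) <= 3 / (7 * \<alpha>) + k" using c by linarith
  hence "4 * (1 / (8 * \<alpha>) - 112 / 1000 * (8 * \<alpha>)) * \<alpha> <= (3 / (7 * \<alpha>) + k) * \<alpha>" using \<alpha> by (intro mult_right_mono) auto
  hence "1 / 2 - 3584 / 1000 * (\<alpha> * \<alpha>) <= 3 / 7 + k * \<alpha>" using \<alpha> by (simp add: algebra_simps)
  moreover have "\<alpha> * \<alpha> <= 1 / 130 * (1 / 130)" using a \<alpha> by (intro mult_mono) auto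
  ultimately show False using ka by simp
 qed
 show "1 / \<alpha> <= 36 / 97 * 10 * L" if n2: "n >= 2"
 proof (rule ccontr)
  assume "\<not> 1 / \<alpha> <= 36 / 97 * 10 * L"
  hence lt: "100 / 97 * k < 1 / \<alpha>" by (simp add: k_def)
  hence ka: "100 / 97 * (k * \<alpha>) < 1" using \<alpha> by (simp add: field_simps)
  have "92 / 10 * \<alpha> <= k * \<alpha>" using k9 \<alpha> by (intro mult_right_mono) auto
  hence a: "\<alpha> < 11 / 100" using ka by simp
  have "\<alpha> + \<alpha> < 29 / 10" using a by simp
  from zero_count_constraint[OF order_refl this A1 A2]
  have c: "4 * (of_int n * (1 / (2 * \<alpha>) - 112 / 1000 * (2 * \<alpha>))) <= 3 / \<alpha> + k" using K unfolding k_def by simp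
  have aa: "\<alpha> * \<alpha> <= 11 / 100 * (11 / 100)" using a \<alpha> by (intro mult_mono) auto
  hence "112 / 1000 * (2 * \<alpha>) <= 1 / (2 * \<alpha>)" using \<alpha> by (simp add: field_simps)
  hence "2 * (1 / (2 * \<alpha>) - 112 / 1000 * (2 * \<alpha>)) <= of_int n * (1 / (2 * \<alpha>) - 112 / 1000 * (2 * \<alpha>))"
   using n2 by (intro mult_right_mono) auto
  hence "8 * (1 / (2 * \<alpha>) - 112 / 1000 * (2 * \<alpha>)) <= 3 / \<alpha> + k" using c by linarith
  hence "8 * (1 / (2 * \<alpha>) - 112 / 1000 * (2 * \<alpha>)) * \<alpha> <= (3 / \<alpha> + k) * \<alpha>" using \<alpha> by (intro mult_right_mono) auto
  hence "4 - 1792 / 1000 * (\<alpha> * \<alpha>) <= 3 + k * \<alpha>" using \<alpha> by (simp add: algebra_simps)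
  thus False using ka aa by simp
 qed
qed

text \<open>At \<open>\<delta> = \<alpha>\<close> the constraint reads
  \<open>y * (2 - 0.896 * \<alpha>^2) <= 3 / \<alpha> + k\<close> with
  \<open>y = n / \<alpha>\<close>. For \<open>\<alpha> <= 1/4\<close> the term
  \<open>3 / \<alpha>\<close> is absorbed by \<open>y\<close>, as \<open>n >= 3\<close>; on the
  other three ranges it is at most 12, 6 and 4, which are the constants in the hypotheses.\<close>

lemma density_bound:
 assumes A1: "zeta_constant A1 (t + 3)" and A2: "zeta_constant A2 (2 * t + 3)"
  and K: "4 * log_deriv_error A1 t + log_deriv_error A2 (2 * t) <= k" and n3: "n >= 3"
  and Y: "k <= 943 / 1000 * Y" "k <= 1104 / 1000 * Y - 4" "k <= 1496 / 1000 * Y - 6" "k <= 1776 / 1000 * Y - 12" "0 <= Y"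
 shows "of_int n / \<alpha> <= Y"
proof -
 define y where "y = of_int n / \<alpha>"
 have a2: "\<alpha> + \<alpha> < 29 / 10" using \<alpha> by simp
 have "4 * (of_int n * (1 / (2 * \<alpha>) - 112 / 1000 * (2 * \<alpha>))) <= 3 / \<alpha> + k"
  using zero_count_constraint[OF order_refl a2 A1 A2] K by simp
 moreover have "4 * (of_int n * (1 / (2 * \<alpha>) - 112 / 1000 * (2 * \<alpha>))) = y * (2 - 896 / 1000 * (\<alpha> * \<alpha>))"
  unfolding y_def using \<alpha> by (simp add: field_simps)
 ultimately have c: "y * (2 - 896 / 1000 * (\<alpha> * \<alpha>)) <= 3 / \<alpha> + k" by simp
 have y3: "3 / \<alpha> <= y" unfolding y_def using n3 \<alpha> by (intro divide_right_mono) auto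
 have y0: "0 <= y" using y3 \<alpha> by (intro order_trans[OF _ y3]) auto
 have st: "y * (2 - 896 / 1000 * (b * b)) <= 3 / \<alpha> + k" if "\<alpha> <= b" for b
 proof -
  have "\<alpha> * \<alpha> <= b * b" using that \<alpha> by (intro mult_mono) auto
  hence "y * (2 - 896 / 1000 * (b * b)) <= y * (2 - 896 / 1000 * (\<alpha> * \<alpha>))" using y0 by (intro mult_left_mono) auto
  thus ?thesis using c by linarith
 qed
 have lo: "3 / \<alpha> <= 3 / b" if "b <= \<alpha>" "b > 0" for b using that by (intro divide_left_mono) auto
 consider "\<alpha> <= 1 / 4" | "1 / 4 <= \<alpha>" "\<alpha> <= 1 / 2" | "1 / 2 <= \<alpha>" "\<alpha> <= 3 / 4" | "3 / 4 <= \<alpha>" by linarith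
 hence "y <= Y"
 proof cases
  case 1
  thus ?thesis using st[OF 1] y3 Y by simp
 next
  case 2
  thus ?thesis using st[OF 2(2)] lo[OF 2(1)] Y by simp
 next
  case 3
  thus ?thesis using st[OF 3(2)] lo[OF 3(1)] Y by simp
 next
  case 4
  thus ?thesis using st[of 1] lo[OF 4] \<alpha> Y by simp
 qed
 thus ?thesis by (simp add: y_def)
qed

text \<open>For \<open>n = 0\<close> the right side is nonnegative; for \<open>n = 1\<close> and
  \<open>n = 2\<close> the zero-free region is enough. For \<open>n >= 3\<close> the bound of
  \<open>count_bound\<close> is used with \<open>\<delta> = \<alpha> / n\<close>: \<open>Y\<close>
  bounds \<open>n / \<alpha>\<close>, and the hypothesis relating \<open>sA\<close>,
  \<open>Y\<close> and \<open>L\<close> is the inequality that remains, exponentiated.\<close>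

lemma count_times_log:
 assumes r: "\<alpha> < r" "r < 1" and A1: "zeta_constant A1 (t + 3)" and A2: "zeta_constant A2 (2 * t + 3)"
  and K: "4 * log_deriv_error A1 t + log_deriv_error A2 (2 * t) <= k" and k36: "k <= 36 / 10 * L"
  and Y: "k <= 943 / 1000 * Y" "k <= 1104 / 1000 * Y - 4" "k <= 1496 / 1000 * Y - 6" "k <= 1776 / 1000 * Y - 12" "0 <= Y"
  and sA: "1001 / 1000 * A1 <= sA\<^sup>2" "sA > 0" and YL: "27183 / 10000 * sA * (1217 / 1000 + 3 / 4 * Y) <= 2297 / 100 * L"
  and err: "5 / (6 * (t - 1)) <= err"
 shows "of_int n * ln (r / \<alpha>) <= c1 r / pi * L + 3 / 2 * ln L + c3 r / pi + c4 r + ln 29.388 + err" (is "_ <= ?B")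
proof -
 have r0: "0 < r" using r \<alpha> by simp
 interpret angles r by unfold_locales (use r0 r in auto)
 define N where "N = real_of_int n"
 have L0: "L > 0" using L_ge by linarith
 have err0: "0 <= err" using err t by (intro order_trans[OF _ err]) auto
 \<comment> \<open>22.97 is just below \<open>29.388 * sqrt 0.611\<close>.\<close>
 have lc: "ln (2297 / 100) <= ln 29.388 + c3 r / pi"
 proof -
  have "2 * ln (2297 / 100) = ln ((2297 / 100)\<^sup>2 :: real)" by (simp add: ln_realpow)
  also have "... <= ln (29.388 ^ 2 * 0.611)" by (intro ln_mono) (auto simp: power2_eq_square)
  also have "... = 2 * ln 29.388 + ln (0.611 :: real)" by (subst ln_mult_pos) (auto simp: ln_realpow)
  finally have "ln (2297 / 100) <= ln 29.388 + ln 0.611 / (2 :: real)" by simp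
  moreover have "ln 0.611 / 2 <= c3 r / pi" using divide_right_mono[OF c3_ge, of pi] by simp
  ultimately show ?thesis by linarith
 qed
 \<comment> \<open>2.56 is the square of 1.6. For \<open>n\<close> equal to 1 or 2 half a
   \<open>ln L\<close> is traded for this constant.\<close>
 have lL: "ln (16 / 10) <= ln L / 2"
 proof -
  have "2 * ln (16 / 10) = ln ((16 / 10)\<^sup>2 :: real)" by (simp add: ln_realpow)
  also have "... <= ln L" using L_ge by (intro ln_mono) (auto simp: power2_eq_square)
  finally show ?thesis by simp
 qed
 have lL0: "0 <= ln L" using L_ge by simp
 define x where "x = r\<^sup>2 * L / 8"
 \<comment> \<open>25.68 is just below \<open>22.97 * sqrt (5/4)\<close>; the root comes from
   \<open>c4 >= ln (zr (1 + r)) / 2\<close> and \<open>zr (1 + r) >= 5/4\<close>.\<close>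
 have B: "x + 3 / 2 * ln L + ln (2568 / 100) <= ?B"
 proof -
  have "r\<^sup>2 / 8 <= c1 r / pi" using divide_right_mono[OF c1_bounds(1), of pi] by simp
  hence "r\<^sup>2 / 8 * L <= c1 r / pi * L" using L0 by (intro mult_right_mono) auto
  moreover have "2 * ln (2568 / 100) <= 2 * ln (2297 / 100) + ln (5 / 4 :: real)"
  proof -
   have "2 * ln (2568 / 100) = ln ((2568 / 100)\<^sup>2 :: real)" by (simp add: ln_realpow)
   also have "... <= ln ((2297 / 100)\<^sup>2 * (5 / 4))" by (intro ln_mono) (auto simp: power2_eq_square)
   also have "... = 2 * ln (2297 / 100) + ln (5 / 4 :: real)" by (subst ln_mult_pos) (auto simp: ln_realpow)
   finally show ?thesis .
  qed
  moreover have "ln (5 / 4) <= 2 * c4 r"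
  proof -
   have "2 powr (- 2) <= (2 :: real) powr (- (1 + r))" using r by (intro powr_mono) auto
   hence "5 / 4 <= zr (1 + r)" using zr_lower[of "1 + r"] r0 by (simp add: powr_minus)
   hence "ln (5 / 4) <= ln (zr (1 + r))" by (intro ln_mono) auto
   thus ?thesis using c4_integral(2)[OF r0 r(2)] by linarith
  qed
  ultimately show ?thesis using lc err0 unfolding x_def by linarith
 qed
 have x0: "0 <= x" using L0 by (simp add: x_def)
 have K36: "4 * log_deriv_error A1 t + log_deriv_error A2 (2 * t) <= 36 / 10 * L" using K k36 by linarith
 note zf = zero_free_from_constraint[OF A1 A2 K36]
 consider "n <= 0" | "n = 1" | "n = 2" | "n >= 3" by linarith
 thus ?thesis
 proof cases
  case 1
  hence n0: "n = 0" using n_nonneg by simp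
  have "0 <= ln (2568 / 100 :: real)" by simp
  hence "0 <= ?B" using B x0 lL0 by linarith
  thus ?thesis by (simp add: n0)
 next
  case 2
  have "r / \<alpha> <= r * (5112 / 100 * L)" using mult_left_mono[OF zf(1), of r] 2 r0 by simp
  also have "r * (5112 / 100 * L) <= (2568 / 100 * (16 / 10) * (1 + x)) * L"
  proof -
   have "r\<^sup>2 * (256 / 100) <= r\<^sup>2 * L" using L_ge by (intro mult_left_mono) auto
   hence x: "32 / 100 * r\<^sup>2 <= x" by (simp add: x_def)
   have "0 <= (1 - r)\<^sup>2" "0 <= 1 - r" using r by auto
   hence "5112 / 100 * r <= 2568 / 100 * (16 / 10) * (1 + 32 / 100 * r\<^sup>2)" by (simp add: power2_eq_square algebra_simps)
   also have "... <= 2568 / 100 * (16 / 10) * (1 + x)" using x by simp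
   finally have "5112 / 100 * r * L <= 2568 / 100 * (16 / 10) * (1 + x) * L" using L0 by (intro mult_right_mono) auto
   thus ?thesis by (simp only: mult_ac)
  qed
  finally have "ln (r / \<alpha>) <= ln ((2568 / 100 * (16 / 10) * (1 + x)) * L)" using r0 \<alpha> by (intro ln_mono) auto
  also have "... = ln (2568 / 100) + ln (16 / 10) + ln (1 + x) + ln L"
   using L0 x0 by (simp only: ln_mult_pos mult_pos_pos add_pos_nonneg zero_less_one divide_pos_pos zero_less_numeral)
  also have "ln (1 + x) <= x" using x0 by (rule ln_add_one_self_le_self)
  finally have "ln (r / \<alpha>) <= ?B" using B lL by linarith
  thus ?thesis using 2 by simp
 next
  case 3
  have ra: "r / \<alpha> <= r * (36 / 97 * 10 * L)" using mult_left_mono[OF zf(2), of r] 3 r0 by simp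
  have "ln (r / \<alpha>) <= ln (r * (36 / 97 * 10 * L))" using r0 \<alpha> ra by (intro ln_mono) auto
  hence "2 * ln (r / \<alpha>) <= 2 * ln (r * (36 / 97 * 10 * L))" by simp
  also have "... = ln ((r * (36 / 97 * 10 * L))\<^sup>2)" using r0 L0 by (simp add: ln_realpow)
  also have "(r * (36 / 97 * 10 * L))\<^sup>2 = x * ((36 / 97 * 10)\<^sup>2 * 8 * L)" unfolding x_def by (simp add: power2_eq_square)
  also have "ln ... = ln x + ln ((36 / 97 * 10)\<^sup>2 * 8) + ln L"
  proof -
   have "x > 0" using r0 L0 by (simp add: x_def)
   thus ?thesis using L0 by (simp only: ln_mult_pos mult_pos_pos zero_less_power divide_pos_pos zero_less_numeral)
  qed
  \<comment> \<open>For two zeros \<open>ln L\<close> occurs twice; the term \<open>x\<close> on the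
    right side, from \<open>c1\<close>, absorbs one of them together with \<open>r\<close>.\<close>
  also have "ln x <= x - 1" using r0 L0 by (intro ln_le_minus_one) (simp add: x_def)
  also have "ln ((36 / 97 * 10)\<^sup>2 * 8) <= 1 + ln (16 / 10) + ln (2568 / 100 :: real)"
  proof -
   have "((36 / 97 * 10)\<^sup>2 * 8 :: real) <= 27182 / 10000 * (16 / 10) * (2568 / 100)" by (simp add: power2_eq_square)
   also have "... <= exp 1 * (16 / 10) * (2568 / 100)" using e_bounds by (intro mult_right_mono) auto
   finally have "ln ((36 / 97 * 10)\<^sup>2 * 8) <= ln (exp 1 * (16 / 10) * (2568 / 100 :: real))" by (intro ln_mono) auto
   also have "... = ln (exp 1) + ln (16 / 10) + ln (2568 / 100 :: real)" by (simp only: ln_mult_pos mult_pos_pos exp_gt_zero divide_pos_pos zero_less_numeral)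
   finally show ?thesis by simp
  qed
  finally have "2 * ln (r / \<alpha>) <= ?B" using B lL by linarith
  thus ?thesis using 3 by simp
 next
  case 4
  have N3: "N >= 3" using 4 by (simp add: N_def)
  \<comment> \<open>Close to the minimiser of
    \<open>N * ln (1 + \<delta> / \<alpha>) - ln \<delta>\<close>, the loss in the logarithm plus
    the cost of the centre.\<close>
  define \<delta> where "\<delta> = \<alpha> / N"
  have \<delta>: "\<delta> > 0" "\<delta> <= 1 / 3" using \<alpha> N3 by (auto simp: \<delta>_def field_simps)
  have dN: "\<alpha> + \<delta> = \<alpha> * (1 + 1 / N)" "1 / \<delta> = N / \<alpha>" using N3 \<alpha> by (auto simp: \<delta>_def field_simps)
  have N1: "N * ln (1 + 1 / N) <= 1"
  proof -
   have "ln (1 + 1 / N) <= 1 / N" using N3 by (intro ln_add_one_self_le_self) auto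
   hence "N * ln (1 + 1 / N) <= N * (1 / N)" using N3 by (intro mult_left_mono) auto
   thus ?thesis using N3 by simp
  qed
  have lsplit: "ln (r / \<alpha>) = ln (r / (\<alpha> + \<delta>)) + ln (1 + 1 / N)"
  proof -
   have "r / \<alpha> = r / (\<alpha> * w) * w" if "w > 0" for w using that \<alpha> by (simp add: field_simps)
   moreover have "1 + 1 / N > 0" using N3 by (intro add_pos_nonneg) auto
   ultimately have "r / \<alpha> = r / (\<alpha> + \<delta>) * (1 + 1 / N)" unfolding dN by blast
   moreover have "0 < r / (\<alpha> + \<delta>)" "0 < 1 + 1 / N" using r0 \<alpha> \<delta> N3 by (auto intro: add_pos_pos)
   ultimately show ?thesis by (simp only: ln_mult_pos)
  qed
  have A0: "A1 > 0" using zeta_constant_pos[OF A1] by simp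
  have key: "1 + ln (1217 / 1000 + 3 / 4 * (N / \<alpha>)) + ln (1001 / 1000 * A1) / 2 <= ln L + ln (2297 / 100)"
  proof -
   \<comment> \<open>1.217 is the value of \<open>11/10 + 35/100 * \<delta>\<close> at
     \<open>\<delta> = 1/3\<close>, rounded up.\<close>
   define Q where "Q = 1217 / 1000 + 3 / 4 * (N / \<alpha>)"
   have Q0: "Q > 0" unfolding Q_def using N3 \<alpha> by (intro add_pos_nonneg) auto
   have "N / \<alpha> <= Y" unfolding N_def by (rule density_bound[OF A1 A2 K 4 Y])
   hence "27183 / 10000 * sA * Q <= 27183 / 10000 * sA * (1217 / 1000 + 3 / 4 * Y)" unfolding Q_def using sA by (intro mult_left_mono) auto
   hence "27183 / 10000 * sA * Q <= 2297 / 100 * L" using YL by linarith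
   moreover have "exp 1 * sA * Q <= 27183 / 10000 * sA * Q" using e_bounds sA Q0 by (intro mult_right_mono) auto
   ultimately have le: "exp 1 * sA * Q <= 2297 / 100 * L" by linarith
   have "ln (exp 1 * sA * Q) <= ln (2297 / 100 * L)" by (rule ln_mono[OF le]) (use sA Q0 in simp)
   hence "ln (exp 1) + ln sA + ln Q <= ln (2297 / 100) + ln L"
    using sA Q0 L0 by (simp only: ln_mult_pos mult_pos_pos exp_gt_zero divide_pos_pos zero_less_numeral)
   moreover have "ln (1001 / 1000 * A1) <= 2 * ln sA"
   proof -
    have "ln (1001 / 1000 * A1) <= ln (sA\<^sup>2)" using sA A0 by (intro ln_mono) auto
    thus ?thesis using sA by (simp add: ln_realpow)
   qed
   ultimately show ?thesis by (simp add: Q_def)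
  qed
  show ?thesis
  proof (cases "\<alpha> + \<delta> < r")
   case True
   have A1': "zeta_constant A1 (t + 1)" by (rule zeta_constant_mono[OF A1]) (use t in auto)
   have re: "Re (Complex (1 + \<delta>) t) = 1 + \<delta>" by simp
   have q: "- ln (norm (zeta (Complex (1 + \<delta>) t))) <= ln (1217 / 1000 + 3 / 4 * (N / \<alpha>))"
   proof -
    have "- ln (norm (zeta (Complex (1 + \<delta>) t))) <= ln ((1 - 4 powr (- (1 + \<delta>))) * zr (1 + \<delta>))"
     using ln_norm_zeta_right(3)[of "Complex (1 + \<delta>) t"] \<delta> by simp
    also have "... <= ln (1217 / 1000 + 3 / 4 * (N / \<alpha>))"
    proof (rule ln_mono)
     have "0 < 1 - 4 powr (- (1 + \<delta>))" using \<delta> powr_less_mono[of "- (1 + \<delta>)" 0 4] by simp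
     thus "0 < (1 - 4 powr (- (1 + \<delta>))) * zr (1 + \<delta>)" using zr_bounds(3)[of "1 + \<delta>"] \<delta> by simp
     show "(1 - 4 powr (- (1 + \<delta>))) * zr (1 + \<delta>) <= 1217 / 1000 + 3 / 4 * (N / \<alpha>)"
      using zr_factor_le[OF \<delta>(1)] \<delta>(2) unfolding dN(2) by linarith
    qed
    finally show ?thesis .
   qed
   have "N * ln (r / (\<alpha> + \<delta>)) <= c1 r / pi * ln (t + 1) + c4 r + (ln (1001 / 1000 * A1) + ln (ln (t + 1))) / 2 - ln (norm (zeta (Complex (1 + \<delta>) t)))"
    unfolding N_def by (rule count_bound[OF r0 r(2) \<delta>(1) True A1'])
   hence 1: "N * ln (r / \<alpha>) <= c1 r / pi * ln (t + 1) + c4 r + ln (1001 / 1000 * A1) / 2 + ln (ln (t + 1)) / 2 + ln (1217 / 1000 + 3 / 4 * (N / \<alpha>)) + 1"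
    unfolding lsplit distrib_left add_divide_distrib using N1 q by linarith
   have s1: "ln (t + 1) <= L + 1 / t" by (rule ln_shift) simp
   have s2: "c1 r / pi * ln (t + 1) <= c1 r / pi * L + 16 / 100 * (1 / t)"
   proof -
    have "c1 r / pi <= (1 / 2) / pi" using c1_bounds(2) r by (intro divide_right_mono) auto
    also have "... <= 16 / 100" using pi_approx by (simp add: field_simps)
    finally have c: "c1 r / pi <= 16 / 100" .
    have c0: "0 <= c1 r / pi" using order_trans[OF _ c1_bounds(1)] by simp
    have "c1 r / pi * ln (t + 1) <= c1 r / pi * (L + 1 / t)" using s1 c0 by (intro mult_left_mono)
    also have "... = c1 r / pi * L + c1 r / pi * (1 / t)" by (rule distrib_left)
    also have "... <= c1 r / pi * L + 16 / 100 * (1 / t)" using c t by (intro add_left_mono mult_right_mono) auto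
    finally show ?thesis .
   qed
   have s3: "ln (ln (t + 1)) <= ln L + 40 / 100 * (1 / t)"
   proof -
    have l1: "0 < ln (t + 1)" using t by simp
    have "ln (ln (t + 1) / L) <= ln (t + 1) / L - 1" using l1 L0 by (intro ln_le_minus_one) auto
    also have "... <= (L + 1 / t) / L - 1" using s1 L0 by (intro diff_right_mono divide_right_mono) auto
    also have "... = (1 / L) * (1 / t)" using L0 t by (simp add: field_simps)
    also have "... <= 40 / 100 * (1 / t)"
    proof (rule mult_right_mono)
     have "1 / L <= 1 / (256 / 100)" using L_ge by (intro divide_left_mono) auto
     thus "1 / L <= 40 / 100" by simp
    qed (use t in simp)
    finally have "ln (ln (t + 1) / L) <= 40 / 100 * (1 / t)" .
    moreover have "ln (ln (t + 1) / L) = ln (ln (t + 1)) - ln L" using l1 L0 by (simp add: ln_div)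
    ultimately show ?thesis by simp
   qed
   \<comment> \<open>The circle reaches height \<open>t + 1\<close>; its effects
     \<open>0.16 / t\<close> on the main term and \<open>0.20 / t\<close> on the iterated logarithm
     are covered by \<open>err\<close>.\<close>
   have "36 / 100 * (1 / t) <= 5 / 6 * (1 / (t - 1))" using t by (intro mult_mono divide_left_mono) auto
   also have "... = 5 / (6 * (t - 1))" by simp
   also have "... <= err" by (rule err)
   finally have s4: "36 / 100 * (1 / t) <= err" .
   hence "N * ln (r / \<alpha>) <= ?B" using 1 s2 s3 key lc by linarith
   thus ?thesis by (simp add: N_def)
  next
   \<comment> \<open>Then \<open>r\<close> is at most \<open>1 + 1 / N\<close> times
     \<open>\<alpha>\<close>, and the left side is at most 1.\<close>
   case False
   hence "r / (\<alpha> + \<delta>) <= 1" using \<alpha> \<delta> by simp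
   hence "ln (r / (\<alpha> + \<delta>)) <= 0" using r0 \<alpha> \<delta> by simp
   hence "N * ln (r / \<alpha>) <= N * ln (1 + 1 / N)" unfolding lsplit using N3 by (intro mult_left_mono) auto
   also have "... <= 1" by (rule N1)
   also have "1 <= ln (2568 / 100 :: real)"
   proof -
    have "exp (1 :: real) <= 2568 / 100" using e_bounds by simp
    thus ?thesis by (subst ln_ge_iff) auto
   qed
   also have "... <= ?B" using B x0 lL0 by linarith
   finally show ?thesis by (simp add: N_def)
  qed
 qed
qed

end

lemma exp_add_ge: "b <= exp x ==> 0 <= b ==> 0 <= y ==> b * (1 + y + y\<^sup>2 / 2) <= exp (x + y :: real)"
 unfolding exp_add using exp_lower_Taylor_quadratic[of y] by (intro mult_mono) auto

lemma exp_diff_le: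
 assumes "exp x <= b" "0 <= y"
 shows "exp (x - y) <= b / (1 + y :: real)"
 unfolding exp_diff using assms exp_ge_add_one_self[of y] order_trans[OF less_imp_le[OF exp_gt_zero] assms(1)]
 by (intro frac_le) auto

context zero_disc
begin

lemma heights:
 assumes "3 / t <= e"
 shows "ln (t + 3) <= L + e" "ln (2 * t + 3) <= L + 7 / 10 + e / 2"
proof -
 show "ln (t + 3) <= L + e" using ln_shift[of 3] assms by simp
 have "2 <= exp (7 / 10 :: real)" using exp_rational_ge[of 2 10 7] by (simp add: power_divide)
 hence "ln 2 <= (7 / 10 :: real)" using ln_le_cancel_iff[of 2 "exp (7 / 10)"] by simp
 moreover have "ln (2 * t + 3) = ln (2 * (t + 3 / 2))" by simp
 moreover have "ln (2 * (t + 3 / 2)) = ln 2 + ln (t + 3 / 2)" using t by (intro ln_mult_pos) auto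
 moreover have "ln (t + 3 / 2) <= L + (3 / 2) / t" by (rule ln_shift) simp
 moreover have "(3 / 2) / t = 3 / t / 2" by simp
 ultimately show "ln (2 * t + 3) <= L + 7 / 10 + e / 2" using assms by linarith
qed

lemma t_between: "L <= a ==> exp a <= b ==> t <= b" "a <= L ==> b <= exp a ==> b <= t"
proof -
 have e: "exp L = t" using t by simp
 show "L <= a ==> exp a <= b ==> t <= b" using exp_le_cancel_iff[of L a] e by linarith
 show "a <= L ==> b <= exp a ==> b <= t" using exp_le_cancel_iff[of a L] e by linarith
qed

lemma ln_le_of_exp: "0 < y ==> y <= b ==> b <= exp a ==> ln y <= (a :: real)"
 using ln_mono[of y "exp a"] by simp

text \<open>
  The admissible constant in the upper bound for \<open>zeta\<close> grows in three steps, and each step is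
  used as long as it is available; with a single constant the inequality fails for small \<open>t\<close>.
\<close>

theorem count_times_log_le:
 assumes r: "\<alpha> < r" "r < 1" and err: "5 / (6 * (t - 1)) <= err"
 shows "of_int n * ln (r / \<alpha>) <= c1 r / pi * L + 3 / 2 * ln L + c3 r / pi + c4 r + ln 29.388 + err"
proof -
 \<comment> \<open>Exponents \<open>a\<close> with \<open>1001/1000 * A <= exp a\<close> for the
   four constants, then tangent points for \<open>log_deriv_error_le\<close>, then the heights that
   belong to the ranges of \<open>L\<close>.\<close>
 have a1: "1001 / 1000 * (349 / 100) <= exp (63 / 50 :: real)" using exp_add_ge[of "27182 / 10000" 1 "13 / 50"] e_bounds by (simp add: power2_eq_square)
 have a2: "1001 / 1000 * (699 / 100) <= exp (39 / 20 :: real)" using exp_add_ge[of "5754 / 1000" "7 / 4" "1 / 5"] exp_rational_ge[of "5754 / 1000" 4 7] by (simp add: power_divide)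
 have a3: "1001 / 1000 * (999 / 100) <= exp (37 / 16 :: real)" using exp_add_ge[of "73886 / 10000" 2 "5 / 16"] exp_rational_ge[of "73886 / 10000" 1 2] by (simp add: power_divide)
 have a4: "1001 / 1000 * (1398 / 100) <= exp (53 / 20 :: real)" using exp_add_ge[of "1218 / 100" "5 / 2" "3 / 20"] exp_rational_ge[of "1218 / 100" 2 5] by (simp add: power_divide)
 have d1: "1 / (2866 / 10000) <= exp (5 / 4 :: real)" using exp_rational_ge[of "1 / (2866 / 10000)" 4 5] by (simp add: power_divide)
 have d2: "1 / (2232 / 10000) <= exp (3 / 2 :: real)" using exp_rational_ge[of "1 / (2232 / 10000)" 2 3] by (simp add: power_divide)
 have d3: "1 / (1354 / 10000) <= exp (2 :: real)" using exp_rational_ge[of "1 / (1354 / 10000)" 1 2] by (simp add: power_divide)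
 have d4: "1 / (821 / 10000) <= exp (5 / 2 :: real)" using exp_rational_ge[of "1 / (821 / 10000)" 2 5] by (simp add: power_divide)
 have e49: "exp (49 / 10) <= (135 :: real)" using exp_diff_le[of 5 "14842 / 100" "1 / 10"] exp_rational_le[of 5 "14842 / 100" 1] by (simp add: power_divide)
 have f49: "(134 :: real) <= exp (49 / 10)" using exp_add_ge[of "1155 / 10" "19 / 4" "3 / 20"] exp_rational_ge[of "1155 / 10" 4 19] by (simp add: power_divide)
 have e89: "exp (89 / 10) <= (7370 :: real)" using exp_diff_le[of 9 8105 "1 / 10"] exp_rational_le[of 9 8105 1] by (simp add: power_divide)
 have f89: "(7000 :: real) <= exp (89 / 10)" using exp_add_ge[of 4800 "17 / 2" "2 / 5"] exp_rational_ge[of 4800 2 17] by (simp add: power_divide)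
 have e104: "exp (52 / 5) <= (33020 :: real)" using exp_diff_le[of "21 / 2" 36320 "1 / 10"] exp_rational_le[of 21 36320 2] by (simp add: power_divide)
 have g5: "(138 :: real) <= exp 5" using exp_rational_ge[of 138 1 5] by (simp add: power_divide)
 have g9: "(7373 :: real) <= exp 9" using exp_rational_ge[of 7373 1 9] by (simp add: power_divide)
 have g105: "(33023 :: real) <= exp (21 / 2)" using exp_rational_ge[of 33023 2 21] by (simp add: power_divide)
 have t0: "t > 0" "2 * t > 0" using t by auto
 have small: "3 / t <= e" if "3 / e <= t" "e > 0" for e using that t0 by (simp add: field_simps)
 \<comment> \<open>The cuts lie 0.1 below the thresholds 5, 9 and 21/2 of
   \<open>zeta_constant\<close>, because the constant must be admissible at height
   \<open>t + 3\<close>.\<close>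
 consider "L <= 49 / 10" | "49 / 10 <= L" "L <= 89 / 10" | "89 / 10 <= L" "L <= 52 / 5" | "52 / 5 <= L" by linarith
 thus ?thesis
 proof cases
  case 1
  have tb: "t <= 135" by (rule t_between(1)[OF 1 e49])
  have A: "zeta_constant (349 / 100) (t + 3)" "zeta_constant (699 / 100) (2 * t + 3)"
   unfolding zeta_constant_def using ln_le_of_exp[OF _ _ g5, of "t + 3"] ln_le_of_exp[OF _ _ g9, of "2 * t + 3"] tb t0 by auto
  note h = heights[OF small[of "3 / 13"]]
  have m: "ln (t + 3) <= L + 3 / 13" "ln (2 * t + 3) <= L + 7 / 10 + 3 / 13 / 2" using h t by auto
  have K: "4 * log_deriv_error (349 / 100) t + log_deriv_error (699 / 100) (2 * t) <= 317 / 100 + 23 / 10 * L"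
   using log_deriv_error_le[OF t0(1) a1 _ d1 _ m(1)] log_deriv_error_le[OF t0(2) a2 _ d2 _ m(2)] L_ge by (simp add: field_simps)
  \<comment> \<open>With \<open>Y = c * L - 1.623\<close> the constant 1.217 in
    \<open>1.217 + 3/4 * Y\<close> cancels, and the hypothesis on \<open>Y\<close> follows from
    \<open>2.7183 * sA * 3/4 * c <= 22.97\<close>. Here \<open>sA\<close> is the root of
    \<open>1001/1000 * A\<close>, rounded up; the other ranges follow the same pattern.\<close>
  show ?thesis
   by (rule count_times_log[OF r A K, of "602 / 100 * L - 1623 / 1000" "187 / 100"])
    (use L_ge err in \<open>simp_all add: power2_eq_square field_simps\<close>)
 next
  case 2
  have tb: "t <= 7370" "134 <= t" by (rule t_between(1)[OF 2(2) e89], rule t_between(2)[OF 2(1) f49])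
  have A: "zeta_constant (699 / 100) (t + 3)" "zeta_constant (1398 / 100) (2 * t + 3)"
   unfolding zeta_constant_def using ln_le_of_exp[OF _ _ g9, of "t + 3"] tb t0 by auto
  note h = heights[OF small[of "224 / 10000"]]
  have m: "ln (t + 3) <= L + 224 / 10000" "ln (2 * t + 3) <= L + 7 / 10 + 224 / 10000 / 2" using h tb by auto
  have K: "4 * log_deriv_error (699 / 100) t + log_deriv_error (1398 / 100) (2 * t) <= 42 / 10 + 2151 / 1000 * L"
   using log_deriv_error_le[OF t0(1) a2 _ d3 _ m(1)] log_deriv_error_le[OF t0(2) a4 _ d3 _ m(2)] 2 by (simp add: field_simps)
  show ?thesis
   by (rule count_times_log[OF r A K, of "425 / 100 * L - 1623 / 1000" "2646 / 1000"])
    (use 2 err in \<open>simp_all add: power2_eq_square field_simps\<close>)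
 next
  case 3
  have tb: "t <= 33020" "7000 <= t" by (rule t_between(1)[OF 3(2) e104], rule t_between(2)[OF 3(1) f89])
  have A: "zeta_constant (999 / 100) (t + 3)" "zeta_constant (1398 / 100) (2 * t + 3)"
   unfolding zeta_constant_def using ln_le_of_exp[OF _ _ g105, of "t + 3"] tb t0 by auto
  note h = heights[OF small[of "5 / 10000"]]
  have m: "ln (t + 3) <= L + 5 / 10000" "ln (2 * t + 3) <= L + 7 / 10 + 5 / 10000 / 2" using h tb by auto
  have K: "4 * log_deriv_error (999 / 100) t + log_deriv_error (1398 / 100) (2 * t) <= 447 / 100 + 2151 / 1000 * L"
   using log_deriv_error_le[OF t0(1) a3 _ d3 _ m(1)] log_deriv_error_le[OF t0(2) a4 _ d3 _ m(2)] 3 by (simp add: field_simps)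
  show ?thesis
   by (rule count_times_log[OF r A K, of "356 / 100 * L - 1623 / 1000" "31623 / 10000"])
    (use 3 err in \<open>simp_all add: power2_eq_square field_simps\<close>)
 next
  case 4
  have tb: "7000 <= t" by (rule t_between(2)[OF _ f89]) (use 4 in simp)
  have A: "zeta_constant (1398 / 100) (t + 3)" "zeta_constant (1398 / 100) (2 * t + 3)"
   unfolding zeta_constant_def by auto
  note h = heights[OF small[of "5 / 10000"]]
  have m: "ln (t + 3) <= L + 5 / 10000" "ln (2 * t + 3) <= L + 7 / 10 + 5 / 10000 / 2" using h tb by auto
  have K: "4 * log_deriv_error (1398 / 100) t + log_deriv_error (1398 / 100) (2 * t) <= 528 / 100 + 2094 / 1000 * L"
   using log_deriv_error_le[OF t0(1) a4 _ d4 _ m(1)] log_deriv_error_le[OF t0(2) a4 _ d4 _ m(2)] 4 by (simp add: field_simps)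
  show ?thesis
   by (rule count_times_log[OF r A K, of "301 / 100 * L - 1623 / 1000" "3741 / 1000"])
    (use 4 err in \<open>simp_all add: power2_eq_square field_simps\<close>)
 qed
qed

end

theorem theorem16:
  fixes r \<alpha> t :: real
  assumes "1 > r" and "r > \<alpha>" and "\<alpha> > 0" and "t > 13"
  shows "zeta_zero_count (Complex 1 t) \<alpha>
    \<le> C1 \<alpha> r / pi * ln \<bar>t\<bar> + C2 \<alpha> r * ln (ln \<bar>t\<bar>) + C3 \<alpha> r
      + 1 / ln (r / \<alpha>) * (5 / (6 * (t - 1)) + 1 / (t - 1)\<^sup>2
          + 579 / (8 * (t - 1)\<^sup>2 * ln (t - 1)))"
proof -
  interpret zero_disc t \<alpha> by unfold_locales (use assms in auto)
  interpret angles r by unfold_locales (use assms in auto)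
  define err where "err = 5 / (6 * (t - 1)) + 1 / (t - 1)\<^sup>2 + 579 / (8 * (t - 1)\<^sup>2 * ln (t - 1))"
  define l where "l = ln (r / \<alpha>)"
  have l: "l > 0" unfolding l_def using assms by simp
  have "0 < ln (t - 1)" using assms by simp
  then have "0 \<le> 1 / (t - 1)\<^sup>2" "0 \<le> 579 / (8 * (t - 1)\<^sup>2 * ln (t - 1))" by (auto intro!: divide_nonneg_nonneg mult_nonneg_nonneg)
  then have "5 / (6 * (t - 1)) \<le> err" unfolding err_def by linarith
  from count_times_log_le[OF assms(2,1) this]
  have "of_int n \<le> (c1 r / pi * L + 3 / 2 * ln L + c3 r / pi + c4 r + ln 29.388 + err) / l"
    using l unfolding l_def by (simp only: pos_le_divide_eq)
  also have "\<dots> = C1 \<alpha> r / pi * ln \<bar>t\<bar> + C2 \<alpha> r * ln (ln \<bar>t\<bar>) + C3 \<alpha> r + 1 / ln (r / \<alpha>) * err"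
  proof -
    have "C1 \<alpha> r / pi * ln \<bar>t\<bar> = c1 r / pi * L / l" using assms by (simp add: C1_def l_def)
    moreover have "C2 \<alpha> r * ln (ln \<bar>t\<bar>) = 3 / 2 * ln L / l"
    proof -
      have "C2 \<alpha> r = 3 / 2 / l" unfolding C2_def c2 l_def[symmetric] using l by (simp add: field_simps)
      then show ?thesis using assms by simp
    qed
    moreover have "C3 \<alpha> r = c3 r / pi / l + c4 r / l + ln 29.388 / l" by (simp only: C3_def l_def divide_divide_eq_left)
    moreover have "1 / ln (r / \<alpha>) * err = err / l" by (simp add: l_def)
    ultimately show ?thesis by (simp only: add_divide_distrib)
  qed
  finally show ?thesis using count_le unfolding err_def by linarith
qed

end
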